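(* Let $\Omega$, $X=(X_1,\dots,X_m)$, $1<p<\infty$ be as in the context. Put $$\lambda_1:=\inf_{u\in \mathcal{W}^{1,p}_{X,0}(\Omega)\setminus\{0\}}\frac{\int_\Omega |Xu|^p\,dx}{\int_\Omega |u|^p\,dx}.$$ Then there exists $u_1\in \mathcal{W}^{1,p}_{X,0}(\Omega)\setminus\{0\}$ such that $$\frac{\int_\Omega |Xu_1|^p\,dx}{\int_\Omega |u_1|^p\,dx}=\lambda_1 .$$ Moreover, $(\lambda_1,u_1)$ satisfies $$\int_\Omega |Xu_1|^{p-2}Xu_1\cdot X\varphi\,dx=\lambda_1\int_\Omega |u_1|^{p-2}u_1\varphi\,dx\qquad\text{for all }\varphi\in \mathcal{W}^{1,p}_{X,0}(\Omega),$$ and $\lambda_1$ is the smallest eigenvalue.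
   Context: Setting. Let $1<p<\infty$, $m,n\in\mathbb{N}$ with $n\ge 2$ and $m\le n$. Let $U\subset\mathbb{R}^n$ be a bounded domain and let $X_i=\sum_{k=1}^n b_{ik}(x)\partial_{x_k}$, $i=1,\dots,m$, be smooth vector fields on $U$ satisfying the Hörmander condition at step $s$: $s\in\mathbb{N}$ is the smallest integer such that the iterated commutators $X_J=[X_{j_1},\dots[X_{j_{k-1}},X_{j_k}]\dots]$, $J=(j_1,\dots,j_k)\in\{1,\dots,m\}^k$, of length $|J|=k\le s$ span $\mathbb{R}^n$ at each $x\in U$. Let $\Omega\Subset U$ be open and connected (i.e. $\bar\Omega$ is compact and contained in $U$). Sobolev spaces. The formal adjoint of $X_i$ is $X_i^*\varphi=-\sum_k\partial_{x_k}(b_{ik}\varphi)$. For $f\in L^1_{loc}(\Omega)$, $X_if=g\in L^1_{loc}(\Omega)$ means $\int_\Omega g\varphi\,dx=\int_\Omega f X_i^*\varphi\,dx$ for all $\varphi\in C_0^\infty(\Omega)$. $Xf=(X_1f,\dots,X_mf)$, $|Xf|=(\sum_i (X_if)^2)^{1/2}$. $\mathcal{W}^{1,p}_X(\Omega)=\{f\in L^p(\Omega): X_if\in L^p(\Omega),\ i=1,\dots,m\}$ with norm $(\int_\Omega(|u|^p+|Xu|^p)dx)^{1/p}$, and $\mathcal{W}^{1,p}_{X,0}(\Omega)$ is the closure of $C_0^\infty(\Omega)$ in $\mathcal{W}^{1,p}_X(\Omega)$. All functions are real-valued. Eigenpairs. $u\in \mathcal{W}^{1,p}_{X,0}(\Omega)\setminus\{0\}$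 is an eigenfunction with eigenvalue $\lambda\in\mathbb{R}$ (of the Dirichlet problem $\sum_i X_i^*(|Xu|^{p-2}X_iu)=\lambda|u|^{p-2}u$ in $\Omega$, $u=0$ on $\partial\Omega$) if $\int_\Omega |Xu|^{p-2}Xu\cdot X\varphi\,dx=\lambda\int_\Omega|u|^{p-2}u\varphi\,dx$ for all $\varphi\in \mathcal{W}^{1,p}_{X,0}(\Omega)$. Expressions $|w|^{p-2}w$ are read as $0$ where $w=0$. *)

theory Defs
  imports "HOL-Analysis.Analysis"
begin

section \<open>Smooth functions and vector fields\<close>

definition partial :: "'n \<Rightarrow> (real^'n \<Rightarrow> real) \<Rightarrow> real^'n \<Rightarrow> real" where
  "partial k f x = frechet_derivative f (at x) (axis k 1)"

text \<open>The next two predicates are meant for open \<open>U\<close> only, where the values of \<open>f\<close> outside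
  \<open>U\<close> play no role.\<close>

fun Ck_on :: "nat \<Rightarrow> (real^'n) set \<Rightarrow> (real^'n \<Rightarrow> real) \<Rightarrow> bool" where
  "Ck_on 0 U f \<longleftrightarrow> continuous_on U f"
| "Ck_on (Suc j) U f \<longleftrightarrow> f differentiable_on U \<and> (\<forall>k. Ck_on j U (partial k f))"

definition smooth_on :: "(real^'n) set \<Rightarrow> (real^'n \<Rightarrow> real) \<Rightarrow> bool" where
  "smooth_on U f \<longleftrightarrow> (\<forall>j. Ck_on j U f)"

text \<open>A vector field \<open>\<Sum>\<^sub>k b\<^sub>k \<partial>\<^sub>k\<close> is the function \<open>V\<close> with \<open>V x $ k = b\<^sub>k(x)\<close>.\<close>

definition smooth_vector_field :: "(real^'n) set \<Rightarrow> (real^'n \<Rightarrow> real^'n) \<Rightarrow> bool" where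
  "smooth_vector_field U V \<longleftrightarrow> (\<forall>k. smooth_on U (\<lambda>x. V x $ k))"

text \<open>Coefficients of the operator \<open>V W - W V\<close>.\<close>

definition lie_bracket ::
    "(real^'n \<Rightarrow> real^'n) \<Rightarrow> (real^'n \<Rightarrow> real^'n) \<Rightarrow> real^'n \<Rightarrow> real^'n" where
  "lie_bracket V W x =
     (\<chi> k. \<Sum>j\<in>UNIV. V x $ j * partial j (\<lambda>y. W y $ k) x - W x $ j * partial j (\<lambda>y. V y $ k) x)"

text \<open>Indices of iterated commutators are nonempty lists; the equation for \<open>[]\<close> is a dummy.\<close>

fun commutator :: "('m \<Rightarrow> real^'n \<Rightarrow> real^'n) \<Rightarrow> 'm list \<Rightarrow> real^'n \<Rightarrow> real^'n" where
  "commutator X [] = (\<lambda>x. 0)"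
| "commutator X [j] = X j"
| "commutator X (j # k # J) = lie_bracket (X j) (commutator X (k # J))"

definition commutators_span ::
    "(real^'n) set \<Rightarrow> ('m \<Rightarrow> real^'n \<Rightarrow> real^'n) \<Rightarrow> nat \<Rightarrow> bool" where
  "commutators_span U X s \<longleftrightarrow>
     (\<forall>x\<in>U. span {commutator X J x | J. J \<noteq> [] \<and> length J \<le> s} = UNIV)"

definition hormander_step ::
    "(real^'n) set \<Rightarrow> ('m \<Rightarrow> real^'n \<Rightarrow> real^'n) \<Rightarrow> nat \<Rightarrow> bool" where
  "hormander_step U X s \<longleftrightarrow>
     commutators_span U X s \<and> (\<forall>s'. commutators_span U X s' \<longrightarrow> s \<le> s')"


section \<open>Weak derivatives along vector fields\<close>

definition test_function :: "(real^'n) set \<Rightarrow> (real^'n \<Rightarrow> real) \<Rightarrow> bool" where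
  "test_function \<Omega> \<phi> \<longleftrightarrow>
     smooth_on UNIV \<phi> \<and> compact (closure {x. \<phi> x \<noteq> 0}) \<and> closure {x. \<phi> x \<noteq> 0} \<subseteq> \<Omega>"

definition formal_adjoint ::
    "(real^'n \<Rightarrow> real^'n) \<Rightarrow> (real^'n \<Rightarrow> real) \<Rightarrow> real^'n \<Rightarrow> real" where
  "formal_adjoint V \<phi> x = - (\<Sum>k\<in>UNIV. partial k (\<lambda>y. V y $ k * \<phi> y) x)"

definition L1_loc :: "(real^'n) set \<Rightarrow> (real^'n \<Rightarrow> real) \<Rightarrow> bool" where
  "L1_loc \<Omega> f \<longleftrightarrow> (\<forall>K. compact K \<and> K \<subseteq> \<Omega> \<longrightarrow> f absolutely_integrable_on K)"

text \<open>Elements of the Lebesgue and Sobolev spaces are represented by functions, not by equivalence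
  classes; two functions represent the same element iff they agree almost everywhere in \<open>\<Omega>\<close>.\<close>

definition Lp :: "real \<Rightarrow> (real^'n) set \<Rightarrow> (real^'n \<Rightarrow> real) \<Rightarrow> bool" where
  "Lp p \<Omega> f \<longleftrightarrow>
     f \<in> borel_measurable (lebesgue_on \<Omega>) \<and> integrable (lebesgue_on \<Omega>) (\<lambda>x. \<bar>f x\<bar> powr p)"

definition has_weak_derivative ::
    "(real^'n) set \<Rightarrow> (real^'n \<Rightarrow> real^'n) \<Rightarrow> (real^'n \<Rightarrow> real) \<Rightarrow> (real^'n \<Rightarrow> real) \<Rightarrow> bool" where
  "has_weak_derivative \<Omega> V f g \<longleftrightarrow>
     L1_loc \<Omega> f \<and> L1_loc \<Omega> g \<and>
     (\<forall>\<phi>. test_function \<Omega> \<phi> \<longrightarrow>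
        (LINT x|lebesgue_on \<Omega>. g x * \<phi> x) = (LINT x|lebesgue_on \<Omega>. f x * formal_adjoint V \<phi> x))"

text \<open>A weak derivative is unique up to null sets, and everything below depends only on its
  almost-everywhere class, so any choice will do.\<close>

definition weak_derivative ::
    "(real^'n) set \<Rightarrow> (real^'n \<Rightarrow> real^'n) \<Rightarrow> (real^'n \<Rightarrow> real) \<Rightarrow> real^'n \<Rightarrow> real" where
  "weak_derivative \<Omega> V f = (SOME g. has_weak_derivative \<Omega> V f g)"

definition weak_gradient ::
    "(real^'n) set \<Rightarrow> ('m \<Rightarrow> real^'n \<Rightarrow> real^'n) \<Rightarrow> (real^'n \<Rightarrow> real) \<Rightarrow> real^'n \<Rightarrow> real^'m" where
  "weak_gradient \<Omega> X f x = (\<chi> i. weak_derivative \<Omega> (X i) f x)"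


section \<open>Sobolev spaces\<close>

definition sobolev ::
    "real \<Rightarrow> (real^'n) set \<Rightarrow> ('m \<Rightarrow> real^'n \<Rightarrow> real^'n) \<Rightarrow> (real^'n \<Rightarrow> real) set" where
  "sobolev p \<Omega> X = {f. Lp p \<Omega> f \<and> (\<forall>i. \<exists>g. has_weak_derivative \<Omega> (X i) f g \<and> Lp p \<Omega> g)}"

definition sobolev_norm ::
    "real \<Rightarrow> (real^'n) set \<Rightarrow> ('m::finite \<Rightarrow> real^'n \<Rightarrow> real^'n) \<Rightarrow> (real^'n \<Rightarrow> real) \<Rightarrow> real" where
  "sobolev_norm p \<Omega> X u =
     (LINT x|lebesgue_on \<Omega>. \<bar>u x\<bar> powr p + norm (weak_gradient \<Omega> X u x) powr p) powr (1 / p)"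

definition sobolev0 ::
    "real \<Rightarrow> (real^'n) set \<Rightarrow> ('m::finite \<Rightarrow> real^'n \<Rightarrow> real^'n) \<Rightarrow> (real^'n \<Rightarrow> real) set" where
  "sobolev0 p \<Omega> X =
     {f \<in> sobolev p \<Omega> X.
        \<forall>\<epsilon>>0. \<exists>\<phi>. test_function \<Omega> \<phi> \<and> sobolev_norm p \<Omega> X (\<lambda>x. f x - \<phi> x) < \<epsilon>}"

definition sobolev0_nonzero ::
    "real \<Rightarrow> (real^'n) set \<Rightarrow> ('m::finite \<Rightarrow> real^'n \<Rightarrow> real^'n) \<Rightarrow> (real^'n \<Rightarrow> real) set" where
  "sobolev0_nonzero p \<Omega> X = {u \<in> sobolev0 p \<Omega> X. \<not> (AE x in lebesgue_on \<Omega>. u x = 0)}"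


section \<open>Eigenvalues\<close>

definition rayleigh_quotient ::
    "real \<Rightarrow> (real^'n) set \<Rightarrow> ('m::finite \<Rightarrow> real^'n \<Rightarrow> real^'n) \<Rightarrow> (real^'n \<Rightarrow> real) \<Rightarrow> real" where
  "rayleigh_quotient p \<Omega> X u =
     (LINT x|lebesgue_on \<Omega>. norm (weak_gradient \<Omega> X u x) powr p) /
     (LINT x|lebesgue_on \<Omega>. \<bar>u x\<bar> powr p)"

definition lambda1 ::
    "real \<Rightarrow> (real^'n) set \<Rightarrow> ('m::finite \<Rightarrow> real^'n \<Rightarrow> real^'n) \<Rightarrow> real" where
  "lambda1 p \<Omega> X = (INF u\<in>sobolev0_nonzero p \<Omega> X. rayleigh_quotient p \<Omega> X u)"

text \<open>Since \<open>0 powr a = 0\<close> for every \<open>a\<close>, the integrands below vanish where the gradient,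
  respectively \<open>u\<close>, vanishes, as required for \<open>p < 2\<close>.\<close>

definition eigen_equation ::
    "real \<Rightarrow> (real^'n) set \<Rightarrow> ('m::finite \<Rightarrow> real^'n \<Rightarrow> real^'n) \<Rightarrow> real \<Rightarrow> (real^'n \<Rightarrow> real) \<Rightarrow> bool" where
  "eigen_equation p \<Omega> X \<mu> u \<longleftrightarrow>
     (\<forall>\<phi>\<in>sobolev0 p \<Omega> X.
        (LINT x|lebesgue_on \<Omega>. norm (weak_gradient \<Omega> X u x) powr (p - 2) *
            (weak_gradient \<Omega> X u x \<bullet> weak_gradient \<Omega> X \<phi> x)) =
        \<mu> * (LINT x|lebesgue_on \<Omega>. \<bar>u x\<bar> powr (p - 2) * u x * \<phi> x))"

definition eigenvalue ::
    "real \<Rightarrow> (real^'n) set \<Rightarrow> ('m::finite \<Rightarrow> real^'n \<Rightarrow> real^'n) \<Rightarrow> real \<Rightarrow> bool" where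
  "eigenvalue p \<Omega> X \<mu> \<longleftrightarrow> (\<exists>u\<in>sobolev0_nonzero p \<Omega> X. eigen_equation p \<Omega> X \<mu> u)"

end

theory Submission
  imports Defs "HOL-Library.Diagonal_Subsequence"
begin

text \<open>
  The point is that a sequence of test functions \<open>\<phi>\<close> with \<open>\<phi>\<close> and \<open>X\<phi>\<close> bounded in \<open>L\<^sup>p\<close> has a
  subsequence which is Cauchy in \<open>L\<^sup>p\<close>. Passing to \<open>v = |\<phi>|\<^sup>p\<^sup>-\<^sup>1\<phi>\<close> reduces this to \<open>L\<^sup>1\<close>: by Young's
  inequality \<open>v\<close> and \<open>Xv\<close> are bounded in \<open>L\<^sup>1\<close>, and \<open>|a - b|\<^sup>p\<close> is at most a constant times the
  difference of the corresponding signed powers.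

  In \<open>L\<^sup>1\<close>, translating \<open>v\<close> by \<open>\<epsilon>X\<^sub>i\<close> costs \<open>O(\<epsilon>)\<close>, up to the isotropic modulus of continuity \<open>\<omega>\<close> of
  \<open>v\<close> at scale \<open>\<epsilon>\<^sup>2\<close>. Comparing the two orders of following two fields for times \<open>\<delta>\<close> and \<open>\<epsilon>\<close> shows
  that a commutator of length \<open>k\<close> can be followed for a suitable power \<open>\<epsilon>\<^sup>m\<close> at cost
  \<open>O(\<epsilon>) + O(\<omega>(C\<epsilon>\<^sup>m\<^sup>+\<^sup>1))\<close>. This property is stable under sums and, for commutators, under smooth
  coefficients, so the Hormander condition and Cramer's rule give it to all constant fields, whence
  \<open>\<omega>(\<epsilon>\<^sup>m) \<le> O(\<epsilon>) + O(\<omega>(C\<epsilon>\<^sup>m\<^sup>+\<^sup>1))\<close>. The last term is absorbed by iteration, and the resulting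
  uniform bound on \<open>\<omega>\<close> yields compactness by Frechet and Kolmogorov.

  A minimizing sequence of test functions is therefore Cauchy in \<open>L\<^sup>p\<close>, and uniform convexity makes
  its gradients Cauchy as well. The eigenvalue equation is the first variation at the minimizer, and
  testing the equation of any eigenfunction with itself bounds its eigenvalue below by \<open>\<lambda>\<^sub>1\<close>.
\<close>

section \<open>The modulus of continuity in the mean\<close>

text \<open>Fields are followed by maps that are merely Lipschitz: single steps x + t Y(x) and
  polygons of such steps, with Y cut off near the compact set \<open>K\<close>. All that is asked of
  such a map is that its displacement has Lipschitz constant at most 1/2; composition then distorts
  integrals by a factor between 4^-n and 4^n. The price is that the maps to be compared agree only
  approximately, and their difference is no constant translation. \<open>L1dist_shift\<close>
  charges it to the isotropic modulus at a comparable scale, which is why every bound along a field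
  carries a modulus term of higher order. The generators X_i are better: polygons with many tiny
  steps follow them at a cost proportional to \<epsilon> times the energy, up to an error as small
  as desired. The bracket step depends on this. In the variational part, strong convergence of the
  gradients takes the place of weak limits: the midpoint of two nearby almost minimizers is itself a
  competitor, so its energy cannot drop much below \<lambda>_1, and this is the situation that
  uniform convexity exploits.\<close>

lemma emeasure_lborel_ball_scale:
  fixes x y :: "'a::euclidean_space"
  assumes "r > 0" "c \<ge> 0"
  shows "emeasure lborel (cball x (c * r)) = ennreal (c ^ DIM('a)) * emeasure lborel (cball y r)"
proof -
  have "emeasure lborel (cball x (c * r)) = ennreal (unit_ball_vol (real DIM('a)) * (c*r) ^ DIM('a))"
    using assms by (intro emeasure_cball) auto
  also have "\<dots> = ennreal (c ^ DIM('a)) * ennreal (unit_ball_vol (real DIM('a)) * r ^ DIM('a))"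
    using assms by (subst ennreal_mult[symmetric]) (auto simp: power_mult_distrib algebra_simps intro!: ennreal_cong)
  also have "ennreal (unit_ball_vol (real DIM('a)) * r ^ DIM('a)) = emeasure lborel (cball y r)"
    using assms by (intro emeasure_cball[symmetric]) auto
  finally show ?thesis .
qed

lemma emeasure_lborel_cball_pos_finite:
  fixes x :: "'a::euclidean_space"
  assumes "r > 0"
  shows "emeasure lborel (cball x r) \<noteq> 0" "emeasure lborel (cball x r) \<noteq> \<infinity>"
  using emeasure_cball[of r x] assms
  by (auto simp: ennreal_eq_0_iff not_le unit_ball_vol_pos)

lemma borel_measurable_mult_indicator_cball [measurable (raw), simp]:
  fixes f :: "'a::euclidean_space \<Rightarrow> ennreal"
  assumes "f \<in> borel_measurable borel"
  shows "(\<lambda>x. f x * indicator (cball a r) x) \<in> borel_measurable borel"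
  using assms by (intro borel_measurable_times_ennreal borel_measurable_indicator) auto

lemma ennreal_le_cancel_mult:
  fixes a b c :: ennreal
  assumes "c * a \<le> c * b" "c \<noteq> 0" "c \<noteq> \<infinity>"
  shows "a \<le> b"
  using assms by (metis ennreal_mult_le_mult_iff infinity_ennreal_def)

text \<open>Inserting an average over a ball and applying Fubini avoids any Jacobian.\<close>

lemma nn_integral_compose_le:
  fixes F :: "'a::euclidean_space \<Rightarrow> 'a" and g :: "'a \<Rightarrow> real"
  assumes F: "continuous_on UNIV F" and L: "\<And>x y. norm (x - y) \<le> L * norm (F x - F y)" and "L > 0"
    and g: "continuous_on UNIV g" and g0: "\<And>x. g x \<ge> 0" and S: "bounded S" "\<And>x. x \<notin> S \<Longrightarrow> g x = 0"
  shows "(\<integral>\<^sup>+x. ennreal (g (F x)) \<partial>lborel) \<le> ennreal ((2*L) ^ DIM('a)) * (\<integral>\<^sup>+x. ennreal (g x) \<partial>lborel)"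
proof -
  let ?n = "DIM('a)"
  obtain R where R: "\<And>x. x \<in> S \<Longrightarrow> norm x \<le> R" using S(1) by (auto simp: bounded_iff)
  have [measurable]: "F \<in> borel_measurable borel" "g \<in> borel_measurable borel"
    using F g by (auto intro: borel_measurable_continuous_onI)
  let ?K = "cball 0 (R+1) :: 'a set"
  have uc: "uniformly_continuous_on (cball 0 (R+2)) g"
    by (rule compact_uniformly_continuous) (auto intro: continuous_on_subset[OF g])
  have main: "(\<integral>\<^sup>+x. ennreal (g (F x)) \<partial>lborel) \<le> ennreal ((2*L) ^ ?n) * ((\<integral>\<^sup>+x. ennreal (g x) \<partial>lborel) + ennreal \<eta> * emeasure lborel ?K)"
    if "\<eta> > 0" for \<eta>
  proof -
    obtain d where d: "d > 0" "\<And>x y. \<lbrakk>x \<in> cball 0 (R+2); y \<in> cball 0 (R+2); dist y x < d\<rbrakk> \<Longrightarrow> dist (g y) (g x) < \<eta>"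
      using uc \<open>\<eta>>0\<close> unfolding uniformly_continuous_on_def by metis
    define r where "r = min (d/2) 1"
    have r: "r > 0" "r < d" "r \<le> 1" using d by (auto simp: r_def)
    let ?B = "emeasure lborel (cball (0::'a) r)"
    have pt: "ennreal (g (F x)) * indicator (cball (F x) r) y \<le> (ennreal (g y) + ennreal \<eta> * indicator ?K y) * indicator (cball (F x) r) y" for x y
    proof (cases "y \<in> cball (F x) r \<and> F x \<in> S")
      case True
      then have "norm (F x) \<le> R" using R by auto
      moreover have "norm y \<le> norm (F x) + r" using True by (metis add_left_mono dist_norm mem_cball norm_minus_commute norm_triangle_sub order_trans)
      ultimately have y: "norm y \<le> R+1" using r by auto
      have "dist (g (F x)) (g y) < \<eta>" 
        using True r y \<open>norm (F x) \<le> R\<close> by (intro d(2)) (auto simp: dist_commute)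
      then have "g (F x) \<le> g y + \<eta>" by (auto simp: dist_real_def)
      then show ?thesis using True y g0 \<open>\<eta>>0\<close>
        by (auto simp: indicator_def simp flip: ennreal_plus intro!: ennreal_leI)
    next
      case False
      then show ?thesis using S(2) by (auto simp: indicator_def)
    qed
    \<comment> \<open>Two points of the fibre have images within 2r of each other, so the expansion
      bound puts the fibre into a ball of radius 2Lr. This is the source of the factor
      (2L)^n.\<close>
    have fib: "emeasure lborel {x. y \<in> cball (F x) r} \<le> ennreal ((2*L)^?n) * ?B" for y
    proof (cases "\<exists>x0. y \<in> cball (F x0) r")
      case True
      then obtain x0 where x0: "dist (F x0) y \<le> r" by auto
      have "{x. y \<in> cball (F x) r} \<subseteq> cball x0 (2*L*r)"
      proof
        fix x assume "x \<in> {x. y \<in> cball (F x) r}"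
        then have "dist (F x0) (F x) \<le> r + r" using x0 by (auto intro: order_trans[OF dist_triangle2[of _ _ y]])
        then have "L * norm (F x0 - F x) \<le> L * (2 * r)" using \<open>L>0\<close> by (auto simp: dist_norm)
        then show "x \<in> cball x0 (2*L*r)" using L[of x0 x] by (auto simp: dist_norm mult_ac)
      qed
      then have "emeasure lborel {x. y \<in> cball (F x) r} \<le> emeasure lborel (cball x0 (2*L*r))"
        by (intro emeasure_mono) auto
      also have "\<dots> = ennreal ((2*L)^?n) * ?B"
        using r \<open>L>0\<close> by (intro emeasure_lborel_ball_scale) auto
      finally show ?thesis .
    qed auto
    have "?B * (\<integral>\<^sup>+x. ennreal (g (F x)) \<partial>lborel) = (\<integral>\<^sup>+x. (\<integral>\<^sup>+y. ennreal (g (F x)) * indicator (cball (F x) r) y \<partial>lborel) \<partial>lborel)"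
      using emeasure_lborel_ball_scale[of r 1 "F _" "0::'a"] r
      by (simp add: nn_integral_cmult_indicator nn_integral_multc mult.commute)
    also have "\<dots> \<le> (\<integral>\<^sup>+x. (\<integral>\<^sup>+y. (ennreal (g y) + ennreal \<eta> * indicator ?K y) * indicator (cball (F x) r) y \<partial>lborel) \<partial>lborel)"
      by (intro nn_integral_mono pt)
    also have "\<dots> = (\<integral>\<^sup>+y. (\<integral>\<^sup>+x. (ennreal (g y) + ennreal \<eta> * indicator ?K y) * indicator (cball (F x) r) y \<partial>lborel) \<partial>lborel)"
    proof (rule lborel_pair.Fubini')
      have "(\<lambda>z. (ennreal (g (fst z)) + ennreal \<eta> * (if norm (fst z) \<le> R+1 then 1 else 0)) * (if dist (F (snd z)) (fst z) \<le> r then 1 else 0)) \<in> borel_measurable (lborel \<Otimes>\<^sub>M lborel)"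
        by measurable
      moreover have "(\<lambda>z. (ennreal (g (fst z)) + ennreal \<eta> * (if norm (fst z) \<le> R+1 then 1 else 0)) * (if dist (F (snd z)) (fst z) \<le> r then 1 else 0))
         = (\<lambda>(y, x). (ennreal (g y) + ennreal \<eta> * indicator ?K y) * indicator (cball (F x) r) y)"
        by (auto simp: fun_eq_iff indicator_def)
      ultimately show "(\<lambda>(y, x). (ennreal (g y) + ennreal \<eta> * indicator ?K y) * indicator (cball (F x) r) y) \<in> borel_measurable (lborel \<Otimes>\<^sub>M lborel)" by simp
    qed
    also have "\<dots> = (\<integral>\<^sup>+y. (ennreal (g y) + ennreal \<eta> * indicator ?K y) * emeasure lborel {x. y \<in> cball (F x) r} \<partial>lborel)"
    proof (intro nn_integral_cong)
      fix y
      have "(\<integral>\<^sup>+x. (ennreal (g y) + ennreal \<eta> * indicator ?K y) * indicator (cball (F x) r) y \<partial>lborel)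
        = (\<integral>\<^sup>+x. (ennreal (g y) + ennreal \<eta> * indicator ?K y) * indicator {x. y \<in> cball (F x) r} x \<partial>lborel)"
        by (intro nn_integral_cong) (auto simp: indicator_def)
      also have "\<dots> = (ennreal (g y) + ennreal \<eta> * indicator ?K y) * emeasure lborel {x. y \<in> cball (F x) r}"
        by (intro nn_integral_cmult_indicator) auto
      finally show "(\<integral>\<^sup>+x. (ennreal (g y) + ennreal \<eta> * indicator ?K y) * indicator (cball (F x) r) y \<partial>lborel) = (ennreal (g y) + ennreal \<eta> * indicator ?K y) * emeasure lborel {x. y \<in> cball (F x) r}" .
    qed
    also have "\<dots> \<le> (\<integral>\<^sup>+y. (ennreal (g y) + ennreal \<eta> * indicator ?K y) * (ennreal ((2*L)^?n) * ?B) \<partial>lborel)"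
      by (intro nn_integral_mono mult_left_mono fib) auto
    also have "\<dots> = ?B * (ennreal ((2*L) ^ ?n) * ((\<integral>\<^sup>+x. ennreal (g x) \<partial>lborel) + ennreal \<eta> * emeasure lborel ?K))"
    proof -
      have "(\<integral>\<^sup>+y. ennreal (g y) + ennreal \<eta> * indicator ?K y \<partial>lborel) = (\<integral>\<^sup>+x. ennreal (g x) \<partial>lborel) + ennreal \<eta> * emeasure lborel ?K"
        by (subst nn_integral_add) (auto simp: nn_integral_cmult_indicator)
      moreover have "(\<integral>\<^sup>+y. (ennreal (g y) + ennreal \<eta> * indicator ?K y) * (ennreal ((2*L)^?n) * ?B) \<partial>lborel)
        = (\<integral>\<^sup>+y. ennreal (g y) + ennreal \<eta> * indicator ?K y \<partial>lborel) * (ennreal ((2*L)^?n) * ?B)"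
        by (intro nn_integral_multc) auto
      ultimately show ?thesis by (simp only: mult_ac)
    qed
    finally show ?thesis
      using emeasure_lborel_cball_pos_finite[OF r(1), of "0::'a"] by (rule ennreal_le_cancel_mult)
  qed
  have K: "emeasure lborel ?K < \<infinity>" by (rule emeasure_lborel_cball_finite)
  show ?thesis
  proof (rule ennreal_le_epsilon)
    fix e :: real assume "e > 0"
    define m where "m = (2*L) ^ ?n * measure lborel ?K"
    have m: "m \<ge> 0" using \<open>L>0\<close> by (auto simp: m_def)
    define \<eta> where "\<eta> = e / (m + 1)"
    have \<eta>: "\<eta> > 0" "m * \<eta> \<le> e" using m \<open>e>0\<close> by (auto simp: \<eta>_def field_simps)
    have "ennreal ((2*L) ^ ?n) * (ennreal \<eta> * emeasure lborel ?K) = ennreal (m * \<eta>)"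
    proof -
      have K': "emeasure lborel ?K = ennreal (measure lborel ?K)"
        using K by (intro emeasure_eq_ennreal_measure) auto
      show ?thesis unfolding m_def K' using \<eta>(1) \<open>L>0\<close> by (simp add: ennreal_mult mult_ac)
    qed
    also have "\<dots> \<le> ennreal e" using \<eta> by (intro ennreal_leI)
    finally show "(\<integral>\<^sup>+x. ennreal (g (F x)) \<partial>lborel) \<le> ennreal ((2*L) ^ ?n) * (\<integral>\<^sup>+x. ennreal (g x) \<partial>lborel) + ennreal e"
      using main[OF \<eta>(1)] by (auto simp: distrib_left elim!: order_trans intro: add_left_mono)
  qed
qed

lemma nn_integral_lborel_translate:
  fixes f :: "'a::euclidean_space \<Rightarrow> ennreal"
  assumes [measurable]: "f \<in> borel_measurable borel"
  shows "(\<integral>\<^sup>+x. f (c + x) \<partial>lborel) = (\<integral>\<^sup>+x. f x \<partial>lborel)"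
proof -
  have "(\<integral>\<^sup>+x. f x \<partial>lborel) = (\<integral>\<^sup>+x. f x \<partial>distr lborel borel ((+) c))"
    by (simp add: lborel_distr_plus)
  also have "\<dots> = (\<integral>\<^sup>+x. f (c + x) \<partial>lborel)"
    by (subst nn_integral_distr) auto
  finally show ?thesis by simp
qed

lemma pred_mem_cball [measurable (raw)]:
  fixes f :: "'b \<Rightarrow> 'a::euclidean_space"
  assumes [measurable]: "f \<in> borel_measurable M"
  shows "Measurable.pred M (\<lambda>x. f x \<in> cball a r)"
  unfolding mem_cball by measurable

text \<open>A quantitative closeness to the identity that needs no differentiability: it makes F
  bi-Lipschitz with constant 2 in both directions and, by a fixed point argument, onto.\<close>

definition near_id :: "('a::euclidean_space \<Rightarrow> 'a) \<Rightarrow> bool" where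
  "near_id F \<longleftrightarrow> (\<forall>x y. norm ((F x - x) - (F y - y)) \<le> norm (x - y) / 2)"

lemma near_idD:
  assumes "near_id F"
  shows "norm (x - y) \<le> 2 * norm (F x - F y)" "norm (F x - F y) \<le> 2 * norm (x - y)"
proof -
  have 1: "norm ((F x - x) - (F y - y)) \<le> norm (x - y) / 2" using assms by (auto simp: near_id_def)
  have "norm (x - y) \<le> norm (F x - F y) + norm ((F x - x) - (F y - y))"
    using norm_triangle_ineq4[of "F x - F y" "(F x - x) - (F y - y)"] by (simp add: algebra_simps)
  then show "norm (x - y) \<le> 2 * norm (F x - F y)" using 1 by linarith
  have "norm (F x - F y) \<le> norm (x - y) + norm ((F x - x) - (F y - y))"
    using norm_triangle_ineq[of "x - y" "(F x - x) - (F y - y)"] by (simp add: algebra_simps)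
  then show "norm (F x - F y) \<le> 2 * norm (x - y)" using 1 norm_ge_zero[of "x-y"] by linarith
qed

lemma near_id_continuous: "near_id F \<Longrightarrow> continuous_on UNIV F"
proof -
  assume F: "near_id F"
  have "lipschitz_on 2 UNIV F"
    using near_idD(2)[OF F] by (auto intro!: lipschitz_onI simp: dist_norm)
  then show ?thesis by (rule lipschitz_on_continuous_on)
qed

text \<open>A solution of F x = y is a fixed point of x \<mapsto> y - (F x - x), a contraction with
  constant 1/2.\<close>

lemma near_id_surj:
  assumes "near_id F"
  shows "\<exists>x. F x = y"
proof -
  have lip: "dist (y - (F x - x)) (y - (F z - z)) \<le> 1/2 * dist x z" for x z
  proof -
    have "dist (y - (F x - x)) (y - (F z - z)) = norm ((F x - x) - (F z - z))"
    proof -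
      have "(y - (F x - x)) - (y - (F z - z)) = - ((F x - x) - (F z - z))" by (simp only: diff_diff_eq2) simp
      then show ?thesis unfolding dist_norm by (simp only: norm_minus_cancel)
    qed
    then show ?thesis using assms by (simp add: near_id_def dist_norm)
  qed
  have "\<exists>!x. y - (F x - x) = x"
    by (rule banach_fix_type[of "1/2"]) (use lip in auto)
  then obtain x where "y - (F x - x) = x" by auto
  then have "F x = y" by (simp add: algebra_simps)
  then show ?thesis by blast
qed

text \<open>Values in \<open>ennreal\<close> make the triangle inequality available for all
  measurable functions, without integrability conditions.\<close>

definition L1dist :: "('a::euclidean_space \<Rightarrow> real) \<Rightarrow> ('a \<Rightarrow> real) \<Rightarrow> ennreal" where
  "L1dist f g = (\<integral>\<^sup>+x. ennreal \<bar>f x - g x\<bar> \<partial>lborel)"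

lemma L1dist_commute: "L1dist f g = L1dist g f"
  by (simp add: L1dist_def abs_minus_commute)

lemma L1dist_triangle:
  assumes "f \<in> borel_measurable borel" "g \<in> borel_measurable borel" "h \<in> borel_measurable borel"
  shows "L1dist f h \<le> L1dist f g + L1dist g h"
proof -
  have "L1dist f h \<le> (\<integral>\<^sup>+x. ennreal \<bar>f x - g x\<bar> + ennreal \<bar>g x - h x\<bar> \<partial>lborel)"
    unfolding L1dist_def by (intro nn_integral_mono) (auto simp flip: ennreal_plus intro!: ennreal_leI)
  also have "\<dots> = L1dist f g + L1dist g h"
    unfolding L1dist_def using assms by (intro nn_integral_add) auto
  finally show ?thesis .
qed

definition C0 :: "'a::euclidean_space set \<Rightarrow> ('a \<Rightarrow> real) \<Rightarrow> bool" where
  "C0 S u \<longleftrightarrow> continuous_on UNIV u \<and> (\<forall>x. x \<notin> S \<longrightarrow> u x = 0)"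

lemma nn_integral_near_id_le:
  fixes F :: "'a::euclidean_space \<Rightarrow> 'a" and g :: "'a \<Rightarrow> real"
  assumes F: "near_id F" and g: "C0 S g" "bounded S" "\<And>x. g x \<ge> 0"
  shows "(\<integral>\<^sup>+x. ennreal (g (F x)) \<partial>lborel) \<le> ennreal (4 ^ DIM('a)) * (\<integral>\<^sup>+x. ennreal (g x) \<partial>lborel)"
  using nn_integral_compose_le[of F 2 g S] near_id_continuous[OF F] near_idD[OF F] g by (auto simp: C0_def)

text \<open>The upper bound is applied to the inverse of F, which again satisfies the expansion
  bound with L = 2, and to the function g composed with F.\<close>

lemma nn_integral_near_id_ge:
  fixes F :: "'a::euclidean_space \<Rightarrow> 'a" and g :: "'a \<Rightarrow> real"
  assumes F: "near_id F" and g: "C0 S g" "bounded S" "\<And>x. g x \<ge> 0"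
  shows "(\<integral>\<^sup>+x. ennreal (g x) \<partial>lborel) \<le> ennreal (4 ^ DIM('a)) * (\<integral>\<^sup>+x. ennreal (g (F x)) \<partial>lborel)"
proof -
  obtain G where G: "\<And>y. F (G y) = y" using near_id_surj[OF F] by metis
  have lip: "norm (x - y) \<le> 2 * norm (G x - G y)" "norm (G x - G y) \<le> 2 * norm (x - y)" for x y
    using near_idD[OF F, of "G x" "G y"] by (auto simp: G)
  have "lipschitz_on 2 UNIV G" using lip by (auto intro!: lipschitz_onI simp: dist_norm)
  then have Gc: "continuous_on UNIV G" by (rule lipschitz_on_continuous_on)
  have Fc: "continuous_on UNIV F" by (rule near_id_continuous[OF F])
  obtain R where R: "\<And>x. x \<in> S \<Longrightarrow> norm x \<le> R" using g(2) by (auto simp: bounded_iff)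
  have z: "g (F x) = 0" if "x \<notin> cball (G 0) (2 * R)" for x
  proof (rule ccontr)
    assume "g (F x) \<noteq> 0"
    then have "norm (F x) \<le> R" using g(1) R by (auto simp: C0_def)
    moreover have "norm (x - G 0) \<le> 2 * norm (F x)" using near_idD(1)[OF F, of x "G 0"] by (simp add: G)
    ultimately show False using that by (simp add: dist_norm norm_minus_commute)
  qed
  have "(\<integral>\<^sup>+x. ennreal (g (F (G x))) \<partial>lborel) \<le> ennreal ((2*2) ^ DIM('a)) * (\<integral>\<^sup>+x. ennreal (g (F x)) \<partial>lborel)"
    by (rule nn_integral_compose_le[where g="\<lambda>x. g (F x)" and S="cball (G 0) (2 * R)"])
       (use Gc lip g z in \<open>auto simp: C0_def intro!: continuous_on_compose2[OF _ Fc]\<close>)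
  then show ?thesis by (simp add: G)
qed

lemma C0_compose:
  assumes "C0 S u" "bounded S" "near_id F"
  shows "\<exists>S'. bounded S' \<and> C0 S' (\<lambda>x. u (F x))"
proof -
  obtain R where R: "\<And>x. x \<in> S \<Longrightarrow> norm x \<le> R" using assms(2) by (auto simp: bounded_iff)
  obtain z where z: "F z = 0" using near_id_surj[OF assms(3)] by metis
  have "u (F x) = 0" if "x \<notin> cball z (2 * R)" for x
  proof (rule ccontr)
    assume "u (F x) \<noteq> 0"
    then have "norm (F x) \<le> R" using assms(1) R by (auto simp: C0_def)
    moreover have "norm (x - z) \<le> 2 * norm (F x)" using near_idD(1)[OF assms(3), of x z] by (simp add: z)
    ultimately show False using that by (simp add: dist_norm norm_minus_commute)
  qed
  then have "C0 (cball z (2 * R)) (\<lambda>x. u (F x))"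
    using assms(1) near_id_continuous[OF assms(3)]
    by (auto simp: C0_def intro: continuous_on_compose2)
  then show ?thesis by blast
qed

lemma C0_absdiff:
  assumes "C0 S u" "C0 S' v"
  shows "C0 (S \<union> S') (\<lambda>x. \<bar>u x - v x\<bar>)"
  using assms by (auto simp: C0_def intro!: continuous_intros)

lemma C0_measurable: "C0 S u \<Longrightarrow> u \<in> borel_measurable borel"
  by (auto simp: C0_def intro: borel_measurable_continuous_onI)

lemma L1dist_near_id:
  fixes F :: "'a::euclidean_space \<Rightarrow> 'a"
  assumes "near_id F" "C0 S u" "bounded S" "C0 S' v" "bounded S'"
  shows "L1dist (\<lambda>x. u (F x)) (\<lambda>x. v (F x)) \<le> ennreal (4 ^ DIM('a)) * L1dist u v"
    and "L1dist u v \<le> ennreal (4 ^ DIM('a)) * L1dist (\<lambda>x. u (F x)) (\<lambda>x. v (F x))"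
  unfolding L1dist_def
  using nn_integral_near_id_le[OF assms(1) C0_absdiff[OF assms(2,4)]]
    nn_integral_near_id_ge[OF assms(1) C0_absdiff[OF assms(2,4)]] assms by auto

section \<open>Translation modulus and oscillation over balls\<close>

definition modulus :: "('a::euclidean_space \<Rightarrow> real) \<Rightarrow> real \<Rightarrow> ennreal" where
  "modulus u r = (SUP h\<in>cball 0 r. L1dist (\<lambda>x. u (x + h)) u)"

lemma modulus_mono: "r \<le> s \<Longrightarrow> modulus u r \<le> modulus u s"
  unfolding modulus_def by (intro SUP_subset_mono) auto

lemma modulus_upper: "norm h \<le> r \<Longrightarrow> L1dist (\<lambda>x. u (x + h)) u \<le> modulus u r"
  unfolding modulus_def by (intro SUP_upper) auto

text \<open>The mean oscillation of u about its value at the centre, not divided by the volume of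
  the ball; all volumes are cancelled at the end in \<open>ennreal\<close>.\<close>

definition ball_osc :: "('a::euclidean_space \<Rightarrow> real) \<Rightarrow> real \<Rightarrow> 'a \<Rightarrow> ennreal" where
  "ball_osc u r z = (\<integral>\<^sup>+y. ennreal \<bar>u y - u z\<bar> * indicator (cball z r) y \<partial>lborel)"

lemma near_id_translation: "near_id (\<lambda>x. x + h)"
  by (simp add: near_id_def)

lemma C0_translate:
  assumes "C0 S u" "bounded S"
  shows "\<exists>S'. bounded S' \<and> C0 S' (\<lambda>x. u (x + h))"
  using C0_compose[OF assms near_id_translation] .

lemma ball_osc_translate:
  assumes [measurable]: "u \<in> borel_measurable borel"
  shows "ball_osc u r z = (\<integral>\<^sup>+k. ennreal \<bar>u (z + k) - u z\<bar> * indicator (cball 0 r) k \<partial>lborel)"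
proof -
  have "ball_osc u r z = (\<integral>\<^sup>+k. ennreal \<bar>u (z + k) - u z\<bar> * indicator (cball z r) (z + k) \<partial>lborel)"
    unfolding ball_osc_def
    by (rule nn_integral_lborel_translate[where c=z, symmetric])
       (intro borel_measurable_times_ennreal borel_measurable_indicator, auto)
  also have "\<dots> = (\<integral>\<^sup>+k. ennreal \<bar>u (z + k) - u z\<bar> * indicator (cball 0 r) k \<partial>lborel)"
    by (intro nn_integral_cong) (auto simp: indicator_def dist_norm)
  finally show ?thesis .
qed

text \<open>After writing y = F x + k and exchanging the integrals, each fixed k contributes the
  distance between a translate of u and u, both composed with F; this is at most 4^n times the
  modulus.\<close>

lemma nn_integral_ball_osc:
  fixes F :: "'a::euclidean_space \<Rightarrow> 'a"
  assumes F: "near_id F" and u: "C0 S u" "bounded S"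
  shows "(\<integral>\<^sup>+x. ball_osc u r (F x) \<partial>lborel) \<le> ennreal (4 ^ DIM('a)) * emeasure lborel (cball (0::'a) r) * modulus u r"
proof -
  have [measurable]: "F \<in> borel_measurable borel" "u \<in> borel_measurable borel"
    using near_id_continuous[OF F] u by (auto intro: borel_measurable_continuous_onI C0_measurable)
  have "(\<integral>\<^sup>+x. ball_osc u r (F x) \<partial>lborel) = (\<integral>\<^sup>+x. (\<integral>\<^sup>+k. ennreal \<bar>u (F x + k) - u (F x)\<bar> * indicator (cball 0 r) k \<partial>lborel) \<partial>lborel)"
    by (simp add: ball_osc_translate)
  also have "\<dots> = (\<integral>\<^sup>+k. (\<integral>\<^sup>+x. ennreal \<bar>u (F x + k) - u (F x)\<bar> * indicator (cball 0 r) k \<partial>lborel) \<partial>lborel)"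
  proof (rule lborel_pair.Fubini')
    show "(\<lambda>(k, x). ennreal \<bar>u (F x + k) - u (F x)\<bar> * indicator (cball 0 r) k) \<in> borel_measurable (lborel \<Otimes>\<^sub>M lborel)"
      by measurable
  qed
  also have "\<dots> = (\<integral>\<^sup>+k. L1dist (\<lambda>x. u (F x + k)) (\<lambda>x. u (F x)) * indicator (cball 0 r) k \<partial>lborel)"
    by (intro nn_integral_cong) (simp add: nn_integral_multc L1dist_def)
  also have "\<dots> \<le> (\<integral>\<^sup>+k. (ennreal (4 ^ DIM('a)) * modulus u r) * indicator (cball (0::'a) r) k \<partial>lborel)"
  proof (rule nn_integral_mono)
    fix k :: 'a
    show "L1dist (\<lambda>x. u (F x + k)) (\<lambda>x. u (F x)) * indicator (cball 0 r) k \<le> (ennreal (4 ^ DIM('a)) * modulus u r) * indicator (cball 0 r) k"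
    proof (cases "k \<in> cball 0 r")
      case True
      obtain S' where S': "bounded S'" "C0 S' (\<lambda>x. u (x + k))" using C0_translate[OF u] by blast
      have "L1dist (\<lambda>x. u (F x + k)) (\<lambda>x. u (F x)) \<le> ennreal (4 ^ DIM('a)) * L1dist (\<lambda>x. u (x + k)) u"
        by (rule L1dist_near_id(1)[OF F S'(2,1) u])
      also have "\<dots> \<le> ennreal (4 ^ DIM('a)) * modulus u r"
        using True by (intro mult_left_mono modulus_upper) auto
      finally show ?thesis using True by simp
    qed auto
  qed
  also have "\<dots> = ennreal (4 ^ DIM('a)) * emeasure lborel (cball (0::'a) r) * modulus u r"
    by (subst nn_integral_cmult_indicator) (simp_all only: sets_lborel borel_closed[OF closed_cball] mult_ac)
  finally show ?thesis .
qed

lemma ball_osc_measurable: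
  assumes [measurable]: "u \<in> borel_measurable borel" "F \<in> borel_measurable borel"
  shows "(\<lambda>x. ball_osc u r (F x)) \<in> borel_measurable borel"
proof -
  have "(\<lambda>(x, y). ennreal \<bar>u y - u (F x)\<bar> * (if dist (F x) y \<le> r then 1 else 0)) \<in> borel_measurable (borel \<Otimes>\<^sub>M lborel)"
    by measurable
  then have "(\<lambda>x. \<integral>\<^sup>+y. ennreal \<bar>u y - u (F x)\<bar> * (if dist (F x) y \<le> r then 1 else 0) \<partial>lborel) \<in> borel_measurable borel"
    by (rule lborel.borel_measurable_nn_integral)
  moreover have "(\<lambda>x. \<integral>\<^sup>+y. ennreal \<bar>u y - u (F x)\<bar> * (if dist (F x) y \<le> r then 1 else 0) \<partial>lborel) = (\<lambda>x. ball_osc u r (F x))"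
    unfolding ball_osc_def by (intro ext nn_integral_cong) (auto simp: indicator_def)
  ultimately show ?thesis by simp
qed

text \<open>2 for the two oscillations in \<open>L1dist_shift\<close>, and 8^n = 4^n 2^n for the
  change of variables and the volume ratio of balls of radius 2\<rho> and \<rho>.\<close>

definition shift_const :: "'a::euclidean_space itself \<Rightarrow> ennreal" where
  "shift_const _ = 2 * ennreal (8 ^ DIM('a))"

text \<open>Since F x - G x varies with x, the translation modulus does not apply directly. Both
  values are compared with u(y) averaged over the \<rho>-ball about G x, which lies in the
  2\<rho>-balls about F x and G x. The first alternative in \<open>close\<close> serves points where
  u vanishes at both images and closeness has not been established.\<close>

lemma L1dist_shift:
  fixes F G :: "'a::euclidean_space \<Rightarrow> 'a"
  assumes F: "near_id F" and G: "near_id G" and u: "C0 S u" "bounded S" and "\<rho> > 0"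
    and close: "\<And>x. u (F x) = u (G x) \<or> norm (F x - G x) \<le> \<rho>"
  shows "L1dist (\<lambda>x. u (F x)) (\<lambda>x. u (G x)) \<le> shift_const TYPE('a) * modulus u (2 * \<rho>)"
proof -
  have [measurable]: "F \<in> borel_measurable borel" "G \<in> borel_measurable borel" "u \<in> borel_measurable borel"
    using near_id_continuous[OF F] near_id_continuous[OF G] u by (auto intro: borel_measurable_continuous_onI C0_measurable)
  note [measurable] = ball_osc_measurable
  let ?B = "emeasure lborel (cball (0::'a) \<rho>)"
  have ball: "emeasure lborel (cball z \<rho>) = ?B" for z :: 'a
    using emeasure_lborel_ball_scale[of \<rho> 1 z 0] \<open>\<rho>>0\<close> by simp
  have pt: "?B * ennreal \<bar>u (F x) - u (G x)\<bar> \<le> ball_osc u (2*\<rho>) (F x) + ball_osc u (2*\<rho>) (G x)" for x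
  proof (cases "u (F x) = u (G x)")
    case False
    then have d: "dist (F x) (G x) \<le> \<rho>" using close[of x] by (auto simp: dist_norm)
    have "?B * ennreal \<bar>u (F x) - u (G x)\<bar> = (\<integral>\<^sup>+y. ennreal \<bar>u (F x) - u (G x)\<bar> * indicator (cball (G x) \<rho>) y \<partial>lborel)"
      by (subst nn_integral_cmult_indicator) (simp_all add: ball[of "G x"] mult.commute)
    also have "\<dots> \<le> (\<integral>\<^sup>+y. ennreal \<bar>u y - u (F x)\<bar> * indicator (cball (F x) (2*\<rho>)) y + ennreal \<bar>u y - u (G x)\<bar> * indicator (cball (G x) (2*\<rho>)) y \<partial>lborel)"
    proof (rule nn_integral_mono)
      fix y
      show "ennreal \<bar>u (F x) - u (G x)\<bar> * indicator (cball (G x) \<rho>) y \<le> ennreal \<bar>u y - u (F x)\<bar> * indicator (cball (F x) (2*\<rho>)) y + ennreal \<bar>u y - u (G x)\<bar> * indicator (cball (G x) (2*\<rho>)) y"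
      proof (cases "dist (G x) y \<le> \<rho>")
        case True
        then have "dist (F x) y \<le> 2 * \<rho>" using d dist_triangle[of "F x" y "G x"] by simp
        then show ?thesis using True \<open>\<rho>>0\<close> by (auto simp flip: ennreal_plus intro!: ennreal_leI)
      qed auto
    qed
    also have "\<dots> = ball_osc u (2*\<rho>) (F x) + ball_osc u (2*\<rho>) (G x)"
      unfolding ball_osc_def by (intro nn_integral_add) auto
    finally show ?thesis .
  qed auto
  have "?B * L1dist (\<lambda>x. u (F x)) (\<lambda>x. u (G x)) = (\<integral>\<^sup>+x. ?B * ennreal \<bar>u (F x) - u (G x)\<bar> \<partial>lborel)"
    unfolding L1dist_def by (simp add: nn_integral_cmult)
  also have "\<dots> \<le> (\<integral>\<^sup>+x. ball_osc u (2*\<rho>) (F x) + ball_osc u (2*\<rho>) (G x) \<partial>lborel)"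
    by (intro nn_integral_mono pt)
  also have "\<dots> = (\<integral>\<^sup>+x. ball_osc u (2*\<rho>) (F x) \<partial>lborel) + (\<integral>\<^sup>+x. ball_osc u (2*\<rho>) (G x) \<partial>lborel)"
    by (intro nn_integral_add) auto
  also have "\<dots> \<le> 2 * (ennreal (4 ^ DIM('a)) * emeasure lborel (cball (0::'a) (2*\<rho>)) * modulus u (2*\<rho>))"
    using nn_integral_ball_osc[OF F u, of "2*\<rho>"] nn_integral_ball_osc[OF G u, of "2*\<rho>"]
    by (subst mult_2[where 'a=ennreal]) (intro add_mono)
  also have "emeasure lborel (cball (0::'a) (2*\<rho>)) = ennreal (2 ^ DIM('a)) * ?B"
    using \<open>\<rho>>0\<close> by (intro emeasure_lborel_ball_scale) auto
  also have "2 * (ennreal (4 ^ DIM('a)) * (ennreal (2 ^ DIM('a)) * ?B) * modulus u (2*\<rho>)) = ?B * (2 * (ennreal (4 ^ DIM('a)) * ennreal (2 ^ DIM('a))) * modulus u (2 * \<rho>))"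
    by (simp add: mult_ac)
  also have "ennreal (4 ^ DIM('a)) * ennreal (2 ^ DIM('a)) = ennreal (8 ^ DIM('a))"
    by (subst ennreal_mult[symmetric]) (auto simp flip: power_mult_distrib)
  finally have "?B * L1dist (\<lambda>x. u (F x)) (\<lambda>x. u (G x)) \<le> ?B * (shift_const TYPE('a) * modulus u (2*\<rho>))"
    by (simp add: shift_const_def)
  then show ?thesis
    using emeasure_lborel_cball_pos_finite[OF \<open>\<rho>>0\<close>, of "0::'a"] by (rule ennreal_le_cancel_mult)
qed

section \<open>Calculus of smooth functions\<close>

lemma frechet_derivative_eq:
  assumes "(f has_derivative f') (at x)"
  shows "frechet_derivative f (at x) = f'"
  using frechet_derivative_at[OF assms] by simp

lemma partial_eq:
  fixes f :: "real^'n \<Rightarrow> real"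
  assumes "(f has_derivative f') (at x)"
  shows "partial k f x = f' (axis k 1)"
  by (simp add: partial_def frechet_derivative_eq[OF assms])

lemma partial_cong_open:
  fixes f g :: "real^'n \<Rightarrow> real"
  assumes "open U" "x \<in> U" "\<And>y. y \<in> U \<Longrightarrow> f y = g y"
  shows "partial k f x = partial k g x"
proof -
  have "(f has_derivative f') (at x) \<longleftrightarrow> (g has_derivative f') (at x)" for f'
    using assms by (metis has_derivative_transform_within_open)
  then show ?thesis by (simp add: partial_def frechet_derivative_def)
qed

lemma Ck_on_cong:
  fixes f g :: "real^'n \<Rightarrow> real"
  assumes "open U" "\<And>y. y \<in> U \<Longrightarrow> f y = g y"
  shows "Ck_on j U f \<longleftrightarrow> Ck_on j U g"
  using assms(2)
proof (induction j arbitrary: f g)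
  case 0
  then show ?case by (simp cong: continuous_on_cong)
next
  case (Suc j)
  have "Ck_on j U (partial k f) \<longleftrightarrow> Ck_on j U (partial k g)" for k
    by (rule Suc.IH) (rule partial_cong_open[OF assms(1) _ Suc.prems])
  moreover have "f differentiable_on U \<longleftrightarrow> g differentiable_on U"
    using Suc.prems differentiable_transform_within[OF _ zero_less_one] unfolding differentiable_on_def by (metis (no_types, lifting))
  ultimately show ?case by simp
qed

lemma Ck_on_SucD: "Ck_on (Suc j) U f \<Longrightarrow> Ck_on j U f"
  by (induction j arbitrary: f) (auto simp: differentiable_imp_continuous_on)

definition grad :: "(real^'n \<Rightarrow> real) \<Rightarrow> real^'n \<Rightarrow> real^'n" where
  "grad f x = (\<chi> k. partial k f x)"

lemma grad_eq:
  fixes f :: "real^'n \<Rightarrow> real"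
  assumes "(f has_derivative f') (at x)"
  shows "grad f x \<bullet> v = f' v"
proof -
  have "linear f'" using assms has_derivative_linear by blast
  then have "f' v = (\<Sum>k\<in>UNIV. v $ k *\<^sub>R f' (axis k 1))"
    by (subst basis_expansion[symmetric, of v]) (simp add: linear_sum linear_cmul scalar_mult_eq_scaleR)
  then show ?thesis
    by (simp add: inner_vec_def grad_def partial_eq[OF assms] mult.commute)
qed

lemma has_derivative_grad:
  fixes f :: "real^'n \<Rightarrow> real"
  assumes "f differentiable (at x)"
  shows "(f has_derivative (\<lambda>v. grad f x \<bullet> v)) (at x)"
proof -
  obtain f' where "(f has_derivative f') (at x)" using assms by (auto simp: differentiable_def)
  then show ?thesis using grad_eq by (metis (no_types, lifting) ext)
qed

lemma grad_unique:
  fixes f :: "real^'n \<Rightarrow> real"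
  assumes "(f has_derivative (\<lambda>v. G \<bullet> v)) (at x)"
  shows "grad f x = G"
  using grad_eq[OF assms] vector_eq_rdot[of "grad f x" G] by blast

lemma differentiable_onD_open: "f differentiable_on U \<Longrightarrow> open U \<Longrightarrow> x \<in> U \<Longrightarrow> f differentiable (at x)"
  by (simp add: differentiable_on_eq_differentiable_at)

lemma partial_add:
  assumes "f differentiable (at x)" "g differentiable (at x)"
  shows "partial k (\<lambda>x. f x + g x) x = partial k f x + partial k g x"
  using partial_eq[OF has_derivative_add[OF has_derivative_grad[OF assms(1)] has_derivative_grad[OF assms(2)]]]
    partial_eq[OF has_derivative_grad[OF assms(1)]] partial_eq[OF has_derivative_grad[OF assms(2)]] by simp

lemma partial_mult:
  assumes "f differentiable (at x)" "g differentiable (at x)"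
  shows "partial k (\<lambda>x. f x * g x) x = partial k f x * g x + f x * partial k g x"
  using partial_eq[OF has_derivative_mult[OF has_derivative_grad[OF assms(1)] has_derivative_grad[OF assms(2)]]]
    partial_eq[OF has_derivative_grad[OF assms(1)]] partial_eq[OF has_derivative_grad[OF assms(2)]] by simp

lemma partial_compose:
  assumes "f differentiable (at x)" "(h has_real_derivative h') (at (f x))"
  shows "partial k (\<lambda>x. h (f x)) x = h' * partial k f x"
proof -
  have "((\<lambda>x. h (f x)) has_derivative (\<lambda>v. h' * (grad f x \<bullet> v))) (at x)"
    using has_derivative_compose[OF has_derivative_grad[OF assms(1)], of h "(*) h'"] assms(2)
    by (simp add: has_field_derivative_def)
  from partial_eq[OF this] show ?thesis
    using partial_eq[OF has_derivative_grad[OF assms(1)]] by simp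
qed

lemma partial_const: "partial k (\<lambda>x. c) x = 0"
  using partial_eq[OF has_derivative_const[of c "at x"]] by simp

lemma Ck_on_const: "Ck_on j (U :: (real^'n) set) (\<lambda>x. c)"
proof (induction j arbitrary: c)
  case (Suc j)
  have "partial k (\<lambda>x::real^'n. c) = (\<lambda>x. 0)" for k by (auto simp: partial_const)
  then show ?case using Suc.IH[of 0] by (simp only: Ck_on.simps) simp
qed simp

lemma Ck_on_add:
  assumes "open U" "Ck_on j U f" "Ck_on j U g"
  shows "Ck_on j U (\<lambda>x. f x + g x)"
  using assms(2,3)
proof (induction j arbitrary: f g)
  case (Suc j)
  have "Ck_on j U (partial k (\<lambda>x. f x + g x)) \<longleftrightarrow> Ck_on j U (\<lambda>x. partial k f x + partial k g x)" for k
    by (rule Ck_on_cong[OF assms(1)], rule partial_add) (use Suc.prems assms(1) in \<open>auto intro: differentiable_onD_open\<close>)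
  then show ?case using Suc by (auto intro: differentiable_on_add)
qed (auto intro: continuous_on_add)

lemma Ck_on_mult:
  assumes "open U" "Ck_on j U f" "Ck_on j U g"
  shows "Ck_on j U (\<lambda>x. f x * g x)"
  using assms(2,3)
proof (induction j arbitrary: f g)
  case (Suc j)
  have "Ck_on j U (partial k (\<lambda>x. f x * g x)) \<longleftrightarrow> Ck_on j U (\<lambda>x. partial k f x * g x + f x * partial k g x)" for k
    by (rule Ck_on_cong[OF assms(1)], rule partial_mult) (use Suc.prems assms(1) in \<open>auto intro: differentiable_onD_open\<close>)
  moreover have "Ck_on j U (\<lambda>x. partial k f x * g x + f x * partial k g x)" for k
    by (intro Ck_on_add[OF assms(1)] Suc.IH) (use Suc.prems Ck_on_SucD in auto)
  ultimately show ?case using Suc by (auto intro: differentiable_on_mult)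
qed (auto intro: continuous_on_mult)

lemma smooth_on_const: "smooth_on U (\<lambda>x. c)"
  by (simp add: smooth_on_def Ck_on_const)

lemma smooth_on_add: "open U \<Longrightarrow> smooth_on U f \<Longrightarrow> smooth_on U g \<Longrightarrow> smooth_on U (\<lambda>x. f x + g x)"
  by (simp add: smooth_on_def Ck_on_add)

lemma smooth_on_mult: "open U \<Longrightarrow> smooth_on U f \<Longrightarrow> smooth_on U g \<Longrightarrow> smooth_on U (\<lambda>x. f x * g x)"
  by (simp add: smooth_on_def Ck_on_mult)

lemma smooth_on_minus: "open U \<Longrightarrow> smooth_on U f \<Longrightarrow> smooth_on U (\<lambda>x. - f x)"
  using smooth_on_mult[of U "\<lambda>x. -1" f] by (simp add: smooth_on_const)

lemma smooth_on_diff: "open U \<Longrightarrow> smooth_on U f \<Longrightarrow> smooth_on U g \<Longrightarrow> smooth_on U (\<lambda>x. f x - g x)"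
  using smooth_on_add[of U f "\<lambda>x. - g x"] by (simp add: smooth_on_minus)

lemma smooth_on_sum:
  assumes "open U" "\<And>i. i \<in> I \<Longrightarrow> smooth_on U (f i)"
  shows "smooth_on U (\<lambda>x. \<Sum>i\<in>I. f i x)"
  using assms(2) by (induction I rule: infinite_finite_induct) (auto intro: smooth_on_const smooth_on_add[OF assms(1)])

lemma smooth_on_prod:
  assumes "open U" "\<And>i. i \<in> I \<Longrightarrow> smooth_on U (f i)"
  shows "smooth_on U (\<lambda>x. \<Prod>i\<in>I. f i x)"
  using assms(2) by (induction I rule: infinite_finite_induct) (auto intro: smooth_on_const smooth_on_mult[OF assms(1)])

lemma smooth_on_cong:
  assumes "open U" "\<And>y. y \<in> U \<Longrightarrow> f y = g y"
  shows "smooth_on U f \<longleftrightarrow> smooth_on U g"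
  unfolding smooth_on_def using Ck_on_cong[where f=f and g=g, OF assms] by blast

lemma smooth_on_differentiable_on: "smooth_on U f \<Longrightarrow> f differentiable_on U"
  unfolding smooth_on_def by (metis Ck_on.simps(2))

lemma smooth_on_differentiable: "smooth_on U f \<Longrightarrow> open U \<Longrightarrow> x \<in> U \<Longrightarrow> f differentiable (at x)"
  by (blast intro: differentiable_onD_open smooth_on_differentiable_on)

lemma smooth_on_continuous_on: "smooth_on U f \<Longrightarrow> continuous_on U f"
  unfolding smooth_on_def by (metis Ck_on.simps(1))

lemma smooth_on_partial: "smooth_on U f \<Longrightarrow> smooth_on U (partial k f)"
  unfolding smooth_on_def by (metis Ck_on.simps(2))

lemma smooth_on_subset: 
  assumes "smooth_on U f" "V \<subseteq> U"
  shows "smooth_on V f"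
proof -
  have "Ck_on j V f" if "Ck_on j U f" for j f
    using that by (induction j arbitrary: f) (auto intro: continuous_on_subset[OF _ assms(2)] differentiable_on_subset[OF _ assms(2)])
  then show ?thesis using assms(1) by (auto simp: smooth_on_def)
qed

text \<open>A family of functions of one real variable closed under differentiation stays smooth under
  composition; this covers \<open>exp\<close>, the powers of \<open>inverse\<close> and the functions \<open>flat_exp n\<close> at once.\<close>

lemma smooth_on_compose_family:
  fixes h :: "'i \<Rightarrow> real \<Rightarrow> real"
  assumes U: "open U" and f: "smooth_on U f"
    and h: "\<And>i t. t \<in> f ` U \<Longrightarrow> (h i has_real_derivative (a i * h (\<alpha> i) t + b i * h (\<beta> i) t)) (at t)"
  shows "smooth_on U (\<lambda>x. h i (f x))"
proof -
  have d: "(\<lambda>x. h i (f x)) differentiable (at x)" if "x \<in> U" for x i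
    using smooth_on_differentiable[OF f U that] h[of "f x" i] that
    by (auto intro!: differentiable_compose[of "h i" f] simp: real_differentiable_def)
  have "Ck_on j U (\<lambda>x. h i (f x))" for j
  proof (induction j arbitrary: i)
    case 0
    have "(\<lambda>x. h i (f x)) differentiable_on U" using d U by (auto simp: differentiable_on_eq_differentiable_at)
    then show ?case by (simp add: differentiable_imp_continuous_on)
  next
    case (Suc j)
    have "Ck_on j U (partial k (\<lambda>x. h i (f x))) \<longleftrightarrow> Ck_on j U (\<lambda>x. (a i * h (\<alpha> i) (f x) + b i * h (\<beta> i) (f x)) * partial k f x)" for k
      by (rule Ck_on_cong[OF U], rule partial_compose) (use smooth_on_differentiable[OF f U] h in auto)
    moreover have "Ck_on j U (\<lambda>x. (a i * h (\<alpha> i) (f x) + b i * h (\<beta> i) (f x)) * partial k f x)" for k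
      using smooth_on_partial[OF f] by (intro Ck_on_mult Ck_on_add Ck_on_const U Suc) (auto simp: smooth_on_def)
    moreover have "(\<lambda>x. h i (f x)) differentiable_on U" using d U by (auto simp: differentiable_on_eq_differentiable_at)
    ultimately show ?case by simp
  qed
  then show ?thesis by (simp add: smooth_on_def)
qed

lemma DERIV_inverse_power:
  fixes t :: real
  assumes t: "t \<noteq> 0"
  shows "((\<lambda>t. inverse t ^ n) has_real_derivative - real n * inverse t ^ Suc n) (at t)"
proof -
  have "((\<lambda>t. inverse t ^ n) has_real_derivative real n * (- (inverse t ^ 2) * inverse t ^ (n - 1))) (at t)"
    using DERIV_power[OF DERIV_inverse[OF t], of n] by (simp add: numeral_2_eq_2)
  moreover have "real n * (- (inverse t ^ 2) * inverse t ^ (n - 1)) = - real n * inverse t ^ Suc n"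
    by (cases n) (simp_all add: power2_eq_square algebra_simps)
  ultimately show ?thesis by metis
qed

lemma smooth_on_inverse:
  assumes "open U" "smooth_on U f" "\<And>x. x \<in> U \<Longrightarrow> f x \<noteq> 0"
  shows "smooth_on U (\<lambda>x. inverse (f x))"
proof -
  have "smooth_on U (\<lambda>x. (\<lambda>n t. inverse t ^ n) 1 (f x))"
  proof (rule smooth_on_compose_family[OF assms(1,2), where a="\<lambda>n. - real n" and b="\<lambda>n. 0" and \<alpha>=Suc and \<beta>=Suc])
    fix n :: nat and t assume "t \<in> f ` U"
    then have t: "t \<noteq> 0" using assms(3) by auto
    show "((\<lambda>t. inverse t ^ n) has_real_derivative - real n * inverse t ^ Suc n + 0 * inverse t ^ Suc n) (at t)"
      using DERIV_inverse_power[OF t] by simp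
  qed
  then show ?thesis by simp
qed

lemma smooth_on_exp:
  assumes "open U" "smooth_on U f"
  shows "smooth_on U (\<lambda>x. exp (f x))"
  using smooth_on_compose_family[OF assms, where h="\<lambda>_::unit. exp" and a="\<lambda>_. 1" and b="\<lambda>_. 0" and \<alpha>="\<lambda>_. ()" and \<beta>="\<lambda>_. ()"]
  by (auto intro: DERIV_exp)

lemma smooth_on_nth: "smooth_on U (\<lambda>x. x $ i)"
proof -
  have "Ck_on j U (\<lambda>x. x $ i)" for j
  proof (cases j)
    case (Suc l)
    have "partial k (\<lambda>x. x $ i) = (\<lambda>x. axis k 1 $ i)" for k
      using partial_eq[OF bounded_linear.has_derivative[OF bounded_linear_vec_nth has_derivative_ident]] by auto
    moreover have "(\<lambda>x. x $ i) differentiable_on U"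
      by (intro linear_imp_differentiable_on bounded_linear.linear bounded_linear_vec_nth)
    ultimately show ?thesis using Suc by (simp add: Ck_on_const)
  qed (auto intro: continuous_intros)
  then show ?thesis by (simp add: smooth_on_def)
qed

text \<open>The flat function exp(-1/t), extended by 0, with an additional factor t^-n. The index
  makes the family closed under differentiation, the derivative being a combination of the indices n
  + 1 and n + 2.\<close>

definition flat_exp :: "nat \<Rightarrow> real \<Rightarrow> real" where
  "flat_exp n t = (if t > 0 then inverse t ^ n * exp (- inverse t) else 0)"

lemma flat_exp_tendsto_0: "(flat_exp n \<longlongrightarrow> 0) (at 0)"
proof -
  have "((\<lambda>t. inverse t ^ n / exp (inverse t)) \<longlongrightarrow> 0) (at_right (0::real))"
    using filterlim_compose[OF tendsto_power_div_exp_0 filterlim_inverse_at_top_right] .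
  then have "(flat_exp n \<longlongrightarrow> 0) (at_right 0)"
    by (rule Lim_transform_eventually) (auto simp: eventually_at_filter flat_exp_def exp_minus field_simps)
  moreover have "(flat_exp n \<longlongrightarrow> 0) (at_left 0)"
    by (rule Lim_transform_eventually[OF tendsto_const]) (auto simp: eventually_at_filter flat_exp_def)
  ultimately show ?thesis by (simp add: filterlim_split_at)
qed

lemma flat_exp_deriv:
  "(flat_exp n has_real_derivative (- real n * flat_exp (Suc n) t + 1 * flat_exp (n + 2) t)) (at t)"
proof -
  consider "t > 0" | "t < 0" | "t = 0" by linarith
  then show ?thesis
  proof cases
    case 1
    have "((\<lambda>t. inverse t ^ n * exp (- inverse t)) has_real_derivative (- real n * flat_exp (Suc n) t + 1 * flat_exp (n + 2) t)) (at t)"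
    proof -
      have "((\<lambda>t::real. exp (- inverse t)) has_real_derivative inverse t ^ 2 * exp (- inverse t)) (at t)"
        using 1 by (auto intro!: derivative_eq_intros simp: power2_eq_square)
      from DERIV_mult[OF DERIV_inverse_power[of t n] this] show ?thesis
        using 1 by (simp add: flat_exp_def power2_eq_square algebra_simps)
    qed
    then show ?thesis
      by (rule has_field_derivative_transform_within_open[where S="{0<..}"]) (use 1 in \<open>auto simp: flat_exp_def\<close>)
  next
    case 2
    have "((\<lambda>t. 0) has_real_derivative (- real n * flat_exp (Suc n) t + 1 * flat_exp (n + 2) t)) (at t)"
      using 2 by (auto intro!: derivative_eq_intros simp: flat_exp_def)
    then show ?thesis
      by (rule has_field_derivative_transform_within_open[where S="{..<0}"]) (use 2 in \<open>auto simp: flat_exp_def\<close>)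
  next
    case 3
    \<comment> \<open>At 0 the difference quotient is again a member of the family,
      \<open>flat_exp (Suc n) h\<close>, and tends to 0.\<close>
    have "((\<lambda>h. (flat_exp n (0 + h) - flat_exp n 0) / h) \<longlongrightarrow> 0) (at 0)"
      by (rule Lim_transform_eventually[OF flat_exp_tendsto_0[of "Suc n"]])
         (auto simp: eventually_at_filter flat_exp_def field_simps)
    then show ?thesis using 3 by (simp add: DERIV_def flat_exp_def)
  qed
qed

lemma flat_exp_pos: "flat_exp n t \<ge> 0" "flat_exp n t > 0 \<longleftrightarrow> t > 0" "flat_exp n t = 0 \<longleftrightarrow> t \<le> 0"
  by (auto simp: flat_exp_def)

lemma smooth_on_flat_exp:
  assumes "open U" "smooth_on U f"
  shows "smooth_on U (\<lambda>x. flat_exp n (f x))"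
  by (rule smooth_on_compose_family[OF assms, where h="flat_exp"]) (rule flat_exp_deriv)

section \<open>Vector fields near a compact set\<close>

definition jac :: "(real^'n \<Rightarrow> real^'n) \<Rightarrow> real^'n \<Rightarrow> real^'n \<Rightarrow> real^'n" where
  "jac Y x v = (\<chi> k. grad (\<lambda>y. Y y $ k) x \<bullet> v)"

lemma lie_bracket_eq_jac: "lie_bracket V W x = jac W x (V x) - jac V x (W x)"
  by (simp add: vec_eq_iff lie_bracket_def jac_def grad_def inner_vec_def sum_subtractf mult.commute)

lemma linear_jac: "linear (jac Y x)"
  by (rule linearI) (simp_all add: jac_def vec_eq_iff inner_add_right)

lemma smooth_vector_field_lie_bracket:
  assumes "open U" "smooth_vector_field U V" "smooth_vector_field U W"
  shows "smooth_vector_field U (lie_bracket V W)"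
  using assms
  by (auto simp: smooth_vector_field_def lie_bracket_def
      intro!: smooth_on_sum smooth_on_diff smooth_on_mult smooth_on_partial)

lemma smooth_vector_field_commutator:
  assumes "open U" "\<And>i. smooth_vector_field U (X i)"
  shows "smooth_vector_field U (commutator X J)"
proof (induction J rule: induct_list012)
  case 1 then show ?case by (simp add: smooth_vector_field_def smooth_on_const)
next
  case (2 x) then show ?case using assms by simp
next
  case (3 x y zs) then show ?case using assms by (auto intro: smooth_vector_field_lie_bracket)
qed

lemma smooth_vector_field_scale:
  "open U \<Longrightarrow> smooth_on U f \<Longrightarrow> smooth_vector_field U Y \<Longrightarrow> smooth_vector_field U (\<lambda>x. f x *\<^sub>R Y x)"
  by (auto simp: smooth_vector_field_def intro!: smooth_on_mult)

lemma smooth_vector_field_add: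
  "open U \<Longrightarrow> smooth_vector_field U Y \<Longrightarrow> smooth_vector_field U Z \<Longrightarrow> smooth_vector_field U (\<lambda>x. Y x + Z x)"
  by (auto simp: smooth_vector_field_def intro!: smooth_on_add)

lemma continuous_on_grad:
  assumes "smooth_on U f"
  shows "continuous_on U (grad f)"
  unfolding grad_def[abs_def]
  by (intro continuous_on_vec_lambda smooth_on_continuous_on smooth_on_partial assms)

lemma norm_vec_le_sum_bound:
  fixes v :: "real^'n"
  assumes "\<And>k. \<bar>v $ k\<bar> \<le> b k"
  shows "norm v \<le> (\<Sum>k\<in>UNIV. b k)"
  using norm_le_l1_cart[of v] assms by (meson order_trans sum_mono)

lemma onorm_inner_le: "onorm (\<lambda>v. g \<bullet> v) \<le> norm g"
  by (rule onorm_bound) (auto simp: Cauchy_Schwarz_ineq2)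

text \<open>\<open>K\<close> will be the closure of \<Omega>. The radius 4r leaves room for three
  layers: fields are unchanged up to distance r, vanish beyond 2r, and Lipschitz estimates look a
  further distance r around points within 2r.\<close>

locale tube =
  fixes U K :: "(real^'n) set" and r :: real
  assumes open_U: "open U" and compact_K: "compact K" and K_ne: "K \<noteq> {}" and r_pos: "r > 0"
    and tube_sub: "{x. infdist x K \<le> 4 * r} \<subseteq> U"
begin

definition nb :: "real \<Rightarrow> (real^'n) set" where "nb \<rho> = {x. infdist x K \<le> \<rho>}"

lemma compact_nb: "compact (nb \<rho>)"
proof (cases "\<rho> > 0")
  case True
  then show ?thesis unfolding nb_def using compact_infdist_le[OF K_ne compact_K] by simp
next
  case False
  have "nb \<rho> \<subseteq> {x. infdist x K \<le> 1}" using False by (auto simp: nb_def)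
  moreover have "closed (nb \<rho>)" unfolding nb_def by (intro closed_Collect_le continuous_intros)
  ultimately show ?thesis using compact_infdist_le[OF K_ne compact_K, of 1]
    by (metis compact_Int_closed inf.absorb_iff2 zero_less_one)
qed

lemma nb_mono: "a \<le> b \<Longrightarrow> nb a \<subseteq> nb b" by (auto simp: nb_def)

lemma nb_sub_U: "\<rho> \<le> 4 * r \<Longrightarrow> nb \<rho> \<subseteq> U" using tube_sub by (auto simp: nb_def)

lemma nb_step: "x \<in> nb a \<Longrightarrow> norm (y - x) \<le> b \<Longrightarrow> y \<in> nb (a + b)"
  unfolding nb_def using infdist_triangle[of y K x] by (auto simp: dist_norm)

lemma K_sub_nb: "0 \<le> a \<Longrightarrow> K \<subseteq> nb a" by (auto simp: nb_def)

lemma notin_nb: "x \<notin> nb a \<Longrightarrow> norm (y - x) \<le> a \<Longrightarrow> y \<notin> K"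
  using infdist_le[of y K x] by (fastforce simp: nb_def dist_norm norm_minus_commute)

text \<open>A Lipschitz cutoff is enough: a field is differentiated only on \<open>nb r\<close>,
  where \<open>chi\<close> is 1, and elsewhere only bounds and Lipschitz constants of the cut field
  enter.\<close>

definition chi :: "real^'n \<Rightarrow> real" where
  "chi x = max 0 (min 1 (2 - infdist x K / r))"

lemma chi_bounds: "0 \<le> chi x" "chi x \<le> 1" by (auto simp: chi_def)

lemma chi_1: "x \<in> nb r \<Longrightarrow> chi x = 1"
  using r_pos by (auto simp: chi_def nb_def field_simps)

lemma chi_0: "x \<notin> nb (2 * r) \<Longrightarrow> chi x = 0"
  using r_pos by (auto simp: chi_def nb_def field_simps)

lemma chi_lipschitz: "\<bar>chi x - chi y\<bar> \<le> (1 / r) * norm (x - y)"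
proof -
  have "\<bar>chi x - chi y\<bar> \<le> \<bar>infdist x K / r - infdist y K / r\<bar>" by (auto simp: chi_def)
  also have "\<dots> = \<bar>infdist x K - infdist y K\<bar> / r" using r_pos by (simp add: diff_divide_distrib[symmetric])
  also have "\<dots> \<le> norm (x - y) / r" 
    using infdist_triangle_abs[of x K y] r_pos by (intro divide_right_mono) (auto simp: dist_norm)
  finally show ?thesis by simp
qed

definition cut :: "(real^'n \<Rightarrow> real^'n) \<Rightarrow> real^'n \<Rightarrow> real^'n" where "cut Y x = chi x *\<^sub>R Y x"

lemma cut_eq: "x \<in> nb r \<Longrightarrow> cut Y x = Y x" by (simp add: cut_def chi_1)

lemma smooth_bounds:
  assumes f: "smooth_on U f"
  shows "\<exists>B\<ge>0. (\<forall>x\<in>nb (4*r). norm (grad f x) \<le> B \<and> \<bar>f x\<bar> \<le> B)"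
proof -
  have "compact (grad f ` nb (4*r))" "compact (f ` nb (4*r))"
    by (intro compact_continuous_image compact_nb continuous_on_subset[OF _ nb_sub_U]
        continuous_on_grad smooth_on_continuous_on f order_refl)+
  then obtain b c where "\<forall>y\<in>grad f ` nb (4*r). norm y \<le> b" "\<forall>y\<in>f ` nb (4*r). norm y \<le> c"
    by (metis bounded_iff compact_imp_bounded)
  then show ?thesis by (intro exI[of _ "max 0 (max b c)"]) (auto simp: le_max_iff_disj)
qed

lemma smooth_lipschitz:
  assumes f: "smooth_on U f" and B: "\<And>x. x \<in> nb (4*r) \<Longrightarrow> norm (grad f x) \<le> B"
    and S: "convex S" "S \<subseteq> nb (4*r)" "y \<in> S" "z \<in> S"
  shows "\<bar>f y - f z\<bar> \<le> B * norm (y - z)"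
proof -
  have "norm (f y - f z) \<le> B * norm (y - z)"
  proof (rule differentiable_bound[OF S(1)])
    fix x assume x: "x \<in> S"
    then have "x \<in> U" using S(2) nb_sub_U by blast
    then show "(f has_derivative (\<lambda>v. grad f x \<bullet> v)) (at x within S)"
      using has_derivative_grad[OF smooth_on_differentiable[OF f open_U]] has_derivative_at_withinI by blast
    show "onorm (\<lambda>v. grad f x \<bullet> v) \<le> B"
      using B[of x] x S(2) order_trans[OF onorm_inner_le] by blast
  qed (use S in auto)
  then show ?thesis by simp
qed

text \<open>The increment from z to y is compared with the derivative at a third point x. In this
  form it applies to two polygons starting near x, with an error that keeps the factor |y - z|. The
  reason is that the gradient is Lipschitz on the r-ball about x.\<close>

lemma smooth_linearization:
  assumes f: "smooth_on U f"
  shows "\<exists>B\<ge>0. \<forall>x\<in>nb r. \<forall>y z. norm (y - x) \<le> r \<longrightarrow> norm (z - x) \<le> r \<longrightarrow>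
    \<bar>f y - f z - grad f x \<bullet> (y - z)\<bar> \<le> B * norm (y - z) * (norm (y - x) + norm (z - x))"
proof -
  have "\<forall>k. \<exists>B\<ge>0. \<forall>x\<in>nb (4*r). norm (grad (partial k f) x) \<le> B"
    using smooth_bounds[OF smooth_on_partial[OF f]] by blast
  then obtain b where b: "\<And>k. b k \<ge> 0" "\<And>k x. x \<in> nb (4*r) \<Longrightarrow> norm (grad (partial k f) x) \<le> b k" by metis
  define B where "B = (\<Sum>k\<in>UNIV. b k)"
  have B0: "B \<ge> 0" unfolding B_def by (intro sum_nonneg b)
  have gl: "norm (grad f w - grad f x) \<le> B * norm (w - x)" if x: "x \<in> nb r" and w: "norm (w - x) \<le> r" for x w
  proof -
    have sub: "cball x r \<subseteq> nb (4*r)"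
    proof
      fix y assume "y \<in> cball x r"
      then have "norm (y - x) \<le> r" by (simp add: dist_norm norm_minus_commute)
      from nb_step[OF x this] show "y \<in> nb (4*r)" using nb_mono[of "r + r" "4*r"] r_pos by auto
    qed
    have "norm (grad f w - grad f x) \<le> (\<Sum>k\<in>UNIV. b k * norm (w - x))"
    proof (rule norm_vec_le_sum_bound)
      fix k
      show "\<bar>(grad f w - grad f x) $ k\<bar> \<le> b k * norm (w - x)"
        using smooth_lipschitz[where f="partial k f" and B="b k" and S= "cball x r" and y=w and z=x, OF smooth_on_partial[OF f] b(2)] sub w r_pos
        by (simp add: grad_def dist_norm norm_minus_commute)
    qed
    then show ?thesis by (simp add: B_def sum_distrib_right)
  qed
  show ?thesis
  proof (intro exI[of _ B] conjI B0 ballI allI impI)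
    fix x y z assume x: "x \<in> nb r" and y: "norm (y - x) \<le> r" and z: "norm (z - x) \<le> r"
    define \<rho> where "\<rho> = max (norm (y - x)) (norm (z - x))"
    have \<rho>: "\<rho> \<le> r" "\<rho> \<le> norm (y - x) + norm (z - x)" using y z norm_ge_zero[of "y-x"] norm_ge_zero[of "z-x"] by (auto simp: \<rho>_def)
    have "norm (f y - f z - grad f x \<bullet> (y - z)) \<le> norm (y - z) * (B * \<rho>)"
    proof (rule differentiable_bound_linearization[where S="cball x \<rho>" and f'="\<lambda>w v. grad f w \<bullet> v" and ?x0.0=x])
      fix t :: real assume t: "t \<in> {0..1}"
      have "z \<in> cball x \<rho>" "y \<in> cball x \<rho>" by (auto simp: \<rho>_def dist_norm norm_minus_commute)
      moreover have "z + t *\<^sub>R (y - z) = (1 - t) *\<^sub>R z + t *\<^sub>R y" by (simp add: algebra_simps)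
      ultimately show "z + t *\<^sub>R (y - z) \<in> cball x \<rho>" using t convex_cball[of x \<rho>] 
        by (auto simp: convex_alt)
    next
      fix w assume "w \<in> cball x \<rho>"
      then have w: "norm (w - x) \<le> \<rho>" by (simp add: dist_norm norm_minus_commute)
      then have "w \<in> nb (r + r)" using nb_step[OF x, of w r] \<rho> by auto
      then have "w \<in> U" using nb_sub_U[of "r + r"] r_pos by auto
      then show "(f has_derivative (\<lambda>v. grad f w \<bullet> v)) (at w within cball x \<rho>)"
        using has_derivative_grad[OF smooth_on_differentiable[OF f open_U]] has_derivative_at_withinI by blast
      have "onorm (\<lambda>i. grad f w \<bullet> i - grad f x \<bullet> i) \<le> norm (grad f w - grad f x)"
        using onorm_inner_le[of "grad f w - grad f x"] by (simp add: inner_diff_left)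
      also have "\<dots> \<le> B * norm (w - x)" using gl[OF x] w \<rho> by simp
      also have "\<dots> \<le> B * \<rho>" using B0 w by (intro mult_left_mono)
      finally show "onorm ((\<lambda>v. grad f w \<bullet> v) - (\<lambda>v. grad f x \<bullet> v)) \<le> B * \<rho>"
        by (simp add: fun_diff_def)
    qed (auto simp: \<rho>_def le_max_iff_disj)
    also have "\<dots> \<le> norm (y - z) * (B * (norm (y - x) + norm (z - x)))"
      using \<rho> B0 by (intro mult_left_mono) auto
    finally show "\<bar>f y - f z - grad f x \<bullet> (y - z)\<bar> \<le> B * norm (y - z) * (norm (y - x) + norm (z - x))"
      by (simp add: mult_ac)
  qed
qed

text \<open>One constant for all estimates on a field, so that several fields can share the largest.
  The requirement B \<ge> 1 permits lower powers of B to be replaced by higher ones.\<close>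

definition vf_bound :: "(real^'n \<Rightarrow> real^'n) \<Rightarrow> real \<Rightarrow> bool" where
  "vf_bound Y B \<longleftrightarrow> B \<ge> 1 \<and> (\<forall>x. norm (cut Y x) \<le> B) \<and> (\<forall>x y. norm (cut Y x - cut Y y) \<le> B * norm (x - y)) \<and>
    (\<forall>x\<in>nb r. \<forall>v. norm (jac Y x v) \<le> B * norm v) \<and>
    (\<forall>x\<in>nb r. \<forall>y z. norm (y - x) \<le> r \<longrightarrow> norm (z - x) \<le> r \<longrightarrow>
      norm (Y y - Y z - jac Y x (y - z)) \<le> B * norm (y - z) * (norm (y - x) + norm (z - x)))"

lemma vf_bound_mono: 
  assumes "vf_bound Y B" "B \<le> C"
  shows "vf_bound Y C"
proof -
  have m: "a \<le> B * b \<Longrightarrow> 0 \<le> b \<Longrightarrow> a \<le> C * b" for a b :: real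
    using mult_right_mono[OF assms(2), of b] by linarith
  show ?thesis
    using assms order_trans[OF _ assms(2)] unfolding vf_bound_def mult.assoc
    by (intro conjI allI ballI impI m) auto
qed

lemma cut_lipschitz:
  assumes Y: "smooth_vector_field U Y"
  shows "\<exists>B\<ge>0. (\<forall>x. norm (cut Y x) \<le> B) \<and> (\<forall>x y. norm (cut Y x - cut Y y) \<le> B * norm (x - y))
     \<and> (\<forall>x\<in>nb r. \<forall>v. norm (jac Y x v) \<le> B * norm v)"
proof -
  have "\<forall>k. \<exists>B\<ge>0. (\<forall>x\<in>nb (4*r). norm (grad (\<lambda>x. Y x $ k) x) \<le> B \<and> \<bar>Y x $ k\<bar> \<le> B)"
    using smooth_bounds Y by (auto simp: smooth_vector_field_def)
  then obtain b where b: "\<And>k. b k \<ge> 0" "\<And>k x. x \<in> nb (4*r) \<Longrightarrow> norm (grad (\<lambda>x. Y x $ k) x) \<le> b k"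
      "\<And>k x. x \<in> nb (4*r) \<Longrightarrow> \<bar>Y x $ k\<bar> \<le> b k" by metis
  define B where "B = (\<Sum>k\<in>UNIV. b k)"
  have B0: "B \<ge> 0" unfolding B_def by (intro sum_nonneg b)
  have YB: "norm (Y x) \<le> B" if "x \<in> nb (4*r)" for x
    unfolding B_def using b(3)[OF that] by (rule norm_vec_le_sum_bound)
  have cB: "norm (cut Y x) \<le> B" for x
  proof (cases "x \<in> nb (2*r)")
    case True
    then have "norm (Y x) \<le> B" using YB nb_mono[of "2*r" "4*r"] r_pos by auto
    moreover have "\<bar>chi x\<bar> * norm (Y x) \<le> 1 * norm (Y x)" 
      using chi_bounds[of x] by (intro mult_right_mono) auto
    ultimately show ?thesis by (simp add: cut_def)
  qed (use B0 in \<open>simp add: cut_def chi_0\<close>)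
  have Yl: "norm (Y y - Y x) \<le> B * norm (y - x)" if x: "x \<in> nb (2*r)" and y: "norm (y - x) \<le> r" for x y
  proof -
    have sub: "cball x r \<subseteq> nb (4*r)"
    proof
      fix y assume "y \<in> cball x r"
      then have "norm (y - x) \<le> r" by (simp add: dist_norm norm_minus_commute)
      from nb_step[OF x this] show "y \<in> nb (4*r)" using nb_mono[of "2*r + r" "4*r"] r_pos by auto
    qed
    have "norm (Y y - Y x) \<le> (\<Sum>k\<in>UNIV. b k * norm (y - x))"
    proof (rule norm_vec_le_sum_bound)
      fix k
      have "smooth_on U (\<lambda>x. Y x $ k)" using Y by (auto simp: smooth_vector_field_def)
      from smooth_lipschitz[OF this b(2), of "cball x r" y x]
      show "\<bar>(Y y - Y x) $ k\<bar> \<le> b k * norm (y - x)"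
        using sub y r_pos by (simp add: dist_norm norm_minus_commute)
    qed
    then show ?thesis by (simp add: B_def sum_distrib_right)
  qed
  \<comment> \<open>B / r + B is the product rule for points at distance at most r; 2 B / r covers
    distant points, where the bound 2 B on the difference is already sufficient.\<close>
  define D where "D = B / r + B + 2 * B / r"
  have near: "norm (cut Y x - cut Y y) \<le> D * norm (x - y)" if x: "x \<in> nb (2*r)" and y: "norm (y - x) \<le> r" for x y
  proof -
    have yn: "y \<in> nb (4*r)" using nb_step[OF x y] nb_mono[of "2*r + r" "4*r"] r_pos by auto
    have "norm (chi x *\<^sub>R (Y x - Y y) + (chi x - chi y) *\<^sub>R Y y) \<le> \<bar>chi x\<bar> * norm (Y x - Y y) + \<bar>chi x - chi y\<bar> * norm (Y y)"
      by (metis norm_scaleR norm_triangle_ineq)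
    also have "\<dots> \<le> 1 * (B * norm (y - x)) + ((1/r) * norm (x - y)) * B"
      using chi_bounds[of x] Yl[OF x y] YB[OF yn] chi_lipschitz[of x y] r_pos B0
      by (intro add_mono mult_mono) (auto simp: norm_minus_commute)
    also have "\<dots> = (B / r + B) * norm (x - y)" by (simp add: algebra_simps norm_minus_commute)
    also have "\<dots> \<le> D * norm (x - y)"
    proof (intro mult_right_mono norm_ge_zero)
      have "0 \<le> 2 * B / r" using B0 r_pos by simp
      then show "B / r + B \<le> D" unfolding D_def by linarith
    qed
    finally show ?thesis by (simp add: cut_def algebra_simps)
  qed
  have lip: "norm (cut Y x - cut Y y) \<le> D * norm (x - y)" for x y
  proof (cases "norm (x - y) \<le> r")
    case True
    consider "x \<in> nb (2*r)" | "y \<in> nb (2*r)" | "x \<notin> nb (2*r)" "y \<notin> nb (2*r)" by blast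
    then show ?thesis
    proof cases
      case 1 then show ?thesis using near[of x y] True by (simp add: norm_minus_commute)
    next
      case 2 then show ?thesis using near[of y x] True by (simp add: norm_minus_commute)
    next
      case 3 then show ?thesis using B0 r_pos by (simp add: cut_def chi_0 D_def)
    qed
  next
    case False
    have "norm (cut Y x - cut Y y) \<le> B + B" using norm_triangle_ineq4 cB add_mono order_trans by metis
    also have "\<dots> \<le> (2 * B / r) * norm (x - y)" 
      using False r_pos B0 mult_left_mono[of r "norm (x - y)" "2 * B / r"] by simp
    also have "\<dots> \<le> D * norm (x - y)"
    proof (intro mult_right_mono norm_ge_zero)
      have "0 \<le> B / r" using B0 r_pos by simp
      then show "2 * B / r \<le> D" unfolding D_def using B0 by linarith
    qed
    finally show ?thesis .
  qed
  have j: "norm (jac Y x v) \<le> B * norm v" if "x \<in> nb r" for x v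
  proof -
    have x4: "x \<in> nb (4*r)" using that nb_mono[of r "4*r"] r_pos by auto
    have "norm (jac Y x v) \<le> (\<Sum>k\<in>UNIV. b k * norm v)"
    proof (rule norm_vec_le_sum_bound)
      fix k
      have "\<bar>grad (\<lambda>x. Y x $ k) x \<bullet> v\<bar> \<le> norm (grad (\<lambda>x. Y x $ k) x) * norm v" by (rule Cauchy_Schwarz_ineq2)
      also have "\<dots> \<le> b k * norm v" using b(2)[OF x4] by (intro mult_right_mono) auto
      finally show "\<bar>jac Y x v $ k\<bar> \<le> b k * norm v" by (simp add: jac_def)
    qed
    then show ?thesis by (simp add: B_def sum_distrib_right)
  qed
  have D: "B \<le> D" "0 \<le> D" using B0 r_pos by (auto simp: D_def)
  show ?thesis
    using cB lip j D mult_right_mono[OF D(1) norm_ge_zero] order_trans by (intro exI[of _ D]) blast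
qed

lemma vf_bound_exists:
  assumes Y: "smooth_vector_field U Y"
  shows "\<exists>B. vf_bound Y B"
proof -
  obtain C where C: "C \<ge> 0" "\<And>x. norm (cut Y x) \<le> C" "\<And>x y. norm (cut Y x - cut Y y) \<le> C * norm (x - y)"
    "\<And>x v. x \<in> nb r \<Longrightarrow> norm (jac Y x v) \<le> C * norm v" using cut_lipschitz[OF Y] by blast
  have "\<forall>k. \<exists>B\<ge>0. \<forall>x\<in>nb r. \<forall>y z. norm (y - x) \<le> r \<longrightarrow> norm (z - x) \<le> r \<longrightarrow>
    \<bar>Y y $ k - Y z $ k - grad (\<lambda>x. Y x $ k) x \<bullet> (y - z)\<bar> \<le> B * norm (y - z) * (norm (y - x) + norm (z - x))"
    using smooth_linearization Y by (auto simp: smooth_vector_field_def)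
  then obtain b where b: "\<And>k. b k \<ge> 0" "\<And>k x y z. x\<in>nb r \<Longrightarrow> norm (y - x) \<le> r \<Longrightarrow> norm (z - x) \<le> r \<Longrightarrow>
    \<bar>Y y $ k - Y z $ k - grad (\<lambda>x. Y x $ k) x \<bullet> (y - z)\<bar> \<le> b k * norm (y - z) * (norm (y - x) + norm (z - x))" by metis
  define E where "E = (\<Sum>k\<in>UNIV. b k)"
  have E: "norm (Y y - Y z - jac Y x (y - z)) \<le> E * norm (y - z) * (norm (y - x) + norm (z - x))"
    if "x\<in>nb r" "norm (y - x) \<le> r" "norm (z - x) \<le> r" for x y z
  proof -
    have "norm (Y y - Y z - jac Y x (y - z)) \<le> (\<Sum>k\<in>UNIV. b k * norm (y - z) * (norm (y - x) + norm (z - x)))"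
      by (rule norm_vec_le_sum_bound) (use b(2)[OF that] in \<open>simp add: jac_def\<close>)
    then show ?thesis by (simp add: E_def sum_distrib_right)
  qed
  have E0: "E \<ge> 0" unfolding E_def by (intro sum_nonneg b)
  define B where "B = 1 + C + E"
  have B: "C \<le> B" "E \<le> B" "1 \<le> B" using C E0 by (auto simp: B_def)
  have m1: "a \<le> C * b \<Longrightarrow> 0 \<le> b \<Longrightarrow> a \<le> B * b" for a b :: real
    using mult_right_mono[OF B(1), of b] by linarith
  have m2: "a \<le> E * b * c \<Longrightarrow> 0 \<le> b \<Longrightarrow> 0 \<le> c \<Longrightarrow> a \<le> B * b * c" for a b c :: real
    using mult_right_mono[OF B(2), of "b * c"] by (simp add: mult.assoc)
  have "vf_bound Y B"
    unfolding vf_bound_def using order_trans[OF C(2) B(1)] B by (auto intro!: m1 C m2 E)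
  then show ?thesis ..
qed

end

section \<open>Euler polygons\<close>

text \<open>The version of \<open>near_id\<close> with an explicit constant, so that compositions of
  two or three maps can be checked to stay below 1/2.\<close>

definition lip_id :: "real \<Rightarrow> ('a::euclidean_space \<Rightarrow> 'a) \<Rightarrow> bool" where
  "lip_id a F \<longleftrightarrow> (\<forall>x y. norm ((F x - x) - (F y - y)) \<le> a * norm (x - y))"

lemma lip_id_near_id:
  assumes "lip_id a F" "a \<le> 1/2"
  shows "near_id F"
  unfolding near_id_def
proof (intro allI)
  fix x y
  have "norm ((F x - x) - (F y - y)) \<le> a * norm (x - y)" using assms(1) by (simp add: lip_id_def)
  also have "\<dots> \<le> 1/2 * norm (x - y)" using assms(2) by (intro mult_right_mono) auto
  finally show "norm ((F x - x) - (F y - y)) \<le> norm (x - y) / 2" by simp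
qed

lemma lip_id_mono: "lip_id a F \<Longrightarrow> a \<le> b \<Longrightarrow> lip_id b F"
  unfolding lip_id_def by (meson mult_right_mono norm_ge_zero order_trans)

lemma lip_id_norm:
  assumes "lip_id a F"
  shows "norm (F x - F y) \<le> (1 + a) * norm (x - y)"
proof -
  have "norm ((F x - x) - (F y - y)) \<le> a * norm (x - y)" using assms by (simp add: lip_id_def)
  moreover have "F x - F y = ((F x - x) - (F y - y)) + (x - y)" by simp
  ultimately show ?thesis
    using norm_triangle_ineq[of "(F x - x) - (F y - y)" "x - y"] unfolding distrib_right by simp
qed

text \<open>The displacement of the composite is that of F taken at G x plus that of G.\<close>

lemma lip_id_compose:
  assumes "lip_id a F" "lip_id b G" "a \<ge> 0"
  shows "lip_id (a * (1 + b) + b) (\<lambda>x. F (G x))"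
  unfolding lip_id_def
proof (intro allI)
  fix x y
  have "norm ((F (G x) - x) - (F (G y) - y)) \<le> norm ((F (G x) - G x) - (F (G y) - G y)) + norm ((G x - x) - (G y - y))"
    using norm_triangle_ineq[of "(F (G x) - G x) - (F (G y) - G y)" "(G x - x) - (G y - y)"] by (simp add: algebra_simps)
  also have "\<dots> \<le> a * norm (G x - G y) + b * norm (x - y)"
    using assms by (intro add_mono) (auto simp: lip_id_def)
  also have "\<dots> \<le> a * ((1 + b) * norm (x - y)) + b * norm (x - y)"
    by (intro add_right_mono mult_left_mono lip_id_norm[OF assms(2)] assms(3))
  finally show "norm ((F (G x) - x) - (F (G y) - y)) \<le> (a * (1 + b) + b) * norm (x - y)"
    by (simp add: algebra_simps)
qed

lemma exp_minus_1_le: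
  fixes x :: real
  assumes "0 \<le> x" "x \<le> 1"
  shows "exp x - 1 \<le> 2 * x"
proof -
  have "exp x \<le> 1 + x + x\<^sup>2" using assms by (rule exp_bound)
  moreover have "x\<^sup>2 \<le> x" using assms by (simp add: power2_eq_square mult_left_le)
  ultimately show ?thesis by linarith
qed

text \<open>Euler polygons of \<open>W\<close> with step \<open>h\<close> replace the flow of \<open>W\<close>.\<close>

fun euler :: "('a::real_vector \<Rightarrow> 'a) \<Rightarrow> real \<Rightarrow> nat \<Rightarrow> 'a \<Rightarrow> 'a" where
  "euler W h 0 x = x"
| "euler W h (Suc j) x = euler W h j x + h *\<^sub>R W (euler W h j x)"

lemma euler_sum: "euler W h j x = x + h *\<^sub>R (\<Sum>i<j. W (euler W h i x))"
  by (induction j) (auto simp: algebra_simps)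

context
  fixes W :: "'a::euclidean_space \<Rightarrow> 'a" and B :: real
  assumes B: "B \<ge> 0" and WB: "\<And>x. norm (W x) \<le> B" and WL: "\<And>x y. norm (W x - W y) \<le> B * norm (x - y)"
begin

lemma step_lip_id: "t \<ge> 0 \<Longrightarrow> lip_id (t * B) (\<lambda>x. x + t *\<^sub>R W x)"
  unfolding lip_id_def using WL by (auto simp: scaleR_diff_right[symmetric] mult.assoc intro!: mult_left_mono)

lemma euler_disp:
  assumes "h \<ge> 0"
  shows "norm (euler W h j x - x) \<le> real j * h * B"
proof -
  have "norm (\<Sum>i<j. W (euler W h i x)) \<le> (\<Sum>i<j. B)" using WB by (intro sum_norm_le) auto
  then have "h * norm (\<Sum>i<j. W (euler W h i x)) \<le> h * (real j * B)" using assms by (intro mult_left_mono) auto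
  then show ?thesis using assms by (simp add: euler_sum[of W h j x] mult_ac)
qed

lemma euler_lip_id_pow:
  assumes "h \<ge> 0"
  shows "lip_id ((1 + h * B) ^ j - 1) (euler W h j)"
proof (induction j)
  case 0
  then show ?case by (simp add: lip_id_def)
next
  case (Suc j)
  have "lip_id ((h * B) * (1 + ((1 + h * B) ^ j - 1)) + ((1 + h * B) ^ j - 1)) (\<lambda>x. (\<lambda>x. x + h *\<^sub>R W x) (euler W h j x))"
    using B assms by (intro lip_id_compose step_lip_id Suc) auto
  then show ?case by (simp add: algebra_simps)
qed

text \<open>(1 + hB)^j \<le> exp(jhB) \<le> exp(\<epsilon>B): the bound depends on the total time
  only and survives arbitrary refinement of the steps.\<close>

lemma euler_lip_id:
  assumes "h \<ge> 0" "real j * h \<le> \<epsilon>" "\<epsilon> * B \<le> 1"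
  shows "lip_id (2 * \<epsilon> * B) (euler W h j)"
proof -
  have "0 \<le> \<epsilon>" using assms by (meson mult_nonneg_nonneg of_nat_0_le_iff order_trans)
  have "(1 + h * B) ^ j \<le> exp (h * B) ^ j" using assms B by (intro power_mono exp_ge_add_one_self) auto
  also have "\<dots> = exp (real j * h * B)" by (simp add: exp_of_nat_mult[symmetric] mult.assoc)
  also have "\<dots> \<le> exp (\<epsilon> * B)" using assms B by (simp add: mult_right_mono)
  also have "\<dots> \<le> 1 + 2 * (\<epsilon> * B)" using exp_minus_1_le[of "\<epsilon> * B"] assms B \<open>0 \<le> \<epsilon>\<close> by simp
  finally show ?thesis using euler_lip_id_pow[OF assms(1), of j] by (auto elim: lip_id_mono)
qed

end

section \<open>Admissible functions and their variation along a field\<close>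

context tube
begin

text \<open>Regularity is limited to continuous differentiability because the functions to be
  inserted are signed powers of test functions, which need not be smoother.\<close>

definition adm :: "(real^'n \<Rightarrow> real) \<Rightarrow> bool" where
  "adm u \<longleftrightarrow> (\<forall>x. u differentiable (at x)) \<and> continuous_on UNIV (grad u) \<and> (\<forall>x. x \<notin> K \<longrightarrow> u x = 0)"

lemma adm_C0: "adm u \<Longrightarrow> C0 K u"
  unfolding adm_def C0_def using differentiable_imp_continuous_on[of u UNIV] by (simp add: differentiable_on_def)

lemma bounded_K: "bounded K" using compact_K compact_imp_bounded by blast

lemma adm_measurable: "adm u \<Longrightarrow> u \<in> borel_measurable borel"
  using adm_C0 C0_measurable by blast

lemma adm_grad_0:
  assumes "adm u" "x \<notin> K"
  shows "grad u x = 0"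
proof -
  have "open (- K)" using compact_K by (simp add: compact_imp_closed open_Compl)
  then have "partial k u x = partial k (\<lambda>x. 0) x" for k
    by (rule partial_cong_open) (use assms in \<open>auto simp: adm_def\<close>)
  then show ?thesis by (simp add: grad_def vec_eq_iff partial_const)
qed

text \<open>The L^1 norm of the derivative of u along V. The indicator keeps the integrand where V
  is under control: V may be arbitrary outside the open set \<open>U\<close>.\<close>

definition energy :: "(real^'n \<Rightarrow> real^'n) \<Rightarrow> (real^'n \<Rightarrow> real) \<Rightarrow> ennreal" where
  "energy V u = (\<integral>\<^sup>+x. ennreal \<bar>grad u x \<bullet> V x\<bar> * indicator K x \<partial>lborel)"

lemma adm_comp_C0:
  assumes "adm u" "near_id F"
  shows "\<exists>S. bounded S \<and> C0 S (\<lambda>x. u (F x))"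
  using C0_compose[OF adm_C0[OF assms(1)] bounded_K assms(2)] .

lemma adm_comp_measurable: "adm u \<Longrightarrow> near_id F \<Longrightarrow> (\<lambda>x. u (F x)) \<in> borel_measurable borel"
  using adm_comp_C0 C0_measurable by blast

lemma L1dist_near_id_triangle:
  assumes "adm u" "near_id F" "near_id G" "near_id H"
  shows "L1dist (\<lambda>x. u (F x)) (\<lambda>x. u (H x)) \<le> L1dist (\<lambda>x. u (F x)) (\<lambda>x. u (G x)) + L1dist (\<lambda>x. u (G x)) (\<lambda>x. u (H x))"
  by (intro L1dist_triangle adm_comp_measurable assms)

lemma near_id_id: "near_id (\<lambda>x. x)" by (simp add: near_id_def)

lemma L1dist_near_id_triangle_id:
  assumes "adm u" "near_id F" "near_id G"
  shows "L1dist (\<lambda>x. u (F x)) u \<le> L1dist (\<lambda>x. u (F x)) (\<lambda>x. u (G x)) + L1dist (\<lambda>x. u (G x)) u"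
  using L1dist_near_id_triangle[OF assms near_id_id] by simp

text \<open>The first bound estimates an outer map in the presence of an inner one; the second
  removes the inner map again, which isolates the bracket from a composition.\<close>

lemma L1dist_compose_near_id:
  assumes "adm u" "near_id F" "near_id G"
  shows "L1dist (\<lambda>x. u (F (G x))) (\<lambda>x. u (G x)) \<le> ennreal (4 ^ CARD('n)) * L1dist (\<lambda>x. u (F x)) u"
    "L1dist (\<lambda>x. u (F x)) u \<le> ennreal (4 ^ CARD('n)) * L1dist (\<lambda>x. u (F (G x))) (\<lambda>x. u (G x))"
proof -
  obtain S where S: "bounded S" "C0 S (\<lambda>x. u (F x))" using adm_comp_C0[OF assms(1,2)] by blast
  show "L1dist (\<lambda>x. u (F (G x))) (\<lambda>x. u (G x)) \<le> ennreal (4 ^ CARD('n)) * L1dist (\<lambda>x. u (F x)) u"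
    "L1dist (\<lambda>x. u (F x)) u \<le> ennreal (4 ^ CARD('n)) * L1dist (\<lambda>x. u (F (G x))) (\<lambda>x. u (G x))"
    using L1dist_near_id[OF assms(3) S(2,1) adm_C0[OF assms(1)] bounded_K] by simp_all
qed

lemma energy_measurable:
  assumes u: "adm u" and W: "vf_bound Y B"
  shows "(\<lambda>x. ennreal \<bar>grad u x \<bullet> Y x\<bar> * indicator K x) \<in> borel_measurable borel"
proof -
  have mK: "K \<in> sets borel" using compact_K by (simp add: compact_imp_closed)
  have gc: "continuous_on UNIV (grad u)" using u by (auto simp: adm_def)
  have "continuous_on UNIV (cut Y)" 
    using W by (intro lipschitz_on_continuous_on[of B] lipschitz_onI) (auto simp: vf_bound_def dist_norm)
  then have [measurable]: "cut Y \<in> borel_measurable borel" "grad u \<in> borel_measurable borel"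
    using gc by (auto intro: borel_measurable_continuous_onI)
  have "(\<lambda>x. ennreal \<bar>grad u x \<bullet> cut Y x\<bar> * indicator K x) \<in> borel_measurable borel"
    using mK by (intro borel_measurable_times_ennreal borel_measurable_indicator) auto
  moreover have "(\<lambda>x. ennreal \<bar>grad u x \<bullet> cut Y x\<bar> * indicator K x) = (\<lambda>x. ennreal \<bar>grad u x \<bullet> Y x\<bar> * indicator K x)"
    using cut_eq K_sub_nb[of r] r_pos by (auto simp: fun_eq_iff indicator_def)
  ultimately show ?thesis by simp
qed

text \<open>The admissible step size \<open>h0\<close> depends on u through the uniform continuity
  of its gradient. This does no harm, because u is fixed before the number of steps of the polygon
  is chosen.\<close>

lemma euler_step_energy:
  assumes u: "adm u" and W: "vf_bound Y B" and "\<sigma> > 0"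
  shows "\<exists>h0>0. \<forall>h. 0 \<le> h \<and> h \<le> h0 \<longrightarrow> L1dist (\<lambda>x. u (x + h *\<^sub>R cut Y x)) u \<le> ennreal h * (energy Y u + ennreal \<sigma>)"
proof -
  have B: "B \<ge> 1" "\<And>x. norm (cut Y x) \<le> B" using W by (auto simp: vf_bound_def)
  let ?M = "measure lborel (nb 1)"
  have fin: "emeasure lborel (nb 1) < \<infinity>" using compact_nb emeasure_compact_finite by blast
  have M: "emeasure lborel (nb 1) = ennreal ?M" using fin by (intro emeasure_eq_ennreal_measure) auto
  have closed_nb: "closed (nb 1)" using compact_nb compact_imp_closed by blast
  \<comment> \<open>The allowed oscillation of the gradient; multiplied by the speed B and by the
    volume of \<open>nb 1\<close>, outside of which the integrand vanishes, it stays below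
    \<sigma>.\<close>
  define \<tau> where "\<tau> = \<sigma> / (B * (?M + 1))"
  have \<tau>: "\<tau> > 0" "\<tau> * B * ?M \<le> \<sigma>" 
  proof -
    have D: "B * (?M + 1) > 0" using B(1) add_nonneg_pos[OF measure_nonneg zero_less_one] by (intro mult_pos_pos) (linarith, blast)
    then show "\<tau> > 0" using \<open>\<sigma>>0\<close> by (simp add: \<tau>_def)
    have "\<sigma> * (B * ?M) \<le> \<sigma> * (B * (?M + 1))" using \<open>\<sigma>>0\<close> B(1) by (intro mult_left_mono) auto
    then have "\<sigma> * (B * ?M) / (B * (?M + 1)) \<le> \<sigma>" by (simp only: pos_divide_le_eq[OF D])
    then show "\<tau> * B * ?M \<le> \<sigma>" by (simp only: \<tau>_def times_divide_eq_left mult.assoc)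
  qed
  have gc: "continuous_on UNIV (grad u)" using u by (auto simp: adm_def)
  have "uniformly_continuous_on (nb 2) (grad u)"
    by (intro compact_uniformly_continuous compact_nb continuous_on_subset[OF gc]) auto
  then obtain d where d: "d > 0" "\<And>x y. x \<in> nb 2 \<Longrightarrow> y \<in> nb 2 \<Longrightarrow> dist y x < d \<Longrightarrow> dist (grad u y) (grad u x) < \<tau>"
    using \<tau>(1) unfolding uniformly_continuous_on_def by metis
  define h0 where "h0 = min (d / 2) 1 / B"
  have h0: "h0 > 0" "h0 * B < d" "h0 * B \<le> 1" using d B by (auto simp: h0_def)
  show ?thesis
  proof (intro exI[of _ h0] conjI h0 allI impI)
    fix h assume h: "0 \<le> h \<and> h \<le> h0"
    have hB: "h * B < d" "h * B \<le> 1" 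
    proof -
      have "h * B \<le> h0 * B" using h B(1) by (intro mult_right_mono) auto
      then show "h * B < d" "h * B \<le> 1" using h0 by linarith+
    qed
    have pt: "ennreal \<bar>u (x + h *\<^sub>R cut Y x) - u x\<bar> \<le> ennreal h * (ennreal \<bar>grad u x \<bullet> Y x\<bar> * indicator K x + ennreal (\<tau> * B) * indicator (nb 1) x)" for x
    proof -
      have disp: "norm (h *\<^sub>R cut Y x) \<le> h * B" using B(2)[of x] h by (auto intro!: mult_left_mono)
      show ?thesis
      proof (cases "x \<in> nb 1")
        case True
        let ?y = "x + h *\<^sub>R cut Y x"
        have "norm (u ?y - u x - grad u x \<bullet> (?y - x)) \<le> norm (?y - x) * \<tau>"
        proof (rule differentiable_bound_linearization[where S="cball x (h * B)" and f'="\<lambda>w v. grad u w \<bullet> v" and ?x0.0=x])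
          fix t :: real assume t: "t \<in> {0..1}"
          have "norm (t *\<^sub>R (?y - x)) \<le> 1 * norm (?y - x)" unfolding norm_scaleR using t by (intro mult_right_mono) auto
          then show "x + t *\<^sub>R (?y - x) \<in> cball x (h * B)" using disp by (auto simp: dist_norm)
        next
          fix w assume w: "w \<in> cball x (h * B)"
          show "(u has_derivative (\<lambda>v. grad u w \<bullet> v)) (at w within cball x (h * B))"
            using has_derivative_grad[of u w] u has_derivative_at_withinI by (auto simp: adm_def)
          have wx: "norm (w - x) \<le> h * B" using w by (simp add: dist_norm norm_minus_commute)
          then have "w \<in> nb (1 + 1)" using nb_step[OF True, of w 1] hB by auto
          moreover have "x \<in> nb 2" using True nb_mono[of 1 2] by auto
          ultimately have "dist (grad u w) (grad u x) < \<tau>" using wx hB by (intro d(2)) (auto simp: dist_norm)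
          then show "onorm ((\<lambda>v. grad u w \<bullet> v) - (\<lambda>v. grad u x \<bullet> v)) \<le> \<tau>"
            using onorm_inner_le[of "grad u w - grad u x"] by (simp add: fun_diff_def inner_diff_left dist_norm)
        qed (use h B in auto)
        then have "\<bar>u ?y - u x\<bar> \<le> \<bar>h * (grad u x \<bullet> cut Y x)\<bar> + norm (h *\<^sub>R cut Y x) * \<tau>" by simp
        also have "\<bar>h * (grad u x \<bullet> cut Y x)\<bar> = h * (\<bar>grad u x \<bullet> Y x\<bar> * indicator K x)"
          using h adm_grad_0[OF u, of x] cut_eq[of x] K_sub_nb[of r] r_pos by (cases "x \<in> K") (auto simp: abs_mult)
        also have "norm (h *\<^sub>R cut Y x) * \<tau> \<le> h * (\<tau> * B)"
          using mult_right_mono[OF disp, of \<tau>] \<tau> by (simp add: mult_ac)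
        finally have "\<bar>u ?y - u x\<bar> \<le> h * (\<bar>grad u x \<bullet> Y x\<bar> * indicator K x + \<tau> * B)" by (simp add: algebra_simps)
        then have "ennreal \<bar>u ?y - u x\<bar> \<le> ennreal (h * (\<bar>grad u x \<bullet> Y x\<bar> * indicator K x + \<tau> * B))" by (rule ennreal_leI)
        also have "\<dots> = ennreal h * (ennreal \<bar>grad u x \<bullet> Y x\<bar> * indicator K x + ennreal (\<tau> * B) * indicator (nb 1) x)"
          using True h \<tau> B by (subst ennreal_mult) (auto simp: ennreal_plus ennreal_mult' indicator_def)
        finally show ?thesis .
      next
        case False
        have "u x = 0" using notin_nb[OF False, of x] u by (auto simp: adm_def)
        moreover have "u (x + h *\<^sub>R cut Y x) = 0" 
          using notin_nb[OF False, of "x + h *\<^sub>R cut Y x"] disp hB u by (auto simp: adm_def)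
        ultimately show ?thesis by simp
      qed
    qed
    have Ymeas: "(\<lambda>x. ennreal \<bar>grad u x \<bullet> Y x\<bar> * indicator K x) \<in> borel_measurable borel"
      by (rule energy_measurable[OF u W])
    have "L1dist (\<lambda>x. u (x + h *\<^sub>R cut Y x)) u \<le> (\<integral>\<^sup>+x. ennreal h * (ennreal \<bar>grad u x \<bullet> Y x\<bar> * indicator K x + ennreal (\<tau> * B) * indicator (nb 1) x) \<partial>lborel)"
      unfolding L1dist_def by (intro nn_integral_mono pt)
    also have "\<dots> = ennreal h * (energy Y u + ennreal (\<tau> * B) * emeasure lborel (nb 1))"
      unfolding energy_def using Ymeas closed_nb
      by (subst nn_integral_cmult, simp, subst nn_integral_add) (auto simp: nn_integral_cmult_indicator)
    also have "\<dots> \<le> ennreal h * (energy Y u + ennreal \<sigma>)"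
      using \<tau> B by (intro mult_left_mono add_left_mono) (auto simp: M ennreal_mult[symmetric] intro!: ennreal_leI)
    finally show "L1dist (\<lambda>x. u (x + h *\<^sub>R cut Y x)) u \<le> ennreal h * (energy Y u + ennreal \<sigma>)" .
  qed
qed

text \<open>The polygon is telescoped into single steps. Each summand is one step preceded by a
  shorter polygon, which is itself near the identity, so the factor 4^n occurs once per summand and
  does not accumulate. The N summands of size \<epsilon>/N add up to \<epsilon>.\<close>

lemma euler_energy:
  assumes u: "adm u" and W: "vf_bound Y B" and e: "0 < \<epsilon>" "\<epsilon> * B \<le> 1/4" and \<eta>: "\<eta> > 0"
  shows "\<exists>N>0. L1dist (\<lambda>x. u (euler (cut Y) (\<epsilon> / real N) N x)) u \<le> ennreal (4 ^ CARD('n)) * (ennreal \<epsilon> * energy Y u) + ennreal \<eta>"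
proof -
  have WB: "0 \<le> B" "\<And>x. norm (cut Y x) \<le> B" "\<And>x y. norm (cut Y x - cut Y y) \<le> B * norm (x - y)" 
    using W by (auto simp: vf_bound_def)
  define \<sigma> where "\<sigma> = \<eta> / (4 ^ CARD('n) * \<epsilon>)"
  have \<sigma>: "\<sigma> > 0" using \<eta> e by (auto simp: \<sigma>_def)
  obtain h0 where h0: "h0 > 0" "\<And>h. 0 \<le> h \<Longrightarrow> h \<le> h0 \<Longrightarrow> L1dist (\<lambda>x. u (x + h *\<^sub>R cut Y x)) u \<le> ennreal h * (energy Y u + ennreal \<sigma>)"
    using euler_step_energy[OF u W \<sigma>] by blast
  obtain N :: nat where N: "real N > \<epsilon> / h0" using reals_Archimedean2 by blast
  have N0: "N > 0" using N e h0 by (metis divide_pos_pos gr0I not_less_iff_gr_or_eq of_nat_0)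
  define h where "h = \<epsilon> / real N"
  have h: "0 \<le> h" "h \<le> h0" "real N * h = \<epsilon>" using N N0 e h0 by (auto simp: h_def field_simps)
  have nid: "near_id (euler (cut Y) h j)" if "j \<le> N" for j
  proof -
    have "real j * h \<le> \<epsilon>" using that h by (metis mult_right_mono of_nat_le_iff)
    from euler_lip_id[OF WB h(1) this] show ?thesis using e by (intro lip_id_near_id) auto
  qed
  have nid1: "near_id (\<lambda>x. x + h *\<^sub>R cut Y x)" 
  proof -
    have "euler (cut Y) h 1 = (\<lambda>x. x + h *\<^sub>R cut Y x)" by auto
    then show ?thesis using nid[of 1] N0 by simp
  qed
  have "L1dist (\<lambda>x. u (euler (cut Y) h j x)) u \<le> of_nat j * (ennreal (4 ^ CARD('n)) * (ennreal h * (energy Y u + ennreal \<sigma>)))" if "j \<le> N" for j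
    using that
  proof (induction j)
    case 0
    then show ?case by (simp add: L1dist_def)
  next
    case (Suc j)
    have "L1dist (\<lambda>x. u (euler (cut Y) h (Suc j) x)) u \<le> L1dist (\<lambda>x. u (euler (cut Y) h (Suc j) x)) (\<lambda>x. u (euler (cut Y) h j x)) + L1dist (\<lambda>x. u (euler (cut Y) h j x)) u"
      using Suc.prems by (intro L1dist_near_id_triangle_id u nid) auto
    also have "L1dist (\<lambda>x. u (euler (cut Y) h (Suc j) x)) (\<lambda>x. u (euler (cut Y) h j x)) \<le> ennreal (4 ^ CARD('n)) * L1dist (\<lambda>x. u (x + h *\<^sub>R cut Y x)) u"
      using L1dist_compose_near_id(1)[OF u nid1 nid[of j]] Suc.prems by simp
    also have "\<dots> \<le> ennreal (4 ^ CARD('n)) * (ennreal h * (energy Y u + ennreal \<sigma>))"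
      by (intro mult_left_mono h0 h) auto
    also have "L1dist (\<lambda>x. u (euler (cut Y) h j x)) u \<le> of_nat j * (ennreal (4 ^ CARD('n)) * (ennreal h * (energy Y u + ennreal \<sigma>)))"
      using Suc by simp
    finally show ?case by (simp add: distrib_right add_mono)
  qed
  from this[of N] have "L1dist (\<lambda>x. u (euler (cut Y) h N x)) u \<le> of_nat N * (ennreal (4 ^ CARD('n)) * (ennreal h * (energy Y u + ennreal \<sigma>)))"
    by simp
  also have "\<dots> = ennreal (4 ^ CARD('n)) * ((of_nat N * ennreal h) * (energy Y u + ennreal \<sigma>))" by (simp only: mult_ac)
  also have "of_nat N * ennreal h = ennreal \<epsilon>" using h by (simp add: ennreal_of_nat_eq_real_of_nat ennreal_mult[symmetric])
  also have "ennreal (4 ^ CARD('n)) * (ennreal \<epsilon> * (energy Y u + ennreal \<sigma>)) = ennreal (4 ^ CARD('n)) * (ennreal \<epsilon> * energy Y u) + ennreal (4 ^ CARD('n)) * (ennreal \<epsilon> * ennreal \<sigma>)"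
    by (simp add: distrib_left)
  also have "ennreal (4 ^ CARD('n)) * (ennreal \<epsilon> * ennreal \<sigma>) = ennreal \<eta>"
    using e \<sigma> \<eta> by (subst ennreal_mult[symmetric], simp, simp)+ (simp add: \<sigma>_def)
  finally show ?thesis using N0 by (auto simp: h_def)
qed

end

section \<open>Moduli along commutators\<close>

locale tube_fields = tube +
  fixes X :: "'m::finite \<Rightarrow> real^'a \<Rightarrow> real^'a"
  assumes smooth_X: "\<And>i. smooth_vector_field U (X i)"
begin

definition total_energy :: "(real^'a \<Rightarrow> real) \<Rightarrow> ennreal" where
  "total_energy u = (\<Sum>i\<in>UNIV. energy (X i) u)"

lemma energy_le_nrg: "energy (X i) u \<le> total_energy u"
  unfolding total_energy_def by (rule member_le_sum) auto

text \<open>The last term is of higher order than the displacement \<open>\<epsilon>\<^sup>k\<close>: once all constant fields are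
  controlled, it can be absorbed into the isotropic modulus.\<close>

definition shift_bound :: "nat \<Rightarrow> (real^'a \<Rightarrow> real^'a) \<Rightarrow> bool" where
  "shift_bound k Y \<longleftrightarrow> (\<exists>C>0. \<exists>e0>0. e0 \<le> 1 \<and> (\<forall>u \<epsilon>. adm u \<longrightarrow> 0 < \<epsilon> \<longrightarrow> \<epsilon> \<le> e0 \<longrightarrow>
     L1dist (\<lambda>x. u (x + \<epsilon> ^ k *\<^sub>R cut Y x)) u \<le> ennreal C * (ennreal \<epsilon> * total_energy u + modulus u (C * \<epsilon> ^ Suc k))))"

text \<open>Replacing \<epsilon> by \<epsilon>^l improves the remainder to order (k + 1) l, which
  for l > 1 is more than one order above the displacement. With l = 2 this surplus pays for the
  bracket.\<close>

lemma shift_boundD_scaled: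
  assumes "shift_bound k Y" "l > 0"
  shows "\<exists>C>0. \<exists>e0>0. e0 \<le> 1 \<and> (\<forall>u \<epsilon>. adm u \<longrightarrow> 0 < \<epsilon> \<longrightarrow> \<epsilon> \<le> e0 \<longrightarrow>
     L1dist (\<lambda>x. u (x + \<epsilon> ^ (k * l) *\<^sub>R cut Y x)) u \<le> ennreal C * (ennreal \<epsilon> * total_energy u + modulus u (C * \<epsilon> ^ ((k + 1) * l))))"
proof -
  obtain C e0 where C: "C > 0" "e0 > 0" "e0 \<le> 1" "\<And>u \<epsilon>. adm u \<Longrightarrow> 0 < \<epsilon> \<Longrightarrow> \<epsilon> \<le> e0 \<Longrightarrow>
     L1dist (\<lambda>x. u (x + \<epsilon> ^ k *\<^sub>R cut Y x)) u \<le> ennreal C * (ennreal \<epsilon> * total_energy u + modulus u (C * \<epsilon> ^ Suc k))"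
    using assms(1) unfolding shift_bound_def by blast
  show ?thesis
  proof (rule exI[of _ C], intro exI[of _ e0] conjI allI impI C(1-3))
    fix u \<epsilon> assume u: "adm u" and e: "0 < \<epsilon>" "\<epsilon> \<le> e0"
    have le: "\<epsilon> ^ l \<le> \<epsilon>" using e C(3) assms(2) power_decreasing[of 1 l \<epsilon>] by simp
    have pw: "\<epsilon> ^ (k * l) = (\<epsilon> ^ l) ^ k" "\<epsilon> ^ ((k + 1) * l) = (\<epsilon> ^ l) ^ Suc k"
      by (simp_all only: power_mult[symmetric] mult.commute Suc_eq_plus1)
    have "L1dist (\<lambda>x. u (x + \<epsilon> ^ (k * l) *\<^sub>R cut Y x)) u \<le> ennreal C * (ennreal (\<epsilon> ^ l) * total_energy u + modulus u (C * (\<epsilon> ^ l) ^ Suc k))"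
      unfolding pw using e le by (intro C(4) u) auto
    also have "\<dots> \<le> ennreal C * (ennreal \<epsilon> * total_energy u + modulus u (C * \<epsilon> ^ ((k + 1) * l)))"
      unfolding pw by (intro mult_left_mono add_right_mono mult_right_mono ennreal_leI le) auto
    finally show "L1dist (\<lambda>x. u (x + \<epsilon> ^ (k * l) *\<^sub>R cut Y x)) u \<le> ennreal C * (ennreal \<epsilon> * total_energy u + modulus u (C * \<epsilon> ^ ((k + 1) * l)))" .
  qed
qed

lemma shift_bound_mult:
  assumes "shift_bound k Y" "l > 0"
  shows "shift_bound (k * l) Y"
proof -
  obtain C e0 where C: "C > 0" "e0 > 0" "e0 \<le> 1" "\<And>u \<epsilon>. adm u \<Longrightarrow> 0 < \<epsilon> \<Longrightarrow> \<epsilon> \<le> e0 \<Longrightarrow>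
     L1dist (\<lambda>x. u (x + \<epsilon> ^ (k * l) *\<^sub>R cut Y x)) u \<le> ennreal C * (ennreal \<epsilon> * total_energy u + modulus u (C * \<epsilon> ^ ((k + 1) * l)))"
    using shift_boundD_scaled[OF assms] by blast
  show ?thesis unfolding shift_bound_def
  proof (rule exI[of _ C], intro exI[of _ e0] conjI allI impI C(1-3))
    fix u \<epsilon> assume u: "adm u" and e: "0 < \<epsilon>" "\<epsilon> \<le> e0"
    have "\<epsilon> ^ ((k + 1) * l) \<le> \<epsilon> ^ Suc (k * l)"
      using e C(3) assms(2) by (intro power_decreasing) auto
    then have "modulus u (C * \<epsilon> ^ ((k + 1) * l)) \<le> modulus u (C * \<epsilon> ^ Suc (k * l))"
      using C(1) by (intro modulus_mono mult_left_mono) auto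
    then show "L1dist (\<lambda>x. u (x + \<epsilon> ^ (k * l) *\<^sub>R cut Y x)) u \<le> ennreal C * (ennreal \<epsilon> * total_energy u + modulus u (C * \<epsilon> ^ Suc (k * l)))"
      using C(4)[OF u e] by (elim order_trans) (intro mult_left_mono add_left_mono, auto)
  qed
qed

lemma shift_const_eq: "shift_const TYPE(real^'a) = ennreal (2 * 8 ^ CARD('a))"
  by (simp add: shift_const_def ennreal_mult)

text \<open>The single step of length \<epsilon> and the polygon of total time \<epsilon> differ by
  at most B^2 \<epsilon>^2. The polygon costs energy, and the difference costs the modulus at that
  scale, which is the remainder allowed in \<open>shift_bound 1\<close>.\<close>

lemma shift_bound_1_of_energy:
  assumes Y: "smooth_vector_field U Y" and F: "F \<ge> 0" "\<And>u. adm u \<Longrightarrow> energy Y u \<le> ennreal F * total_energy u"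
  shows "shift_bound 1 Y"
proof -
  obtain B where W: "vf_bound Y B" using vf_bound_exists[OF Y] by blast
  have B1: "B \<ge> 1" using W by (simp add: vf_bound_def)
  have WB: "0 \<le> B" "\<And>x. norm (cut Y x) \<le> B" "\<And>x y. norm (cut Y x - cut Y y) \<le> B * norm (x - y)" 
    using W by (auto simp: vf_bound_def)
  define A :: real where "A = 4 ^ CARD('a)"
  define s :: real where "s = 2 * 8 ^ CARD('a)"
  define C where "C = 2 * B^2 + s + A * F"
  have As: "A \<ge> 0" "s \<ge> 0" by (auto simp: A_def s_def)
  have C: "C > 0" "2 * B^2 \<le> C" using B1 As F by (auto simp: C_def intro!: add_pos_nonneg)
  define e0 where "e0 = 1 / (4 * B)"
  have e0: "e0 > 0" "e0 \<le> 1" using B1 by (auto simp: e0_def)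
  show ?thesis unfolding shift_bound_def
  proof (rule exI[of _ C], intro exI[of _ e0] conjI allI impI C(1) e0)
    fix u \<epsilon> assume u: "adm u" and e: "0 < \<epsilon>" "\<epsilon> \<le> e0"
    have eB: "\<epsilon> * B \<le> 1/4" using e(2) B1 by (simp add: e0_def field_simps)
    let ?R = "ennreal \<epsilon> * total_energy u + modulus u (C * \<epsilon> ^ Suc 1)"
    show "L1dist (\<lambda>x. u (x + \<epsilon> ^ 1 *\<^sub>R cut Y x)) u \<le> ennreal C * ?R"
    proof (rule ennreal_le_epsilon)
      fix \<eta> :: real assume \<eta>: "\<eta> > 0"
      obtain N where N: "N > 0" "L1dist (\<lambda>x. u (euler (cut Y) (\<epsilon> / real N) N x)) u \<le> ennreal (4 ^ CARD('a)) * (ennreal \<epsilon> * energy Y u) + ennreal \<eta>"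
        using euler_energy[OF u W e(1) eB \<eta>] by blast
      define h where "h = \<epsilon> / real N"
      have h: "0 \<le> h" "real N * h = \<epsilon>" using N e by (auto simp: h_def)
      have nT: "near_id (euler (cut Y) h N)"
        using euler_lip_id[OF WB h(1), of N \<epsilon>] h eB by (intro lip_id_near_id) auto
      have nS: "near_id (\<lambda>x. x + \<epsilon> *\<^sub>R cut Y x)"
        using step_lip_id[OF WB, of \<epsilon>] e eB by (intro lip_id_near_id) auto
      have close: "norm ((x + \<epsilon> *\<^sub>R cut Y x) - euler (cut Y) h N x) \<le> B^2 * \<epsilon>^2" for x
      proof -
        have "(x + \<epsilon> *\<^sub>R cut Y x) - euler (cut Y) h N x = h *\<^sub>R (\<Sum>j<N. cut Y x - cut Y (euler (cut Y) h j x))"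
          by (simp add: euler_sum[of _ h N] sum_subtractf scaleR_diff_right scaleR_sum_right[symmetric] sum_constant_scaleR h(2)[symmetric] mult.commute del: sum_constant)
        moreover have "norm (\<Sum>j<N. cut Y x - cut Y (euler (cut Y) h j x)) \<le> (\<Sum>j<N. B * (\<epsilon> * B))"
        proof (rule sum_norm_le)
          fix j assume "j \<in> {..<N}"
          then have "real j * h \<le> \<epsilon>" using h by (metis lessThan_iff less_imp_le mult_right_mono of_nat_le_iff)
          then have "norm (x - euler (cut Y) h j x) \<le> \<epsilon> * B"
            using euler_disp[OF WB h(1), of j x] WB(1) by (metis mult_right_mono norm_minus_commute order_trans)
          then show "norm (cut Y x - cut Y (euler (cut Y) h j x)) \<le> B * (\<epsilon> * B)"
            using WB(1,3) by (meson mult_left_mono order_trans)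
        qed
        ultimately have "norm ((x + \<epsilon> *\<^sub>R cut Y x) - euler (cut Y) h N x) \<le> h * (real N * (B * (\<epsilon> * B)))"
          using h(1) by (simp add: mult_left_mono)
        also have "\<dots> = B^2 * \<epsilon>^2" using h(2) by (metis mult.assoc mult.commute mult.left_commute power2_eq_square)
        finally show ?thesis .
      qed
      have "L1dist (\<lambda>x. u (x + \<epsilon> ^ 1 *\<^sub>R cut Y x)) u \<le> L1dist (\<lambda>x. u (x + \<epsilon> *\<^sub>R cut Y x)) (\<lambda>x. u (euler (cut Y) h N x)) + L1dist (\<lambda>x. u (euler (cut Y) h N x)) u"
        using L1dist_near_id_triangle_id[OF u nS nT] by simp
      also have "L1dist (\<lambda>x. u (x + \<epsilon> *\<^sub>R cut Y x)) (\<lambda>x. u (euler (cut Y) h N x)) \<le> ennreal s * modulus u (2 * (B^2 * \<epsilon>^2))"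
        unfolding s_def shift_const_eq[symmetric]
        by (rule L1dist_shift[OF nS nT adm_C0[OF u] bounded_K]) (use close B1 e in auto)
      also have "modulus u (2 * (B^2 * \<epsilon>^2)) \<le> ?R"
      proof -
        have "2 * (B^2 * \<epsilon>^2) \<le> C * \<epsilon> ^ Suc 1"
          using mult_right_mono[OF C(2), of "\<epsilon>^2"] by (simp add: power2_eq_square mult.assoc)
        from modulus_mono[OF this] show ?thesis by (intro add_increasing) auto
      qed
      also have "L1dist (\<lambda>x. u (euler (cut Y) h N x)) u \<le> ennreal A * (ennreal \<epsilon> * energy Y u) + ennreal \<eta>"
        using N(2) by (simp add: h_def A_def)
      also have "ennreal \<epsilon> * energy Y u \<le> ennreal F * ?R"
      proof -
        have "ennreal \<epsilon> * energy Y u \<le> ennreal \<epsilon> * (ennreal F * total_energy u)" by (intro mult_left_mono F(2) u) auto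
        also have "\<dots> = ennreal F * (ennreal \<epsilon> * total_energy u)" by (simp only: mult_ac)
        also have "\<dots> \<le> ennreal F * ?R" by (intro mult_left_mono) auto
        finally show ?thesis .
      qed
      finally have "L1dist (\<lambda>x. u (x + \<epsilon> ^ 1 *\<^sub>R cut Y x)) u \<le> ennreal s * ?R + (ennreal A * (ennreal F * ?R) + ennreal \<eta>)"
        by (simp add: add_mono mult_left_mono)
      also have "\<dots> = ennreal (s + A * F) * ?R + ennreal \<eta>"
        using As F by (simp only: ennreal_plus ennreal_mult mult_nonneg_nonneg distrib_right mult.assoc add.assoc)
      also have "\<dots> \<le> ennreal C * ?R + ennreal \<eta>"
        by (intro add_right_mono mult_right_mono ennreal_leI) (auto simp: C_def)
      finally show "L1dist (\<lambda>x. u (x + \<epsilon> ^ 1 *\<^sub>R cut Y x)) u \<le> ennreal C * ?R + ennreal \<eta>" .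
    qed
  qed
qed

lemma energy_scale_le:
  assumes f: "smooth_on U f" and Y: "smooth_vector_field U Y"
  shows "\<exists>F\<ge>0. \<forall>u. adm u \<longrightarrow> energy (\<lambda>x. f x *\<^sub>R Y x) u \<le> ennreal F * energy Y u"
proof -
  obtain F where F: "F \<ge> 0" "\<And>x. x \<in> nb (4*r) \<Longrightarrow> \<bar>f x\<bar> \<le> F" using smooth_bounds[OF f] by blast
  obtain B where B: "vf_bound Y B" using vf_bound_exists[OF Y] by blast
  have "energy (\<lambda>x. f x *\<^sub>R Y x) u \<le> ennreal F * energy Y u" if u: "adm u" for u
  proof -
    have "energy (\<lambda>x. f x *\<^sub>R Y x) u \<le> (\<integral>\<^sup>+x. ennreal F * (ennreal \<bar>grad u x \<bullet> Y x\<bar> * indicator K x) \<partial>lborel)"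
      unfolding energy_def
    proof (intro nn_integral_mono)
      fix x
      show "ennreal \<bar>grad u x \<bullet> f x *\<^sub>R Y x\<bar> * indicator K x \<le> ennreal F * (ennreal \<bar>grad u x \<bullet> Y x\<bar> * indicator K x)"
      proof (cases "x \<in> K")
        case True
        then have "\<bar>f x\<bar> \<le> F" using F(2) K_sub_nb[of "4*r"] r_pos by auto
        then have "\<bar>f x\<bar> * \<bar>grad u x \<bullet> Y x\<bar> \<le> F * \<bar>grad u x \<bullet> Y x\<bar>" by (intro mult_right_mono) auto
        then show ?thesis using True F(1) by (simp add: abs_mult ennreal_mult[symmetric] ennreal_leI)
      qed simp
    qed
    also have "\<dots> = ennreal F * energy Y u" unfolding energy_def
      using energy_measurable[OF u B] by (subst nn_integral_cmult) auto
    finally show ?thesis .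
  qed
  then show ?thesis using F(1) by blast
qed

text \<open>A coefficient bounded near \<open>K\<close> merely rescales the energy of a generator.
  Commutators carry no energy bound of their own, so their coefficients have to be treated in
  another way.\<close>

lemma shift_bound_scale_X: "smooth_on U f \<Longrightarrow> shift_bound 1 (\<lambda>x. f x *\<^sub>R X i x)"
proof -
  assume f: "smooth_on U f"
  obtain F where F: "F \<ge> 0" "\<And>u. adm u \<Longrightarrow> energy (\<lambda>x. f x *\<^sub>R X i x) u \<le> ennreal F * energy (X i) u"
    using energy_scale_le[OF f smooth_X[of i]] by blast
  show ?thesis
    by (rule shift_bound_1_of_energy[OF smooth_vector_field_scale[OF open_U f smooth_X] F(1)])
       (use F(2) energy_le_nrg in \<open>meson mult_left_mono order_trans zero_le\<close>)
qed

lemma cut_add: "cut (\<lambda>x. Y x + Z x) x = cut Y x + cut Z x"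
  by (simp add: cut_def scaleR_add_right)

text \<open>With t = \<epsilon>^k, the step along Y + Z and the step along Y followed by that along
  Z differ by at most B^2 t^2, and t^2 \<le> \<epsilon>^(k+1) because k \<ge> 1.\<close>

lemma shift_bound_add_same:
  assumes Y: "smooth_vector_field U Y" "shift_bound k Y" and Z: "smooth_vector_field U Z" "shift_bound k Z" and k: "k > 0"
  shows "shift_bound k (\<lambda>x. Y x + Z x)"
proof -
  obtain B1 where W1: "vf_bound Y B1" using vf_bound_exists[OF Y(1)] by blast
  obtain B2 where W2: "vf_bound Z B2" using vf_bound_exists[OF Z(1)] by blast
  obtain B3 where W3: "vf_bound (\<lambda>x. Y x + Z x) B3" 
    using vf_bound_exists[OF smooth_vector_field_add[OF open_U Y(1) Z(1)]] by blast
  define B where "B = max B1 (max B2 B3)"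
  have W: "vf_bound Y B" "vf_bound Z B" "vf_bound (\<lambda>x. Y x + Z x) B"
    using vf_bound_mono[OF W1, of B] vf_bound_mono[OF W2, of B] vf_bound_mono[OF W3, of B] by (auto simp: B_def)
  have B1: "B \<ge> 1" using W(1) by (simp add: vf_bound_def)
  have b: "0 \<le> B" "\<And>x. norm (cut V x) \<le> B" "\<And>x y. norm (cut V x - cut V y) \<le> B * norm (x - y)" if "vf_bound V B" for V
    using that by (auto simp: vf_bound_def)
  obtain CY eY where CY: "CY > 0" "eY > 0" "eY \<le> 1" "\<And>u \<epsilon>. adm u \<Longrightarrow> 0 < \<epsilon> \<Longrightarrow> \<epsilon> \<le> eY \<Longrightarrow>
     L1dist (\<lambda>x. u (x + \<epsilon> ^ k *\<^sub>R cut Y x)) u \<le> ennreal CY * (ennreal \<epsilon> * total_energy u + modulus u (CY * \<epsilon> ^ Suc k))"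
    using Y(2) unfolding shift_bound_def by blast
  obtain CZ eZ where CZ: "CZ > 0" "eZ > 0" "eZ \<le> 1" "\<And>u \<epsilon>. adm u \<Longrightarrow> 0 < \<epsilon> \<Longrightarrow> \<epsilon> \<le> eZ \<Longrightarrow>
     L1dist (\<lambda>x. u (x + \<epsilon> ^ k *\<^sub>R cut Z x)) u \<le> ennreal CZ * (ennreal \<epsilon> * total_energy u + modulus u (CZ * \<epsilon> ^ Suc k))"
    using Z(2) unfolding shift_bound_def by blast
  define A :: real where "A = 4 ^ CARD('a)"
  define s :: real where "s = 2 * 8 ^ CARD('a)"
  have As: "A \<ge> 0" "s \<ge> 0" by (auto simp: A_def s_def)
  define c where "c = s + (A * CZ + CY)"
  \<comment> \<open>The summands dominate, in turn, the radius doubled by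
    \<open>L1dist_shift\<close>, the total prefactor, and the radii inside the two assumed
    bounds.\<close>
  define C where "C = 2 * B^2 + c + CY + CZ"
  have c0: "c \<ge> 0" using As CY CZ by (auto simp: c_def)
  have C: "C > 0" "2 * B^2 \<le> C" "CY \<le> C" "CZ \<le> C" "c \<le> C" using B1 c0 CY(1) CZ(1) by (auto simp: C_def add_nonneg_pos)
  \<comment> \<open>With displacement constants at most 1/6, the composite of two steps has at most
    1/6 (1 + 1/6) + 1/6 < 1/2.\<close>
  define e0 where "e0 = min (1 / (6 * B)) (min eY eZ)"
  have e0: "e0 > 0" "e0 \<le> 1" using B1 CY CZ by (auto simp: e0_def)
  show ?thesis unfolding shift_bound_def
  proof (rule exI[of _ C], intro exI[of _ e0] conjI allI impI C(1) e0)
    fix u \<epsilon> assume u: "adm u" and e: "0 < \<epsilon>" "\<epsilon> \<le> e0"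
    define t where "t = \<epsilon> ^ k"
    have e1: "\<epsilon> \<le> 1" using e e0 by linarith
    have t: "t > 0" "t \<le> \<epsilon>" "t * t \<le> \<epsilon> ^ Suc k"
      using e e1 k power_decreasing[of 1 k \<epsilon>] by (auto simp: t_def mult_right_mono)
    have "\<epsilon> \<le> 1 / (6 * B)" using e(2) by (simp add: e0_def)
    then have "\<epsilon> * B \<le> 1/6" using B1 by (simp add: field_simps)
    then have tB: "t * B \<le> 1/6" using t B1 mult_right_mono[of t \<epsilon> B] by linarith
    let ?R = "ennreal \<epsilon> * total_energy u + modulus u (C * \<epsilon> ^ Suc k)"
    have m: "modulus u (D * \<epsilon> ^ Suc k) \<le> modulus u (C * \<epsilon> ^ Suc k)" if "D \<le> C" for D
      using that e by (intro modulus_mono mult_right_mono) auto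
    let ?Y = "\<lambda>x. x + t *\<^sub>R cut Y x" and ?Z = "\<lambda>x. x + t *\<^sub>R cut Z x" and ?S = "\<lambda>x. x + t *\<^sub>R cut (\<lambda>x. Y x + Z x) x"
    have l: "lip_id (t * B) ?Y" "lip_id (t * B) ?Z" "lip_id (t * B) ?S"
      using t step_lip_id[OF b[OF W(1)], of t] step_lip_id[OF b[OF W(2)], of t] step_lip_id[OF b[OF W(3)], of t] by auto
    have ll: "lip_id (t * B * (1 + t * B) + t * B) (\<lambda>x. ?Z (?Y x))"
      using t B1 by (intro lip_id_compose l) auto
    have "t * B * (1 + t * B) \<le> 1/6 * (1 + 1/6)" using tB t B1 by (intro mult_mono) auto
    then have n: "near_id ?Y" "near_id ?Z" "near_id ?S" "near_id (\<lambda>x. ?Z (?Y x))"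
      using tB by (auto intro!: lip_id_near_id[OF l(1)] lip_id_near_id[OF l(2)] lip_id_near_id[OF l(3)] lip_id_near_id[OF ll])
    have close: "norm (?S x - ?Z (?Y x)) \<le> B^2 * \<epsilon> ^ Suc k" for x
    proof -
      have "?S x - ?Z (?Y x) = t *\<^sub>R (cut Z x - cut Z (?Y x))" by (simp add: cut_add algebra_simps)
      moreover have "norm (cut Z x - cut Z (?Y x)) \<le> B * norm (x - ?Y x)" by (rule b[OF W(2)])
      moreover have "norm (x - ?Y x) \<le> t * B" using b(2)[OF W(1), of x] t by simp
      ultimately have "norm (?S x - ?Z (?Y x)) \<le> t * (B * (t * B))"
        using t B1 by (simp add: mult_left_mono order_trans[OF _ mult_left_mono])
      also have "\<dots> = B^2 * (t * t)" by (simp add: power2_eq_square)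
      also have "\<dots> \<le> B^2 * \<epsilon> ^ Suc k" using t by (intro mult_left_mono) auto
      finally show ?thesis .
    qed
    have "L1dist (\<lambda>x. u (?S x)) u \<le> L1dist (\<lambda>x. u (?S x)) (\<lambda>x. u (?Z (?Y x))) + (L1dist (\<lambda>x. u (?Z (?Y x))) (\<lambda>x. u (?Y x)) + L1dist (\<lambda>x. u (?Y x)) u)"
      by (intro order_trans[OF L1dist_near_id_triangle_id[OF u n(3,4)]] add_left_mono L1dist_near_id_triangle_id u n)
    also have "L1dist (\<lambda>x. u (?S x)) (\<lambda>x. u (?Z (?Y x))) \<le> ennreal s * modulus u (2 * (B^2 * \<epsilon> ^ Suc k))"
      unfolding s_def shift_const_eq[symmetric]
      by (rule L1dist_shift[OF n(3,4) adm_C0[OF u] bounded_K]) (use close B1 e in auto)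
    also have "modulus u (2 * (B^2 * \<epsilon> ^ Suc k)) \<le> ?R"
      using m[OF C(2)] by (intro add_increasing) (simp_all add: mult.assoc)
    also have "L1dist (\<lambda>x. u (?Z (?Y x))) (\<lambda>x. u (?Y x)) \<le> ennreal A * L1dist (\<lambda>x. u (?Z x)) u"
      unfolding A_def by (rule L1dist_compose_near_id(1)[OF u n(2,1)])
    also have "L1dist (\<lambda>x. u (?Z x)) u \<le> ennreal CZ * ?R"
      unfolding t_def using e by (intro order_trans[OF CZ(4)[OF u]] mult_left_mono add_left_mono m C) (auto simp: e0_def)
    also have "L1dist (\<lambda>x. u (?Y x)) u \<le> ennreal CY * ?R"
      unfolding t_def using e by (intro order_trans[OF CY(4)[OF u]] mult_left_mono add_left_mono m C) (auto simp: e0_def)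
    finally have "L1dist (\<lambda>x. u (?S x)) u \<le> ennreal s * ?R + (ennreal A * (ennreal CZ * ?R) + ennreal CY * ?R)"
      by (simp add: add_mono mult_left_mono)
    also have "\<dots> = ennreal c * ?R"
      unfolding c_def using As CY(1) CZ(1) less_imp_le[OF CY(1)] less_imp_le[OF CZ(1)]
      by (simp only: ennreal_plus ennreal_mult mult_nonneg_nonneg add_nonneg_nonneg distrib_right mult.assoc)
    also have "\<dots> \<le> ennreal C * ?R" by (intro mult_right_mono ennreal_leI C) auto
    finally show "L1dist (\<lambda>x. u (x + \<epsilon> ^ k *\<^sub>R cut (\<lambda>x. Y x + Z x) x)) u \<le> ennreal C * ?R" by (simp add: t_def)
  qed
qed

definition controlled :: "(real^'a \<Rightarrow> real^'a) \<Rightarrow> bool" where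
  "controlled Y \<longleftrightarrow> smooth_vector_field U Y \<and> (\<exists>k>0. shift_bound k Y)"

text \<open>The two exponents k and l are brought to the common value k l before adding.\<close>

lemma controlled_add:
  assumes "controlled Y" "controlled Z"
  shows "controlled (\<lambda>x. Y x + Z x)"
proof -
  obtain k l where k: "k > 0" "shift_bound k Y" "l > 0" "shift_bound l Z" using assms by (auto simp: controlled_def)
  have "shift_bound (k * l) Y" "shift_bound (k * l) Z" using shift_bound_mult[OF k(2,3)] shift_bound_mult[OF k(4,1)] by (simp_all add: mult.commute)
  then show ?thesis
    using shift_bound_add_same[of Y "k * l" Z] assms k smooth_vector_field_add[OF open_U, of Y Z]
    unfolding controlled_def by (metis nat_0_less_mult_iff)
qed


text \<open>The dependence of a polygon on its starting point, to first order in time. The error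
  keeps a factor |v|: for a displacement v of size \<delta> \<le> \<epsilon> it is of order
  \<delta>\<epsilon>^2, hence small against the bracket term \<delta>\<epsilon>.\<close>

lemma euler_linearization:
  assumes W: "vf_bound V B" and h: "0 \<le> h" "real N * h = \<epsilon>" and x: "x \<in> nb (r/2)"
    and v: "norm v \<le> r/4" and e: "\<epsilon> * B \<le> r/4" "\<epsilon> * B \<le> 1/2"
  shows "norm (euler (cut V) h N (x + v) - euler (cut V) h N x - v - \<epsilon> *\<^sub>R jac V x v) \<le> 6 * B^2 * (\<epsilon> * norm v * (norm v + \<epsilon>))"
proof -
  have WB: "0 \<le> B" "\<And>x. norm (cut V x) \<le> B" "\<And>x y. norm (cut V x - cut V y) \<le> B * norm (x - y)" 
    using W by (auto simp: vf_bound_def)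
  have B1: "B \<ge> 1" using W by (simp add: vf_bound_def)
  have e0: "0 \<le> \<epsilon>" using h by (metis mult_nonneg_nonneg of_nat_0_le_iff)
  have xr: "x \<in> nb r" using x nb_mono[of "r/2" r] r_pos by auto
  have jacB: "norm (jac V x w) \<le> B * norm w" for w using W xr by (auto simp: vf_bound_def)
  define y where "y j = euler (cut V) h j (x + v)" for j
  define z where "z j = euler (cut V) h j x" for j
  let ?b = "B * (6 * B * (norm v * (norm v + \<epsilon>)))"
  \<comment> \<open>Every increment is compared with the same vector \<open>jac V x v\<close>. The
    two errors are the Taylor remainder based at x and the drift of y_j - z_j away from v.\<close>
  have step: "norm (cut V (y j) - cut V (z j) - jac V x v) \<le> ?b" if "j < N" for j
  proof -
    have jh: "real j * h \<le> \<epsilon>" using that h by (metis less_imp_le mult_right_mono of_nat_le_iff)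
    then have jhB: "real j * h * B \<le> \<epsilon> * B" using WB(1) by (intro mult_right_mono)
    have zx: "norm (z j - x) \<le> \<epsilon> * B" using euler_disp[OF WB h(1), of j x] jhB by (simp add: z_def)
    have "norm (y j - (x + v)) \<le> \<epsilon> * B" using euler_disp[OF WB h(1), of j "x + v"] jhB by (simp add: y_def)
    then have yx: "norm (y j - x) \<le> \<epsilon> * B + norm v"
      using norm_triangle_ineq[of "y j - (x + v)" v] by simp
    have lip: "lip_id (2 * \<epsilon> * B) (euler (cut V) h j)" using euler_lip_id[OF WB h(1) jh] e by simp
    have d: "norm (y j - z j - v) \<le> 2 * \<epsilon> * B * norm v"
    proof -
      have "y j - z j - v = (y j - (x + v)) - (z j - x)" by simp
      then show ?thesis using lip unfolding lip_id_def y_def z_def by (metis add_diff_cancel_left')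
    qed
    have "2 * \<epsilon> * B * norm v \<le> 1 * norm v" using e by (intro mult_right_mono) auto
    then have yz: "norm (y j - z j) \<le> 2 * norm v"
      using d norm_triangle_ineq[of "y j - z j - v" v] by simp
    have nbs: "y j \<in> nb r" "z j \<in> nb r"
      using nb_step[OF x, of "y j" "r/2"] nb_step[OF x, of "z j" "r/2"] yx zx e v r_pos by auto
    have "norm (V (y j) - V (z j) - jac V x (y j - z j)) \<le> B * norm (y j - z j) * (norm (y j - x) + norm (z j - x))"
      using W xr yx zx e v r_pos by (auto simp: vf_bound_def)
    also have "\<dots> \<le> B * (2 * norm v) * ((\<epsilon> * B + norm v) + \<epsilon> * B)"
      using yz yx zx WB(1) by (intro mult_mono add_mono) auto
    finally have 1: "norm (cut V (y j) - cut V (z j) - jac V x (y j - z j)) \<le> B * (2 * norm v) * ((\<epsilon> * B + norm v) + \<epsilon> * B)"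
      using nbs by (simp add: cut_eq)
    have "norm (jac V x (y j - z j - v)) \<le> B * (2 * \<epsilon> * B * norm v)"
      using jacB[of "y j - z j - v"] d WB(1) by (meson mult_left_mono order_trans)
    then have 2: "norm (jac V x (y j - z j) - jac V x v) \<le> B * (2 * \<epsilon> * B * norm v)"
      by (simp add: linear_diff[OF linear_jac])
    have "norm (cut V (y j) - cut V (z j) - jac V x v) \<le> B * (2 * norm v) * ((\<epsilon> * B + norm v) + \<epsilon> * B) + B * (2 * \<epsilon> * B * norm v)"
    proof -
      have eq: "cut V (y j) - cut V (z j) - jac V x v = (cut V (y j) - cut V (z j) - jac V x (y j - z j)) + (jac V x (y j - z j) - jac V x v)"
        by simp
      show ?thesis unfolding eq by (rule order_trans[OF norm_triangle_ineq add_mono[OF 1 2]])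
    qed
    also have "\<dots> = B * (norm v * (2 * norm v + 6 * B * \<epsilon>))" by (simp add: algebra_simps)
    also have "\<dots> \<le> B * (norm v * (6 * B * norm v + 6 * B * \<epsilon>))"
      using B1 by (intro mult_left_mono add_right_mono mult_right_mono) auto
    also have "\<dots> = ?b" by (simp add: algebra_simps)
    finally show ?thesis .
  qed
  have "y N - z N - v - \<epsilon> *\<^sub>R jac V x v = h *\<^sub>R (\<Sum>j<N. cut V (y j) - cut V (z j) - jac V x v)"
    unfolding y_def z_def
    by (subst (1) euler_sum, subst (2) euler_sum)
       (simp add: sum_subtractf scaleR_diff_right sum_constant_scaleR h(2)[symmetric] mult.commute del: sum_constant)
  moreover have "norm (\<Sum>j<N. cut V (y j) - cut V (z j) - jac V x v) \<le> (\<Sum>j<N. ?b)"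
    using step by (intro sum_norm_le) auto
  ultimately have "norm (y N - z N - v - \<epsilon> *\<^sub>R jac V x v) \<le> h * (real N * ?b)"
    using h(1) by (simp add: mult_left_mono)
  also have "\<dots> = \<epsilon> * ?b" using h(2) by (metis mult.assoc mult.commute)
  also have "\<dots> = 6 * B^2 * (\<epsilon> * norm v * (norm v + \<epsilon>))" by (simp add: power2_eq_square)
  finally show ?thesis by (simp add: y_def z_def)
qed

lemma euler_first_order:
  assumes W: "vf_bound V B" and h: "0 \<le> h" "real N * h = \<epsilon>"
  shows "norm (euler (cut V) h N x - x - \<epsilon> *\<^sub>R cut V x) \<le> B^2 * \<epsilon>^2"
proof -
  have WB: "0 \<le> B" "\<And>x. norm (cut V x) \<le> B" "\<And>x y. norm (cut V x - cut V y) \<le> B * norm (x - y)" 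
    using W by (auto simp: vf_bound_def)
  have "euler (cut V) h N x - x - \<epsilon> *\<^sub>R cut V x = h *\<^sub>R (\<Sum>j<N. cut V (euler (cut V) h j x) - cut V x)"
    by (simp add: euler_sum[of _ h N] sum_subtractf scaleR_diff_right scaleR_sum_right[symmetric] sum_constant_scaleR h(2)[symmetric] mult.commute del: sum_constant)
  moreover have "norm (\<Sum>j<N. cut V (euler (cut V) h j x) - cut V x) \<le> (\<Sum>j<N. B * (\<epsilon> * B))"
  proof (rule sum_norm_le)
    fix j assume "j \<in> {..<N}"
    then have "real j * h \<le> \<epsilon>" using h by (metis lessThan_iff less_imp_le mult_right_mono of_nat_le_iff)
    then have "norm (euler (cut V) h j x - x) \<le> \<epsilon> * B"
      using euler_disp[OF WB h(1), of j x] WB(1) by (metis mult_right_mono order_trans)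
    then show "norm (cut V (euler (cut V) h j x) - cut V x) \<le> B * (\<epsilon> * B)"
      using WB(1,3) by (meson mult_left_mono order_trans)
  qed
  ultimately have "norm (euler (cut V) h N x - x - \<epsilon> *\<^sub>R cut V x) \<le> h * (real N * (B * (\<epsilon> * B)))"
    using h(1) by (simp add: mult_left_mono)
  also have "\<dots> = B^2 * \<epsilon>^2" using h(2) by (metis mult.assoc mult.commute mult.left_commute power2_eq_square)
  finally show ?thesis .
qed

text \<open>Following \<open>Y\<close> for time \<open>\<delta>\<close> and then \<open>V\<close> for time \<open>\<epsilon>\<close>, or in the other order, differs by the
  bracket at time \<open>\<delta>\<epsilon>\<close>, up to an error of order \<open>\<delta>\<epsilon>\<^sup>2\<close>. Since the two times are of different
  order, no further terms of the Campbell-Hausdorff expansion are needed.\<close>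

lemma bracket_expansion:
  assumes WV: "vf_bound V B" and WY: "vf_bound Y B" and WZ: "vf_bound (lie_bracket Y V) B"
    and h: "0 \<le> h" "real N * h = \<epsilon>" and d: "0 \<le> \<delta>" "\<delta> \<le> \<epsilon>" "\<epsilon> \<le> 1"
    and e: "\<epsilon> * B \<le> r/4" "\<epsilon> * B \<le> 1/2" and x: "x \<in> nb (r/2)"
  defines "T \<equiv> euler (cut V) h N" and "D \<equiv> \<lambda>x. x + \<delta> *\<^sub>R cut Y x"
    and "Z \<equiv> \<lambda>x. x + (\<delta> * \<epsilon>) *\<^sub>R cut (lie_bracket Y V) x"
  shows "norm (T (D x) - Z (D (T x))) \<le> 16 * B^4 * (\<delta> * \<epsilon>^2)"
proof -
  have b: "0 \<le> B" "\<And>x. norm (cut V x) \<le> B" "\<And>x y. norm (cut V x - cut V y) \<le> B * norm (x - y)" if "vf_bound V B" for V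
    using that by (auto simp: vf_bound_def)
  have B1: "B \<ge> 1" using WV by (simp add: vf_bound_def)
  have B0: "B \<ge> 0" using B1 by simp
  have e0: "0 \<le> \<epsilon>" using d by linarith
  have xr: "x \<in> nb r" using x nb_mono[of "r/2" r] r_pos by auto
  have cx: "cut V x = V x" "cut Y x = Y x" "cut (lie_bracket Y V) x = lie_bracket Y V x" using xr by (auto simp: cut_eq)
  have Yx: "norm (Y x) \<le> B" using b(2)[OF WY, of x] cx by simp
  define v where "v = \<delta> *\<^sub>R Y x"
  have nv: "norm v \<le> \<delta> * B" using Yx d by (simp add: v_def mult_left_mono)
  have dB: "\<delta> * B \<le> \<epsilon> * B" using d B0 by (intro mult_right_mono)
  have nv4: "norm v \<le> r/4" using nv dB e by linarith
  have Tx: "norm (T x - x) \<le> \<epsilon> * B"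
    using euler_disp[OF b[OF WV] h(1), of N x] h(2) by (simp add: T_def)
  have Tnb: "T x \<in> nb r" using nb_step[OF x, of "T x" "r/2"] Tx e r_pos by auto
  have E1: "norm (T (x + v) - T x - v - \<epsilon> *\<^sub>R jac V x v) \<le> 12 * B^4 * (\<delta> * \<epsilon>^2)"
  proof -
    have "norm (T (x + v) - T x - v - \<epsilon> *\<^sub>R jac V x v) \<le> 6 * B^2 * (\<epsilon> * norm v * (norm v + \<epsilon>))"
      unfolding T_def by (rule euler_linearization[OF WV h x nv4 e])
    also have "\<dots> \<le> 6 * B^2 * (\<epsilon> * (\<delta> * B) * (\<epsilon> * B + \<epsilon> * B))"
      using nv order_trans[OF nv dB] e0 B0 d B1 mult_left_mono[OF B1 e0] by (intro mult_left_mono mult_mono add_mono) auto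
    also have "\<dots> = 12 * B^4 * (\<delta> * \<epsilon>^2)" by (simp add: power2_eq_square power4_eq_xxxx)
    finally show ?thesis .
  qed
  have E2: "norm (\<delta> *\<^sub>R (Y (T x) - Y x - jac Y x (T x - x))) \<le> B^4 * (\<delta> * \<epsilon>^2)"
  proof -
    have "norm (Y (T x) - Y x - jac Y x (T x - x)) \<le> B * norm (T x - x) * (norm (T x - x) + norm (x - x))"
    proof -
      have "norm (T x - x) \<le> r" "norm (x - x) \<le> r" using Tx e r_pos by auto
      then show ?thesis using WY xr unfolding vf_bound_def by blast
    qed
    also have "\<dots> \<le> B * (\<epsilon> * B) * (\<epsilon> * B)" using Tx B0 e0 by (intro mult_mono) auto
    also have "\<dots> = B^3 * \<epsilon>^2" by (simp add: power2_eq_square power3_eq_cube)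
    also have "\<dots> \<le> B^4 * \<epsilon>^2" using B1 by (intro mult_right_mono power_increasing) auto
    finally have "\<delta> * norm (Y (T x) - Y x - jac Y x (T x - x)) \<le> \<delta> * (B^4 * \<epsilon>^2)" using d(1) by (rule mult_left_mono)
    then show ?thesis using d by (simp add: mult_ac)
  qed
  have E3: "norm (\<delta> *\<^sub>R jac Y x (T x - x - \<epsilon> *\<^sub>R V x)) \<le> B^4 * (\<delta> * \<epsilon>^2)"
  proof -
    have "norm (jac Y x (T x - x - \<epsilon> *\<^sub>R V x)) \<le> B * norm (T x - x - \<epsilon> *\<^sub>R V x)" using WY xr by (auto simp: vf_bound_def)
    also have "\<dots> \<le> B * (B^2 * \<epsilon>^2)" using euler_first_order[OF WV h, of x] cx B0 by (intro mult_left_mono) (auto simp: T_def)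
    also have "\<dots> = B^3 * \<epsilon>^2" by (simp add: power2_eq_square power3_eq_cube)
    also have "\<dots> \<le> B^4 * \<epsilon>^2" using B1 by (intro mult_right_mono power_increasing) auto
    finally have "\<delta> * norm (jac Y x (T x - x - \<epsilon> *\<^sub>R V x)) \<le> \<delta> * (B^4 * \<epsilon>^2)" using d(1) by (rule mult_left_mono)
    then show ?thesis using d by (simp add: mult_ac)
  qed
  have E4: "norm ((\<delta> * \<epsilon>) *\<^sub>R (cut (lie_bracket Y V) x - cut (lie_bracket Y V) (D (T x)))) \<le> 2 * B^4 * (\<delta> * \<epsilon>^2)"
  proof -
    have "norm (D (T x) - x) \<le> norm (T x - x) + norm (\<delta> *\<^sub>R cut Y (T x))"
      using norm_triangle_ineq[of "T x - x" "\<delta> *\<^sub>R cut Y (T x)"] by (simp add: D_def algebra_simps)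
    also have "\<dots> \<le> \<epsilon> * B + \<delta> * B" using Tx b(2)[OF WY, of "T x"] d by (intro add_mono) (auto intro: mult_left_mono)
    finally have "norm (x - D (T x)) \<le> 2 * \<epsilon> * B" using dB by (simp add: norm_minus_commute)
    then have "norm (cut (lie_bracket Y V) x - cut (lie_bracket Y V) (D (T x))) \<le> B * (2 * \<epsilon> * B)"
      using b(3)[OF WZ] B0 by (meson mult_left_mono order_trans)
    then have "(\<delta> * \<epsilon>) * norm (cut (lie_bracket Y V) x - cut (lie_bracket Y V) (D (T x))) \<le> (\<delta> * \<epsilon>) * (B * (2 * \<epsilon> * B))"
      using d e0 by (intro mult_left_mono) auto
    also have "\<dots> = 2 * B^2 * (\<delta> * \<epsilon>^2)" by (simp add: power2_eq_square)
    also have "\<dots> \<le> 2 * B^4 * (\<delta> * \<epsilon>^2)" using B1 d by (intro mult_right_mono mult_left_mono power_increasing) auto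
    finally show ?thesis using d e0 by simp
  qed
  have cT: "cut Y (T x) = Y (T x)" using Tnb by (rule cut_eq)
  have jv: "jac V x v = \<delta> *\<^sub>R jac V x (Y x)" unfolding v_def by (rule linear_scale[OF linear_jac])
  have jy: "jac Y x (T x - x - \<epsilon> *\<^sub>R V x) = jac Y x (T x - x) - \<epsilon> *\<^sub>R jac Y x (V x)"
    by (simp add: linear_diff[OF linear_jac] linear_scale[OF linear_jac])
  \<comment> \<open>The terms of order \<delta>\<epsilon>, namely DV(Y) - DY(V), form the bracket
    and cancel against Z. There remain the linearized polygon, the Taylor remainder of Y, the
    replacement of the polygon by one step, and the bracket taken at D(T x) instead of x; they
    contribute 12 + 1 + 1 + 2 = 16.\<close>
  have "T (D x) - Z (D (T x)) = (T (x + v) - T x - v - \<epsilon> *\<^sub>R jac V x v) - \<delta> *\<^sub>R (Y (T x) - Y x - jac Y x (T x - x))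
     - \<delta> *\<^sub>R jac Y x (T x - x - \<epsilon> *\<^sub>R V x) + (\<delta> * \<epsilon>) *\<^sub>R (cut (lie_bracket Y V) x - cut (lie_bracket Y V) (D (T x)))"
    unfolding jv jy Z_def D_def cx cT by (simp add: lie_bracket_eq_jac v_def algebra_simps)
  then have "norm (T (D x) - Z (D (T x))) \<le> 12 * B^4 * (\<delta> * \<epsilon>^2) + B^4 * (\<delta> * \<epsilon>^2) + B^4 * (\<delta> * \<epsilon>^2) + 2 * B^4 * (\<delta> * \<epsilon>^2)"
    by (simp only:) (intro norm_add_rule_thm norm_triangle_le_diff norm_triangle_le add_mono E1 E2 E3 E4 order_trans[OF norm_triangle_ineq] order_trans[OF norm_triangle_ineq4])
  then show ?thesis by linarith
qed

text \<open>Y is followed for time \<delta> = \<epsilon>^(2k) and X_i for time \<epsilon>, so the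
  bracket is followed for time \<epsilon>^(2k+1). Both the commutation error \<delta>\<epsilon>^2
  and the remainder of Y, of order 2 (k + 1), then have order 2k + 2, one above the displacement.
  With \<delta> = \<epsilon>^k the remainder of Y would only have the order of the displacement
  itself. The second field must be a generator: its polygon costs energy and no modulus term,
  whereas a modulus at scale \<epsilon>^2 would be too large.\<close>

lemma controlled_bracket:
  assumes "controlled Y"
  shows "controlled (lie_bracket Y (X i))"
proof -
  let ?V = "X i"
  have Y: "smooth_vector_field U Y" using assms by (simp add: controlled_def)
  obtain k where k: "k > 0" "shift_bound k Y" using assms by (auto simp: controlled_def)
  let ?Zf = "lie_bracket Y ?V"
  have Zs: "smooth_vector_field U ?Zf" by (rule smooth_vector_field_lie_bracket[OF open_U Y smooth_X])
  obtain B1 where W1: "vf_bound Y B1" using vf_bound_exists[OF Y] by blast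
  obtain B2 where W2: "vf_bound ?V B2" using vf_bound_exists[OF smooth_X] by blast
  obtain B3 where W3: "vf_bound ?Zf B3" using vf_bound_exists[OF Zs] by blast
  define B where "B = max B1 (max B2 B3)"
  have W: "vf_bound Y B" "vf_bound ?V B" "vf_bound ?Zf B"
    using vf_bound_mono[OF W1, of B] vf_bound_mono[OF W2, of B] vf_bound_mono[OF W3, of B] by (auto simp: B_def)
  have B1: "B \<ge> 1" using W(1) by (simp add: vf_bound_def)
  have b: "0 \<le> B" "\<And>x. norm (cut V x) \<le> B" "\<And>x y. norm (cut V x - cut V y) \<le> B * norm (x - y)" if "vf_bound V B" for V
    using that by (auto simp: vf_bound_def)
  obtain CY eY where CY: "CY > 0" "eY > 0" "eY \<le> 1" "\<And>u \<epsilon>. adm u \<Longrightarrow> 0 < \<epsilon> \<Longrightarrow> \<epsilon> \<le> eY \<Longrightarrow>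
     L1dist (\<lambda>x. u (x + \<epsilon> ^ (k * 2) *\<^sub>R cut Y x)) u \<le> ennreal CY * (ennreal \<epsilon> * total_energy u + modulus u (CY * \<epsilon> ^ ((k + 1) * 2)))"
    using shift_boundD_scaled[OF k(2), of 2] by auto
  define A :: real where "A = 4 ^ CARD('a)"
  define s :: real where "s = 2 * 8 ^ CARD('a)"
  have As: "A \<ge> 1" "A \<ge> 0" "s \<ge> 0" by (auto simp: A_def s_def)
  define c where "c = A * (s + ((A + 1) * A + (A + 1) * CY))"
  have CY0: "CY \<ge> 0" using CY by simp
  have c0: "c \<ge> 0" using As CY0 by (simp add: c_def)
  \<comment> \<open>32 is twice the constant 16 of \<open>bracket_expansion\<close>, since
    \<open>L1dist_shift\<close> doubles the radius; c is the prefactor produced by the final chain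
    of triangle inequalities.\<close>
  define C where "C = 32 * B^4 + c + CY"
  have C: "C > 0" "32 * B^4 \<le> C" "CY \<le> C" "c \<le> C" using B1 c0 CY(1) by (auto simp: C_def add_nonneg_pos)
  \<comment> \<open>1/(20 B) makes each of the three displacement constants at most 1/10, so their
    composite stays below 1/2; r/(8 B) limits the total displacement of three moves to 3r/8 <
    r/2.\<close>
  define e0 where "e0 = min (min (1 / (20 * B)) (r / (8 * B))) eY"
  have e0: "e0 > 0" "e0 \<le> 1" using B1 CY r_pos by (auto simp: e0_def)
  have "shift_bound (k * 2 + 1) ?Zf" unfolding shift_bound_def
  proof (rule exI[of _ C], intro exI[of _ e0] conjI allI impI C(1) e0)
    fix u \<epsilon> assume u: "adm u" and e: "0 < \<epsilon>" "\<epsilon> \<le> e0"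
    have e1: "\<epsilon> \<le> 1" using e e0 by linarith
    have "\<epsilon> \<le> 1 / (20 * B)" "\<epsilon> \<le> r / (8 * B)" using e(2) by (auto simp: e0_def)
    then have eB: "\<epsilon> * B \<le> 1/20" "\<epsilon> * B \<le> r/8" using B1 by (simp_all add: field_simps)
    have eBp: "0 \<le> \<epsilon> * B" using e B1 by auto
    define \<delta> where "\<delta> = \<epsilon> ^ (k * 2)"
    have d: "0 < \<delta>" "\<delta> \<le> \<epsilon>" using e e1 k power_decreasing[of 1 "k * 2" \<epsilon>] by (auto simp: \<delta>_def)
    define t where "t = \<delta> * \<epsilon>"
    have t: "0 < t" "t \<le> \<epsilon>" "t = \<epsilon> ^ (k * 2 + 1)" 
      using d e e1 mult_mono[of \<delta> \<epsilon> \<epsilon> 1] by (auto simp: t_def \<delta>_def)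
    have dB: "\<delta> * B \<le> \<epsilon> * B" "t * B \<le> \<epsilon> * B" using d t B1 by (auto intro!: mult_right_mono)
    have dBp: "0 \<le> \<delta> * B" "0 \<le> t * B" using d t B1 by auto
    let ?R = "ennreal \<epsilon> * total_energy u + modulus u (C * \<epsilon> ^ Suc (k * 2 + 1))"
    have m: "modulus u (D * \<epsilon> ^ Suc (k * 2 + 1)) \<le> ?R" if "D \<le> C" for D
      using that e by (intro add_increasing modulus_mono mult_right_mono) auto
    show "L1dist (\<lambda>x. u (x + \<epsilon> ^ (k * 2 + 1) *\<^sub>R cut ?Zf x)) u \<le> ennreal C * ?R"
    proof (rule ennreal_le_epsilon)
      fix \<eta>' :: real assume \<eta>': "\<eta>' > 0"
      \<comment> \<open>The polygon error enters A + 1 times and is then multiplied by A.\<close>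
      define \<eta> where "\<eta> = \<eta>' / (A * (A + 1))"
      have \<eta>: "\<eta> > 0" "A * ((A + 1) * \<eta>) = \<eta>'" using \<eta>' As(1) by (auto simp: \<eta>_def)
      obtain N where N: "N > 0" "L1dist (\<lambda>x. u (euler (cut ?V) (\<epsilon> / real N) N x)) u \<le> ennreal (4 ^ CARD('a)) * (ennreal \<epsilon> * energy ?V u) + ennreal \<eta>"
        using euler_energy[OF u W(2) e(1) _ \<eta>(1)] eB by auto
      define h where "h = \<epsilon> / real N"
      have h: "0 \<le> h" "real N * h = \<epsilon>" using N e by (auto simp: h_def)
      define T where "T = euler (cut ?V) h N"
      define D where "D = (\<lambda>x. x + \<delta> *\<^sub>R cut Y x)"
      define Z where "Z = (\<lambda>x. x + t *\<^sub>R cut ?Zf x)"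
      have dB10: "\<delta> * B \<le> 1/10" "t * B \<le> 1/10" "2 * \<epsilon> * B \<le> 1/10" "\<epsilon> * B \<le> 1"
        using dB eB by linarith+
      have l: "lip_id (1/10) T" "lip_id (1/10) D" "lip_id (1/10) Z"
        using lip_id_mono[OF euler_lip_id[OF b[OF W(2)] h(1), of N \<epsilon>], of "1/10"]
          lip_id_mono[OF step_lip_id[OF b[OF W(1)], of \<delta>], of "1/10"]
          lip_id_mono[OF step_lip_id[OF b[OF W(3)], of t], of "1/10"] h dB10 d(1) t(1)
        by (auto simp: T_def D_def Z_def)
      have l2: "lip_id (1/5 + 1/100) (\<lambda>x. T (D x))" "lip_id (1/5 + 1/100) (\<lambda>x. D (T x))"
        using lip_id_compose[OF l(1,2)] lip_id_compose[OF l(2,1)] by auto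
      have l3: "lip_id (1/2) (\<lambda>x. Z (D (T x)))"
        using lip_id_mono[OF lip_id_compose[OF l(3) l2(2)]] by auto
      have n: "near_id T" "near_id D" "near_id Z" "near_id (\<lambda>x. T (D x))" "near_id (\<lambda>x. D (T x))" "near_id (\<lambda>x. Z (D (T x)))"
        by (rule lip_id_near_id[OF l(1)] lip_id_near_id[OF l(2)] lip_id_near_id[OF l(3)] lip_id_near_id[OF l2(1)] lip_id_near_id[OF l2(2)] lip_id_near_id[OF l3]; simp)+
      have disp: "norm (T x - x) \<le> \<epsilon> * B" "norm (D x - x) \<le> \<epsilon> * B" "norm (Z x - x) \<le> \<epsilon> * B" for x
      proof -
        show "norm (T x - x) \<le> \<epsilon> * B" using euler_disp[OF b[OF W(2)] h(1), of N x] h(2) by (simp add: T_def)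
        have "\<delta> * norm (cut Y x) \<le> \<delta> * B" using b(2)[OF W(1)] d by (intro mult_left_mono) auto
        moreover have "norm (D x - x) = \<delta> * norm (cut Y x)" using d by (simp add: D_def)
        ultimately show "norm (D x - x) \<le> \<epsilon> * B" using dB by linarith
        have "t * norm (cut ?Zf x) \<le> t * B" using b(2)[OF W(3)] t by (intro mult_left_mono) auto
        moreover have "norm (Z x - x) = t * norm (cut ?Zf x)" using t(1) by (simp add: Z_def)
        ultimately show "norm (Z x - x) \<le> \<epsilon> * B" using dB by linarith
      qed
      have close: "u (T (D x)) = u (Z (D (T x))) \<or> norm (T (D x) - Z (D (T x))) \<le> 16 * B^4 * (\<delta> * \<epsilon>^2)" for x
      proof (cases "x \<in> nb (r/2)")
        case True
        have "norm (T (D x) - Z (D (T x))) \<le> 16 * B^4 * (\<delta> * \<epsilon>^2)"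
          unfolding T_def D_def Z_def t_def
          by (rule bracket_expansion[OF W(2,1,3) h]) (use d e1 eB True r_pos in auto)
        then show ?thesis ..
      next
        case False
        have "norm (T (D x) - x) \<le> r/2" 
          using norm_triangle_ineq[of "T (D x) - D x" "D x - x"] disp(1)[of "D x"] disp(2)[of x] eB r_pos by simp
        moreover have "norm (Z (D (T x)) - x) \<le> r/2"
          using norm_triangle_ineq[of "Z (D (T x)) - D (T x)" "D (T x) - x"] norm_triangle_ineq[of "D (T x) - T x" "T x - x"] 
            disp(3)[of "D (T x)"] disp(2)[of "T x"] disp(1)[of x] eB r_pos by simp
        ultimately show ?thesis using notin_nb[OF False] u by (auto simp: adm_def)
      qed
      have de: "\<delta> * \<epsilon>^2 = \<epsilon> ^ Suc (k * 2 + 1)" by (simp add: \<delta>_def power2_eq_square)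
      have shift: "L1dist (\<lambda>x. u (T (D x))) (\<lambda>x. u (Z (D (T x)))) \<le> ennreal s * ?R"
      proof -
        have "L1dist (\<lambda>x. u (T (D x))) (\<lambda>x. u (Z (D (T x)))) \<le> ennreal s * modulus u (2 * (16 * B^4 * (\<delta> * \<epsilon>^2)))"
          unfolding s_def shift_const_eq[symmetric]
          by (rule L1dist_shift[OF n(4,6) adm_C0[OF u] bounded_K _ close]) (use B1 e d in auto)
        also have "2 * (16 * B^4 * (\<delta> * \<epsilon>^2)) = (32 * B^4) * \<epsilon> ^ Suc (k * 2 + 1)" by (simp add: de)
        also have "ennreal s * modulus u ((32 * B^4) * \<epsilon> ^ Suc (k * 2 + 1)) \<le> ennreal s * ?R"
          by (intro mult_left_mono m C) auto
        finally show ?thesis .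
      qed
      have dT: "L1dist (\<lambda>x. u (T x)) u \<le> ennreal A * ?R + ennreal \<eta>"
      proof -
        have "ennreal \<epsilon> * energy ?V u \<le> ?R" by (intro add_increasing2 mult_left_mono energy_le_nrg) auto
        then have "ennreal A * (ennreal \<epsilon> * energy ?V u) + ennreal \<eta> \<le> ennreal A * ?R + ennreal \<eta>"
          by (intro add_right_mono mult_left_mono) auto
        moreover have "L1dist (\<lambda>x. u (T x)) u \<le> ennreal A * (ennreal \<epsilon> * energy ?V u) + ennreal \<eta>"
          using N(2) by (simp only: T_def h_def A_def)
        ultimately show ?thesis by (rule order_trans[rotated])
      qed
      have dD: "L1dist (\<lambda>x. u (D x)) u \<le> ennreal CY * ?R"
      proof -
        have "L1dist (\<lambda>x. u (D x)) u \<le> ennreal CY * (ennreal \<epsilon> * total_energy u + modulus u (CY * \<epsilon> ^ ((k + 1) * 2)))"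
          unfolding D_def \<delta>_def using e by (intro CY(4) u) (auto simp: e0_def)
        also have "modulus u (CY * \<epsilon> ^ ((k + 1) * 2)) \<le> modulus u (C * \<epsilon> ^ Suc (k * 2 + 1))"
          using e C(3) by (intro modulus_mono mult_mono) (auto simp: less_imp_le[OF C(1)])
        finally show ?thesis by (simp add: mult_left_mono)
      qed
      let ?a = "L1dist (\<lambda>x. u (T x)) u" and ?b = "L1dist (\<lambda>x. u (D x)) u"
      have F1: "L1dist (\<lambda>x. u (T (D x))) u \<le> ennreal A * ?a + ?b"
        using order_trans[OF L1dist_near_id_triangle_id[OF u n(4,2)] add_right_mono[OF L1dist_compose_near_id(1)[OF u n(1,2)]]] by (simp add: A_def)
      have F2: "L1dist (\<lambda>x. u (D (T x))) u \<le> ennreal A * ?b + ?a"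
        using order_trans[OF L1dist_near_id_triangle_id[OF u n(5,1)] add_right_mono[OF L1dist_compose_near_id(1)[OF u n(2,1)]]] by (simp add: A_def)
      \<comment> \<open>Z is compared with the identity after inserting the inner map D T; then Z D
        T is exchanged for T D, and what is left are separate costs of T and D.\<close>
      have "L1dist (\<lambda>x. u (Z x)) u \<le> ennreal A * L1dist (\<lambda>x. u (Z (D (T x)))) (\<lambda>x. u (D (T x)))"
        unfolding A_def by (rule L1dist_compose_near_id(2)[OF u n(3,5)])
      also have "L1dist (\<lambda>x. u (Z (D (T x)))) (\<lambda>x. u (D (T x))) \<le> L1dist (\<lambda>x. u (Z (D (T x)))) (\<lambda>x. u (T (D x))) + (L1dist (\<lambda>x. u (T (D x))) u + L1dist u (\<lambda>x. u (D (T x))))"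
        by (intro order_trans[OF L1dist_near_id_triangle[OF u n(6,4,5)]] add_left_mono L1dist_near_id_triangle[OF u n(4) near_id_id n(5), simplified])
      also have "\<dots> \<le> ennreal s * ?R + ((ennreal A * ?a + ?b) + (ennreal A * ?b + ?a))"
        using shift F1 F2 by (intro add_mono) (simp_all add: L1dist_commute)
      also have "\<dots> \<le> ennreal s * ?R + ((ennreal A * (ennreal A * ?R + ennreal \<eta>) + ennreal CY * ?R) + (ennreal A * (ennreal CY * ?R) + (ennreal A * ?R + ennreal \<eta>)))"
        by (intro add_mono mult_left_mono order_refl dT dD) auto
      finally have "L1dist (\<lambda>x. u (Z x)) u \<le> ennreal A * (ennreal s * ?R + ((ennreal A * (ennreal A * ?R + ennreal \<eta>) + ennreal CY * ?R) + (ennreal A * (ennreal CY * ?R) + (ennreal A * ?R + ennreal \<eta>))))"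
        by (simp add: mult_left_mono)
      also have "\<dots> = ennreal c * ?R + ennreal (A * ((A + 1) * \<eta>))"
      proof -
        have n1: "0 \<le> (A + 1) * A" "0 \<le> (A + 1) * CY" "0 \<le> (A + 1) * \<eta>" "0 \<le> s + ((A + 1) * A + (A + 1) * CY)" "0 \<le> A + 1" "0 \<le> (A + 1) * A + (A + 1) * CY" "0 \<le> \<eta>"
          using As CY0 \<eta> by auto
        show ?thesis unfolding c_def using As CY0 n1
          by (simp add: ennreal_mult algebra_simps)
      qed
      also have "\<dots> \<le> ennreal C * ?R + ennreal \<eta>'"
        unfolding \<eta>(2) by (intro add_right_mono mult_right_mono ennreal_leI C) auto
      finally show "L1dist (\<lambda>x. u (x + \<epsilon> ^ (k * 2 + 1) *\<^sub>R cut ?Zf x)) u \<le> ennreal C * ?R + ennreal \<eta>'"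
        by (simp only: Z_def t(3))
    qed
  qed
  then show ?thesis using Zs by (auto simp: controlled_def)
qed


lemma controlled_scale_X: "smooth_on U f \<Longrightarrow> controlled (\<lambda>x. f x *\<^sub>R X i x)"
  unfolding controlled_def using shift_bound_scale_X[of f i] smooth_vector_field_scale[OF open_U _ smooth_X, of f i] zero_less_one by blast

lemma vf_cong_cut:
  assumes "\<And>x. x \<in> U \<Longrightarrow> Y x = Z x"
  shows "cut Y = cut Z"
proof
  fix x
  show "cut Y x = cut Z x"
  proof (cases "x \<in> nb (2*r)")
    case True
    then have "x \<in> U" using nb_sub_U[of "2*r"] r_pos by auto
    then show ?thesis using assms by (simp add: cut_def)
  next
    case False then show ?thesis by (simp add: cut_def chi_0)
  qed
qed

lemma controlled_cong:
  assumes "controlled Y" "\<And>x. x \<in> U \<Longrightarrow> Z x = Y x"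
  shows "controlled Z"
proof -
  have "cut Z = cut Y" by (rule vf_cong_cut) (use assms in auto)
  moreover have "smooth_on U (\<lambda>x. Z x $ k) \<longleftrightarrow> smooth_on U (\<lambda>x. Y x $ k)" for k
    by (rule smooth_on_cong[OF open_U]) (simp add: assms(2))
  ultimately show ?thesis using assms(1) by (simp add: controlled_def shift_bound_def smooth_vector_field_def)
qed

lemma controlled_sum:
  assumes "\<And>i. i \<in> I \<Longrightarrow> controlled (Y i)" "finite I"
  shows "controlled (\<lambda>x. \<Sum>i\<in>I. Y i x)"
  using assms(2,1)
proof (induction I rule: finite_induct)
  case empty
  \<comment> \<open>The zero field is viewed as 0 times a generator; \<open>undefined\<close> stands
    for an arbitrary index.\<close>
  have "controlled (\<lambda>x. (\<lambda>x. 0) x *\<^sub>R X undefined x)" by (rule controlled_scale_X[OF smooth_on_const])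
  then show ?case by simp
next
  case (insert i I)
  then show ?case using controlled_add[of "Y i" "\<lambda>x. \<Sum>i\<in>I. Y i x"] by simp
qed

lemma jac_scale:
  assumes f: "f differentiable (at x)" and Y: "\<And>k. (\<lambda>y. Y y $ k) differentiable (at x)"
  shows "jac (\<lambda>y. f y *\<^sub>R Y y) x v = f x *\<^sub>R jac Y x v + (grad f x \<bullet> v) *\<^sub>R Y x"
proof -
  have "grad (\<lambda>y. f y * Y y $ k) x \<bullet> v = f x * (grad (\<lambda>y. Y y $ k) x \<bullet> v) + (grad f x \<bullet> v) * Y x $ k" for k
    using grad_eq[OF has_derivative_mult[OF has_derivative_grad[OF f] has_derivative_grad[OF Y]]] by simp
  then show ?thesis by (simp add: jac_def vec_eq_iff)
qed

text \<open>The coefficient is moved inside the bracket: f [X_i, Y] = [-f Y, X_i] - (X_i f) Y. The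
  right-hand side involves only the shorter commutator Y with new smooth coefficients, so the
  induction must let f vary.\<close>

lemma controlled_scale_commutator:
  assumes "J \<noteq> []" "smooth_on U f"
  shows "controlled (\<lambda>x. f x *\<^sub>R commutator X J x)"
  using assms
proof (induction J arbitrary: f rule: induct_list012)
  case (2 j)
  then show ?case using controlled_scale_X by simp
next
  case (3 i j J)
  let ?Y = "commutator X (j # J)"
  have Ys: "smooth_vector_field U ?Y" by (rule smooth_vector_field_commutator[OF open_U smooth_X])
  have f: "smooth_on U f" by fact
  have mf: "smooth_on U (\<lambda>x. - f x)" by (rule smooth_on_minus[OF open_U f])
  define g where "g x = - (\<Sum>k\<in>UNIV. X i x $ k * partial k f x)" for x
  have g: "smooth_on U g" unfolding g_def
    using smooth_X[of i] by (intro smooth_on_minus smooth_on_sum smooth_on_mult open_U smooth_on_partial f) (auto simp: smooth_vector_field_def)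
  have "controlled (\<lambda>x. lie_bracket (\<lambda>x. - f x *\<^sub>R ?Y x) (X i) x + g x *\<^sub>R ?Y x)"
    by (intro controlled_add controlled_bracket 3 mf g) auto
  then show ?case
  proof (rule controlled_cong)
    fix x assume x: "x \<in> U"
    have df: "f differentiable (at x)" "(\<lambda>x. - f x) differentiable (at x)" using smooth_on_differentiable[OF _ open_U x] f mf by auto
    have dY: "(\<lambda>y. ?Y y $ k) differentiable (at x)" for k
      using Ys smooth_on_differentiable[OF _ open_U x] by (auto simp: smooth_vector_field_def)
    have gf: "grad (\<lambda>x. - f x) x \<bullet> v = - (grad f x \<bullet> v)" for v
      using grad_eq[OF has_derivative_minus[OF has_derivative_grad[OF df(1)]]] by simp
    have gx: "g x = - (grad f x \<bullet> X i x)" by (simp add: g_def inner_vec_def grad_def mult.commute)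
    have js: "jac (X i) x (- f x *\<^sub>R ?Y x) = - f x *\<^sub>R jac (X i) x (?Y x)" by (rule linear_scale[OF linear_jac])
    show "f x *\<^sub>R commutator X (i # j # J) x = lie_bracket (\<lambda>x. - f x *\<^sub>R ?Y x) (X i) x + g x *\<^sub>R ?Y x"
      unfolding commutator.simps lie_bracket_eq_jac jac_scale[OF df(2) dY] js gf gx by (simp add: algebra_simps)
  qed
qed auto

end

section \<open>From commutators to all directions\<close>

lemma smooth_on_det:
  fixes M :: "real^'n \<Rightarrow> real^'k^'k"
  assumes "open U" "\<And>i j. smooth_on U (\<lambda>x. M x $ i $ j)"
  shows "smooth_on U (\<lambda>x. det (M x))"
  unfolding det_def by (intro smooth_on_sum smooth_on_mult smooth_on_prod smooth_on_const assms)

text \<open>If \<open>Z\<^sub>i(x)\<close> span at every point, then \<open>G = \<Sum>\<^sub>i Z\<^sub>i Z\<^sub>i\<^sup>T\<close> is invertible and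
  \<open>c = \<Sum>\<^sub>i (Z\<^sub>i \<bullet> G\<^sup>-\<^sup>1 c) Z\<^sub>i\<close>, where Cramer's rule shows that the coefficients are smooth.\<close>

lemma smooth_coefficients:
  fixes Z :: "'i \<Rightarrow> real^'n \<Rightarrow> real^'n" and c :: "real^'n"
  assumes U: "open U" and I: "finite I" and Z: "\<And>i. i \<in> I \<Longrightarrow> smooth_vector_field U (Z i)"
    and span: "\<And>x. x \<in> U \<Longrightarrow> span ((\<lambda>i. Z i x) ` I) = UNIV"
  shows "\<exists>f. (\<forall>i\<in>I. smooth_on U (f i)) \<and> (\<forall>x\<in>U. c = (\<Sum>i\<in>I. f i x *\<^sub>R Z i x))"
proof -
  define G :: "real^'n \<Rightarrow> real^'n^'n" where "G x = (\<chi> k l. \<Sum>i\<in>I. Z i x $ k * Z i x $ l)" for x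
  have Gv: "G x *v w = (\<Sum>i\<in>I. (Z i x \<bullet> w) *\<^sub>R Z i x)" for x w
  proof -
    have "(G x *v w) $ k = (\<Sum>i\<in>I. (Z i x \<bullet> w) *\<^sub>R Z i x) $ k" for k
    proof -
      have "(G x *v w) $ k = (\<Sum>l\<in>UNIV. \<Sum>i\<in>I. Z i x $ k * Z i x $ l * w $ l)"
        by (simp add: G_def matrix_vector_mult_def sum_distrib_right)
      also have "\<dots> = (\<Sum>i\<in>I. \<Sum>l\<in>UNIV. Z i x $ k * Z i x $ l * w $ l)" by (rule sum.swap)
      also have "\<dots> = (\<Sum>i\<in>I. (Z i x \<bullet> w) *\<^sub>R Z i x) $ k"
        by (simp add: inner_vec_def sum_distrib_left sum_distrib_right mult_ac)
      finally show ?thesis .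
    qed
    then show ?thesis by (simp add: vec_eq_iff)
  qed
  have det: "det (G x) \<noteq> 0" if x: "x \<in> U" for x
  proof -
    have "w = 0" if w: "G x *v w = 0" for w
    proof -
      have "(\<Sum>i\<in>I. (Z i x \<bullet> w)^2) = (G x *v w) \<bullet> w"
        by (simp add: Gv inner_sum_left power2_eq_square)
      then have "(\<Sum>i\<in>I. (Z i x \<bullet> w)^2) = 0" using w by simp
      then have "\<forall>i\<in>I. Z i x \<bullet> w = 0" using I by (simp add: sum_nonneg_eq_0_iff)
      then have "\<And>v. v \<in> (\<lambda>i. Z i x) ` I \<Longrightarrow> orthogonal w v" by (auto simp: orthogonal_def inner_commute)
      then have "orthogonal w w" using orthogonal_to_span[of w "(\<lambda>i. Z i x) ` I" w] span[OF x] by auto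
      then show ?thesis by (simp add: orthogonal_def)
    qed
    then have "invertible (G x)" by (metis invertible_left_inverse matrix_left_invertible_ker)
    then show ?thesis by (simp add: invertible_det_nz)
  qed
  define w :: "real^'n \<Rightarrow> real^'n" where "w x = (\<chi> k. det (\<chi> i j. if j = k then c $ i else G x $ i $ j) / det (G x))" for x
  have Gs: "smooth_on U (\<lambda>x. G x $ k $ l)" for k l
    using Z by (auto simp: G_def smooth_vector_field_def intro!: smooth_on_sum smooth_on_mult U)
  have ws: "smooth_on U (\<lambda>x. w x $ k)" for k
  proof -
    have "smooth_on U (\<lambda>x. det (\<chi> i j. if j = k then c $ i else G x $ i $ j) * inverse (det (G x)))"
    proof (intro smooth_on_mult smooth_on_inverse smooth_on_det U Gs det)
      fix i j
      show "smooth_on U (\<lambda>x. (\<chi> i j. if j = k then c $ i else G x $ i $ j) $ i $ j)"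
        by (cases "j = k") (simp_all add: Gs smooth_on_const)
    qed
    then show ?thesis by (simp add: w_def divide_inverse)
  qed
  have "G x *v w x = c" if "x \<in> U" for x
    using cramer[OF det[OF that]] by (simp add: w_def)
  then have "\<forall>x\<in>U. c = (\<Sum>i\<in>I. (Z i x \<bullet> w x) *\<^sub>R Z i x)" by (simp add: Gv)
  moreover have "\<forall>i\<in>I. smooth_on U (\<lambda>x. Z i x \<bullet> w x)"
    unfolding inner_vec_def using Z ws by (auto simp: smooth_vector_field_def intro!: smooth_on_sum smooth_on_mult U)
  ultimately show ?thesis by (intro exI[of _ "\<lambda>i x. Z i x \<bullet> w x"]) auto
qed

context tube_fields
begin

lemma controlled_const:
  assumes "commutators_span U X s"
  shows "controlled (\<lambda>x. c)"
proof -
  define I where "I = {J :: 'm list. J \<noteq> [] \<and> length J \<le> s}"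
  have fin: "finite I" 
    by (rule finite_subset[OF _ finite_lists_length_le[of "UNIV :: 'm set" s]]) (auto simp: I_def)
  have span: "span ((\<lambda>J. commutator X J x) ` I) = UNIV" if "x \<in> U" for x
  proof -
    have "(\<lambda>J. commutator X J x) ` I = {commutator X J x | J. J \<noteq> [] \<and> length J \<le> s}" by (auto simp: I_def)
    then show ?thesis using assms that by (simp add: commutators_span_def)
  qed
  obtain f where f: "\<And>J. J \<in> I \<Longrightarrow> smooth_on U (f J)" "\<And>x. x \<in> U \<Longrightarrow> c = (\<Sum>J\<in>I. f J x *\<^sub>R commutator X J x)"
    using smooth_coefficients[where c=c and I=I and Z="commutator X", OF open_U fin smooth_vector_field_commutator[OF open_U smooth_X] span] by blast
  have "controlled (\<lambda>x. \<Sum>J\<in>I. f J x *\<^sub>R commutator X J x)"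
    by (intro controlled_sum fin controlled_scale_commutator f) (auto simp: I_def)
  then show ?thesis by (rule controlled_cong) (rule f(2))
qed

text \<open>Both orientations are listed because \<open>shift_bound\<close> speaks of positive times
  only. The product of all exponents is a common multiple of them.\<close>

lemma shift_bound_const_axes:
  assumes "commutators_span U X s"
  shows "\<exists>k>0. \<forall>i. \<forall>\<sigma>\<in>{1,-1}. shift_bound k (\<lambda>x. axis i \<sigma>)"
proof -
  have "\<forall>i. \<exists>k>0. shift_bound k (\<lambda>x. axis i 1)" "\<forall>i. \<exists>k>0. shift_bound k (\<lambda>x. axis i (-1))"
    using controlled_const[OF assms] by (auto simp: controlled_def)
  then obtain k l where k: "\<And>i. k i > 0" "\<And>i. shift_bound (k i) (\<lambda>x. axis i 1)" and l: "\<And>i. l i > 0" "\<And>i. shift_bound (l i) (\<lambda>x. axis i (-1))"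
    by metis
  define m where "m = (\<Prod>i\<in>UNIV. k i * l i)"
  have m: "m > 0" using k l by (auto simp: m_def intro!: prod_pos)
  have dv: "k i dvd m" "l i dvd m" for i
    unfolding m_def using dvd_prodI[of UNIV i "\<lambda>i. k i * l i"] by (auto intro: dvd_mult_left dvd_mult_right)
  have "shift_bound m (\<lambda>x. axis i 1)" for i
  proof -
    obtain q where q: "m = k i * q" using dv by blast
    then have "q > 0" using m by (cases q) auto
    from shift_bound_mult[OF k(2) this] show ?thesis using q by simp
  qed
  moreover have "shift_bound m (\<lambda>x. axis i (-1))" for i
  proof -
    obtain q where q: "m = l i * q" using dv by blast
    then have "q > 0" using m by (cases q) auto
    from shift_bound_mult[OF l(2) this] show ?thesis using q by simp
  qed
  ultimately show ?thesis using m by auto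
qed

end

section \<open>Absorbing the remainder into the isotropic modulus\<close>

lemma norm_axis_real: "norm (axis i a :: real^'n) = \<bar>a\<bar>"
proof -
  have "(axis i a :: real^'n) = a *\<^sub>R axis i 1" by (simp add: vec_eq_iff axis_def)
  then show ?thesis by simp
qed

lemma L1dist_translate:
  fixes u v :: "'a::euclidean_space \<Rightarrow> real"
  assumes [measurable]: "u \<in> borel_measurable borel" "v \<in> borel_measurable borel"
  shows "L1dist (\<lambda>x. u (x + h)) (\<lambda>x. v (x + h)) = L1dist u v"
  unfolding L1dist_def
  using nn_integral_lborel_translate[of "\<lambda>x. ennreal \<bar>u x - v x\<bar>" h] by (simp add: add.commute)

lemma L1dist_translate_sum:
  fixes u :: "'a::euclidean_space \<Rightarrow> real"
  assumes [measurable]: "u \<in> borel_measurable borel" and "finite S"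
    and M: "\<And>i. i \<in> S \<Longrightarrow> L1dist (\<lambda>x. u (x + h i)) u \<le> M"
  shows "L1dist (\<lambda>x. u (x + (\<Sum>i\<in>S. h i))) u \<le> of_nat (card S) * M"
  using assms(2) M
proof (induction S rule: finite_induct)
  case empty
  then show ?case by (simp add: L1dist_def)
next
  case (insert j S)
  let ?s = "\<Sum>i\<in>S. h i"
  have "L1dist (\<lambda>x. u (x + (\<Sum>i\<in>insert j S. h i))) u \<le> L1dist (\<lambda>x. u (x + (h j + ?s))) (\<lambda>x. u (x + ?s)) + L1dist (\<lambda>x. u (x + ?s)) u"
  proof -
    have "sum h (insert j S) = h j + ?s" using insert by simp
    then show ?thesis by (simp only:) (intro L1dist_triangle; measurable)
  qed
  also have "L1dist (\<lambda>x. u (x + (h j + ?s))) (\<lambda>x. u (x + ?s)) = L1dist (\<lambda>x. u (x + h j)) u"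
    using L1dist_translate[of "\<lambda>x. u (x + h j)" u ?s] by (simp add: add_ac)
  also have "\<dots> \<le> M" using insert by simp
  also have "L1dist (\<lambda>x. u (x + ?s)) u \<le> of_nat (card S) * M" using insert by simp
  finally show ?case using insert by (simp add: distrib_right add_mono)
qed

context tube_fields
begin

text \<open>A qualitative bound whose constant depends on u. It only provides the starting point of
  an iteration in which it is multiplied by arbitrarily small factors.\<close>

lemma modulus_linear:
  assumes u: "adm u"
  shows "\<exists>L\<ge>0. \<forall>\<rho>. 0 \<le> \<rho> \<and> \<rho> \<le> 1 \<longrightarrow> modulus u \<rho> \<le> ennreal (L * \<rho>)"
proof -
  have gc: "continuous_on UNIV (grad u)" using u by (auto simp: adm_def)
  have "compact (grad u ` K)" by (intro compact_continuous_image compact_K continuous_on_subset[OF gc]) auto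
  then obtain b where "\<forall>y\<in>grad u ` K. norm y \<le> b" by (metis bounded_iff compact_imp_bounded)
  then have b: "\<And>x. x \<in> K \<Longrightarrow> norm (grad u x) \<le> b" by blast
  define B where "B = max 0 b"
  have B: "B \<ge> 0" "norm (grad u x) \<le> B" for x
    using b[of x] adm_grad_0[OF u, of x] by (cases "x \<in> K"; force simp: B_def)+
  have lip: "\<bar>u y - u x\<bar> \<le> B * norm (y - x)" for x y
  proof -
    have "norm (u y - u x) \<le> B * norm (y - x)"
    proof (rule differentiable_bound[of UNIV])
      fix z
      show "(u has_derivative (\<lambda>v. grad u z \<bullet> v)) (at z within UNIV)"
        using has_derivative_grad[of u z] u by (auto simp: adm_def)
      show "onorm (\<lambda>v. grad u z \<bullet> v) \<le> B" using order_trans[OF onorm_inner_le B(2)] .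
    qed auto
    then show ?thesis by simp
  qed
  let ?M = "measure lborel (nb 1)"
  have fin: "emeasure lborel (nb 1) < \<infinity>" using compact_nb emeasure_compact_finite by blast
  have M: "emeasure lborel (nb 1) = ennreal ?M" using fin by (intro emeasure_eq_ennreal_measure) auto
  have cl: "closed (nb 1)" using compact_nb compact_imp_closed by blast
  show ?thesis
  proof (intro exI[of _ "B * ?M"] conjI allI impI mult_nonneg_nonneg B(1) measure_nonneg)
    fix \<rho> :: real assume \<rho>: "0 \<le> \<rho> \<and> \<rho> \<le> 1"
    show "modulus u \<rho> \<le> ennreal (B * ?M * \<rho>)"
      unfolding modulus_def
    proof (intro SUP_least)
      fix h :: "real^'a" assume "h \<in> cball 0 \<rho>"
      then have h: "norm h \<le> \<rho>" by simp
      have "L1dist (\<lambda>x. u (x + h)) u \<le> (\<integral>\<^sup>+x. ennreal (B * \<rho>) * indicator (nb 1) x \<partial>lborel)"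
        unfolding L1dist_def
      proof (intro nn_integral_mono)
        fix x
        show "ennreal \<bar>u (x + h) - u x\<bar> \<le> ennreal (B * \<rho>) * indicator (nb 1) x"
        proof (cases "x \<in> nb 1")
          case True
          have "\<bar>u (x + h) - u x\<bar> \<le> B * norm h" using lip[of "x + h" x] by simp
          also have "\<dots> \<le> B * \<rho>" using h B by (intro mult_left_mono)
          finally show ?thesis using True by (simp add: ennreal_leI)
        next
          case False
          then show ?thesis using notin_nb[OF False, of x] notin_nb[OF False, of "x + h"] h \<rho> u by (auto simp: adm_def)
        qed
      qed
      also have "\<dots> = ennreal (B * \<rho>) * ennreal ?M" using cl by (simp add: nn_integral_cmult_indicator M)
      also have "\<dots> = ennreal (B * ?M * \<rho>)" using B \<rho> by (subst ennreal_mult[symmetric]) (simp_all only: mult_nonneg_nonneg measure_nonneg mult_ac)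
      finally show "L1dist (\<lambda>x. u (x + h)) u \<le> ennreal (B * ?M * \<rho>)" .
    qed
  qed
qed

text \<open>An arbitrary translation is a sum of translations along the axes, each of them a step
  along a constant field. The scale on the right has order k + 1, hence is much smaller than the
  scale on the left, which makes the inequality iterable.\<close>

lemma modulus_recursion:
  assumes "commutators_span U X s"
  shows "\<exists>k>0. \<exists>C\<ge>1. \<exists>e0>0. e0 \<le> 1 \<and> (\<forall>u \<epsilon>. adm u \<longrightarrow> 0 < \<epsilon> \<longrightarrow> \<epsilon> \<le> e0 \<longrightarrow>
     modulus u (\<epsilon> ^ k) \<le> ennreal C * (ennreal \<epsilon> * total_energy u + modulus u (C * \<epsilon> ^ Suc k)))"
proof -
  obtain k where k: "k > 0" "\<And>i \<sigma>. \<sigma> \<in> {1,-1} \<Longrightarrow> shift_bound k (\<lambda>x. axis i \<sigma>)" using shift_bound_const_axes[OF assms] by blast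
  have "\<forall>p\<in>UNIV \<times> {1,-1::real}. \<exists>C e0. C > 0 \<and> e0 > 0 \<and> e0 \<le> 1 \<and> (\<forall>u \<epsilon>. adm u \<longrightarrow> 0 < \<epsilon> \<longrightarrow> \<epsilon> \<le> e0 \<longrightarrow>
     L1dist (\<lambda>x. u (x + \<epsilon> ^ k *\<^sub>R cut (\<lambda>x. axis (fst p) (snd p)) x)) u \<le> ennreal C * (ennreal \<epsilon> * total_energy u + modulus u (C * \<epsilon> ^ Suc k)))"
    (is "\<forall>p\<in>?I. \<exists>C e0. ?P p C e0")
  proof
    fix p :: "'a \<times> real" assume "p \<in> ?I"
    then have "snd p \<in> {1,-1}" by auto
    from k(2)[OF this, of "fst p"] show "\<exists>C e0. ?P p C e0" unfolding shift_bound_def by blast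
  qed
  then obtain Cf where "\<forall>p\<in>?I. \<exists>e0. ?P p (Cf p) e0" using bchoice[of ?I "\<lambda>p C. \<exists>e0. ?P p C e0"] by blast
  then obtain ef where P: "\<forall>p\<in>?I. ?P p (Cf p) (ef p)" using bchoice[of ?I "\<lambda>p e. ?P p (Cf p) e"] by blast
  have fin: "finite ?I" by simp
  define C where "C = 1 + (\<Sum>p\<in>?I. Cf p)"
  \<comment> \<open>The bound by r ensures that translations by at most \<epsilon>^k do not carry a
    point outside \<open>nb r\<close> into \<open>K\<close>; there the cutoff changes the step but
    not the value of u, which is 0.\<close>
  define e0 where "e0 = min r (Min (ef ` ?I))"
  have Cf: "Cf p \<le> C" "Cf p > 0" if "p \<in> ?I" for p
  proof -
    have "Cf p \<le> (\<Sum>p\<in>?I. Cf p)" using P by (intro member_le_sum that fin less_imp_le) auto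
    then show "Cf p \<le> C" by (simp add: C_def)
    show "Cf p > 0" using P that by blast
  qed
  have C: "C \<ge> 1" 
  proof -
    have "0 \<le> (\<Sum>p\<in>?I. Cf p)" by (rule sum_nonneg) (use Cf(2) less_imp_le in blast)
    then show ?thesis by (simp add: C_def)
  qed
  have "Min (ef ` ?I) \<in> ef ` ?I" using fin by (intro Min_in) auto
  then obtain p0 where p0: "p0 \<in> ?I" "Min (ef ` ?I) = ef p0" by blast
  have "ef p0 > 0" "ef p0 \<le> 1" using P p0(1) by blast+
  then have e0: "e0 > 0" "e0 \<le> 1" using r_pos unfolding e0_def p0(2) by auto
  have ef: "e0 \<le> ef p" if "p \<in> ?I" for p
    using fin that by (auto simp: e0_def intro: min.coboundedI2 Min_le)
  define n where "n = real CARD('a)"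
  have n: "n \<ge> 1" unfolding n_def using zero_less_card_finite[where 'a='a] by linarith
  have "modulus u (\<epsilon> ^ k) \<le> ennreal (n * C) * (ennreal \<epsilon> * total_energy u + modulus u ((n * C) * \<epsilon> ^ Suc k))"
    if u: "adm u" and e: "0 < \<epsilon>" "\<epsilon> \<le> e0" for u \<epsilon>
  proof -
    let ?M = "ennreal C * (ennreal \<epsilon> * total_energy u + modulus u (C * \<epsilon> ^ Suc k))"
    have ek: "\<epsilon> ^ k \<le> \<epsilon>" using e e0 k power_decreasing[of 1 k \<epsilon>] by simp
    have single: "L1dist (\<lambda>x. u (x + axis i a)) u \<le> ?M" if a: "\<bar>a\<bar> \<le> \<epsilon> ^ k" for i a
    proof (cases "a = 0")
      case True
      then have ax: "axis i a = (0 :: real^'a)" by (simp add: axis_eq_0_iff)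
      show ?thesis unfolding ax by (simp add: L1dist_def)
    next
      case False
      \<comment> \<open>A displacement shorter than \<epsilon>^k is reached with a smaller
        parameter, whose bound is dominated by the one for \<epsilon>. The sign of a selects the
        orientation of the axis.\<close>
      define \<epsilon>' where "\<epsilon>' = root k \<bar>a\<bar>"
      have e': "\<epsilon>' > 0" "\<epsilon>' ^ k = \<bar>a\<bar>" using False k by (auto simp: \<epsilon>'_def)
      have "\<epsilon>' \<le> \<epsilon>" using a e' e by (metis less_imp_le power_mono_iff k(1))
      let ?p = "(i, sgn a)"
      have p: "?p \<in> ?I" using False by (auto simp: sgn_if)
      have "u (x + \<epsilon>' ^ k *\<^sub>R cut (\<lambda>x. axis i (sgn a)) x) = u (x + axis i a)" for x
      proof (cases "x \<in> nb r")
        case True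
        have "\<epsilon>' ^ k *\<^sub>R axis i (sgn a) = (axis i a :: real^'a)"
          unfolding e' by (simp add: vec_eq_iff axis_def abs_mult_sgn sgn_if)
        then show ?thesis using True by (simp add: cut_eq)
      next
        case False
        have ar: "\<bar>a\<bar> \<le> r" using a ek e by (simp add: e0_def)
        have "norm (\<epsilon>' ^ k *\<^sub>R cut (\<lambda>x. axis i (sgn a) :: real^'a) x) \<le> \<bar>a\<bar> * 1"
          unfolding norm_scaleR cut_def e'(2) using chi_bounds[of x]
          by (intro mult_mono mult_le_one) (auto simp: norm_axis_real abs_sgn_eq)
        then have "u (x + \<epsilon>' ^ k *\<^sub>R cut (\<lambda>x. axis i (sgn a)) x) = 0" 
          using notin_nb[OF False, of "x + \<epsilon>' ^ k *\<^sub>R cut (\<lambda>x. axis i (sgn a)) x"] ar u by (auto simp: adm_def)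
        moreover have "u (x + axis i a) = 0"
          using notin_nb[OF False, of "x + axis i a"] ar u by (auto simp: adm_def norm_axis_real)
        ultimately show ?thesis by simp
      qed
      then have "L1dist (\<lambda>x. u (x + axis i a)) u = L1dist (\<lambda>x. u (x + \<epsilon>' ^ k *\<^sub>R cut (\<lambda>x. axis (fst ?p) (snd ?p)) x)) u" by simp
      also have "\<dots> \<le> ennreal (Cf ?p) * (ennreal \<epsilon>' * total_energy u + modulus u (Cf ?p * \<epsilon>' ^ Suc k))"
        using P[rule_format, OF p] u e' \<open>\<epsilon>' \<le> \<epsilon>\<close> e ef[OF p] by (meson order_trans)
      also have "\<dots> \<le> ?M"
        using Cf[OF p] C e e' \<open>\<epsilon>' \<le> \<epsilon>\<close>
        by (intro mult_mono add_mono ennreal_leI modulus_mono order_refl power_mono) (auto intro: add_nonneg_nonneg)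
      finally show ?thesis .
    qed
    have "modulus u (\<epsilon> ^ k) \<le> of_nat CARD('a) * ?M"
      unfolding modulus_def[of u "\<epsilon> ^ k"]
    proof (intro SUP_least)
      fix h :: "real^'a" assume "h \<in> cball 0 (\<epsilon> ^ k)"
      then have "norm h \<le> \<epsilon> ^ k" by simp
      then have hi: "\<bar>h $ i\<bar> \<le> \<epsilon> ^ k" for i using component_le_norm_cart[of h i] by linarith
      have "(\<Sum>i\<in>UNIV. axis i (h $ i)) = h" by (simp add: vec_eq_iff axis_def if_distrib cong: if_cong)
      then show "L1dist (\<lambda>x. u (x + h)) u \<le> of_nat CARD('a) * ?M"
        using L1dist_translate_sum[OF adm_measurable[OF u], of UNIV "\<lambda>i. axis i (h $ i)" ?M] single hi by simp
    qed
    also have "\<dots> = ennreal (n * C) * (ennreal \<epsilon> * total_energy u + modulus u (C * \<epsilon> ^ Suc k))"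
      using C n by (simp add: n_def ennreal_mult ennreal_of_nat_eq_real_of_nat mult.assoc)
    also have "\<dots> \<le> ennreal (n * C) * (ennreal \<epsilon> * total_energy u + modulus u ((n * C) * \<epsilon> ^ Suc k))"
      using n C e mult_right_mono[OF n, of C] by (intro mult_left_mono add_left_mono modulus_mono mult_right_mono) auto
    finally show ?thesis .
  qed
  moreover have "n * C \<ge> 1" using n C mult_mono[OF n C] by simp
  ultimately show ?thesis using k(1) e0 by blast
qed

text \<open>For small \<epsilon> the recursion leads from \<epsilon> to \<theta>\<epsilon> with a
  fixed \<theta>. After m steps the constant of \<open>modulus_linear\<close> has been divided by
  2^m, and it disappears in the limit, leaving a bound uniform in u.\<close>

theorem modulus_estimate:
  assumes "commutators_span U X s"
  shows "\<exists>k>0. \<exists>C\<ge>0. \<exists>e1>0. \<forall>u \<epsilon>. adm u \<longrightarrow> 0 < \<epsilon> \<longrightarrow> \<epsilon> \<le> e1 \<longrightarrow> modulus u (\<epsilon> ^ k) \<le> ennreal (C * \<epsilon>) * total_energy u"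
proof -
  obtain k C e0 where k: "k > 0" and C: "C \<ge> 1" and e0: "e0 > 0" "e0 \<le> 1" and
    rec: "\<And>u \<epsilon>. adm u \<Longrightarrow> 0 < \<epsilon> \<Longrightarrow> \<epsilon> \<le> e0 \<Longrightarrow>
     modulus u (\<epsilon> ^ k) \<le> ennreal C * (ennreal \<epsilon> * total_energy u + modulus u (C * \<epsilon> ^ Suc k))"
    using modulus_recursion[OF assms] by blast
  \<comment> \<open>C \<theta> = 1/2 halves the qualitative term at each step and also reproduces
    the energy term: C\<epsilon> + C (2C \<theta>\<epsilon>) = 2C\<epsilon>. The choice of
    \<open>e1\<close> below gives C \<epsilon>^(k+1) \<le> (\<theta>\<epsilon>)^k.\<close>
  define \<theta> where "\<theta> = 1 / (2 * C)"
  have \<theta>: "\<theta> > 0" "\<theta> \<le> 1" "C * \<theta> = 1/2" using C by (auto simp: \<theta>_def field_simps)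
  define e1 where "e1 = min e0 (\<theta> ^ k / C)"
  have e1: "e1 > 0" "e1 \<le> e0" "C * e1 \<le> \<theta> ^ k" 
  proof -
    show "e1 > 0" "e1 \<le> e0" using e0 C \<theta> by (auto simp: e1_def)
    have "C * e1 \<le> C * (\<theta> ^ k / C)" using C by (intro mult_left_mono) (auto simp: e1_def)
    then show "C * e1 \<le> \<theta> ^ k" using C by simp
  qed
  have "modulus u (\<epsilon> ^ k) \<le> ennreal (2 * C * \<epsilon>) * total_energy u" if u: "adm u" and e: "0 < \<epsilon>" "\<epsilon> \<le> e1" for u \<epsilon>
  proof -
    obtain L where L: "L \<ge> 0" "\<And>\<rho>. 0 \<le> \<rho> \<Longrightarrow> \<rho> \<le> 1 \<Longrightarrow> modulus u \<rho> \<le> ennreal (L * \<rho>)" using modulus_linear[OF u] by blast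
    have it: "modulus u (\<epsilon> ^ k) \<le> ennreal (2 * C * \<epsilon>) * total_energy u + ennreal (L * \<epsilon> / 2 ^ m)" if "0 < \<epsilon>" "\<epsilon> \<le> e1" for m \<epsilon>
      using that
    proof (induction m arbitrary: \<epsilon>)
      case 0
      have "\<epsilon> ^ k \<le> \<epsilon>" "\<epsilon> \<le> 1" using 0 e0 e1 k power_decreasing[of 1 k \<epsilon>] by auto
      then have "modulus u (\<epsilon> ^ k) \<le> ennreal (L * \<epsilon>)"
        using 0 L(1) by (intro order_trans[OF L(2) ennreal_leI] mult_left_mono) auto
      then show ?case by (simp add: add_increasing)
    next
      case (Suc m)
      have "C * \<epsilon> ^ Suc k \<le> (\<theta> * \<epsilon>) ^ k"
      proof -
        have "C * \<epsilon> \<le> \<theta> ^ k" using mult_left_mono[of \<epsilon> e1 C] Suc.prems C e1 by linarith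
        then have "(C * \<epsilon>) * \<epsilon> ^ k \<le> \<theta> ^ k * \<epsilon> ^ k" using Suc.prems by (intro mult_right_mono) auto
        then show ?thesis by (simp add: power_mult_distrib mult.assoc)
      qed
      then have "modulus u (C * \<epsilon> ^ Suc k) \<le> modulus u ((\<theta> * \<epsilon>) ^ k)" by (rule modulus_mono)
      also have "\<dots> \<le> ennreal (2 * C * (\<theta> * \<epsilon>)) * total_energy u + ennreal (L * (\<theta> * \<epsilon>) / 2 ^ m)"
      proof (rule Suc.IH)
        show "0 < \<theta> * \<epsilon>" using Suc.prems \<theta> by simp
        have "\<theta> * \<epsilon> \<le> 1 * \<epsilon>" using Suc.prems \<theta> by (intro mult_right_mono) auto
        then show "\<theta> * \<epsilon> \<le> e1" using Suc.prems by linarith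
      qed
      also have "2 * C * (\<theta> * \<epsilon>) = \<epsilon>" using \<theta>(3) by (simp add: mult.assoc[symmetric])
      finally have "modulus u (\<epsilon> ^ k) \<le> ennreal C * (ennreal \<epsilon> * total_energy u + (ennreal \<epsilon> * total_energy u + ennreal (L * (\<theta> * \<epsilon>) / 2 ^ m)))"
        using Suc.prems e1 by (intro order_trans[OF rec[OF u]] mult_left_mono add_left_mono) auto
      also have "\<dots> = ennreal (C * \<epsilon> + C * \<epsilon>) * total_energy u + ennreal (C * (L * (\<theta> * \<epsilon>) / 2 ^ m))"
      proof -
        have q: "0 \<le> L * (\<theta> * \<epsilon>) / 2 ^ m" "0 \<le> C" "0 \<le> \<epsilon>" "0 \<le> C * \<epsilon>" using C Suc.prems \<theta> L(1) by auto
        have s1: "ennreal (C * \<epsilon> + C * \<epsilon>) = ennreal C * ennreal \<epsilon> + ennreal C * ennreal \<epsilon>"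
          by (simp only: ennreal_plus[OF q(4,4)] ennreal_mult[OF q(2,3)])
        have s2: "ennreal (C * (L * (\<theta> * \<epsilon>) / 2 ^ m)) = ennreal C * ennreal (L * (\<theta> * \<epsilon>) / 2 ^ m)"
          by (rule ennreal_mult[OF q(2,1)])
        show ?thesis unfolding s1 s2 by (simp only: distrib_left distrib_right mult.assoc add.assoc)
      qed
      also have "C * (L * (\<theta> * \<epsilon>) / 2 ^ m) = (C * \<theta>) * (L * \<epsilon>) / 2 ^ m" by simp
      also have "\<dots> = L * \<epsilon> / 2 ^ Suc m" unfolding \<theta>(3) by simp
      finally show ?case by (simp add: algebra_simps)
    qed
    have lim: "(\<lambda>m. ennreal (2 * C * \<epsilon>) * total_energy u + ennreal (L * \<epsilon> / 2 ^ m)) \<longlonglongrightarrow> ennreal (2 * C * \<epsilon>) * total_energy u + ennreal 0"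
    proof (intro tendsto_add tendsto_const tendsto_ennrealI)
      have "(\<lambda>m. (L * \<epsilon>) * (1/2) ^ m) \<longlonglongrightarrow> (L * \<epsilon>) * 0"
        by (intro tendsto_mult tendsto_const LIMSEQ_power_zero) auto
      then show "(\<lambda>m. L * \<epsilon> / 2 ^ m) \<longlonglongrightarrow> 0" by (simp add: power_divide)
    qed
    have "modulus u (\<epsilon> ^ k) \<le> ennreal (2 * C * \<epsilon>) * total_energy u + ennreal 0"
      by (rule LIMSEQ_le_const[OF lim]) (use it[OF e] in auto)
    then show ?thesis by simp
  qed
  then show ?thesis using k e1(1) C by (intro exI[of _ k] conjI exI[of _ "2 * C"] exI[of _ e1]) auto
qed

end

section \<open>Compactness\<close>

lemma finite_convergent_subsequence:
  fixes f :: "nat \<Rightarrow> 'b \<Rightarrow> real"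
  assumes "finite S" "\<And>n x. x \<in> S \<Longrightarrow> \<bar>f n x\<bar> \<le> M"
  shows "\<exists>r. strict_mono (r::nat\<Rightarrow>nat) \<and> (\<forall>x\<in>S. convergent (\<lambda>n. f (r n) x))"
  using assms
proof (induction S rule: finite_induct)
  case empty
  then show ?case by (auto intro: exI[of _ id] strict_mono_id)
next
  case (insert a S)
  then obtain r where r: "strict_mono (r::nat\<Rightarrow>nat)" "\<forall>x\<in>S. convergent (\<lambda>n. f (r n) x)" by auto
  have "bounded (range (\<lambda>n. f (r n) a))" using insert.prems by (auto simp: bounded_iff intro!: exI[of _ M])
  then obtain l q where q: "strict_mono (q::nat\<Rightarrow>nat)" "((\<lambda>n. f (r n) a) \<circ> q) \<longlonglongrightarrow> l"
    using bounded_imp_convergent_subsequence by blast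
  have "convergent (\<lambda>n. f ((r \<circ> q) n) x)" if "x \<in> insert a S" for x
  proof (cases "x = a")
    case True
    then show ?thesis using q(2) by (auto simp: o_def convergent_def)
  next
    case False
    then have "convergent (\<lambda>n. f (r n) x)" using r(2) that by auto
    then show ?thesis using convergent_subseq_convergent[OF _ q(1)] by (auto simp: o_def)
  qed
  then show ?case using strict_mono_o[OF r(1) q(1)] by blast
qed

text \<open>The convolution of v with the indicator of a ball, without normalisation by its
  volume.\<close>

definition ball_int :: "('a::euclidean_space \<Rightarrow> real) \<Rightarrow> real \<Rightarrow> 'a \<Rightarrow> real" where
  "ball_int v \<rho> z = (LINT k|lborel. indicator (cball 0 \<rho>) k * v (z + k))"

lemma C0_integrable_ball:
  fixes v :: "'a::euclidean_space \<Rightarrow> real"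
  assumes "continuous_on UNIV v"
  shows "integrable lborel (\<lambda>k. indicator (cball 0 \<rho>) k * v (z + k))"
proof -
  have "continuous_on (cball 0 \<rho>) (\<lambda>k. v (z + k))"
    by (intro continuous_on_compose2[OF assms]) (auto intro: continuous_intros)
  from borel_integrable_compact[OF compact_cball this] show ?thesis
    by (simp add: mult.commute indicator_times_eq_if if_distrib cong: if_cong)
qed

lemma ball_int_diff:
  assumes "continuous_on UNIV v" "continuous_on UNIV w"
  shows "ball_int (\<lambda>x. v x - w x) \<rho> z = ball_int v \<rho> z - ball_int w \<rho> z"
  unfolding ball_int_def right_diff_distrib
  by (rule Bochner_Integration.integral_diff) (intro C0_integrable_ball assms)+

lemma ball_int_bound:
  assumes v: "continuous_on UNIV v"
  shows "ennreal \<bar>ball_int v \<rho> z\<bar> \<le> (\<integral>\<^sup>+x. ennreal \<bar>v x\<bar> \<partial>lborel)"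
proof -
  have [measurable]: "v \<in> borel_measurable borel" using v by (rule borel_measurable_continuous_onI)
  have "ennreal \<bar>ball_int v \<rho> z\<bar> \<le> (\<integral>\<^sup>+k. ennreal (norm (indicator (cball 0 \<rho>) k * v (z + k))) \<partial>lborel)"
    unfolding ball_int_def real_norm_def[symmetric]
    by (rule integral_norm_bound_ennreal[OF C0_integrable_ball[OF v]])
  also have "\<dots> \<le> (\<integral>\<^sup>+k. ennreal \<bar>v (z + k)\<bar> \<partial>lborel)"
    by (intro nn_integral_mono) (auto simp: indicator_def)
  also have "\<dots> = (\<integral>\<^sup>+x. ennreal \<bar>v x\<bar> \<partial>lborel)"
    by (rule nn_integral_lborel_translate) simp
  finally show ?thesis .
qed

text \<open>The modulus of v is itself a modulus of continuity of its ball integrals. A uniform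
  bound on moduli thus makes the ball integrals equicontinuous, and their values on a finite net
  determine them up to a small error.\<close>

lemma ball_int_equicont:
  assumes v: "continuous_on UNIV v"
  shows "ennreal \<bar>ball_int v \<rho> z - ball_int v \<rho> z'\<bar> \<le> modulus v (norm (z - z'))"
proof -
  have [measurable]: "v \<in> borel_measurable borel" using v by (rule borel_measurable_continuous_onI)
  have "ball_int v \<rho> z - ball_int v \<rho> z' = (LINT k|lborel. indicator (cball 0 \<rho>) k * v (z + k) - indicator (cball 0 \<rho>) k * v (z' + k))"
    unfolding ball_int_def by (rule Bochner_Integration.integral_diff[symmetric]) (intro C0_integrable_ball v)+
  then have "ennreal \<bar>ball_int v \<rho> z - ball_int v \<rho> z'\<bar> \<le> (\<integral>\<^sup>+k. ennreal (norm (indicator (cball 0 \<rho>) k * v (z + k) - indicator (cball 0 \<rho>) k * v (z' + k))) \<partial>lborel)"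
    unfolding real_norm_def[symmetric]
    by (simp only:) (intro integral_norm_bound_ennreal Bochner_Integration.integrable_diff C0_integrable_ball v)
  also have "\<dots> \<le> (\<integral>\<^sup>+k. ennreal \<bar>v (z + k) - v (z' + k)\<bar> \<partial>lborel)"
    by (intro nn_integral_mono) (auto simp: indicator_def)
  also have "\<dots> = L1dist (\<lambda>x. v ((x + z') + (z - z'))) (\<lambda>x. v (x + z'))"
    by (simp add: L1dist_def add_ac)
  also have "\<dots> = L1dist (\<lambda>x. v (x + (z - z'))) v"
    using L1dist_translate[of "\<lambda>x. v (x + (z - z'))" v z'] by simp
  also have "\<dots> \<le> modulus v (norm (z - z'))" by (intro modulus_upper) simp
  finally show ?thesis .
qed

lemma ball_int_approx:
  fixes w :: "'a::euclidean_space \<Rightarrow> real"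
  assumes w: "continuous_on UNIV w"
  shows "emeasure lborel (cball (0::'a) \<rho>) * ennreal \<bar>w x\<bar> \<le> ball_osc w \<rho> x + ennreal \<bar>ball_int w \<rho> x\<bar>"
proof -
  let ?b = "measure lborel (cball (0::'a) \<rho>)"
  have [measurable]: "w \<in> borel_measurable borel" using w by (rule borel_measurable_continuous_onI)
  have b: "emeasure lborel (cball (0::'a) \<rho>) = ennreal ?b"
    using emeasure_lborel_cball_finite[of "0::'a" \<rho>] by (intro emeasure_eq_ennreal_measure) auto
  have int1: "integrable lborel (\<lambda>k::'a. indicator (cball 0 \<rho>) k * w x)"
    using C0_integrable_ball[of "\<lambda>_. w x" \<rho> 0] by simp
  have "ball_int w \<rho> x - ?b * w x = (LINT k|lborel. indicator (cball 0 \<rho>) k * w (x + k) - indicator (cball 0 \<rho>) k * w x)"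
    unfolding ball_int_def
    by (subst Bochner_Integration.integral_diff[OF C0_integrable_ball[OF w] int1]) simp
  then have "ennreal \<bar>ball_int w \<rho> x - ?b * w x\<bar> \<le> (\<integral>\<^sup>+k. ennreal (norm (indicator (cball 0 \<rho>) k * w (x + k) - indicator (cball 0 \<rho>) k * w x)) \<partial>lborel)"
    unfolding real_norm_def[symmetric]
    by (simp only:) (intro integral_norm_bound_ennreal Bochner_Integration.integrable_diff C0_integrable_ball w int1)
  also have "\<dots> = ball_osc w \<rho> x"
    unfolding ball_osc_translate[OF \<open>w \<in> borel_measurable borel\<close>]
    by (intro nn_integral_cong) (auto simp: indicator_def)
  finally have 1: "ennreal \<bar>ball_int w \<rho> x - ?b * w x\<bar> \<le> ball_osc w \<rho> x" .
  have "?b * \<bar>w x\<bar> = \<bar>?b * w x\<bar>" by (simp add: abs_mult)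
  also have "\<dots> \<le> \<bar>ball_int w \<rho> x - ?b * w x\<bar> + \<bar>ball_int w \<rho> x\<bar>" by linarith
  finally have "ennreal (?b * \<bar>w x\<bar>) \<le> ennreal \<bar>ball_int w \<rho> x - ?b * w x\<bar> + ennreal \<bar>ball_int w \<rho> x\<bar>"
    by (simp add: ennreal_leI flip: ennreal_plus)
  also have "\<dots> \<le> ball_osc w \<rho> x + ennreal \<bar>ball_int w \<rho> x\<bar>" by (intro add_right_mono 1)
  finally show ?thesis unfolding b by (simp add: ennreal_mult)
qed

lemma modulus_diff:
  fixes u v :: "'a::euclidean_space \<Rightarrow> real"
  assumes [measurable]: "u \<in> borel_measurable borel" "v \<in> borel_measurable borel"
  shows "modulus (\<lambda>x. u x - v x) \<rho> \<le> modulus u \<rho> + modulus v \<rho>"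
  unfolding modulus_def[of "\<lambda>x. u x - v x"]
proof (intro SUP_least)
  fix h :: 'a assume h: "h \<in> cball 0 \<rho>"
  have "L1dist (\<lambda>x. u (x + h) - v (x + h)) (\<lambda>x. u x - v x) \<le> (\<integral>\<^sup>+x. ennreal \<bar>u (x + h) - u x\<bar> + ennreal \<bar>v (x + h) - v x\<bar> \<partial>lborel)"
    unfolding L1dist_def by (intro nn_integral_mono) (auto simp flip: ennreal_plus intro!: ennreal_leI)
  also have "\<dots> = L1dist (\<lambda>x. u (x + h)) u + L1dist (\<lambda>x. v (x + h)) v"
    unfolding L1dist_def by (intro nn_integral_add) measurable
  also have "\<dots> \<le> modulus u \<rho> + modulus v \<rho>" using h by (intro add_mono modulus_upper) auto
  finally show "L1dist (\<lambda>x. u (x + h) - v (x + h)) (\<lambda>x. u x - v x) \<le> modulus u \<rho> + modulus v \<rho>" .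
qed

text \<open>The total boundedness half of the Frechet-Kolmogorov theorem.\<close>

lemma L1_close_subsequence:
  fixes v :: "nat \<Rightarrow> 'a::euclidean_space \<Rightarrow> real"
  assumes K: "compact K" and v: "\<And>n. C0 K (v n)" and M: "\<And>n. (\<integral>\<^sup>+x. ennreal \<bar>v n x\<bar> \<partial>lborel) \<le> ennreal M" "M \<ge> 0"
    and eq: "\<And>\<eta>. \<eta> > 0 \<Longrightarrow> \<exists>\<rho>>0. \<forall>n. modulus (v n) \<rho> \<le> ennreal \<eta>" and \<eta>: "\<eta> > 0"
  shows "\<exists>r. strict_mono (r::nat\<Rightarrow>nat) \<and> (\<exists>N. \<forall>i\<ge>N. \<forall>j\<ge>N. L1dist (v (r i)) (v (r j)) \<le> ennreal \<eta>)"
proof -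
  have c: "continuous_on UNIV (v n)" for n using v by (simp add: C0_def)
  have meas[measurable]: "v n \<in> borel_measurable borel" for n using v by (rule C0_measurable)
  let ?A = "4 ^ DIM('a) :: real"
  \<comment> \<open>A difference of two members has at most twice this modulus, so after the factor
    4^n the oscillation uses up half of \<eta>. The other half pays for the ball integrals, which
    are at most 3\<delta> on \<open>K\<close>.\<close>
  obtain \<rho> where \<rho>: "\<rho> > 0" "\<And>n. modulus (v n) \<rho> \<le> ennreal (\<eta> / (4 * ?A))" using eq[of "\<eta> / (4 * ?A)"] \<eta> by auto
  let ?b = "measure lborel (cball (0::'a) \<rho>)" and ?m = "measure lborel K"
  have b: "emeasure lborel (cball (0::'a) \<rho>) = ennreal ?b"
    using emeasure_lborel_cball_finite[of "0::'a" \<rho>] by (intro emeasure_eq_ennreal_measure) auto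
  have bpos: "?b > 0" using emeasure_lborel_cball_pos_finite(1)[OF \<rho>(1), of "0::'a"] unfolding b by (simp add: ennreal_eq_0_iff not_le)
  have m: "emeasure lborel K = ennreal ?m"
    using emeasure_compact_finite[OF K] by (intro emeasure_eq_ennreal_measure) auto
  have clK: "closed K" using K by (rule compact_imp_closed)
  define \<delta> where "\<delta> = ?b * \<eta> / (6 * (?m + 1))"
  have \<delta>: "\<delta> > 0" "3 * \<delta> * ?m \<le> ?b * (\<eta> / 2)"
  proof -
    have m1: "?m + 1 > 0" using measure_nonneg[of lborel K] by linarith
    then show "\<delta> > 0" using bpos \<eta> by (simp add: \<delta>_def)
    have "3 * \<delta> * ?m = (?b * (\<eta> / 2)) * (?m / (?m + 1))" using m1 by (simp add: \<delta>_def field_simps)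
    also have "\<dots> \<le> (?b * (\<eta> / 2)) * 1" using m1 bpos \<eta> by (intro mult_left_mono) auto
    finally show "3 * \<delta> * ?m \<le> ?b * (\<eta> / 2)" by simp
  qed
  obtain \<rho>' where \<rho>': "\<rho>' > 0" "\<And>n. modulus (v n) \<rho>' \<le> ennreal \<delta>" using eq[OF \<delta>(1)] by blast
  obtain F where F: "finite F" "K \<subseteq> (\<Union>x\<in>F. ball x \<rho>')"
    by (rule compactE_image[OF K, of K "\<lambda>x. ball x \<rho>'"]) (use \<rho>'(1) in \<open>auto intro: finite_subset\<close>)
  have "\<bar>ball_int (v n) \<rho> z\<bar> \<le> M" for n z
    using order_trans[OF ball_int_bound[OF c] M(1)] M(2) by (simp add: ennreal_le_iff)
  then obtain r where r: "strict_mono (r::nat\<Rightarrow>nat)" "\<forall>z\<in>F. convergent (\<lambda>n. ball_int (v (r n)) \<rho> z)"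
    using finite_convergent_subsequence[OF F(1), of "\<lambda>n. ball_int (v n) \<rho>" M] by auto
  have "\<forall>z\<in>F. \<exists>N. \<forall>i\<ge>N. \<forall>j\<ge>N. \<bar>ball_int (v (r i)) \<rho> z - ball_int (v (r j)) \<rho> z\<bar> < \<delta>"
    using r(2) \<delta>(1) unfolding Cauchy_convergent_iff[symmetric] Cauchy_def dist_real_def by blast
  then obtain N where N: "\<And>z i j. z \<in> F \<Longrightarrow> i \<ge> N z \<Longrightarrow> j \<ge> N z \<Longrightarrow> \<bar>ball_int (v (r i)) \<rho> z - ball_int (v (r j)) \<rho> z\<bar> < \<delta>" by metis
  define N0 where "N0 = Max (insert 0 (N ` F))"
  have N0: "z \<in> F \<Longrightarrow> N z \<le> N0" for z using F(1) by (auto simp: N0_def)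
  have "L1dist (v (r i)) (v (r j)) \<le> ennreal \<eta>" if ij: "i \<ge> N0" "j \<ge> N0" for i j
  proof -
    let ?w = "\<lambda>x. v (r i) x - v (r j) x"
    have wc: "continuous_on UNIV ?w" by (intro continuous_intros c)
    have wC: "C0 K ?w" using v wc by (simp add: C0_def)
    have small: "\<bar>ball_int ?w \<rho> x\<bar> \<le> 3 * \<delta>" if x: "x \<in> K" for x
    proof -
      obtain z where z: "z \<in> F" "dist z x < \<rho>'" using F(2) x by auto
      have q: "\<bar>ball_int (v n) \<rho> x - ball_int (v n) \<rho> z\<bar> \<le> \<delta>" for n
      proof -
        have "ennreal \<bar>ball_int (v n) \<rho> x - ball_int (v n) \<rho> z\<bar> \<le> modulus (v n) (norm (x - z))" by (rule ball_int_equicont[OF c])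
        also have "\<dots> \<le> modulus (v n) \<rho>'" using z by (intro modulus_mono) (simp add: dist_norm norm_minus_commute)
        also have "\<dots> \<le> ennreal \<delta>" by (rule \<rho>')
        finally show ?thesis using \<delta>(1) by (simp add: ennreal_le_iff)
      qed
      have "\<bar>ball_int (v (r i)) \<rho> z - ball_int (v (r j)) \<rho> z\<bar> < \<delta>" using N0[OF z(1)] ij by (intro N z(1)) auto
      then show ?thesis using q[of "r i"] q[of "r j"] unfolding ball_int_diff[OF c c] by linarith
    qed
    have osc_m: "(\<lambda>x. ball_osc ?w \<rho> x) \<in> borel_measurable borel"
      using ball_osc_measurable[of ?w "\<lambda>x. x" \<rho>] by simp
    have "ennreal ?b * L1dist (v (r i)) (v (r j)) = (\<integral>\<^sup>+x. ennreal ?b * ennreal \<bar>?w x\<bar> \<partial>lborel)"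
      unfolding L1dist_def by (subst nn_integral_cmult) auto
    also have "\<dots> \<le> (\<integral>\<^sup>+x. ball_osc ?w \<rho> x + ennreal (3 * \<delta>) * indicator K x \<partial>lborel)"
    proof (intro nn_integral_mono)
      fix x
      show "ennreal ?b * ennreal \<bar>?w x\<bar> \<le> ball_osc ?w \<rho> x + ennreal (3 * \<delta>) * indicator K x"
      proof (cases "x \<in> K")
        case True
        have "ennreal ?b * ennreal \<bar>?w x\<bar> \<le> ball_osc ?w \<rho> x + ennreal \<bar>ball_int ?w \<rho> x\<bar>"
          using ball_int_approx[OF wc, of \<rho> x] unfolding b .
        also have "\<dots> \<le> ball_osc ?w \<rho> x + ennreal (3 * \<delta>) * indicator K x"
          using small[OF True] True by (intro add_left_mono) (simp add: ennreal_leI)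
        finally show ?thesis .
      next
        case False
        then have "?w x = 0" using wC by (simp add: C0_def)
        then show ?thesis by simp
      qed
    qed
    also have "\<dots> = (\<integral>\<^sup>+x. ball_osc ?w \<rho> x \<partial>lborel) + ennreal (3 * \<delta>) * ennreal ?m"
      using osc_m clK by (subst nn_integral_add) (auto simp: nn_integral_cmult_indicator m)
    also have "(\<integral>\<^sup>+x. ball_osc ?w \<rho> x \<partial>lborel) \<le> ennreal ?A * ennreal ?b * modulus ?w \<rho>"
      using nn_integral_ball_osc[of "\<lambda>x. x" K ?w \<rho>] wC K by (simp add: near_id_def compact_imp_bounded b)
    also have "modulus ?w \<rho> \<le> ennreal (\<eta> / (4 * ?A)) + ennreal (\<eta> / (4 * ?A))"
      by (intro order_trans[OF modulus_diff] add_mono \<rho>) measurable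
    also have "ennreal ?A * ennreal ?b * (ennreal (\<eta> / (4 * ?A)) + ennreal (\<eta> / (4 * ?A))) + ennreal (3 * \<delta>) * ennreal ?m
       = ennreal (?A * ?b * (\<eta> / (4 * ?A) + \<eta> / (4 * ?A)) + 3 * \<delta> * ?m)"
      using bpos \<eta> \<delta>(1) by (simp add: ennreal_mult[symmetric] ennreal_plus[symmetric] del: ennreal_plus)
    also have "\<dots> \<le> ennreal (?b * \<eta>)"
      using \<delta>(2) by (intro ennreal_leI) (simp add: field_simps)
    also have "\<dots> = ennreal ?b * ennreal \<eta>" using bpos \<eta> by (simp add: ennreal_mult)
    finally have "ennreal ?b * L1dist (v (r i)) (v (r j)) \<le> ennreal ?b * ennreal \<eta>"
      by (simp add: add_right_mono mult_left_mono)
    then show ?thesis using emeasure_lborel_cball_pos_finite[OF \<rho>(1), of "0::'a"]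
      unfolding b by (rule ennreal_le_cancel_mult)
  qed
  then show ?thesis using r(1) by blast
qed

text \<open>A diagonal sequence over the tolerances 1/(k+1); closeness up to a fixed tolerance from
  some index on is inherited by subsequences.\<close>

lemma L1_Cauchy_subsequence:
  fixes v :: "nat \<Rightarrow> 'a::euclidean_space \<Rightarrow> real"
  assumes K: "compact K" and v: "\<And>n. C0 K (v n)" and M: "\<And>n. (\<integral>\<^sup>+x. ennreal \<bar>v n x\<bar> \<partial>lborel) \<le> ennreal M" "M \<ge> 0"
    and eq: "\<And>\<eta>. \<eta> > 0 \<Longrightarrow> \<exists>\<rho>>0. \<forall>n. modulus (v n) \<rho> \<le> ennreal \<eta>"
  shows "\<exists>r. strict_mono (r::nat\<Rightarrow>nat) \<and> (\<forall>\<eta>>0. \<exists>N. \<forall>i\<ge>N. \<forall>j\<ge>N. L1dist (v (r i)) (v (r j)) \<le> ennreal \<eta>)"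
proof -
  define P where "P k r \<longleftrightarrow> (\<exists>N. \<forall>i\<ge>N. \<forall>j\<ge>N. L1dist (v (r i)) (v (r j)) \<le> ennreal (1 / real (Suc k)))" for k and r :: "nat \<Rightarrow> nat"
  interpret subseqs P
  proof
    fix k and s :: "nat \<Rightarrow> nat"
    assume "strict_mono s"
    show "\<exists>r'. strict_mono r' \<and> P k (s \<circ> r')"
      using L1_close_subsequence[of K "\<lambda>n. v (s n)" M "1 / real (Suc k)", OF K v M] eq unfolding P_def o_def by (metis of_nat_0_less_iff zero_less_Suc zero_less_divide_1_iff)
  qed
  have hold: "P k (diagseq \<circ> ((+) (Suc k)))" for k
  proof (rule diagseq_holds)
    fix n and r s :: "nat \<Rightarrow> nat"
    assume r: "strict_mono r" and "P n s"
    then obtain N where "\<And>i j. i \<ge> N \<Longrightarrow> j \<ge> N \<Longrightarrow> L1dist (v (s i)) (v (s j)) \<le> ennreal (1 / real (Suc n))" by (auto simp: P_def)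
    then show "P n (s \<circ> r)" unfolding P_def o_def
      using seq_suble[OF r] order_trans by (intro exI[of _ N]) blast
  qed
  have "\<exists>N. \<forall>i\<ge>N. \<forall>j\<ge>N. L1dist (v (diagseq i)) (v (diagseq j)) \<le> ennreal \<eta>" if \<eta>: "\<eta> > 0" for \<eta>
  proof -
    obtain k where k: "1 / real (Suc k) < \<eta>" by (rule nat_approx_posE[OF \<eta>])
    obtain N where N: "\<And>i j. i \<ge> N \<Longrightarrow> j \<ge> N \<Longrightarrow> L1dist (v (diagseq (Suc k + i))) (v (diagseq (Suc k + j))) \<le> ennreal (1 / real (Suc k))"
      using hold[of k] by (auto simp: P_def)
    have "L1dist (v (diagseq i)) (v (diagseq j)) \<le> ennreal \<eta>" if "i \<ge> Suc k + N" "j \<ge> Suc k + N" for i j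
    proof -
      have "L1dist (v (diagseq i)) (v (diagseq j)) \<le> ennreal (1 / real (Suc k))"
        using N[of "i - Suc k" "j - Suc k"] that by simp
      also have "\<dots> \<le> ennreal \<eta>" using k by (intro ennreal_leI) simp
      finally show ?thesis .
    qed
    then show ?thesis by blast
  qed
  then show ?thesis using subseq_diagseq by blast
qed

context tube_fields
begin

theorem adm_compact:
  assumes span: "commutators_span U X s"
    and v: "\<And>n. adm (v n)" and M: "\<And>n. (\<integral>\<^sup>+x. ennreal \<bar>v n x\<bar> \<partial>lborel) \<le> ennreal M" "M \<ge> 0" and E: "\<And>n. total_energy (v n) \<le> ennreal M"
  shows "\<exists>r. strict_mono (r::nat\<Rightarrow>nat) \<and> (\<forall>\<eta>>0. \<exists>N. \<forall>i\<ge>N. \<forall>j\<ge>N. L1dist (v (r i)) (v (r j)) \<le> ennreal \<eta>)"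
proof (rule L1_Cauchy_subsequence[OF compact_K adm_C0[OF v] M])
  fix \<eta> :: real assume \<eta>: "\<eta> > 0"
  obtain k C e1 where k: "k > 0" and C: "C \<ge> 0" and e1: "e1 > 0" 
    and est: "\<And>u \<epsilon>. adm u \<Longrightarrow> 0 < \<epsilon> \<Longrightarrow> \<epsilon> \<le> e1 \<Longrightarrow> modulus u (\<epsilon> ^ k) \<le> ennreal (C * \<epsilon>) * total_energy u"
    using modulus_estimate[OF span] by blast
  define \<epsilon> where "\<epsilon> = min e1 (\<eta> / (C * M + 1))"
  have CM: "C * M + 1 > 0" using C M(2) by (simp add: add_nonneg_pos)
  have e: "\<epsilon> > 0" "\<epsilon> \<le> e1" using e1 \<eta> CM by (auto simp: \<epsilon>_def)
  have "C * \<epsilon> * M \<le> \<eta>"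
  proof -
    have "C * \<epsilon> * M = (C * M) * \<epsilon>" by simp
    also have "\<dots> \<le> (C * M + 1) * (\<eta> / (C * M + 1))" using C M(2) e CM by (intro mult_mono) (auto simp: \<epsilon>_def)
    also have "\<dots> = \<eta>" using CM by simp
    finally show ?thesis .
  qed
  have "modulus (v n) (\<epsilon> ^ k) \<le> ennreal \<eta>" for n
  proof -
    have "modulus (v n) (\<epsilon> ^ k) \<le> ennreal (C * \<epsilon>) * ennreal M"
      by (intro order_trans[OF est[OF v e]] mult_left_mono E) auto
    also have "\<dots> = ennreal (C * \<epsilon> * M)" using C e M(2) by (simp add: ennreal_mult)
    also have "\<dots> \<le> ennreal \<eta>" by (rule ennreal_leI) fact
    finally show ?thesis .
  qed
  then show "\<exists>\<rho>>0. \<forall>n. modulus (v n) \<rho> \<le> ennreal \<eta>" using e by (intro exI[of _ "\<epsilon> ^ k"]) auto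
qed

end

section \<open>Test functions and weak derivatives\<close>

lemma Ck_on_Un:
  assumes "open A" "open B" "Ck_on j A f" "Ck_on j B f"
  shows "Ck_on j (A \<union> B) f"
  using assms(3,4)
proof (induction j arbitrary: f)
  case 0
  then show ?case using assms by (auto intro: continuous_on_open_Un)
next
  case (Suc j)
  have "f differentiable_on (A \<union> B)"
    using Suc.prems assms(1,2) by (auto simp: differentiable_on_eq_differentiable_at open_Un)
  then show ?case using Suc by auto
qed

lemma smooth_on_Un: "open A \<Longrightarrow> open B \<Longrightarrow> smooth_on A f \<Longrightarrow> smooth_on B f \<Longrightarrow> smooth_on (A \<union> B) f"
  by (simp add: smooth_on_def Ck_on_Un)

lemma test_function_0: "test_function \<Omega> \<phi> \<Longrightarrow> x \<notin> \<Omega> \<Longrightarrow> \<phi> x = 0"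
  unfolding test_function_def using closure_subset[of "{x. \<phi> x \<noteq> 0}"] by blast

lemma test_functionI:
  assumes "smooth_on UNIV \<phi>" "compact C" "C \<subseteq> \<Omega>" "\<And>x. x \<notin> C \<Longrightarrow> \<phi> x = 0"
  shows "test_function \<Omega> \<phi>"
proof -
  have "closure {x. \<phi> x \<noteq> 0} \<subseteq> C"
    using assms(2,4) by (intro closure_minimal compact_imp_closed) auto
  moreover from this have "compact (closure {x. \<phi> x \<noteq> 0})"
    using assms(2) by (metis closed_closure compact_Int_closed inf.absorb_iff2)
  ultimately show ?thesis using assms by (auto simp: test_function_def)
qed

lemma test_functionD:
  assumes "test_function \<Omega> \<phi>"
  shows "\<exists>C. compact C \<and> C \<subseteq> \<Omega> \<and> (\<forall>x. x \<notin> C \<longrightarrow> \<phi> x = 0) \<and> smooth_on UNIV \<phi>"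
  using assms closure_subset[of "{x. \<phi> x \<noteq> 0}"] unfolding test_function_def by blast

lemma test_function_smooth_mult:
  assumes U: "open U" "\<Omega> \<subseteq> U" and h: "smooth_on U h" and \<phi>: "test_function \<Omega> \<phi>"
  shows "test_function \<Omega> (\<lambda>x. h x * \<phi> x)"
proof -
  obtain C where C: "compact C" "C \<subseteq> \<Omega>" "\<And>x. x \<notin> C \<Longrightarrow> \<phi> x = 0" "smooth_on UNIV \<phi>" using test_functionD[OF \<phi>] by blast
  have oC: "open (- C)" using C(1) by (simp add: compact_imp_closed open_Compl)
  have "smooth_on (- C) (\<lambda>x. h x * \<phi> x) \<longleftrightarrow> smooth_on (- C) (\<lambda>x. 0)"
    by (rule smooth_on_cong[OF oC]) (use C(3) in auto)
  moreover have "smooth_on U (\<lambda>x. h x * \<phi> x)"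
    by (intro smooth_on_mult U h smooth_on_subset[OF C(4)]) auto
  ultimately have "smooth_on (U \<union> - C) (\<lambda>x. h x * \<phi> x)"
    by (intro smooth_on_Un U oC) (auto simp: smooth_on_const)
  moreover have "U \<union> - C = UNIV" using C(2) U(2) by auto
  ultimately show ?thesis using C by (intro test_functionI[of _ C]) auto
qed

lemma test_function_partial:
  assumes "test_function \<Omega> \<phi>"
  shows "test_function \<Omega> (partial k \<phi>)"
proof -
  obtain C where C: "compact C" "C \<subseteq> \<Omega>" "\<And>x. x \<notin> C \<Longrightarrow> \<phi> x = 0" "smooth_on UNIV \<phi>" using test_functionD[OF assms] by blast
  have "partial k \<phi> x = 0" if "x \<notin> C" for x
  proof -
    have "partial k \<phi> x = partial k (\<lambda>x. 0) x"
      using C that by (intro partial_cong_open[of "- C"]) (auto simp: compact_imp_closed open_Compl)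
    then show ?thesis by (simp add: partial_const)
  qed
  then show ?thesis using C by (intro test_functionI[of _ C] smooth_on_partial)
qed

lemma test_function_add:
  assumes "test_function \<Omega> \<phi>" "test_function \<Omega> \<psi>"
  shows "test_function \<Omega> (\<lambda>x. \<phi> x + \<psi> x)"
proof -
  obtain C where C: "compact C" "C \<subseteq> \<Omega>" "\<And>x. x \<notin> C \<Longrightarrow> \<phi> x = 0" "smooth_on UNIV \<phi>" using test_functionD[OF assms(1)] by blast
  obtain D where D: "compact D" "D \<subseteq> \<Omega>" "\<And>x. x \<notin> D \<Longrightarrow> \<psi> x = 0" "smooth_on UNIV \<psi>" using test_functionD[OF assms(2)] by blast
  show ?thesis using C D by (intro test_functionI[of _ "C \<union> D"] smooth_on_add) auto
qed

lemma test_function_cmult: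
  assumes "test_function \<Omega> \<phi>"
  shows "test_function \<Omega> (\<lambda>x. c * \<phi> x)"
  by (rule test_function_smooth_mult[OF open_UNIV _ smooth_on_const assms]) simp

lemma test_function_zero: "test_function \<Omega> (\<lambda>x. 0)"
  by (rule test_functionI[of _ "{}"]) (auto simp: smooth_on_const)

lemma test_function_sum:
  assumes "finite I" "\<And>i. i \<in> I \<Longrightarrow> test_function \<Omega> (f i)"
  shows "test_function \<Omega> (\<lambda>x. \<Sum>i\<in>I. f i x)"
  using assms by (induction I rule: finite_induct) (auto intro: test_function_zero test_function_add)

lemma test_function_formal_adjoint:
  assumes U: "open U" "\<Omega> \<subseteq> U" and V: "smooth_vector_field U V" and \<phi>: "test_function \<Omega> \<phi>"
  shows "test_function \<Omega> (formal_adjoint V \<phi>)"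
proof -
  have "test_function \<Omega> (\<lambda>x. (-1) * (\<Sum>k\<in>UNIV. partial k (\<lambda>y. V y $ k * \<phi> y) x))"
    using V by (intro test_function_cmult test_function_sum test_function_partial test_function_smooth_mult[OF U _ \<phi>])
      (auto simp: smooth_vector_field_def)
  then show ?thesis by (simp add: formal_adjoint_def[abs_def])
qed

lemma test_function_continuous: "test_function \<Omega> \<phi> \<Longrightarrow> continuous_on UNIV \<phi>"
  by (simp add: test_function_def smooth_on_continuous_on)

lemma test_function_measurable: "test_function \<Omega> \<phi> \<Longrightarrow> \<phi> \<in> borel_measurable borel"
  by (intro borel_measurable_continuous_onI test_function_continuous)

lemma test_function_bounded:
  assumes "test_function \<Omega> \<phi>"
  shows "\<exists>B\<ge>0. \<forall>x. \<bar>\<phi> x\<bar> \<le> B"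
proof -
  obtain C where C: "compact C" "C \<subseteq> \<Omega>" "\<And>x. x \<notin> C \<Longrightarrow> \<phi> x = 0" "smooth_on UNIV \<phi>" using test_functionD[OF assms] by blast
  have "compact (\<phi> ` C)" by (intro compact_continuous_image C continuous_on_subset[OF test_function_continuous[OF assms]]) auto
  then obtain b where b: "\<forall>y\<in>\<phi> ` C. norm y \<le> b" by (metis bounded_iff compact_imp_bounded)
  have "\<bar>\<phi> x\<bar> \<le> max 0 b" for x using b C(3)[of x] by (cases "x \<in> C") (auto simp: le_max_iff_disj)
  then show ?thesis by (intro exI[of _ "max 0 b"]) auto
qed

section \<open>Integration by parts for test functions\<close>

lemma test_function_integrable: 
  assumes "test_function \<Omega> \<phi>"
  shows "integrable lborel \<phi>"
proof -
  obtain C where C: "compact C" "C \<subseteq> \<Omega>" "\<And>x. x \<notin> C \<Longrightarrow> \<phi> x = 0" using test_functionD[OF assms] by blast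
  have "integrable lborel (\<lambda>x. indicator C x *\<^sub>R \<phi> x)"
    by (rule borel_integrable_compact[OF C(1)]) (rule continuous_on_subset[OF test_function_continuous[OF assms]], simp)
  moreover have "(\<lambda>x. indicator C x *\<^sub>R \<phi> x) = \<phi>" using C(3) by (auto simp: indicator_def fun_eq_iff)
  ultimately show ?thesis by simp
qed

lemma integral_test_function:
  assumes "test_function \<Omega> \<phi>" "open \<Omega>"
  shows "(LINT x|lebesgue_on \<Omega>. \<phi> x) = (LINT x|lborel. \<phi> x)"
proof -
  have "(LINT x|lebesgue_on \<Omega>. \<phi> x) = (LINT x|lebesgue. indicator \<Omega> x *\<^sub>R \<phi> x)"
    using assms(2) by (intro integral_restrict_space) auto
  also have "(\<lambda>x. indicator \<Omega> x *\<^sub>R \<phi> x) = \<phi>" using test_function_0[OF assms(1)] by (auto simp: indicator_def fun_eq_iff)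
  also have "(LINT x|lebesgue. \<phi> x) = (LINT x|lborel. \<phi> x)"
    using test_function_measurable[OF assms(1)] by (intro integral_completion) simp
  finally show ?thesis .
qed

text \<open>By translation invariance all difference quotients have integral 0. They converge to the
  partial derivative and are dominated by the Lipschitz constant of F on a fixed ball.\<close>

lemma integral_partial_test_function:
  fixes F :: "real^'n \<Rightarrow> real"
  assumes F: "test_function \<Omega> F"
  shows "(LINT x|lborel. partial k F x) = 0"
proof -
  obtain C where C: "compact C" "C \<subseteq> \<Omega>" "\<And>x. x \<notin> C \<Longrightarrow> F x = 0" "smooth_on UNIV F" using test_functionD[OF F] by blast
  have dF: "(F has_derivative (\<lambda>v. grad F x \<bullet> v)) (at x)" for x
    by (rule has_derivative_grad[OF smooth_on_differentiable[OF C(4)]]) auto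
  have "\<forall>k. \<exists>B\<ge>0. \<forall>x. \<bar>partial k F x\<bar> \<le> B" using test_function_bounded[OF test_function_partial[OF F]] by blast
  then obtain b where b: "\<And>k. b k \<ge> 0" "\<And>k x. \<bar>partial k F x\<bar> \<le> b k" by metis
  define B where "B = (\<Sum>k\<in>UNIV. b k)"
  have gB: "norm (grad F x) \<le> B" for x unfolding B_def by (rule norm_vec_le_sum_bound) (simp add: grad_def b)
  have lip: "\<bar>F y - F x\<bar> \<le> B * norm (y - x)" for x y
  proof -
    have "norm (F y - F x) \<le> B * norm (y - x)"
      by (rule differentiable_bound[of UNIV _ "\<lambda>x v. grad F x \<bullet> v"])
         (use dF order_trans[OF onorm_inner_le gB] in auto)
    then show ?thesis by simp
  qed
  have B0: "B \<ge> 0" using gB[of 0] norm_ge_zero order_trans by blast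
  obtain R where R: "\<And>x. x \<in> C \<Longrightarrow> norm x \<le> R" using compact_imp_bounded[OF C(1)] by (auto simp: bounded_iff)
  let ?e = "axis k 1 :: real^'n"
  define t :: "nat \<Rightarrow> real" where "t n = 1 / real (Suc n)" for n
  have t: "t n > 0" "t n \<le> 1" for n by (auto simp: t_def)
  have t0: "t \<longlonglongrightarrow> 0" unfolding t_def[abs_def] using LIMSEQ_Suc[OF lim_1_over_n] by simp
  define f where "f n x = (F (x + t n *\<^sub>R ?e) - F x) / t n" for n x
  have [measurable]: "F \<in> borel_measurable borel" by (rule test_function_measurable[OF F])
  have "(\<lambda>n. LINT x|lborel. f n x) \<longlonglongrightarrow> (LINT x|lborel. partial k F x)"
  proof (rule integral_dominated_convergence[where w="\<lambda>x. B * indicator (cball 0 (R + 1)) x"])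
    show "partial k F \<in> borel_measurable lborel" using test_function_measurable[OF test_function_partial[OF F]] by simp
    show "f n \<in> borel_measurable lborel" for n unfolding f_def by measurable
    show "integrable lborel (\<lambda>x::real^'n. B * indicator (cball 0 (R + 1)) x)"
      using emeasure_lborel_cball_finite[of "0 :: real^'n" "R + 1"]
      by (intro integrable_mult_right integrable_real_indicator) auto
    show "AE x in lborel. (\<lambda>n. f n x) \<longlonglongrightarrow> partial k F x"
    proof (intro AE_I2)
      fix x
      have "((\<lambda>s. F (x + s *\<^sub>R ?e)) has_derivative (\<lambda>s. grad F x \<bullet> (s *\<^sub>R ?e))) (at 0)"
        by (rule has_derivative_compose[of "\<lambda>s. x + s *\<^sub>R ?e" "\<lambda>s. s *\<^sub>R ?e" 0 UNIV F, simplified])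
           (auto intro!: derivative_eq_intros simp: dF)
      moreover have "(\<lambda>s. grad F x \<bullet> (s *\<^sub>R ?e)) = (*) (partial k F x)" by (auto simp: grad_def inner_axis)
      ultimately have "((\<lambda>s. F (x + s *\<^sub>R ?e)) has_real_derivative partial k F x) (at 0)"
        by (simp add: has_field_derivative_def)
      then have "((\<lambda>h. (F (x + h *\<^sub>R ?e) - F x) / h) \<longlongrightarrow> partial k F x) (at 0)" by (simp add: DERIV_def)
      moreover have "filterlim t (at 0) sequentially"
        using t0 t(1) by (auto simp: filterlim_at intro!: always_eventually less_imp_neq[symmetric])
      ultimately show "(\<lambda>n. f n x) \<longlonglongrightarrow> partial k F x" unfolding f_def by (rule filterlim_compose)
    qed
    fix n
    show "AE x in lborel. norm (f n x) \<le> B * indicator (cball 0 (R + 1)) x"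
    proof (intro AE_I2)
      fix x
      show "norm (f n x) \<le> B * indicator (cball 0 (R + 1)) x"
      proof (cases "norm x \<le> R + 1")
        case True
        have "\<bar>F (x + t n *\<^sub>R ?e) - F x\<bar> \<le> B * t n" using lip[of "x + t n *\<^sub>R ?e" x] t(1)[of n] by simp
        then show ?thesis using True t(1)[of n] by (simp add: f_def divide_simps)
      next
        case False
        have "norm x \<le> norm (x + t n *\<^sub>R ?e) + t n" using norm_triangle_ineq4[of "x + t n *\<^sub>R ?e" "t n *\<^sub>R ?e"] t(1)[of n] by simp
        then have "x + t n *\<^sub>R ?e \<notin> C" "x \<notin> C" using False R t[of n] by force+
        then show ?thesis using C(3) False by (simp add: f_def)
      qed
    qed
  qed
  moreover have "(LINT x|lborel. f n x) = 0" for n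
  proof -
    have Fi: "integrable lborel F" by (rule test_function_integrable[OF F])
    have "(LINT x|lborel. F x) = (LINT x|distr lborel borel ((+) (t n *\<^sub>R ?e)). F x)" by (simp add: lborel_distr_plus)
    also have "\<dots> = (LINT x|lborel. F (t n *\<^sub>R ?e + x))" by (subst integral_distr) auto
    finally have eq: "(LINT x|lborel. F (x + t n *\<^sub>R ?e)) = (LINT x|lborel. F x)" by (simp add: add.commute)
    have "integrable (distr lborel borel ((+) (t n *\<^sub>R ?e))) F" using Fi by (simp add: lborel_distr_plus)
    then have "integrable lborel (\<lambda>x. F (t n *\<^sub>R ?e + x))" by (subst (asm) integrable_distr_eq) auto
    then have "integrable lborel (\<lambda>x. F (x + t n *\<^sub>R ?e))" by (simp add: add.commute)
    then show ?thesis unfolding f_def using eq Fi by simp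
  qed
  ultimately have "(\<lambda>n::nat. 0) \<longlonglongrightarrow> (LINT x|lborel. partial k F x)" by simp
  from LIMSEQ_unique[OF this tendsto_const] show ?thesis .
qed

text \<open>The classical counterpart of \<open>weak_gradient\<close>, free of any choice of
  representative.\<close>

definition Xgrad :: "('m::finite \<Rightarrow> real^'n \<Rightarrow> real^'n) \<Rightarrow> (real^'n \<Rightarrow> real) \<Rightarrow> real^'n \<Rightarrow> real^'m" where
  "Xgrad X \<phi> x = (\<chi> i. grad \<phi> x \<bullet> X i x)"

lemma test_function_Xderiv:
  assumes U: "open U" "\<Omega> \<subseteq> U" and V: "smooth_vector_field U V" and \<phi>: "test_function \<Omega> \<phi>"
  shows "test_function \<Omega> (\<lambda>x. grad \<phi> x \<bullet> V x)"
proof -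
  have "test_function \<Omega> (\<lambda>x. \<Sum>k\<in>UNIV. V x $ k * partial k \<phi> x)"
    using V by (intro test_function_sum test_function_smooth_mult[OF U] test_function_partial[OF \<phi>]) (auto simp: smooth_vector_field_def)
  then show ?thesis by (simp add: inner_vec_def grad_def mult.commute)
qed

text \<open>The sum over k of the partial derivatives of \<phi> V_k \<psi> is the difference of the
  two integrands, and each of these derivatives integrates to 0.\<close>

lemma integration_by_parts:
  assumes U: "open U" "\<Omega> \<subseteq> U" and \<Omega>: "open \<Omega>" and V: "smooth_vector_field U V"
    and \<phi>: "test_function \<Omega> \<phi>" and \<psi>: "test_function \<Omega> \<psi>"
  shows "(LINT x|lebesgue_on \<Omega>. (grad \<phi> x \<bullet> V x) * \<psi> x) = (LINT x|lebesgue_on \<Omega>. \<phi> x * formal_adjoint V \<psi> x)"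
proof -
  have s\<phi>: "smooth_on UNIV \<phi>" "smooth_on UNIV \<psi>" using \<phi> \<psi> by (auto simp: test_function_def)
  have t1: "test_function \<Omega> (\<lambda>y. V y $ k * \<psi> y)" for k
    using V by (intro test_function_smooth_mult[OF U _ \<psi>]) (auto simp: smooth_vector_field_def)
  have t2: "test_function \<Omega> (\<lambda>y. \<phi> y * (V y $ k * \<psi> y))" for k
    by (rule test_function_smooth_mult[OF open_UNIV _ s\<phi>(1) t1]) simp
  have pd: "partial k (\<lambda>y. \<phi> y * (V y $ k * \<psi> y)) x = partial k \<phi> x * (V x $ k * \<psi> x) + \<phi> x * partial k (\<lambda>y. V y $ k * \<psi> y) x" for k x
    using s\<phi> t1[of k] by (intro partial_mult) (auto intro!: smooth_on_differentiable[of UNIV] simp: test_function_def)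
  have s: "(\<Sum>k\<in>UNIV. partial k (\<lambda>y. \<phi> y * (V y $ k * \<psi> y)) x) = (grad \<phi> x \<bullet> V x) * \<psi> x - \<phi> x * formal_adjoint V \<psi> x" for x
    unfolding pd by (simp add: sum.distrib formal_adjoint_def inner_vec_def grad_def sum_distrib_right sum_distrib_left mult.assoc)
  have tA: "test_function \<Omega> (\<lambda>x. (grad \<phi> x \<bullet> V x) * \<psi> x)"
    by (rule test_function_smooth_mult[OF open_UNIV]) (use test_function_Xderiv[OF U V \<phi>] \<psi> in \<open>auto simp: test_function_def\<close>)
  have tB: "test_function \<Omega> (\<lambda>x. \<phi> x * formal_adjoint V \<psi> x)"
    by (rule test_function_smooth_mult[OF open_UNIV _ s\<phi>(1) test_function_formal_adjoint[OF U V \<psi>]]) simp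
  have "(LINT x|lborel. (grad \<phi> x \<bullet> V x) * \<psi> x) - (LINT x|lborel. \<phi> x * formal_adjoint V \<psi> x) = (LINT x|lborel. (\<Sum>k\<in>UNIV. partial k (\<lambda>y. \<phi> y * (V y $ k * \<psi> y)) x))"
    unfolding s by (rule Bochner_Integration.integral_diff[symmetric]) (rule test_function_integrable[OF tA], rule test_function_integrable[OF tB])
  also have "\<dots> = (\<Sum>k\<in>UNIV. LINT x|lborel. partial k (\<lambda>y. \<phi> y * (V y $ k * \<psi> y)) x)"
    by (rule Bochner_Integration.integral_sum) (rule test_function_integrable[OF test_function_partial[OF t2]])
  also have "\<dots> = 0" using integral_partial_test_function[OF t2] by simp
  finally show ?thesis using integral_test_function[OF tA \<Omega>] integral_test_function[OF tB \<Omega>] by simp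
qed

section \<open>The fundamental lemma and uniqueness of weak derivatives\<close>

lemma borel_measurable_lebesgue_on: "f \<in> borel_measurable borel \<Longrightarrow> f \<in> borel_measurable (lebesgue_on S)"
  by (intro measurable_restrict_space1 measurable_completion) simp

lemma One_vec_nth: "(One :: real^'n) $ i = 1"
proof -
  have "(\<Sum>b\<in>(Basis :: (real^'n) set). (1 :: real) *\<^sub>R b) \<bullet> (axis i 1 :: real^'n) = (1 :: real)"
    by (rule inner_sum_left_Basis) (rule axis_in_Basis_iff[THEN iffD2], simp)
  then have "(One :: real^'n) \<bullet> axis i 1 = 1" by (simp only: scaleR_one)
  then show ?thesis by (simp only: cart_eq_inner_axis)
qed

lemma L1_loc_measurable:
  assumes \<Omega>: "open \<Omega>" and f: "L1_loc \<Omega> f"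
  shows "f \<in> borel_measurable (lebesgue_on \<Omega>)"
proof -
  obtain D where D: "countable D" "D \<subseteq> Pow \<Omega>" "\<And>X. X \<in> D \<Longrightarrow> \<exists>a b. X = cbox a b" "\<Union>D = \<Omega>"
    using open_countable_Union_open_cbox[OF \<Omega>] by metis
  have sub: "X \<subseteq> \<Omega>" "compact X" "X \<in> sets lebesgue" if "X \<in> D" for X
    using D(2) D(3)[OF that] that by auto
  show ?thesis
  proof (rule measurable_piecewise_restrict[OF D(1)])
    show "X \<inter> space (lebesgue_on \<Omega>) \<in> sets (lebesgue_on \<Omega>)" if "X \<in> D" for X
      using sub[OF that] \<Omega> by (auto simp: sets_restrict_space_iff Int_absorb2)
    show "space (lebesgue_on \<Omega>) \<subseteq> \<Union> D" using D(4) by simp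
    fix X assume X: "X \<in> D"
    have "f \<in> borel_measurable (lebesgue_on X)"
      using f sub[OF X] by (auto simp: L1_loc_def absolutely_integrable_measurable)
    moreover have "restrict_space (lebesgue_on \<Omega>) X = lebesgue_on X"
      using sub[OF X] \<Omega> by (subst restrict_restrict_space) (auto simp: Int_absorb1)
    ultimately show "f \<in> borel_measurable (restrict_space (lebesgue_on \<Omega>) X)" by simp
  qed
qed

lemma L1_loc_mult_integrable:
  assumes \<Omega>: "open \<Omega>" and f: "L1_loc \<Omega> f" and \<phi>: "test_function \<Omega> \<phi>"
  shows "integrable (lebesgue_on \<Omega>) (\<lambda>x. f x * \<phi> x)"
proof -
  obtain C where C: "compact C" "C \<subseteq> \<Omega>" "\<And>x. x \<notin> C \<Longrightarrow> \<phi> x = 0" using test_functionD[OF \<phi>] by blast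
  obtain B where B: "B \<ge> 0" "\<And>x. \<bar>\<phi> x\<bar> \<le> B" using test_function_bounded[OF \<phi>] by blast
  have [measurable]: "f \<in> borel_measurable (lebesgue_on \<Omega>)" by (rule L1_loc_measurable[OF \<Omega> f])
  have [measurable]: "\<phi> \<in> borel_measurable (lebesgue_on \<Omega>)"
    by (rule borel_measurable_lebesgue_on[OF test_function_measurable[OF \<phi>]])
  have "set_integrable lebesgue C f" using f C by (auto simp: L1_loc_def)
  then have "integrable lebesgue (\<lambda>x. indicator \<Omega> x *\<^sub>R (indicator C x * f x))"
    using C(2) by (simp add: set_integrable_def indicator_inter_arith[symmetric] Int_absorb1 mult.assoc[symmetric] flip: indicator_inter_arith)
  then have "integrable (lebesgue_on \<Omega>) (\<lambda>x. indicator C x * f x)"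
    using \<Omega> by (subst integrable_restrict_space) auto
  then have "integrable (lebesgue_on \<Omega>) (\<lambda>x. B * (indicator C x * f x))" by simp
  then show ?thesis
  proof (rule Bochner_Integration.integrable_bound)
    show "AE x in lebesgue_on \<Omega>. norm (f x * \<phi> x) \<le> norm (B * (indicator C x * f x))"
    proof (intro AE_I2)
      fix x
      have "\<bar>f x\<bar> * \<bar>\<phi> x\<bar> \<le> \<bar>f x\<bar> * B" by (intro mult_left_mono B) auto
      then show "norm (f x * \<phi> x) \<le> norm (B * (indicator C x * f x))"
        using C(3)[of x] B(1) by (auto simp: indicator_def abs_mult mult.commute)
    qed
  qed measurable
qed

definition box_bump :: "real^'n \<Rightarrow> real^'n \<Rightarrow> real^'n \<Rightarrow> real" where
  "box_bump a b x = (\<Prod>i\<in>UNIV. flat_exp 0 (x $ i - a $ i) * flat_exp 0 (b $ i - x $ i))"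

lemma box_bump:
  shows "smooth_on UNIV (box_bump a b)" "0 \<le> box_bump a b x" "x \<in> box a b \<Longrightarrow> 0 < box_bump a b x" "x \<notin> box a b \<Longrightarrow> box_bump a b x = 0"
proof -
  show "smooth_on UNIV (box_bump a b)"
    unfolding box_bump_def[abs_def]
    by (intro smooth_on_prod smooth_on_mult smooth_on_flat_exp smooth_on_diff smooth_on_nth smooth_on_const open_UNIV)
  show "0 \<le> box_bump a b x" unfolding box_bump_def by (intro prod_nonneg ballI mult_nonneg_nonneg flat_exp_pos)
  show "0 < box_bump a b x" if "x \<in> box a b"
    unfolding box_bump_def using that by (intro prod_pos mult_pos_pos) (auto simp: flat_exp_pos mem_box_cart)
  show "box_bump a b x = 0" if "x \<notin> box a b"
    using that unfolding box_bump_def by (auto simp: mem_box_cart not_less flat_exp_pos)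
qed

lemma box_bump_outside: "x \<notin> cbox a b \<Longrightarrow> box_bump a b x = 0"
  by (meson box_bump(4) box_subset_cbox subsetD)

lemma test_function_box_bump:
  assumes "cbox a b \<subseteq> \<Omega>"
  shows "test_function \<Omega> (box_bump a b)"
  by (rule test_functionI[OF box_bump(1) compact_cbox assms box_bump_outside])

text \<open>With a bump b that is positive exactly on the open box, 1 - exp(-m b) is smooth,
  vanishes off the box, has values in [0,1] and tends to the indicator of the open box. Dominated
  convergence carries the vanishing over to the box.\<close>

lemma integral_box_eq_0:
  assumes \<Omega>: "open \<Omega>" and g: "L1_loc \<Omega> g"
    and z: "\<And>\<phi>. test_function \<Omega> \<phi> \<Longrightarrow> (LINT x|lebesgue_on \<Omega>. g x * \<phi> x) = 0" and ab: "cbox a b \<subseteq> \<Omega>"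
  shows "integral (cbox a b) g = 0"
proof -
  define \<theta> where "\<theta> m x = 1 - exp (- real m * box_bump a b x)" for m x
  have \<theta>: "test_function \<Omega> (\<theta> m)" for m
  proof (rule test_functionI[OF _ compact_cbox ab])
    show "smooth_on UNIV (\<theta> m)" unfolding \<theta>_def[abs_def]
      by (intro smooth_on_diff smooth_on_exp smooth_on_mult smooth_on_const box_bump(1) open_UNIV)
    show "\<theta> m x = 0" if "x \<notin> cbox a b" for x using that by (simp add: \<theta>_def box_bump_outside)
  qed
  have \<theta>b: "0 \<le> \<theta> m x" "\<theta> m x \<le> indicator (cbox a b) x" for m x
  proof -
    show "0 \<le> \<theta> m x" using box_bump(2)[of a b x] by (simp add: \<theta>_def)
    show "\<theta> m x \<le> indicator (cbox a b) x"
      by (cases "x \<in> cbox a b") (simp_all add: \<theta>_def box_bump_outside)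
  qed
  have [measurable]: "g \<in> borel_measurable (lebesgue_on \<Omega>)" by (rule L1_loc_measurable[OF \<Omega> g])
  have set: "set_integrable lebesgue (cbox a b) g" using g ab by (auto simp: L1_loc_def)
  then have "integrable lebesgue (\<lambda>x. indicator \<Omega> x *\<^sub>R (indicator (cbox a b) x * g x))"
    unfolding set_integrable_def by (rule Bochner_Integration.integrable_cong[THEN iffD1, rotated -1]) (use ab in \<open>auto simp: indicator_def\<close>)
  then have dom: "integrable (lebesgue_on \<Omega>) (\<lambda>x. indicator (cbox a b) x * g x)"
    using \<Omega> by (subst integrable_restrict_space) auto
  have bm: "box a b \<inter> \<Omega> \<in> sets (lebesgue_on \<Omega>)" using \<Omega> by (auto simp: sets_restrict_space)
  have "(\<lambda>m. LINT x|lebesgue_on \<Omega>. g x * \<theta> m x) \<longlonglongrightarrow> (LINT x|lebesgue_on \<Omega>. g x * indicator (box a b \<inter> \<Omega>) x)"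
  proof (rule integral_dominated_convergence[where w="\<lambda>x. norm (indicator (cbox a b) x * g x)"])
    show "(\<lambda>x. g x * indicator (box a b \<inter> \<Omega>) x) \<in> borel_measurable (lebesgue_on \<Omega>)" using bm by measurable
    show "(\<lambda>x. g x * \<theta> m x) \<in> borel_measurable (lebesgue_on \<Omega>)" for m
      using L1_loc_mult_integrable[OF \<Omega> g \<theta>] by (rule borel_measurable_integrable)
    show "integrable (lebesgue_on \<Omega>) (\<lambda>x. norm (indicator (cbox a b) x * g x))" using dom by (rule integrable_norm)
    show "AE x in lebesgue_on \<Omega>. (\<lambda>m. g x * \<theta> m x) \<longlonglongrightarrow> g x * indicator (box a b \<inter> \<Omega>) x"
    proof (intro AE_I2)
      fix x assume "x \<in> space (lebesgue_on \<Omega>)"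
      then have x: "x \<in> \<Omega>" by simp
      have "(\<lambda>m. \<theta> m x) \<longlonglongrightarrow> indicator (box a b) x"
      proof (cases "x \<in> box a b")
        case True
        let ?q = "exp (- box_bump a b x)"
        have "?q < 1" using box_bump(3)[OF True] by simp
        then have "(\<lambda>m. 1 - ?q ^ m) \<longlonglongrightarrow> 1 - 0" by (intro tendsto_diff tendsto_const LIMSEQ_power_zero) auto
        moreover have "?q ^ m = exp (- real m * box_bump a b x)" for m by (simp add: exp_of_nat_mult[symmetric])
        ultimately show ?thesis using True by (simp add: \<theta>_def)
      next
        case False
        then show ?thesis using box_bump(4)[OF False] by (simp add: \<theta>_def)
      qed
      then show "(\<lambda>m. g x * \<theta> m x) \<longlonglongrightarrow> g x * indicator (box a b \<inter> \<Omega>) x"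
        using x by (intro tendsto_mult tendsto_const) (auto simp: indicator_def)
    qed
    show "AE x in lebesgue_on \<Omega>. norm (g x * \<theta> m x) \<le> norm (indicator (cbox a b) x * g x)" for m
    proof (intro AE_I2)
      fix x
      have "\<bar>g x\<bar> * \<theta> m x \<le> \<bar>g x\<bar> * indicator (cbox a b) x" by (intro mult_left_mono \<theta>b) auto
      then show "norm (g x * \<theta> m x) \<le> norm (indicator (cbox a b) x * g x)"
        using \<theta>b(1)[of m x] by (simp add: abs_mult mult.commute)
    qed
  qed
  then have "(LINT x|lebesgue_on \<Omega>. g x * indicator (box a b \<inter> \<Omega>) x) = 0"
    unfolding z[OF \<theta>] by (rule LIMSEQ_unique[OF _ tendsto_const])
  moreover have "(LINT x|lebesgue_on \<Omega>. g x * indicator (box a b \<inter> \<Omega>) x) = (LINT x|lebesgue. indicator \<Omega> x *\<^sub>R (g x * indicator (box a b \<inter> \<Omega>) x))"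
    using \<Omega> by (intro integral_restrict_space) auto
  moreover have "(\<lambda>x. indicator \<Omega> x *\<^sub>R (g x * indicator (box a b \<inter> \<Omega>) x)) = (\<lambda>x. indicator (box a b) x *\<^sub>R g x)"
    using ab box_subset_cbox[of a b] by (auto simp: indicator_def fun_eq_iff)
  moreover have "set_integrable lebesgue (box a b) g" by (rule set_integrable_subset[OF set]) (auto simp: box_subset_cbox)
  ultimately show ?thesis
    using set_lebesgue_integral_eq_integral(2)[of "box a b" g] by (simp add: set_lebesgue_integral_def integral_open_interval)
qed

text \<open>By \<open>integral_box_eq_0\<close> the integral of g over every closed box in \<Omega>
  is 0, while at almost every point g is the limit of its averages over shrinking cubes with a
  corner there. Restricting g to one box of a countable cover makes it integrable; the faces of the
  boxes are negligible.\<close>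

lemma fundamental_lemma:
  fixes g :: "real^'n \<Rightarrow> real"
  assumes \<Omega>: "open \<Omega>" and g: "L1_loc \<Omega> g"
    and z: "\<And>\<phi>. test_function \<Omega> \<phi> \<Longrightarrow> (LINT x|lebesgue_on \<Omega>. g x * \<phi> x) = 0"
  shows "AE x in lebesgue_on \<Omega>. g x = 0"
proof -
  obtain D where D: "countable D" "D \<subseteq> Pow \<Omega>" "\<And>X. X \<in> D \<Longrightarrow> \<exists>a b. X = cbox a b" "\<Union>D = \<Omega>"
    using open_countable_Union_open_cbox[OF \<Omega>] by metis
  have neg: "negligible {x\<in>X. g x \<noteq> 0}" if X: "X \<in> D" for X
  proof -
    obtain c d where cd: "X = cbox c d" using D(3)[OF X] by blast
    have sub: "cbox c d \<subseteq> \<Omega>" using D(2) X cd by auto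
    define h where "h x = (if x \<in> cbox c d then g x else 0)" for x
    have "g absolutely_integrable_on cbox c d" using g sub by (auto simp: L1_loc_def)
    then have "h absolutely_integrable_on UNIV" unfolding h_def by (simp add: absolutely_integrable_restrict_UNIV)
    then have hi: "h integrable_on cbox a b" for a b
      using absolutely_integrable_on_def integrable_on_subcbox by blast
    obtain N where N: "negligible N" "\<And>x e. x \<notin> N \<Longrightarrow> 0 < e \<Longrightarrow> \<exists>d>0. \<forall>s. 0 < s \<and> s < d \<longrightarrow>
                         norm (integral (cbox x (x + s *\<^sub>R One)) h /\<^sub>R s ^ DIM(real^'n) - h x) < e"
      using integrable_ccontinuous_explicit[of h, OF hi] by metis
    have "g x = 0" if x: "x \<in> box c d" "x \<notin> N" for x
    proof (rule ccontr)
      assume "g x \<noteq> 0"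
      then obtain q where q: "q > 0" "\<And>s. 0 < s \<Longrightarrow> s < q \<Longrightarrow> norm (integral (cbox x (x + s *\<^sub>R One)) h /\<^sub>R s ^ DIM(real^'n) - h x) < \<bar>g x\<bar>"
        using N(2)[OF x(2), of "\<bar>g x\<bar>"] by auto
      obtain \<rho> where \<rho>: "\<rho> > 0" "cball x \<rho> \<subseteq> box c d" using open_contains_cball[of "box c d"] open_box x(1) by metis
      define s where "s = min (q / 2) (\<rho> / real CARD('n))"
      have s: "s > 0" "s < q" "s * real CARD('n) \<le> \<rho>" 
      proof -
        show "s > 0" "s < q" using q(1) \<rho>(1) by (auto simp: s_def)
        have "s \<le> \<rho> / real CARD('n)" by (simp add: s_def)
        then show "s * real CARD('n) \<le> \<rho>" by (simp add: pos_le_divide_eq)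
      qed
      have sb: "cbox x (x + s *\<^sub>R One) \<subseteq> cbox c d"
      proof
        fix y assume y: "y \<in> cbox x (x + s *\<^sub>R One)"
        have yc: "x $ i \<le> y $ i \<and> y $ i \<le> x $ i + s" for i using y by (simp add: mem_box_cart One_vec_nth del: sum_component)
        have "norm (y - x) \<le> (\<Sum>i\<in>(UNIV::'n set). s)" by (rule norm_vec_le_sum_bound) (use yc in \<open>auto simp: abs_le_iff algebra_simps\<close>)
        then have "y \<in> cball x \<rho>" using s(3) by (simp add: dist_norm norm_minus_commute mult.commute)
        then show "y \<in> cbox c d" using \<rho>(2) box_subset_cbox by blast
      qed
      have "integral (cbox x (x + s *\<^sub>R One)) h = integral (cbox x (x + s *\<^sub>R One)) g"
        by (rule Henstock_Kurzweil_Integration.integral_cong) (use sb in \<open>auto simp: h_def\<close>)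
      also have "\<dots> = 0" by (rule integral_box_eq_0[OF \<Omega> g z]) (use sb sub in auto)
      finally have "norm (h x) < \<bar>g x\<bar>" using q(2)[OF s(1,2)] by simp
      moreover have "h x = g x" using x(1) box_subset_cbox[of c d] by (auto simp: h_def)
      ultimately show False by simp
    qed
    then have "{x\<in>X. g x \<noteq> 0} \<subseteq> N \<union> (cbox c d - box c d)" using cd by auto
    moreover have "negligible (N \<union> (cbox c d - box c d))" using N(1) negligible_frontier_interval by (intro negligible_Un)
    ultimately show ?thesis using negligible_subset by blast
  qed
  have "negligible (\<Union>X\<in>D. {x\<in>X. g x \<noteq> 0})" using D(1) neg by (intro negligible_countable_Union) auto
  moreover have "(\<Union>X\<in>D. {x\<in>X. g x \<noteq> 0}) = {x\<in>\<Omega>. g x \<noteq> 0}" using D(4) by auto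
  ultimately have "{x\<in>\<Omega>. g x \<noteq> 0} \<in> null_sets lebesgue" by (simp add: negligible_iff_null_sets)
  then show ?thesis
    using \<Omega> by (subst AE_restrict_space_iff) (auto intro: AE_I')
qed

lemma L1_loc_diff: "L1_loc \<Omega> f \<Longrightarrow> L1_loc \<Omega> g \<Longrightarrow> L1_loc \<Omega> (\<lambda>x. f x - g x)"
  by (auto simp: L1_loc_def intro: set_integral_diff(1))

lemma L1_loc_add_scaled: 
  assumes "L1_loc \<Omega> f" "L1_loc \<Omega> g"
  shows "L1_loc \<Omega> (\<lambda>x. f x + c * g x)"
  using assms by (auto simp: L1_loc_def intro!: set_integral_add(1) set_integrable_mult_right)

lemma has_weak_derivative_unique:
  assumes \<Omega>: "open \<Omega>" and g: "has_weak_derivative \<Omega> V f g" and h: "has_weak_derivative \<Omega> V f h"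
  shows "AE x in lebesgue_on \<Omega>. g x = h x"
proof -
  have "AE x in lebesgue_on \<Omega>. g x - h x = 0"
  proof (rule fundamental_lemma[OF \<Omega>])
    show "L1_loc \<Omega> (\<lambda>x. g x - h x)" using g h by (auto simp: has_weak_derivative_def intro: L1_loc_diff)
    fix \<phi> assume \<phi>: "test_function \<Omega> \<phi>"
    have "(LINT x|lebesgue_on \<Omega>. (g x - h x) * \<phi> x) = (LINT x|lebesgue_on \<Omega>. g x * \<phi> x) - (LINT x|lebesgue_on \<Omega>. h x * \<phi> x)"
      unfolding left_diff_distrib
      by (rule Bochner_Integration.integral_diff) (use g h \<phi> L1_loc_mult_integrable[OF \<Omega>] in \<open>auto simp: has_weak_derivative_def\<close>)
    then show "(LINT x|lebesgue_on \<Omega>. (g x - h x) * \<phi> x) = 0" using g h \<phi> by (simp add: has_weak_derivative_def)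
  qed
  then show ?thesis by simp
qed

lemma has_weak_derivative_add_scaled:
  assumes U: "open U" "\<Omega> \<subseteq> U" and \<Omega>: "open \<Omega>" and V: "smooth_vector_field U V"
    and g: "has_weak_derivative \<Omega> V f g" and h: "has_weak_derivative \<Omega> V f' h"
  shows "has_weak_derivative \<Omega> V (\<lambda>x. f x + c * f' x) (\<lambda>x. g x + c * h x)"
  unfolding has_weak_derivative_def
proof (intro conjI allI impI L1_loc_add_scaled)
  fix \<phi> assume \<phi>: "test_function \<Omega> \<phi>"
  have lin: "(LINT x|lebesgue_on \<Omega>. (u x + c * v x) * \<psi> x) = (LINT x|lebesgue_on \<Omega>. u x * \<psi> x) + c * (LINT x|lebesgue_on \<Omega>. v x * \<psi> x)"
    if "L1_loc \<Omega> u" "L1_loc \<Omega> v" "test_function \<Omega> \<psi>" for u v \<psi>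
    using L1_loc_mult_integrable[OF \<Omega> that(1,3)] L1_loc_mult_integrable[OF \<Omega> that(2,3)]
    by (simp add: distrib_right mult.assoc)
  show "(LINT x|lebesgue_on \<Omega>. (g x + c * h x) * \<phi> x) = (LINT x|lebesgue_on \<Omega>. (f x + c * f' x) * formal_adjoint V \<phi> x)"
    using g h \<phi> test_function_formal_adjoint[OF U V \<phi>] by (simp add: has_weak_derivative_def lin)
qed (use g h in \<open>auto simp: has_weak_derivative_def\<close>)

lemma test_function_L1_loc: "test_function \<Omega> \<phi> \<Longrightarrow> L1_loc \<Omega> \<phi>"
  unfolding L1_loc_def set_integrable_def
  by (intro allI impI integrable_mult_indicator) 
     (auto simp: compact_imp_closed test_function_measurable intro!: integrable_completion[THEN iffD2] test_function_integrable)

lemma has_weak_derivative_test_function: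
  assumes U: "open U" "\<Omega> \<subseteq> U" and \<Omega>: "open \<Omega>" and V: "smooth_vector_field U V" and \<phi>: "test_function \<Omega> \<phi>"
  shows "has_weak_derivative \<Omega> V \<phi> (\<lambda>x. grad \<phi> x \<bullet> V x)"
  unfolding has_weak_derivative_def
  using test_function_L1_loc[OF \<phi>] test_function_L1_loc[OF test_function_Xderiv[OF U V \<phi>]] integration_by_parts[OF U \<Omega> V \<phi>] by blast

section \<open>Lebesgue spaces\<close>

lemma powr_pred_mult: "0 \<le> (x::real) \<Longrightarrow> x powr (p - 1) * x = x powr p"
  using powr_mult_base[of x "p - 1"] by (simp add: mult.commute)

lemma powr_tangent_strict:
  fixes s z p :: real
  assumes p: "1 < p" and s: "0 < s" and z: "0 \<le> z" "z \<noteq> s"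
  shows "s powr p + p * s powr (p - 1) * (z - s) < z powr p"
proof -
  have D: "((\<lambda>x. x powr p) has_real_derivative p * x powr (p - 1)) (at x)" if "x > 0" for x :: real
    using that by (rule has_real_derivative_powr)
  consider "z = 0" | "0 < z" "z < s" | "s < z" using z s by linarith
  then show ?thesis
  proof cases
    case 1
    have "s powr p = s powr (p - 1) * s" using s by (simp add: powr_pred_mult)
    moreover have "(1 - p) * (s powr (p - 1) * s) < 0" using p s by (intro mult_neg_pos) auto
    ultimately show ?thesis using 1 p by (simp add: algebra_simps)
  next
    case 2
    obtain \<xi> where \<xi>: "z < \<xi>" "\<xi> < s" "s powr p - z powr p = (s - z) * (p * \<xi> powr (p - 1))"
      using MVT2[of z s "\<lambda>x. x powr p" "\<lambda>x. p * x powr (p - 1)"] D 2 by force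
    have "\<xi> powr (p - 1) < s powr (p - 1)" using \<xi> 2 p by (intro powr_less_mono2) auto
    then have "(s - z) * (p * \<xi> powr (p - 1)) < (s - z) * (p * s powr (p - 1))" using 2 p by (intro mult_strict_left_mono) auto
    then show ?thesis using \<xi>(3) by (simp add: algebra_simps)
  next
    case 3
    obtain \<xi> where \<xi>: "s < \<xi>" "\<xi> < z" "z powr p - s powr p = (z - s) * (p * \<xi> powr (p - 1))"
      using MVT2[of s z "\<lambda>x. x powr p" "\<lambda>x. p * x powr (p - 1)"] D 3 s by force
    have "s powr (p - 1) < \<xi> powr (p - 1)" using \<xi> s p by (intro powr_less_mono2) auto
    then have "(z - s) * (p * s powr (p - 1)) < (z - s) * (p * \<xi> powr (p - 1))" using 3 p by (intro mult_strict_left_mono) auto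
    then show ?thesis using \<xi>(3) by (simp add: algebra_simps)
  qed
qed

lemma powr_tangent:
  fixes s z p :: real
  assumes "1 < p" "0 < s" "0 \<le> z"
  shows "s powr p + p * s powr (p - 1) * (z - s) \<le> z powr p"
  using powr_tangent_strict[OF assms] by (cases "z = s") auto

lemma powr_convex_comb:
  fixes x y t p :: real
  assumes p: "1 < p" and "0 \<le> x" "0 \<le> y" "0 \<le> t" "t \<le> 1"
  shows "((1 - t) * x + t * y) powr p \<le> (1 - t) * x powr p + t * y powr p"
proof -
  define s where "s = (1 - t) * x + t * y"
  have "s \<ge> 0" using assms by (simp add: s_def)
  show ?thesis
  proof (cases "s = 0")
    case True
    then show ?thesis using assms by (simp add: s_def[symmetric])
  next
    case False
    then have s: "s > 0" using \<open>s \<ge> 0\<close> by simp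
    let ?c = "p * s powr (p - 1)"
    have "s powr p = (1 - t) * (s powr p + ?c * (x - s)) + t * (s powr p + ?c * (y - s))"
    proof -
      have "(1 - t) * (s powr p + ?c * (x - s)) + t * (s powr p + ?c * (y - s)) = s powr p + ?c * (((1 - t) * x + t * y) - s)"
        by (simp add: algebra_simps)
      then show ?thesis by (simp add: s_def)
    qed
    also have "\<dots> \<le> (1 - t) * x powr p + t * y powr p"
      using assms s by (intro add_mono mult_left_mono powr_tangent) auto
    finally show ?thesis by (simp add: s_def)
  qed
qed

lemma powr_midpoint_strict:
  fixes x y p :: real
  assumes p: "1 < p" and "0 \<le> x" "0 \<le> y" "x \<noteq> y"
  shows "((x + y) / 2) powr p < (x powr p + y powr p) / 2"
proof -
  define s where "s = (x + y) / 2"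
  have s: "s > 0" "x \<noteq> s" "y \<noteq> s" using assms by (auto simp: s_def)
  have "2 * s powr p = (s powr p + p * s powr (p - 1) * (x - s)) + (s powr p + p * s powr (p - 1) * (y - s))"
  proof -
    have "(x - s) + (y - s) = 0" by (simp add: s_def field_simps)
    then have "p * s powr (p - 1) * (x - s) + p * s powr (p - 1) * (y - s) = 0" by (simp only: distrib_left[symmetric] mult_zero_right)
    then show ?thesis by simp
  qed
  also have "\<dots> < x powr p + y powr p" using powr_tangent_strict[OF p s(1)] assms s by (intro add_strict_mono) auto
  finally show ?thesis by (simp add: s_def)
qed

lemma norm_powr_convex:
  fixes a b :: "'a::real_normed_vector"
  assumes p: "1 < p" and t: "0 \<le> t" "t \<le> 1"
  shows "norm ((1 - t) *\<^sub>R a + t *\<^sub>R b) powr p \<le> (1 - t) * norm a powr p + t * norm b powr p"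
proof -
  have "norm ((1 - t) *\<^sub>R a + t *\<^sub>R b) \<le> (1 - t) * norm a + t * norm b"
    using t norm_triangle_ineq[of "(1 - t) *\<^sub>R a" "t *\<^sub>R b"] by simp
  then have "norm ((1 - t) *\<^sub>R a + t *\<^sub>R b) powr p \<le> ((1 - t) * norm a + t * norm b) powr p"
    using p by (intro powr_mono2) auto
  also have "\<dots> \<le> (1 - t) * norm a powr p + t * norm b powr p" by (rule powr_convex_comb) (use p t in auto)
  finally show ?thesis .
qed

lemma norm_powr_add_le:
  fixes a b :: "'a::real_normed_vector"
  assumes p: "1 < p"
  shows "norm (a + b) powr p \<le> 2 powr p * (norm a powr p + norm b powr p)"
proof -
  have "norm ((1 - 1/2) *\<^sub>R (2 *\<^sub>R a) + (1/2) *\<^sub>R (2 *\<^sub>R b)) powr p \<le> (1 - 1/2) * norm (2 *\<^sub>R a) powr p + (1/2) * norm (2 *\<^sub>R b) powr p"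
    by (rule norm_powr_convex[OF p]) auto
  then have "norm (a + b) powr p \<le> (1/2) * (2 powr p * norm a powr p) + (1/2) * (2 powr p * norm b powr p)"
    by (simp add: powr_mult)
  also have "\<dots> \<le> 2 powr p * (norm a powr p + norm b powr p)"
  proof -
    have "0 \<le> 2 powr p * norm a powr p" "0 \<le> 2 powr p * norm b powr p" by auto
    then show ?thesis unfolding distrib_left by linarith
  qed
  finally show ?thesis .
qed

lemma norm_powr_midpoint_strict:
  fixes a b :: "'a::real_inner"
  assumes p: "1 < p" and ab: "a \<noteq> b"
  shows "norm ((a + b) /\<^sub>R 2) powr p < (norm a powr p + norm b powr p) / 2"
proof (cases "norm a = norm b")
  case False
  have "norm ((a + b) /\<^sub>R 2) powr p \<le> ((norm a + norm b) / 2) powr p"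
    using norm_triangle_ineq[of a b] p by (intro powr_mono2) auto
  also have "\<dots> < (norm a powr p + norm b powr p) / 2" using False by (intro powr_midpoint_strict p) auto
  finally show ?thesis .
next
  case True
  have "norm (a + b) \<noteq> norm a + norm b"
  proof
    assume "norm (a + b) = norm a + norm b"
    then have "norm a *\<^sub>R b = norm b *\<^sub>R a" using norm_triangle_eq by metis
    then have "a = b \<or> norm a = 0" using True by auto
    then show False using True ab by auto
  qed
  then have "norm (a + b) / 2 < norm a" using norm_triangle_ineq[of a b] True by simp
  then have "(norm (a + b) / 2) powr p < norm a powr p" using p by (intro powr_less_mono2) auto
  then show ?thesis using True by simp
qed

text \<open>A form of uniform convexity that treats all p > 1 alike. On the compact set of pairs
  with |a|^p + |b|^p = 1 and |a - b|^p \<ge> \<eta>, the convexity defect at the midpoint is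
  positive by strict convexity, hence bounded below. All three expressions are homogeneous of degree
  p, so the normalisation is no restriction.\<close>

lemma norm_powr_uniformly_convex:
  fixes dummy :: "'a::euclidean_space"
  assumes p: "1 < p" and \<eta>: "0 < \<eta>"
  shows "\<exists>c>0. \<forall>a b :: 'a. norm (a - b) powr p \<le> \<eta> * (norm a powr p + norm b powr p)
     + c * ((norm a powr p + norm b powr p) / 2 - norm ((a + b) /\<^sub>R 2) powr p)"
proof -
  define Q where "Q z = norm (fst z) powr p + norm (snd z) powr p" for z :: "'a \<times> 'a"
  define D where "D z = Q z / 2 - norm ((fst z + snd z) /\<^sub>R 2) powr p" for z :: "'a \<times> 'a"
  define E where "E z = norm (fst z - snd z) powr p" for z :: "'a \<times> 'a"
  have c1: "continuous_on UNIV (\<lambda>z. norm (f z) powr p)" if "continuous_on UNIV f" for f :: "'a \<times> 'a \<Rightarrow> 'a"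
    using p that by (intro continuous_on_powr' continuous_intros) auto
  have cQ: "continuous_on UNIV Q" unfolding Q_def by (intro continuous_intros c1)
  have cD: "continuous_on UNIV D" unfolding D_def
    by (intro continuous_on_diff continuous_on_divide cQ continuous_on_const c1[of "\<lambda>z. (fst z + snd z) /\<^sub>R 2"] continuous_intros) auto
  have cE: "continuous_on UNIV E" unfolding E_def by (intro continuous_intros c1)
  have D0: "0 \<le> D z" for z
    using norm_powr_midpoint_strict[OF p, of "fst z" "snd z"] by (cases "fst z = snd z") (auto simp: D_def Q_def scaleR_2[symmetric])
  define S where "S = {z. Q z = 1 \<and> \<eta> \<le> E z}"
  have "closed S" unfolding S_def
    by (intro closed_Collect_conj closed_Collect_eq closed_Collect_le cQ cE continuous_on_const)
  moreover have "bounded S"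
  proof -
    have le1: "norm a \<le> 1" if "norm a powr p \<le> 1" for a :: 'a
    proof (rule ccontr)
      assume "\<not> norm a \<le> 1"
      then have "1 powr p < norm a powr p" using p by (intro powr_less_mono2) auto
      then show False using that by simp
    qed
    have "S \<subseteq> cball 0 1 \<times> cball 0 1"
      using le1 unfolding S_def Q_def by (auto simp: mem_Times_iff) (smt (verit) powr_ge_zero)+
    then show ?thesis by (rule bounded_subset[rotated]) (intro bounded_Times bounded_cball)
  qed
  ultimately have S: "compact S" by (simp add: compact_eq_bounded_closed)
  have Dpos: "0 < D z" if "z \<in> S" for z
  proof -
    have "fst z \<noteq> snd z" using that \<eta> by (auto simp: S_def E_def)
    from norm_powr_midpoint_strict[OF p this] show ?thesis by (simp add: D_def Q_def)
  qed
  have "\<exists>\<delta>>0. \<forall>z\<in>S. \<delta> \<le> D z"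
  proof (cases "S = {}")
    case False
    obtain z0 where "z0 \<in> S" "\<And>z. z \<in> S \<Longrightarrow> D z0 \<le> D z"
      using continuous_attains_inf[OF S False continuous_on_subset[OF cD]] by auto
    then show ?thesis using Dpos by blast
  qed (auto intro: exI[of _ 1])
  then obtain \<delta> where \<delta>: "\<delta> > 0" "\<And>z. z \<in> S \<Longrightarrow> \<delta> \<le> D z" by blast
  \<comment> \<open>On S the crude bound |a - b|^p \<le> 2^p is paid for by a defect of at least
    \<delta>.\<close>
  define c where "c = 2 powr p / \<delta>"
  have c: "c > 0" using \<delta> by (simp add: c_def)
  have unit: "E z \<le> \<eta> + c * D z" if z: "Q z = 1" for z
  proof (cases "z \<in> S")
    case True
    have "E z \<le> 2 powr p * Q z" using norm_powr_add_le[OF p, of "fst z" "- snd z"] by (simp add: E_def Q_def)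
    also have "\<dots> = c * \<delta>" using z \<delta> by (simp add: c_def)
    also have "\<dots> \<le> c * D z" using c \<delta>(2)[OF True] by (intro mult_left_mono) auto
    finally show ?thesis using \<eta> by simp
  next
    case False
    then have "E z < \<eta>" using z by (simp add: S_def)
    then show ?thesis using c D0[of z] mult_nonneg_nonneg[of c "D z"] by linarith
  qed
  have scale: "Q (s *\<^sub>R z) = s powr p * Q z" "D (s *\<^sub>R z) = s powr p * D z" "E (s *\<^sub>R z) = s powr p * E z" if "s > 0" for s z
  proof -
    have n: "norm (s *\<^sub>R v) powr p = s powr p * norm v powr p" for v :: 'a
      using that by (simp add: powr_mult)
    have e1: "s *\<^sub>R fst z - s *\<^sub>R snd z = s *\<^sub>R (fst z - snd z)" by (simp add: scaleR_diff_right)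
    have e2: "(s *\<^sub>R fst z + s *\<^sub>R snd z) /\<^sub>R 2 = s *\<^sub>R ((fst z + snd z) /\<^sub>R 2)" by (simp add: scaleR_add_right)
    show Qs: "Q (s *\<^sub>R z) = s powr p * Q z" unfolding Q_def fst_scaleR snd_scaleR n by (simp only: distrib_left)
    show "D (s *\<^sub>R z) = s powr p * D z" unfolding D_def Qs fst_scaleR snd_scaleR e2 n by (simp add: right_diff_distrib)
    show "E (s *\<^sub>R z) = s powr p * E z" unfolding E_def fst_scaleR snd_scaleR e1 n ..
  qed
  have "E z \<le> \<eta> * Q z + c * D z" for z
  proof (cases "Q z = 0")
    case True
    then have "norm (fst z) powr p = 0" "norm (snd z) powr p = 0" unfolding Q_def by (smt (verit) powr_ge_zero)+
    then show ?thesis using c D0[of z] True by (simp add: E_def)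
  next
    case False
    then have Q: "Q z > 0" unfolding Q_def by (smt (verit) powr_ge_zero)
    define s where "s = (1 / Q z) powr (1 / p)"
    have s: "s > 0" "s powr p = 1 / Q z" using Q p by (auto simp: s_def powr_powr)
    have "E (s *\<^sub>R z) \<le> \<eta> + c * D (s *\<^sub>R z)" by (rule unit) (use s scale Q in simp)
    then have "E z / Q z \<le> \<eta> + c * (D z / Q z)" using scale[OF s(1)] s(2) by simp
    then have "(E z / Q z) * Q z \<le> (\<eta> + c * (D z / Q z)) * Q z" using Q by (intro mult_right_mono) auto
    then show ?thesis using Q by (simp add: distrib_right)
  qed
  from this[of "(a, b)" for a b] show ?thesis using c by (intro exI[of _ c]) (auto simp: E_def Q_def D_def)
qed

section \<open>Norms, completeness and uniform convexity in L^p\<close>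

definition in_Lp :: "'a measure \<Rightarrow> real \<Rightarrow> ('a \<Rightarrow> 'b::euclidean_space) \<Rightarrow> bool" where
  "in_Lp M p f \<longleftrightarrow> f \<in> borel_measurable M \<and> integrable M (\<lambda>x. norm (f x) powr p)"

text \<open>The p-th power of the L^p norm. Limits and variations are computed without roots;
  \<open>Lnorm\<close> is the norm itself.\<close>

definition pnorm :: "'a measure \<Rightarrow> real \<Rightarrow> ('a \<Rightarrow> 'b::euclidean_space) \<Rightarrow> real" where
  "pnorm M p f = (LINT x|M. norm (f x) powr p)"

lemma pnorm_nonneg: "0 \<le> pnorm M p f"
  unfolding pnorm_def by (intro Bochner_Integration.integral_nonneg) auto

lemma in_LpD: "in_Lp M p f \<Longrightarrow> f \<in> borel_measurable M" "in_Lp M p f \<Longrightarrow> integrable M (\<lambda>x. norm (f x) powr p)"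
  by (auto simp: in_Lp_def)

lemma in_Lp_bound:
  assumes "f \<in> borel_measurable M" "integrable M g" "\<And>x. norm (f x) powr p \<le> g x"
  shows "in_Lp M p f"
  unfolding in_Lp_def
proof (intro conjI assms(1))
  have [measurable]: "f \<in> borel_measurable M" by fact
  show "integrable M (\<lambda>x. norm (f x) powr p)"
    by (rule Bochner_Integration.integrable_bound[OF assms(2)]) (use assms(3) abs_ge_self order_trans in \<open>auto intro!: AE_I2, blast\<close>)
qed

lemma in_Lp_cong_AE:
  assumes "in_Lp M p f" "g \<in> borel_measurable M" "AE x in M. f x = g x"
  shows "in_Lp M p g" "pnorm M p f = pnorm M p g"
proof -
  have [measurable]: "f \<in> borel_measurable M" "g \<in> borel_measurable M" using assms by (auto simp: in_Lp_def)
  have AE: "AE x in M. norm (f x) powr p = norm (g x) powr p" using assms(3) by auto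
  show "in_Lp M p g"
    using assms integrable_cong_AE[OF _ _ AE] by (auto simp: in_Lp_def)
  show "pnorm M p f = pnorm M p g" unfolding pnorm_def by (rule integral_cong_AE) (use AE in measurable)
qed

context
  fixes M :: "'a measure" and p :: real
  assumes p: "1 < p"
begin

lemma in_Lp_add:
  assumes "in_Lp M p f" "in_Lp M p g"
  shows "in_Lp M p (\<lambda>x. f x + g x)"
  using assms norm_powr_add_le[OF p]
  by (intro in_Lp_bound[where g="\<lambda>x. 2 powr p * (norm (f x) powr p + norm (g x) powr p)"]) (auto simp: in_Lp_def)

lemma in_Lp_scale:
  assumes "in_Lp M p f"
  shows "in_Lp M p (\<lambda>x. c *\<^sub>R f x)"
  using assms by (auto simp: in_Lp_def powr_mult)

lemma in_Lp_diff: "in_Lp M p f \<Longrightarrow> in_Lp M p g \<Longrightarrow> in_Lp M p (\<lambda>x. f x - g x)"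
  using in_Lp_add[of f "\<lambda>x. (-1) *\<^sub>R g x"] in_Lp_scale[of g "-1"] by simp

lemma pnorm_scale: "pnorm M p (\<lambda>x. c *\<^sub>R f x) = \<bar>c\<bar> powr p * pnorm M p f"
  by (simp add: pnorm_def powr_mult)

lemma pnorm_minus_commute: "pnorm M p (\<lambda>x. f x - g x) = pnorm M p (\<lambda>x. g x - f x)"
  by (simp add: pnorm_def norm_minus_commute)

lemma pnorm_add_le:
  assumes "in_Lp M p f" "in_Lp M p g"
  shows "pnorm M p (\<lambda>x. f x + g x) \<le> 2 powr p * (pnorm M p f + pnorm M p g)"
proof -
  have "pnorm M p (\<lambda>x. f x + g x) \<le> (LINT x|M. 2 powr p * (norm (f x) powr p + norm (g x) powr p))"
    unfolding pnorm_def using assms in_Lp_add[OF assms] norm_powr_add_le[OF p]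
    by (intro integral_mono) (auto simp: in_Lp_def)
  then show ?thesis using assms by (simp add: pnorm_def in_Lp_def)
qed

text \<open>Minkowski's inequality without roots. The weight t = B/(A+B) is the one for which the
  rescaled bounds A/(1-t) and B/t both equal A + B, so that convexity of the p-th power
  suffices.\<close>

lemma pnorm_add_bound:
  assumes f: "in_Lp M p f" "pnorm M p f \<le> A powr p" "A > 0" and g: "in_Lp M p g" "pnorm M p g \<le> B powr p" "B > 0"
  shows "pnorm M p (\<lambda>x. f x + g x) \<le> (A + B) powr p"
proof -
  define t where "t = B / (A + B)"
  have t: "0 < t" "t < 1" "1 - t = A / (A + B)" using f g by (auto simp: t_def field_simps)
  have pt: "norm (f x + g x) powr p \<le> (1 - t) * ((1 / (1 - t)) powr p * norm (f x) powr p) + t * ((1 / t) powr p * norm (g x) powr p)" for x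
    using norm_powr_convex[OF p, of t "(1 / (1 - t)) *\<^sub>R f x" "(1 / t) *\<^sub>R g x"] t(1,2) by (simp add: powr_mult powr_divide)
  have "pnorm M p (\<lambda>x. f x + g x) \<le> (LINT x|M. (1 - t) * ((1 / (1 - t)) powr p * norm (f x) powr p) + t * ((1 / t) powr p * norm (g x) powr p))"
    unfolding pnorm_def using f g in_Lp_add[OF f(1) g(1)] pt by (intro integral_mono) (auto simp: in_Lp_def)
  also have "\<dots> = (1 - t) * ((1 / (1 - t)) powr p * pnorm M p f) + t * ((1 / t) powr p * pnorm M p g)"
    using f g by (simp add: pnorm_def in_Lp_def)
  also have "\<dots> \<le> (1 - t) * ((1 / (1 - t)) powr p * A powr p) + t * ((1 / t) powr p * B powr p)"
    using f g t by (intro add_mono mult_left_mono) auto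
  also have "\<dots> = (1 - t) * (A / (1 - t)) powr p + t * (B / t) powr p"
    using f g t by (simp add: powr_divide)
  also have "A / (1 - t) = A + B" unfolding t(3) using f g by simp
  also have "B / t = A + B" unfolding t_def using f g by simp
  finally show ?thesis by (simp add: algebra_simps)
qed

definition Lnorm :: "('a \<Rightarrow> 'b::euclidean_space) \<Rightarrow> real" where
  "Lnorm f = pnorm M p f powr (1 / p)"

lemma Lnorm_nonneg: "0 \<le> Lnorm f" by (simp add: Lnorm_def)

lemma Lnorm_powr: "Lnorm f powr p = pnorm M p f"
  using p pnorm_nonneg[of M p f] by (simp add: Lnorm_def powr_powr)

lemma Lnorm_triangle:
  assumes "in_Lp M p f" "in_Lp M p g"
  shows "Lnorm (\<lambda>x. f x + g x) \<le> Lnorm f + Lnorm g"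
proof (rule field_le_epsilon)
  fix e :: real assume e: "e > 0"
  \<comment> \<open>The added e/2 makes the bounds strictly positive, as
    \<open>pnorm_add_bound\<close> requires, even if one of the norms is 0.\<close>
  have b: "pnorm M p h \<le> (Lnorm h + e/2) powr p" for h :: "'a \<Rightarrow> 'b"
    unfolding Lnorm_powr[symmetric] using e p by (intro powr_mono2) (auto simp: Lnorm_nonneg)
  have "pnorm M p (\<lambda>x. f x + g x) \<le> ((Lnorm f + e/2) + (Lnorm g + e/2)) powr p"
    using e by (intro pnorm_add_bound assms b) (auto intro: add_nonneg_pos Lnorm_nonneg)
  then have "Lnorm (\<lambda>x. f x + g x) \<le> (((Lnorm f + e/2) + (Lnorm g + e/2)) powr p) powr (1 / p)"
    unfolding Lnorm_def[of "\<lambda>x. f x + g x"] using p by (intro powr_mono2) (auto simp: pnorm_nonneg)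
  also have "\<dots> = (Lnorm f + e/2) + (Lnorm g + e/2)"
    using p e Lnorm_nonneg[of f] Lnorm_nonneg[of g] by (simp add: powr_powr)
  finally show "Lnorm (\<lambda>x. f x + g x) \<le> Lnorm f + Lnorm g + e" by simp
qed

lemma Lnorm_tendsto_0_iff: "(\<lambda>n. Lnorm (f n)) \<longlonglongrightarrow> 0 \<longleftrightarrow> (\<lambda>n. pnorm M p (f n)) \<longlonglongrightarrow> 0"
proof
  assume "(\<lambda>n. Lnorm (f n)) \<longlonglongrightarrow> 0"
  then have "(\<lambda>n. Lnorm (f n) powr p) \<longlonglongrightarrow> 0 powr p" 
    using p by (intro tendsto_powr' tendsto_const) (auto simp: Lnorm_nonneg)
  then show "(\<lambda>n. pnorm M p (f n)) \<longlonglongrightarrow> 0" using p by (simp add: Lnorm_powr)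
next
  assume "(\<lambda>n. pnorm M p (f n)) \<longlonglongrightarrow> 0"
  then have "(\<lambda>n. pnorm M p (f n) powr (1 / p)) \<longlonglongrightarrow> 0 powr (1 / p)"
    using p by (intro tendsto_powr' tendsto_const) (auto simp: pnorm_nonneg)
  then show "(\<lambda>n. Lnorm (f n)) \<longlonglongrightarrow> 0" using p by (simp add: Lnorm_def)
qed

lemma pnorm_tendsto:
  assumes f: "\<And>n. in_Lp M p (f n)" "in_Lp M p g" and lim: "(\<lambda>n. pnorm M p (\<lambda>x. f n x - g x)) \<longlonglongrightarrow> 0"
  shows "(\<lambda>n. pnorm M p (f n)) \<longlonglongrightarrow> pnorm M p g"
proof -
  have d: "\<bar>Lnorm (f n) - Lnorm g\<bar> \<le> Lnorm (\<lambda>x. f n x - g x)" for n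
  proof -
    have "Lnorm (\<lambda>x. g x - f n x) = Lnorm (\<lambda>x. f n x - g x)" unfolding Lnorm_def by (subst pnorm_minus_commute) simp
    then show ?thesis
      using Lnorm_triangle[OF in_Lp_diff[OF f(1)[of n] f(2)] f(2)] Lnorm_triangle[OF in_Lp_diff[OF f(2) f(1)[of n]] f(1)[of n]] by simp
  qed
  have "(\<lambda>n. Lnorm (f n) - Lnorm g) \<longlonglongrightarrow> 0"
    by (rule Lim_null_comparison[OF _ lim[folded Lnorm_tendsto_0_iff]]) (use d in auto)
  then have "(\<lambda>n. Lnorm (f n)) \<longlonglongrightarrow> Lnorm g" by (simp add: LIM_zero_iff)
  then have "(\<lambda>n. Lnorm (f n) powr p) \<longlonglongrightarrow> Lnorm g powr p"
    using p by (intro tendsto_powr' tendsto_const) (auto simp: Lnorm_nonneg)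
  then show ?thesis by (simp add: Lnorm_powr)
qed

end

text \<open>The way back from signed powers to the functions: closeness of the powers in L^1 gives
  closeness in L^p. For equal signs this is superadditivity of t^p on [0, \<infinity>), for opposite
  signs the convexity bound for a sum.\<close>

lemma abs_powr_root_diff:
  fixes x y p :: real
  assumes p: "1 < p"
  shows "\<bar>x - y\<bar> powr p \<le> 2 powr p * \<bar>\<bar>x\<bar> powr (p - 1) * x - \<bar>y\<bar> powr (p - 1) * y\<bar>"
proof -
  have mult: "a powr (p - 1) * a = a powr p" if "a \<ge> 0" for a :: real
    using that by (rule powr_pred_mult)
  have super: "(a - b) powr p \<le> a powr p - b powr p" if "0 \<le> b" "b \<le> a" for a b :: real
  proof (cases "b = 0 \<or> a = b")
    case False
    then have ab: "0 < b" "0 < a - b" using that by auto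
    have 1: "b powr p \<le> b * a powr (p - 1)" "(a - b) powr p \<le> (a - b) * a powr (p - 1)"
      using ab p that by (auto simp: mult[symmetric] mult.commute intro!: mult_left_mono powr_mono2)
    have "b * a powr (p - 1) + (a - b) * a powr (p - 1) = a powr p" using that by (simp add: mult[symmetric] algebra_simps)
    then show ?thesis using 1 by linarith
  qed auto
  have one: "1 \<le> 2 powr p" using p by (simp add: ge_one_powr_ge_zero)
  have main: "\<bar>x - y\<bar> powr p \<le> 2 powr p * \<bar>\<bar>x\<bar> powr (p - 1) * x - \<bar>y\<bar> powr (p - 1) * y\<bar>" if "y \<le> x" for x y :: real
  proof -
    consider "0 \<le> y" | "x \<le> 0" | "y < 0" "0 < x" by linarith
    then show ?thesis
    proof cases
      case 1
      have "\<bar>x - y\<bar> powr p \<le> 1 * \<bar>x powr p - y powr p\<bar>" using super[of y x] 1 that by simp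
      also have "\<dots> \<le> 2 powr p * \<bar>x powr p - y powr p\<bar>" using one by (intro mult_right_mono) auto
      finally show ?thesis using 1 that by (simp add: mult)
    next
      case 2
      have "\<bar>x - y\<bar> powr p \<le> 1 * \<bar>(-y) powr p - (-x) powr p\<bar>" using super[of "-x" "-y"] 2 that by simp
      also have "\<dots> \<le> 2 powr p * \<bar>(-y) powr p - (-x) powr p\<bar>" using one by (intro mult_right_mono) auto
      also have "(-y) powr p - (-x) powr p = \<bar>x\<bar> powr (p - 1) * x - \<bar>y\<bar> powr (p - 1) * y"
        using 2 that mult[of "-x"] mult[of "-y"] by simp
      finally show ?thesis .
    next
      case 3
      have "\<bar>x - y\<bar> powr p \<le> 2 powr p * (x powr p + (-y) powr p)"
        using norm_powr_add_le[OF p, of x "-y"] 3 by simp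
      also have "x powr p + (-y) powr p = \<bar>\<bar>x\<bar> powr (p - 1) * x - \<bar>y\<bar> powr (p - 1) * y\<bar>"
      proof -
        have "\<bar>y\<bar> powr (p - 1) * y = - ((- y) powr p)" using mult[of "-y"] 3 by simp
        then show ?thesis using 3 mult[of x] by simp
      qed
      finally show ?thesis .
    qed
  qed
  show ?thesis using main[of y x] main[of x y] by (cases "y \<le> x") (auto simp: abs_minus_commute)
qed

lemma DERIV_abs_powr:
  fixes s p :: real
  assumes p: "1 < p"
  shows "((\<lambda>s. \<bar>s\<bar> powr (p - 1) * s) has_real_derivative p * \<bar>s\<bar> powr (p - 1)) (at s)"
proof -
  have pm: "x powr p = x powr (p - 1) * x" if "x > 0" for x :: real
    using that by (simp add: powr_pred_mult)
  consider "s > 0" | "s < 0" | "s = 0" by linarith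
  then show ?thesis
  proof cases
    case 1
    have "((\<lambda>s. s powr p) has_real_derivative p * s powr (p - 1)) (at s)" using 1 by (rule has_real_derivative_powr)
    then have "((\<lambda>s. \<bar>s\<bar> powr (p - 1) * s) has_real_derivative p * s powr (p - 1)) (at s)"
      by (rule has_field_derivative_transform_within_open[where S="{0<..}"]) (use 1 pm in auto)
    then show ?thesis using 1 by simp
  next
    case 2
    have "((\<lambda>s. s powr p) has_real_derivative p * (- s) powr (p - 1)) (at (- s))" using 2 by (intro has_real_derivative_powr) auto
    then have "((\<lambda>s. (- s) powr p) has_real_derivative (p * (- s) powr (p - 1)) * (- 1)) (at s)"
      by (rule DERIV_chain2[where g="\<lambda>s. - s"]) (auto intro!: derivative_eq_intros)
    then have "((\<lambda>s. - ((- s) powr p)) has_real_derivative - ((p * (- s) powr (p - 1)) * (- 1))) (at s)" by (rule DERIV_minus)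
    then have "((\<lambda>s. \<bar>s\<bar> powr (p - 1) * s) has_real_derivative - ((p * (- s) powr (p - 1)) * (- 1))) (at s)"
      by (rule has_field_derivative_transform_within_open[where S="{..<0}"]) (use 2 pm in auto)
    then show ?thesis using 2 by simp
  next
    case 3
    have "continuous_on UNIV (\<lambda>h::real. \<bar>h\<bar> powr (p - 1))" using p by (intro continuous_on_powr' continuous_intros) auto
    then have "isCont (\<lambda>h::real. \<bar>h\<bar> powr (p - 1)) 0" by (simp add: continuous_on_eq_continuous_at)
    then have "((\<lambda>h::real. \<bar>h\<bar> powr (p - 1)) \<longlongrightarrow> 0) (at 0)" using p by (simp add: isCont_def)
    then have "((\<lambda>h. (\<bar>0 + h\<bar> powr (p - 1) * (0 + h) - \<bar>0\<bar> powr (p - 1) * 0) / h) \<longlongrightarrow> 0) (at 0)"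
      by (rule Lim_transform_eventually) (auto simp: eventually_at_filter)
    then show ?thesis using 3 p by (simp add: DERIV_def)
  qed
qed

text \<open>The increments are chosen so small that even with the weights 2^(kp) the p-th powers
  have a finite sum of integrals. Hence the weighted sum is finite almost everywhere, and there the
  increments decay like 2^-k, so the series of increments converges.\<close>

lemma Lp_Cauchy_subsequence_AE:
  fixes f :: "nat \<Rightarrow> 'a \<Rightarrow> 'b::euclidean_space"
  assumes p: "1 < p" and f: "\<And>n. in_Lp M p (f n)"
    and C: "\<And>e. e > 0 \<Longrightarrow> \<exists>N. \<forall>m\<ge>N. \<forall>n\<ge>N. pnorm M p (\<lambda>x. f m x - f n x) < e"
  shows "\<exists>r. strict_mono (r::nat\<Rightarrow>nat) \<and> (AE x in M. convergent (\<lambda>k. f (r k) x))"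
proof -
  have [measurable]: "f n \<in> borel_measurable M" for n using f by (rule in_LpD)
  define e where "e k = ((1/2::real) ^ k) powr p * (1/2) ^ k" for k :: nat
  have "\<exists>N. \<forall>m\<ge>N. \<forall>n\<ge>N. pnorm M p (\<lambda>x. f m x - f n x) < e k" for k
    by (rule C) (simp add: e_def)
  then obtain N where N: "\<And>k m n. m \<ge> N k \<Longrightarrow> n \<ge> N k \<Longrightarrow> pnorm M p (\<lambda>x. f m x - f n x) < e k" by metis
  \<comment> \<open>Adding all earlier thresholds and k makes r strictly increasing and keeps r k
    above N k.\<close>
  define r where "r k = k + (\<Sum>j\<le>k. N j)" for k
  have r: "strict_mono r" by (rule strict_monoI_Suc) (simp add: r_def)
  have rN: "r k \<ge> N k" for k
    using member_le_sum[of k "{..k}" N] by (simp add: r_def)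
  have rN': "r (Suc k) \<ge> N k" for k using rN[of k] strict_mono_less[OF r, of k "Suc k"] by simp
  define w where "w k x = (2 ^ k) powr p * norm (f (r (Suc k)) x - f (r k) x) powr p" for k x
  have w0: "w k x \<ge> 0" for k x by (simp add: w_def)
  have [measurable]: "w k \<in> borel_measurable M" for k unfolding w_def by measurable
  have wi: "(\<integral>\<^sup>+x. ennreal (w k x) \<partial>M) \<le> ennreal ((1/2) ^ k)" for k
  proof -
    have i: "integrable M (\<lambda>x. norm (f (r (Suc k)) x - f (r k) x) powr p)"
      using in_Lp_diff[OF p f f] by (rule in_LpD)
    have "(\<integral>\<^sup>+x. ennreal (w k x) \<partial>M) = ennreal (LINT x|M. w k x)"
      unfolding w_def using i by (intro nn_integral_eq_integral) auto
    also have "(LINT x|M. w k x) = (2 ^ k) powr p * pnorm M p (\<lambda>x. f (r (Suc k)) x - f (r k) x)"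
      unfolding w_def pnorm_def by simp
    also have "\<dots> \<le> (2 ^ k) powr p * e k"
      using N[OF rN' rN, of k] by (intro mult_left_mono) auto
    also have "\<dots> = (1/2) ^ k"
    proof -
      have "(2 ^ k) powr p * ((1/2::real) ^ k) powr p = (2 ^ k * (1/2) ^ k) powr p" by (simp add: powr_mult)
      also have "(2::real) ^ k * (1/2) ^ k = 1" by (simp add: power_mult_distrib[symmetric])
      finally show ?thesis by (simp add: e_def)
    qed
    finally show ?thesis by (simp add: ennreal_leI)
  qed
  have "(\<integral>\<^sup>+x. (\<Sum>k. ennreal (w k x)) \<partial>M) = (\<Sum>k. \<integral>\<^sup>+x. ennreal (w k x) \<partial>M)"
    by (rule nn_integral_suminf) measurable
  also have "\<dots> \<le> (\<Sum>k. ennreal ((1/2) ^ k))" by (intro suminf_le wi) auto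
  also have "\<dots> = ennreal (\<Sum>k. (1/2) ^ k)" by (rule suminf_ennreal2) auto
  also have "\<dots> < \<infinity>" by simp
  finally have "(\<integral>\<^sup>+x. (\<Sum>k. ennreal (w k x)) \<partial>M) \<noteq> \<infinity>" by simp
  then have AE: "AE x in M. (\<Sum>k. ennreal (w k x)) \<noteq> \<infinity>" by (intro nn_integral_noteq_infinite) measurable
  have "AE x in M. convergent (\<lambda>k. f (r k) x)"
    using AE
  proof eventually_elim
    case (elim x)
    then obtain C where C: "(\<Sum>k. ennreal (w k x)) = ennreal C" "C \<ge> 0"
      by (metis ennreal_cases infinity_ennreal_def)
    have wC: "w k x \<le> C" for k
    proof -
      have "ennreal (w k x) = (\<Sum>i\<in>{k}. ennreal (w i x))" by simp
      also have "\<dots> \<le> (\<Sum>k. ennreal (w k x))" by (rule sum_le_suminf) auto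
      finally show ?thesis unfolding C(1) using C(2) by (simp add: ennreal_le_iff)
    qed
    have d: "norm (f (r (Suc k)) x - f (r k) x) \<le> C powr (1/p) * (1/2) ^ k" for k
    proof -
      have "(2 ^ k * norm (f (r (Suc k)) x - f (r k) x)) powr p \<le> C"
        using wC[of k] by (simp add: w_def powr_mult)
      then have "((2 ^ k * norm (f (r (Suc k)) x - f (r k) x)) powr p) powr (1/p) \<le> C powr (1/p)"
        using p by (intro powr_mono2) auto
      then have "2 ^ k * norm (f (r (Suc k)) x - f (r k) x) \<le> C powr (1/p)" using p by (simp add: powr_powr)
      then show ?thesis by (simp add: power_divide field_simps)
    qed
    have "summable (\<lambda>k. f (r (Suc k)) x - f (r k) x)"
      by (rule summable_comparison_test[where g="\<lambda>k. C powr (1/p) * (1/2) ^ k"])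
         (use d in \<open>auto intro!: summable_mult summable_geometric\<close>)
    then have "convergent (\<lambda>n. \<Sum>k<n. f (r (Suc k)) x - f (r k) x)" by (simp add: summable_iff_convergent)
    then have "convergent (\<lambda>n. f (r n) x - f (r 0) x)" by (simp add: sum_lessThan_telescope[of "\<lambda>k. f (r k) x"])
    then show ?case by (simp add: convergent_diff_const_right_iff)
  qed
  then show ?thesis using r by blast
qed

text \<open>The limit along an almost everywhere convergent subsequence, undone for the whole
  sequence by Fatou's lemma. Membership of g in L^p follows because one difference f_n - g belongs
  to it.\<close>

theorem Lp_complete:
  fixes f :: "nat \<Rightarrow> 'a \<Rightarrow> 'b::euclidean_space"
  assumes p: "1 < p" and f: "\<And>n. in_Lp M p (f n)"
    and C: "\<And>e. e > 0 \<Longrightarrow> \<exists>N. \<forall>m\<ge>N. \<forall>n\<ge>N. pnorm M p (\<lambda>x. f m x - f n x) < e"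
  shows "\<exists>g. in_Lp M p g \<and> (\<lambda>n. pnorm M p (\<lambda>x. f n x - g x)) \<longlonglongrightarrow> 0"
proof -
  obtain r where r: "strict_mono (r::nat\<Rightarrow>nat)" "AE x in M. convergent (\<lambda>k. f (r k) x)"
    using Lp_Cauchy_subsequence_AE[OF p f C] by blast
  have [measurable]: "f n \<in> borel_measurable M" for n using f by (rule in_LpD)
  define g where "g x = lim (\<lambda>k. f (r k) x)" for x
  have [measurable]: "g \<in> borel_measurable M" unfolding g_def by measurable
  have est: "(\<integral>\<^sup>+x. ennreal (norm (f n x - g x) powr p) \<partial>M) \<le> ennreal e"
    if N: "\<And>m n. m \<ge> N \<Longrightarrow> n \<ge> N \<Longrightarrow> pnorm M p (\<lambda>x. f m x - f n x) < e" and n: "n \<ge> N" for N n e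
  proof -
    have "(\<integral>\<^sup>+x. ennreal (norm (f n x - g x) powr p) \<partial>M) = (\<integral>\<^sup>+x. liminf (\<lambda>k. ennreal (norm (f n x - f (r k) x) powr p)) \<partial>M)"
    proof (rule nn_integral_cong_AE)
      show "AE x in M. ennreal (norm (f n x - g x) powr p) = liminf (\<lambda>k. ennreal (norm (f n x - f (r k) x) powr p))"
        using r(2)
      proof eventually_elim
        case (elim x)
        then have "(\<lambda>k. f (r k) x) \<longlonglongrightarrow> g x" unfolding g_def by (simp add: convergent_LIMSEQ_iff)
        then have "(\<lambda>k. ennreal (norm (f n x - f (r k) x) powr p)) \<longlonglongrightarrow> ennreal (norm (f n x - g x) powr p)"
          using p by (intro tendsto_ennrealI tendsto_powr' tendsto_intros) auto
        from lim_imp_Liminf[OF sequentially_bot this] show ?case by (rule sym)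
      qed
    qed
    also have "\<dots> \<le> liminf (\<lambda>k. \<integral>\<^sup>+x. ennreal (norm (f n x - f (r k) x) powr p) \<partial>M)"
      by (rule nn_integral_liminf) measurable
    also have "\<dots> \<le> ennreal e"
    proof (rule order_trans[OF Liminf_le_Limsup Limsup_bounded])
      show "\<forall>\<^sub>F k in sequentially. (\<integral>\<^sup>+x. ennreal (norm (f n x - f (r k) x) powr p) \<partial>M) \<le> ennreal e"
        unfolding eventually_sequentially
      proof (intro exI[of _ N] allI impI)
        fix k assume "N \<le> k"
        then have "r k \<ge> N" using seq_suble[OF r(1), of k] by linarith
        have "(\<integral>\<^sup>+x. ennreal (norm (f n x - f (r k) x) powr p) \<partial>M) = ennreal (pnorm M p (\<lambda>x. f n x - f (r k) x))"
          unfolding pnorm_def using in_LpD(2)[OF in_Lp_diff[OF p f[of n] f[of "r k"]]] by (intro nn_integral_eq_integral) auto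
        also have "\<dots> \<le> ennreal e" using N[OF n \<open>r k \<ge> N\<close>] by (intro ennreal_leI) simp
        finally show "(\<integral>\<^sup>+x. ennreal (norm (f n x - f (r k) x) powr p) \<partial>M) \<le> ennreal e" .
      qed
    qed simp
    finally show ?thesis .
  qed
  have lp: "in_Lp M p (\<lambda>x. f n x - g x) \<and> pnorm M p (\<lambda>x. f n x - g x) \<le> e"
    if "\<And>m n. m \<ge> N \<Longrightarrow> n \<ge> N \<Longrightarrow> pnorm M p (\<lambda>x. f m x - f n x) < e" "n \<ge> N" "e > 0" for N n e
  proof -
    have i: "integrable M (\<lambda>x. norm (f n x - g x) powr p)"
      using est[OF that(1,2)] by (intro integrableI_bounded) (auto intro: le_less_trans)
    have "ennreal (pnorm M p (\<lambda>x. f n x - g x)) = (\<integral>\<^sup>+x. ennreal (norm (f n x - g x) powr p) \<partial>M)"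
      unfolding pnorm_def using i by (intro nn_integral_eq_integral[symmetric]) auto
    also have "\<dots> \<le> ennreal e" by (rule est[OF that(1,2)])
    finally have "pnorm M p (\<lambda>x. f n x - g x) \<le> e" using that(3) by (simp add: ennreal_le_iff)
    then show ?thesis using i by (auto simp: in_Lp_def)
  qed
  obtain N0 where N0: "\<And>m n. m \<ge> N0 \<Longrightarrow> n \<ge> N0 \<Longrightarrow> pnorm M p (\<lambda>x. f m x - f n x) < 1" using C[of 1] by auto
  have "in_Lp M p (\<lambda>x. f N0 x - (f N0 x - g x))" by (rule in_Lp_diff[OF p f conjunct1[OF lp[OF N0 order_refl zero_less_one]]])
  then have g: "in_Lp M p g" by simp
  have "(\<lambda>n. pnorm M p (\<lambda>x. f n x - g x)) \<longlonglongrightarrow> 0"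
  proof (rule LIMSEQ_I)
    fix e :: real assume e: "e > 0"
    obtain N where N: "\<And>m n. m \<ge> N \<Longrightarrow> n \<ge> N \<Longrightarrow> pnorm M p (\<lambda>x. f m x - f n x) < e/2" using C[of "e/2"] e by auto
    show "\<exists>no. \<forall>n\<ge>no. norm (pnorm M p (\<lambda>x. f n x - g x) - 0) < e"
    proof (intro exI[of _ N] allI impI)
      fix n assume "n \<ge> N"
      then have "pnorm M p (\<lambda>x. f n x - g x) \<le> e/2" using lp[OF N] e by auto
      then show "norm (pnorm M p (\<lambda>x. f n x - g x) - 0) < e" using e pnorm_nonneg[of M p "\<lambda>x. f n x - g x"] by simp
    qed
  qed
  then show ?thesis using g by blast
qed

text \<open>The integrated convexity defect of f_m and f_n is small, since the energies tend to L
  and the energies of the midpoints do not fall much below L. The pointwise inequality converts this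
  into smallness of f_m - f_n.\<close>

lemma Lp_uniformly_convex_Cauchy:
  fixes f :: "nat \<Rightarrow> 'a \<Rightarrow> 'b::euclidean_space"
  assumes p: "1 < p" and f: "\<And>n. in_Lp M p (f n)" and L: "(\<lambda>n. pnorm M p (f n)) \<longlonglongrightarrow> L"
    and mid: "\<And>e. e > 0 \<Longrightarrow> \<exists>N. \<forall>m\<ge>N. \<forall>n\<ge>N. L - e \<le> pnorm M p (\<lambda>x. (f m x + f n x) /\<^sub>R 2)"
    and e: "e > 0"
  shows "\<exists>N. \<forall>m\<ge>N. \<forall>n\<ge>N. pnorm M p (\<lambda>x. f m x - f n x) < e"
proof -
  have L0: "L \<ge> 0" by (rule LIMSEQ_le_const[OF L]) (auto simp: pnorm_nonneg)
  \<comment> \<open>Both energies are eventually below L + 1, so this term contributes e/2; \<delta>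
    below is chosen to make the defect term at most e/4. Adding 1 to L covers L = 0.\<close>
  define \<eta> where "\<eta> = e / (4 * (L + 1))"
  have \<eta>: "\<eta> > 0" "\<eta> * (2 * (L + 1)) = e / 2" using e L0 by (auto simp: \<eta>_def field_simps)
  obtain c where c: "c > 0" "\<And>a b :: 'b. norm (a - b) powr p \<le> \<eta> * (norm a powr p + norm b powr p)
     + c * ((norm a powr p + norm b powr p) / 2 - norm ((a + b) /\<^sub>R 2) powr p)"
    using norm_powr_uniformly_convex[OF p \<eta>(1)] by blast
  define \<delta> where "\<delta> = min 1 (e / (8 * c))"
  have \<delta>: "\<delta> > 0" "\<delta> \<le> 1" "c * (2 * \<delta>) \<le> e / 4"
  proof -
    show "\<delta> > 0" "\<delta> \<le> 1" using e c by (auto simp: \<delta>_def)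
    have "c * (2 * \<delta>) \<le> c * (2 * (e / (8 * c)))" using c(1) by (intro mult_left_mono) (auto simp: \<delta>_def)
    then show "c * (2 * \<delta>) \<le> e / 4" using c(1) by simp
  qed
  obtain N1 where N1: "\<And>n. n \<ge> N1 \<Longrightarrow> norm (pnorm M p (f n) - L) < \<delta>" using LIMSEQ_D[OF L \<delta>(1)] by blast
  obtain N2 where N2: "\<And>m n. m \<ge> N2 \<Longrightarrow> n \<ge> N2 \<Longrightarrow> L - \<delta> \<le> pnorm M p (\<lambda>x. (f m x + f n x) /\<^sub>R 2)" using mid[OF \<delta>(1)] by blast
  have gen: "A < L + \<delta> \<Longrightarrow> B < L + \<delta> \<Longrightarrow> L - \<delta> \<le> P \<Longrightarrow> (A + B) / 2 - P \<le> 2 * \<delta>" for A B P :: real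
    by (simp add: field_simps)
  show ?thesis
  proof (intro exI[of _ "max N1 N2"] allI impI)
    fix m n assume mn: "max N1 N2 \<le> m" "max N1 N2 \<le> n"
    have mi: "in_Lp M p (\<lambda>x. (f m x + f n x) /\<^sub>R 2)" using in_Lp_scale[OF p in_Lp_add[OF p f f], of "inverse 2"] by simp
    note i = in_LpD(2)[OF f[of m]] in_LpD(2)[OF f[of n]] in_LpD(2)[OF mi]
    have "pnorm M p (\<lambda>x. f m x - f n x) \<le> (LINT x|M. \<eta> * (norm (f m x) powr p + norm (f n x) powr p)
     + c * ((norm (f m x) powr p + norm (f n x) powr p) / 2 - norm ((f m x + f n x) /\<^sub>R 2) powr p))"
      unfolding pnorm_def using c(2) in_LpD(2)[OF in_Lp_diff[OF p f[of m] f[of n]]] i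
      by (intro integral_mono) (auto intro!: Bochner_Integration.integrable_add Bochner_Integration.integrable_diff integrable_mult_right integrable_divide simp del: norm_scaleR)
    also have "\<dots> = \<eta> * (pnorm M p (f m) + pnorm M p (f n)) + c * ((pnorm M p (f m) + pnorm M p (f n)) / 2 - pnorm M p (\<lambda>x. (f m x + f n x) /\<^sub>R 2))"
      unfolding pnorm_def using i by (simp del: norm_scaleR)
    also have "\<dots> \<le> \<eta> * (2 * (L + 1)) + c * (2 * \<delta>)"
    proof (intro add_mono mult_left_mono)
      have "\<bar>pnorm M p (f m) - L\<bar> < \<delta>" "\<bar>pnorm M p (f n) - L\<bar> < \<delta>" using N1[of m] N1[of n] mn by auto
      then have b: "pnorm M p (f m) < L + \<delta>" "pnorm M p (f n) < L + \<delta>" by linarith+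
      then show "pnorm M p (f m) + pnorm M p (f n) \<le> 2 * (L + 1)" using add_strict_mono[OF b] \<delta>(2) by simp
      have "L - \<delta> \<le> pnorm M p (\<lambda>x. (f m x + f n x) /\<^sub>R 2)" using N2[of m n] mn by auto
      then show "(pnorm M p (f m) + pnorm M p (f n)) / 2 - pnorm M p (\<lambda>x. (f m x + f n x) /\<^sub>R 2) \<le> 2 * \<delta>"
        using b by (intro gen)
    qed (use \<eta> c in auto)
    also have "\<dots> < e" using \<eta>(2) \<delta>(3) e by linarith
    finally show "pnorm M p (\<lambda>x. f m x - f n x) < e" .
  qed
qed

lemma (in finite_measure) in_Lp_integrable:
  assumes p: "1 < p" and f: "in_Lp M p f"
  shows "integrable M f"
proof (rule Bochner_Integration.integrable_bound)
  show "integrable M (\<lambda>x. 1 + norm (f x) powr p)" using f by (auto simp: in_Lp_def)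
  show "f \<in> borel_measurable M" using f by (simp add: in_Lp_def)
  show "AE x in M. norm (f x) \<le> norm (1 + norm (f x) powr p)"
  proof (intro AE_I2)
    fix x
    have "norm (f x) \<le> 1 + norm (f x) powr p"
    proof (cases "norm (f x) \<le> 1")
      case False
      then have "norm (f x) powr 1 \<le> norm (f x) powr p" using p by (intro powr_mono) auto
      then show ?thesis using False by simp
    qed (simp add: add_increasing2)
    then show "norm (f x) \<le> norm (1 + norm (f x) powr p)" by simp
  qed
qed

text \<open>The inequality |y| \<le> \<eta> + \<eta>^(1-p) |y|^p takes the place of Hoelder's: the
  first term is small because the measure is finite, the second because of the convergence in
  L^p.\<close>

lemma (in finite_measure) Lp_tendsto_imp_L1:
  fixes h :: "nat \<Rightarrow> 'a \<Rightarrow> 'b::euclidean_space"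
  assumes p: "1 < p" and f: "\<And>n. in_Lp M p (h n)" and lim: "(\<lambda>n. pnorm M p (h n)) \<longlonglongrightarrow> 0"
  shows "(\<lambda>n. LINT x|M. norm (h n x)) \<longlonglongrightarrow> 0"
proof (rule LIMSEQ_I)
  fix e :: real assume e: "e > 0"
  define \<mu> where "\<mu> = measure M (space M)"
  have \<mu>: "\<mu> \<ge> 0" by (simp add: \<mu>_def)
  define \<eta> where "\<eta> = e / (2 * (\<mu> + 1))"
  have \<eta>: "\<eta> > 0" using e \<mu> by (simp add: \<eta>_def)
  have \<eta>2: "\<eta> * \<mu> \<le> e / 2"
  proof -
    have "\<eta> * \<mu> \<le> \<eta> * (\<mu> + 1)" using \<eta> by (intro mult_left_mono) auto
    also have "\<dots> = e / 2" using \<mu> by (simp add: \<eta>_def field_simps)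
    finally show ?thesis .
  qed
  have pt: "norm y \<le> \<eta> + \<eta> powr (1 - p) * norm y powr p" for y :: 'b
  proof (cases "norm y \<le> \<eta>")
    case True
    then show ?thesis by (simp add: add_increasing2)
  next
    case False
    then have y: "norm y > 0" using \<eta> by linarith
    have "norm y = norm y powr (1 - p) * norm y powr p" using y by (simp add: powr_add[symmetric])
    also have "\<dots> \<le> \<eta> powr (1 - p) * norm y powr p"
      using False \<eta> p by (intro mult_right_mono powr_mono2') auto
    finally show ?thesis using \<eta> by linarith
  qed
  define \<delta> where "\<delta> = e / 4 / \<eta> powr (1 - p)"
  have \<delta>: "\<delta> > 0" using e \<eta> by (simp add: \<delta>_def)
  obtain N where N: "\<And>n. n \<ge> N \<Longrightarrow> norm (pnorm M p (h n) - 0) < \<delta>" using LIMSEQ_D[OF lim \<delta>] by blast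
  show "\<exists>no. \<forall>n\<ge>no. norm ((LINT x|M. norm (h n x)) - 0) < e"
  proof (intro exI[of _ N] allI impI)
    fix n assume "n \<ge> N"
    then have n: "pnorm M p (h n) < \<delta>" using N[of n] by (simp add: abs_less_iff)
    have "(LINT x|M. norm (h n x)) \<le> (LINT x|M. \<eta> + \<eta> powr (1 - p) * norm (h n x) powr p)"
      using in_Lp_integrable[OF p f] in_LpD(2)[OF f] pt by (intro integral_mono) auto
    also have "\<dots> = \<eta> * \<mu> + \<eta> powr (1 - p) * pnorm M p (h n)"
      using in_LpD(2)[OF f] by (simp add: pnorm_def \<mu>_def mult.commute)
    also have "\<dots> \<le> e / 2 + \<eta> powr (1 - p) * \<delta>" using \<eta>2 n by (intro add_mono mult_left_mono) auto
    also have "\<eta> powr (1 - p) * \<delta> = e / 4" using \<eta> by (simp add: \<delta>_def)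
    finally have "(LINT x|M. norm (h n x)) < e" using e by linarith
    moreover have "0 \<le> (LINT x|M. norm (h n x))" by (intro Bochner_Integration.integral_nonneg) auto
    ultimately show "norm ((LINT x|M. norm (h n x)) - 0) < e" by simp
  qed
qed

text \<open>Away from a = 0 the function is the power p/2 of a quadratic polynomial in t. At a = 0
  the difference quotient has modulus |h|^(p-1) |b|^p and tends to 0, in accordance with
  \<open>0 powr (p - 2) = 0\<close>.\<close>

lemma norm_powr_has_derivative:
  fixes a b :: "'a::real_inner"
  assumes p: "1 < p"
  shows "((\<lambda>t. norm (a + t *\<^sub>R b) powr p) has_real_derivative p * norm a powr (p - 2) * (a \<bullet> b)) (at 0)"
proof (cases "a = 0")
  case True
  have "continuous_on UNIV (\<lambda>h::real. \<bar>h\<bar> powr (p - 1) * norm b powr p)" using p by (intro continuous_on_powr' continuous_intros) auto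
  then have "isCont (\<lambda>h::real. \<bar>h\<bar> powr (p - 1) * norm b powr p) 0" by (simp add: continuous_on_eq_continuous_at)
  then have c: "((\<lambda>h::real. \<bar>h\<bar> powr (p - 1) * norm b powr p) \<longlongrightarrow> 0) (at 0)" using p by (simp add: isCont_def)
  have "((\<lambda>h. (norm (a + (0 + h) *\<^sub>R b) powr p - norm (a + 0 *\<^sub>R b) powr p) / h) \<longlongrightarrow> 0) (at 0)"
  proof (rule Lim_null_comparison[OF _ c])
    show "\<forall>\<^sub>F h in at 0. norm ((norm (a + (0 + h) *\<^sub>R b) powr p - norm (a + 0 *\<^sub>R b) powr p) / h) \<le> \<bar>h\<bar> powr (p - 1) * norm b powr p"
      unfolding eventually_at_filter
    proof (intro always_eventually allI impI)
      fix h :: real assume "h \<noteq> 0"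
      then have "\<bar>h\<bar> powr p / \<bar>h\<bar> = \<bar>h\<bar> powr (p - 1)" by (simp add: powr_diff)
      moreover have "norm ((norm (a + (0 + h) *\<^sub>R b) powr p - norm (a + 0 *\<^sub>R b) powr p) / h) = (\<bar>h\<bar> powr p / \<bar>h\<bar>) * norm b powr p"
        using True p by (simp add: powr_mult abs_mult)
      ultimately show "norm ((norm (a + (0 + h) *\<^sub>R b) powr p - norm (a + 0 *\<^sub>R b) powr p) / h) \<le> \<bar>h\<bar> powr (p - 1) * norm b powr p"
        by (simp only: order_refl)
    qed
  qed
  then show ?thesis using True p by (simp add: DERIV_def)
next
  case False
  let ?q = "\<lambda>t. (a + t *\<^sub>R b) \<bullet> (a + t *\<^sub>R b)"
  have sq: "norm y powr s = (y \<bullet> y) powr (s / 2)" for y :: 'a and s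
  proof -
    have "y \<bullet> y = norm y powr 2" by (simp add: power2_norm_eq_inner[symmetric])
    then show ?thesis by (simp only: powr_powr) simp
  qed
  have "?q = (\<lambda>t. a \<bullet> a + t * (2 * (a \<bullet> b)) + t\<^sup>2 * (b \<bullet> b))"
    by (auto simp: inner_add_left inner_add_right inner_commute power2_eq_square algebra_simps)
  moreover have "((\<lambda>t. a \<bullet> a + t * (2 * (a \<bullet> b)) + t\<^sup>2 * (b \<bullet> b)) has_real_derivative 2 * (a \<bullet> b)) (at 0)"
    by (auto intro!: derivative_eq_intros)
  ultimately have dq: "(?q has_real_derivative 2 * (a \<bullet> b)) (at 0)" by simp
  have dp: "((\<lambda>x. x powr (p/2)) has_real_derivative (p/2) * (a \<bullet> a) powr (p/2 - 1)) (at (?q 0))"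
    using False by (auto intro!: derivative_eq_intros simp: powr_diff)
  have "((\<lambda>t. ?q t powr (p/2)) has_real_derivative ((p/2) * (a \<bullet> a) powr (p/2 - 1)) * (2 * (a \<bullet> b))) (at 0)"
    by (rule DERIV_chain2[OF dp dq])
  moreover have "((p/2) * (a \<bullet> a) powr (p/2 - 1)) * (2 * (a \<bullet> b)) = p * norm a powr (p - 2) * (a \<bullet> b)"
    by (simp add: sq[of a "p - 2"] diff_divide_distrib)
  ultimately have "((\<lambda>t. ?q t powr (p/2)) has_real_derivative p * norm a powr (p - 2) * (a \<bullet> b)) (at 0)" by (simp only:)
  then show ?thesis by (simp only: sq[of _ p])
qed

text \<open>A bound independent of t, for use as dominating function. The upper estimate is
  convexity between a and a + b, the lower one convexity between a + t b and a - b.\<close>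

lemma norm_powr_quotient_bound:
  fixes a b :: "'a::real_inner"
  assumes p: "1 < p" and t: "0 < t" "t \<le> 1"
  shows "\<bar>(norm (a + t *\<^sub>R b) powr p - norm a powr p) / t\<bar> \<le> norm (a + b) powr p + norm (a - b) powr p"
proof -
  have "norm ((1 - t) *\<^sub>R a + t *\<^sub>R (a + b)) powr p \<le> (1 - t) * norm a powr p + t * norm (a + b) powr p"
    by (rule norm_powr_convex[OF p]) (use t in auto)
  moreover have "(1 - t) *\<^sub>R a + t *\<^sub>R (a + b) = a + t *\<^sub>R b" by (simp add: algebra_simps)
  ultimately have 1: "norm (a + t *\<^sub>R b) powr p - norm a powr p \<le> t * norm (a + b) powr p - t * norm a powr p"
    by (simp add: algebra_simps)
  \<comment> \<open>The weight for which (1 - s)(a + t b) + s (a - b) = a.\<close>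
  define s where "s = t / (1 + t)"
  have s: "0 \<le> s" "s \<le> 1" "1 - s = 1 / (1 + t)" using t by (auto simp: s_def field_simps)
  have "norm ((1 - s) *\<^sub>R (a + t *\<^sub>R b) + s *\<^sub>R (a - b)) powr p \<le> (1 - s) * norm (a + t *\<^sub>R b) powr p + s * norm (a - b) powr p"
    by (rule norm_powr_convex[OF p s(1,2)])
  moreover have "(1 - s) *\<^sub>R (a + t *\<^sub>R b) + s *\<^sub>R (a - b) = a"
  proof -
    have "(1 - s) * t = s" using t by (simp add: s(3)) (simp add: s_def)
    then have "(1 - s) *\<^sub>R (t *\<^sub>R b) = s *\<^sub>R b" by simp
    then show ?thesis by (simp add: scaleR_add_right scaleR_diff_right) (simp add: scaleR_diff_left)
  qed
  ultimately have "norm a powr p \<le> (1 - s) * norm (a + t *\<^sub>R b) powr p + s * norm (a - b) powr p" by simp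
  then have "norm a powr p \<le> (1 / (1 + t)) * norm (a + t *\<^sub>R b) powr p + (t / (1 + t)) * norm (a - b) powr p"
    unfolding s(3) unfolding s_def .
  also have "\<dots> = (norm (a + t *\<^sub>R b) powr p + t * norm (a - b) powr p) / (1 + t)" by (simp add: add_divide_distrib)
  finally have "norm a powr p * (1 + t) \<le> norm (a + t *\<^sub>R b) powr p + t * norm (a - b) powr p"
    using t by (simp add: pos_le_divide_eq)
  then have 2: "- (t * norm (a - b) powr p) \<le> norm (a + t *\<^sub>R b) powr p - norm a powr p"
  proof -
    have "norm a powr p * (1 + t) = norm a powr p + t * norm a powr p" by (simp add: algebra_simps)
    moreover have "0 \<le> t * norm a powr p" using t by simp
    ultimately show ?thesis using \<open>norm a powr p * (1 + t) \<le> _\<close> by linarith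
  qed
  have nn: "0 \<le> t * norm a powr p" "0 \<le> t * norm (a + b) powr p" "0 \<le> t * norm (a - b) powr p" using t by auto
  have "\<bar>norm (a + t *\<^sub>R b) powr p - norm a powr p\<bar> \<le> t * (norm (a + b) powr p + norm (a - b) powr p)"
    unfolding abs_le_iff distrib_left using 1 2 nn by linarith
  then show ?thesis using t by (simp add: abs_divide pos_divide_le_eq mult.commute)
qed

text \<open>Stated along a sequence of positive t, as dominated convergence delivers it. A one-sided
  derivative suffices for the first variation because directions may be reversed.\<close>

lemma pnorm_directional_derivative:
  fixes f g :: "'a \<Rightarrow> 'b::euclidean_space"
  assumes p: "1 < p" and f: "in_Lp M p f" and g: "in_Lp M p g"
  shows "integrable M (\<lambda>x. norm (f x) powr (p - 2) * (f x \<bullet> g x))"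
    and "(\<lambda>n. (pnorm M p (\<lambda>x. f x + (1 / real (Suc n)) *\<^sub>R g x) - pnorm M p f) / (1 / real (Suc n)))
      \<longlonglongrightarrow> p * (LINT x|M. norm (f x) powr (p - 2) * (f x \<bullet> g x))"
proof -
  have [measurable]: "f \<in> borel_measurable M" "g \<in> borel_measurable M" using f g by (auto simp: in_Lp_def)
  define t where "t n = 1 / real (Suc n)" for n
  have t: "t n > 0" "t n \<le> 1" for n by (auto simp: t_def)
  have t0: "filterlim t (at 0) sequentially"
  proof -
    have "t \<longlonglongrightarrow> 0" unfolding t_def[abs_def] using LIMSEQ_Suc[OF lim_1_over_n] by simp
    then show ?thesis using t(1) by (auto simp: filterlim_at intro!: always_eventually less_imp_neq[symmetric])
  qed
  let ?q = "\<lambda>n x. (norm (f x + t n *\<^sub>R g x) powr p - norm (f x) powr p) / t n"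
  let ?l = "\<lambda>x. p * norm (f x) powr (p - 2) * (f x \<bullet> g x)"
  let ?w = "\<lambda>x. norm (f x + g x) powr p + norm (f x - g x) powr p"
  have w: "integrable M ?w" 
    using in_LpD(2)[OF in_Lp_add[OF p f g]] in_LpD(2)[OF in_Lp_diff[OF p f g]] by simp
  have lim: "AE x in M. (\<lambda>n. ?q n x) \<longlonglongrightarrow> ?l x"
  proof (intro AE_I2)
    fix x
    have "((\<lambda>h. (norm (f x + h *\<^sub>R g x) powr p - norm (f x) powr p) / h) \<longlongrightarrow> ?l x) (at 0)"
      using norm_powr_has_derivative[OF p, of "f x" "g x"] by (simp add: DERIV_def)
    then show "(\<lambda>n. ?q n x) \<longlonglongrightarrow> ?l x" using t0 by (rule filterlim_compose)
  qed
  have bd: "AE x in M. norm (?q n x) \<le> ?w x" for n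
    using norm_powr_quotient_bound[OF p t] by (intro AE_I2) simp
  have ml: "?l \<in> borel_measurable M" by measurable
  have mq: "?q n \<in> borel_measurable M" for n by measurable
  have il: "integrable M ?l" by (rule integrable_dominated_convergence[OF ml mq w lim bd])
  then have "integrable M (\<lambda>x. (1/p) * ?l x)" by (rule integrable_mult_right)
  then show "integrable M (\<lambda>x. norm (f x) powr (p - 2) * (f x \<bullet> g x))" using p by (simp add: mult.assoc)
  have "(\<lambda>n. LINT x|M. ?q n x) \<longlonglongrightarrow> (LINT x|M. ?l x)"
    by (rule integral_dominated_convergence[OF ml mq w lim bd])
  moreover have "(LINT x|M. ?q n x) = (pnorm M p (\<lambda>x. f x + t n *\<^sub>R g x) - pnorm M p f) / t n" for n
    unfolding pnorm_def using in_LpD(2)[OF f] in_LpD(2)[OF in_Lp_add[OF p f in_Lp_scale[OF p g]]] by simp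
  moreover have "(LINT x|M. ?l x) = p * (LINT x|M. norm (f x) powr (p - 2) * (f x \<bullet> g x))"
    by (simp add: mult.assoc)
  ultimately show "(\<lambda>n. (pnorm M p (\<lambda>x. f x + (1 / real (Suc n)) *\<^sub>R g x) - pnorm M p f) / (1 / real (Suc n)))
      \<longlonglongrightarrow> p * (LINT x|M. norm (f x) powr (p - 2) * (f x \<bullet> g x))"
    by (simp add: t_def)
qed

lemma pnorm_eq_0_iff:
  assumes p: "1 < p" and f: "in_Lp M p f"
  shows "pnorm M p f = 0 \<longleftrightarrow> (AE x in M. f x = 0)"
  unfolding pnorm_def using integral_nonneg_eq_0_iff_AE[OF in_LpD(2)[OF f]] by simp

section \<open>The Sobolev space of the vector fields\<close>

lemma Lp_iff_in_Lp: "Lp p \<Omega> f \<longleftrightarrow> in_Lp (lebesgue_on \<Omega>) p f"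
  by (simp add: Lp_def in_Lp_def)

lemma in_Lp_component:
  fixes g :: "'a \<Rightarrow> real^'m"
  assumes p: "1 < p" and g: "in_Lp M p g"
  shows "in_Lp M p (\<lambda>x. g x $ i)" "pnorm M p (\<lambda>x. g x $ i) \<le> pnorm M p g"
proof -
  have [measurable]: "g \<in> borel_measurable M" using g by (rule in_LpD)
  have m: "(\<lambda>x. g x $ i) \<in> borel_measurable M"
    unfolding cart_eq_inner_axis by measurable
  have le: "norm (g x $ i) powr p \<le> norm (g x) powr p" for x
    using p component_le_norm_cart[of "g x" i] by (intro powr_mono2) auto
  show i: "in_Lp M p (\<lambda>x. g x $ i)" by (rule in_Lp_bound[OF m in_LpD(2)[OF g] le])
  show "pnorm M p (\<lambda>x. g x $ i) \<le> pnorm M p g"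
    unfolding pnorm_def using in_LpD(2)[OF i] in_LpD(2)[OF g] le by (intro integral_mono)
qed

lemma in_Lp_vec:
  fixes g :: "'a \<Rightarrow> real^'m"
  assumes p: "1 < p" and g: "\<And>i. in_Lp M p (\<lambda>x. g x $ i)"
  shows "in_Lp M p g"
proof -
  have "in_Lp M p (\<lambda>x. \<Sum>i\<in>I. (g x $ i) *\<^sub>R axis i (1::real))" if "finite I" for I
    using that
  proof (induction I rule: finite_induct)
    case empty
    then show ?case using p by (simp add: in_Lp_def)
  next
    case (insert i I)
    have [measurable]: "(\<lambda>x. g x $ i) \<in> borel_measurable M" using g by (rule in_LpD)
    have "in_Lp M p (\<lambda>x. (g x $ i) *\<^sub>R (axis i 1 :: real^'m))"
      using g[of i] by (auto simp: in_Lp_def)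
    then show ?case using insert in_Lp_add[OF p] by simp
  qed
  from this[of UNIV] show ?thesis
    using basis_expansion[of "g _"] by (simp add: scalar_mult_eq_scaleR)
qed

lemma AE_finite_type:
  fixes P :: "'i::finite \<Rightarrow> 'a \<Rightarrow> bool"
  assumes "\<And>i. AE x in M. P i x"
  shows "AE x in M. \<forall>i. P i x"
  by (rule eventually_all_finite) (rule assms)

locale sobolev_setting =
  fixes U \<Omega> :: "(real^'n) set" and X :: "'m::finite \<Rightarrow> real^'n \<Rightarrow> real^'n" and p :: real
  assumes p: "1 < p" and open_U: "open U" and open_\<Omega>: "open \<Omega>" and \<Omega>_U: "\<Omega> \<subseteq> U"
    and bounded_\<Omega>: "bounded \<Omega>" and smooth_X: "\<And>i. smooth_vector_field U (X i)"
begin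

abbreviation M where "M \<equiv> lebesgue_on \<Omega>"

lemma finite_M: "finite_measure M"
  using lmeasurable_open[OF bounded_\<Omega> open_\<Omega>] by (rule finite_measure_lebesgue_on)

text \<open>A relation, so that any convenient representative g may be used;
  \<open>weak_gradient\<close> is one that was fixed by choice, and it agrees with g almost
  everywhere.\<close>

definition weak_grad :: "(real^'n \<Rightarrow> real) \<Rightarrow> (real^'n \<Rightarrow> real^'m) \<Rightarrow> bool" where
  "weak_grad u g \<longleftrightarrow> (\<forall>i. has_weak_derivative \<Omega> (X i) u (\<lambda>x. g x $ i))"

lemma has_weak_derivative_some:
  "has_weak_derivative \<Omega> V u g \<Longrightarrow> has_weak_derivative \<Omega> V u (weak_derivative \<Omega> V u)"
  unfolding weak_derivative_def by (rule someI[where P="has_weak_derivative \<Omega> V u"])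

lemma weak_gradient_AE:
  assumes "weak_grad u g"
  shows "AE x in M. weak_gradient \<Omega> X u x = g x" "weak_gradient \<Omega> X u \<in> borel_measurable M"
proof -
  have d: "has_weak_derivative \<Omega> (X i) u (\<lambda>x. g x $ i)" for i using assms by (simp add: weak_grad_def)
  have "AE x in M. \<forall>i. weak_derivative \<Omega> (X i) u x = g x $ i"
    by (intro AE_finite_type has_weak_derivative_unique[OF open_\<Omega> has_weak_derivative_some[OF d] d])
  then show "AE x in M. weak_gradient \<Omega> X u x = g x"
    by (rule AE_mp) (auto intro!: AE_I2 simp: weak_gradient_def vec_eq_iff)
  have "(\<lambda>x. weak_derivative \<Omega> (X i) u x) \<in> borel_measurable M" for i
    using has_weak_derivative_some[OF d[of i]] L1_loc_measurable[OF open_\<Omega>] by (simp add: has_weak_derivative_def)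
  then have "(\<lambda>x. weak_gradient \<Omega> X u x \<bullet> b) \<in> borel_measurable M" if "b \<in> Basis" for b
    using that by (auto simp: Basis_vec_def weak_gradient_def inner_axis)
  then show "weak_gradient \<Omega> X u \<in> borel_measurable M"
    by (subst borel_measurable_euclidean_space) auto
qed

lemma test_in_Lp:
  assumes \<phi>: "test_function \<Omega> \<phi>"
  shows "in_Lp M p \<phi>"
proof -
  interpret finite_measure M by (rule finite_M)
  obtain B where B: "B \<ge> 0" "\<And>x. \<bar>\<phi> x\<bar> \<le> B" using test_function_bounded[OF \<phi>] by blast
  have "norm (\<phi> x) powr p \<le> B powr p" for x using B p by (intro powr_mono2) auto
  then show ?thesis
    by (intro in_Lp_bound[where g="\<lambda>_. B powr p"] borel_measurable_lebesgue_on test_function_measurable[OF \<phi>]) auto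
qed

lemma test_Xgrad: "test_function \<Omega> \<phi> \<Longrightarrow> test_function \<Omega> (\<lambda>x. Xgrad X \<phi> x $ i)"
  using test_function_Xderiv[OF open_U \<Omega>_U smooth_X] by (simp add: Xgrad_def)

lemma Xgrad_in_Lp: "test_function \<Omega> \<phi> \<Longrightarrow> in_Lp M p (Xgrad X \<phi>)"
  by (rule in_Lp_vec[OF p]) (intro test_in_Lp test_Xgrad)

lemma weak_grad_test: "test_function \<Omega> \<phi> \<Longrightarrow> weak_grad \<phi> (Xgrad X \<phi>)"
  using has_weak_derivative_test_function[OF open_U \<Omega>_U open_\<Omega> smooth_X] by (simp add: weak_grad_def Xgrad_def)

lemma weak_grad_add_scaled:
  assumes "weak_grad u g" "weak_grad v h"
  shows "weak_grad (\<lambda>x. u x + c * v x) (\<lambda>x. g x + c *\<^sub>R h x)"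
  using assms has_weak_derivative_add_scaled[OF open_U \<Omega>_U open_\<Omega> smooth_X] by (simp add: weak_grad_def)

lemma smooth_test: "test_function \<Omega> \<phi> \<Longrightarrow> \<phi> differentiable (at x)"
  by (rule smooth_on_differentiable[of UNIV]) (auto simp: test_function_def)

lemma Xgrad_add_scaled:
  assumes "test_function \<Omega> \<phi>" "test_function \<Omega> \<psi>"
  shows "Xgrad X (\<lambda>x. \<phi> x + c * \<psi> x) x = Xgrad X \<phi> x + c *\<^sub>R Xgrad X \<psi> x"
proof -
  have "((\<lambda>x. \<phi> x + c * \<psi> x) has_derivative (\<lambda>v. grad \<phi> x \<bullet> v + c * (grad \<psi> x \<bullet> v))) (at x)"
    by (intro has_derivative_add has_derivative_mult_right has_derivative_grad smooth_test assms)
  from grad_eq[OF this] show ?thesis by (simp add: Xgrad_def vec_eq_iff)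
qed

lemma Lp_mult_test_tendsto:
  fixes f :: "nat \<Rightarrow> real^'n \<Rightarrow> real"
  assumes f: "\<And>n. in_Lp M p (f n)" "in_Lp M p g" and lim: "(\<lambda>n. pnorm M p (\<lambda>x. f n x - g x)) \<longlonglongrightarrow> 0" and \<psi>: "test_function \<Omega> \<psi>"
  shows "(\<lambda>n. LINT x|M. f n x * \<psi> x) \<longlonglongrightarrow> (LINT x|M. g x * \<psi> x)"
proof -
  interpret finite_measure M by (rule finite_M)
  obtain B where B: "B \<ge> 0" "\<And>x. \<bar>\<psi> x\<bar> \<le> B" using test_function_bounded[OF \<psi>] by blast
  have m: "\<psi> \<in> borel_measurable M" by (intro borel_measurable_lebesgue_on test_function_measurable[OF \<psi>])
  have i: "integrable M (\<lambda>x. h x * \<psi> x)" if "in_Lp M p h" for h :: "real^'n \<Rightarrow> real"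
  proof (rule Bochner_Integration.integrable_bound)
    show "integrable M (\<lambda>x. B * h x)" using in_Lp_integrable[OF p that] by simp
    show "(\<lambda>x. h x * \<psi> x) \<in> borel_measurable M" using m in_LpD(1)[OF that] by measurable
    show "AE x in M. norm (h x * \<psi> x) \<le> norm (B * h x)"
    proof (intro AE_I2)
      fix x
      have "\<bar>h x\<bar> * \<bar>\<psi> x\<bar> \<le> \<bar>h x\<bar> * B" by (intro mult_left_mono B) auto
      then show "norm (h x * \<psi> x) \<le> norm (B * h x)" using B(1) by (simp add: abs_mult mult.commute)
    qed
  qed
  have d: "in_Lp M p (\<lambda>x. f n x - g x)" for n by (intro in_Lp_diff p f)
  have "(\<lambda>n. (LINT x|M. f n x * \<psi> x) - (LINT x|M. g x * \<psi> x)) \<longlonglongrightarrow> 0"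
  proof (rule Lim_null_comparison)
    show "(\<lambda>n. B * (LINT x|M. norm (f n x - g x))) \<longlonglongrightarrow> 0"
      using tendsto_mult_left[OF Lp_tendsto_imp_L1[OF p d lim], of B] by simp
    show "\<forall>\<^sub>F n in sequentially. norm ((LINT x|M. f n x * \<psi> x) - (LINT x|M. g x * \<psi> x)) \<le> B * (LINT x|M. norm (f n x - g x))"
    proof (intro always_eventually allI)
      fix n
      have "(LINT x|M. f n x * \<psi> x) - (LINT x|M. g x * \<psi> x) = (LINT x|M. (f n x - g x) * \<psi> x)"
        unfolding left_diff_distrib using i f by (intro Bochner_Integration.integral_diff[symmetric]) auto
      also have "norm \<dots> \<le> (LINT x|M. norm ((f n x - g x) * \<psi> x))" by (rule integral_norm_bound)
      also have "\<dots> \<le> (LINT x|M. B * norm (f n x - g x))"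
      proof (rule integral_mono)
        show "integrable M (\<lambda>x. norm ((f n x - g x) * \<psi> x))" using i[OF d] by (rule integrable_norm)
        show "integrable M (\<lambda>x. B * norm (f n x - g x))" using in_Lp_integrable[OF p d] by simp
        fix x
        show "norm ((f n x - g x) * \<psi> x) \<le> B * norm (f n x - g x)"
          using mult_left_mono[OF B(2)[of x], of "\<bar>f n x - g x\<bar>"] by (simp add: abs_mult mult.commute)
      qed
      finally show "norm ((LINT x|M. f n x * \<psi> x) - (LINT x|M. g x * \<psi> x)) \<le> B * (LINT x|M. norm (f n x - g x))" by simp
    qed
  qed
  then show ?thesis by (simp add: LIM_zero_iff)
qed

lemma in_Lp_L1_loc:
  assumes f: "in_Lp M p (f :: real^'n \<Rightarrow> real)"
  shows "L1_loc \<Omega> f"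
  unfolding L1_loc_def
proof (intro allI impI)
  interpret finite_measure M by (rule finite_M)
  fix K assume K: "compact K \<and> K \<subseteq> \<Omega>"
  have "set_integrable lebesgue \<Omega> f"
    using in_Lp_integrable[OF p f] open_\<Omega> by (simp add: integrable_restrict_space set_integrable_def)
  then show "f absolutely_integrable_on K"
    by (rule set_integrable_subset) (use K in \<open>auto simp: compact_imp_closed\<close>)
qed

lemma weak_grad_closed:
  assumes \<phi>: "\<And>n. test_function \<Omega> (\<phi> n)" and u: "in_Lp M p u" "in_Lp M p g"
    and lim: "(\<lambda>n. pnorm M p (\<lambda>x. \<phi> n x - u x)) \<longlonglongrightarrow> 0" "(\<lambda>n. pnorm M p (\<lambda>x. Xgrad X (\<phi> n) x - g x)) \<longlonglongrightarrow> 0"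
  shows "weak_grad u g"
  unfolding weak_grad_def has_weak_derivative_def
proof (intro allI conjI impI in_Lp_L1_loc u in_Lp_component[OF p u(2)])
  fix i \<psi> assume \<psi>: "test_function \<Omega> \<psi>"
  have "(\<lambda>n. pnorm M p (\<lambda>x. Xgrad X (\<phi> n) x $ i - g x $ i)) \<longlonglongrightarrow> 0"
  proof (rule tendsto_sandwich[OF _ _ tendsto_const lim(2)])
    show "\<forall>\<^sub>F n in sequentially. pnorm M p (\<lambda>x. Xgrad X (\<phi> n) x $ i - g x $ i) \<le> pnorm M p (\<lambda>x. Xgrad X (\<phi> n) x - g x)"
      using in_Lp_component(2)[OF p in_Lp_diff[OF p Xgrad_in_Lp[OF \<phi>] u(2)], of _ i] by simp
  qed (simp add: pnorm_nonneg)
  then have 1: "(\<lambda>n. LINT x|M. Xgrad X (\<phi> n) x $ i * \<psi> x) \<longlonglongrightarrow> (LINT x|M. g x $ i * \<psi> x)"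
    by (intro Lp_mult_test_tendsto in_Lp_component[OF p] Xgrad_in_Lp \<phi> u \<psi>)
  have 2: "(\<lambda>n. LINT x|M. \<phi> n x * formal_adjoint (X i) \<psi> x) \<longlonglongrightarrow> (LINT x|M. u x * formal_adjoint (X i) \<psi> x)"
    by (intro Lp_mult_test_tendsto test_in_Lp \<phi> u lim test_function_formal_adjoint[OF open_U \<Omega>_U smooth_X \<psi>])
  have "(LINT x|M. Xgrad X (\<phi> n) x $ i * \<psi> x) = (LINT x|M. \<phi> n x * formal_adjoint (X i) \<psi> x)" for n
    using weak_grad_test[OF \<phi>[of n]] \<psi> by (simp add: weak_grad_def has_weak_derivative_def)
  then show "(LINT x|M. g x $ i * \<psi> x) = (LINT x|M. u x * formal_adjoint (X i) \<psi> x)"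
    using LIMSEQ_unique[OF 1] 2 by simp
qed

text \<open>Encodes \<open>u \<in> W\<^sup>1\<^sup>,\<^sup>p\<^sub>X\<^sub>,\<^sub>0(\<Omega>)\<close> together with a choice of \<open>g = Xu\<close>.\<close>

definition sobolev_pair :: "(real^'n \<Rightarrow> real) \<Rightarrow> (real^'n \<Rightarrow> real^'m) \<Rightarrow> bool" where
  "sobolev_pair u g \<longleftrightarrow> in_Lp M p u \<and> in_Lp M p g \<and> (\<exists>\<phi>. (\<forall>n. test_function \<Omega> (\<phi> n)) \<and>
     (\<lambda>n. pnorm M p (\<lambda>x. \<phi> n x - u x)) \<longlonglongrightarrow> 0 \<and> (\<lambda>n. pnorm M p (\<lambda>x. Xgrad X (\<phi> n) x - g x)) \<longlonglongrightarrow> 0)"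

lemma sobolev_pairD: "sobolev_pair u g \<Longrightarrow> in_Lp M p u" "sobolev_pair u g \<Longrightarrow> in_Lp M p g"
  by (auto simp: sobolev_pair_def)

lemma sobolev_pair_weak_grad: "sobolev_pair u g \<Longrightarrow> weak_grad u g"
  unfolding sobolev_pair_def using weak_grad_closed by blast

lemma sobolev_pair_test: "test_function \<Omega> \<phi> \<Longrightarrow> sobolev_pair \<phi> (Xgrad X \<phi>)"
  unfolding sobolev_pair_def using test_in_Lp Xgrad_in_Lp p by (auto intro!: exI[of _ "\<lambda>_. \<phi>"] simp: pnorm_def)

lemma pnorm_add_scaled_tendsto:
  fixes f g :: "nat \<Rightarrow> real^'n \<Rightarrow> 'b::euclidean_space"
  assumes f: "\<And>n. in_Lp M p (f n)" "(\<lambda>n. pnorm M p (f n)) \<longlonglongrightarrow> 0"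
    and g: "\<And>n. in_Lp M p (g n)" "(\<lambda>n. pnorm M p (g n)) \<longlonglongrightarrow> 0"
  shows "(\<lambda>n. pnorm M p (\<lambda>x. f n x + c *\<^sub>R g n x)) \<longlonglongrightarrow> 0"
proof (rule tendsto_sandwich[OF _ _ tendsto_const])
  show "\<forall>\<^sub>F n in sequentially. pnorm M p (\<lambda>x. f n x + c *\<^sub>R g n x) \<le> 2 powr p * (pnorm M p (f n) + \<bar>c\<bar> powr p * pnorm M p (g n))"
  proof (intro always_eventually allI)
    fix n
    show "pnorm M p (\<lambda>x. f n x + c *\<^sub>R g n x) \<le> 2 powr p * (pnorm M p (f n) + \<bar>c\<bar> powr p * pnorm M p (g n))"
      using pnorm_add_le[OF p f(1)[of n] in_Lp_scale[OF p g(1)[of n], of c]] unfolding pnorm_scale[OF p] .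
  qed
  show "(\<lambda>n. 2 powr p * (pnorm M p (f n) + \<bar>c\<bar> powr p * pnorm M p (g n))) \<longlonglongrightarrow> 0"
    using tendsto_mult_left[OF tendsto_add[OF f(2) tendsto_mult_left[OF g(2), of "\<bar>c\<bar> powr p"]], of "2 powr p"] by simp
qed (simp add: pnorm_nonneg)

lemma sobolev_pair_add_scaled:
  assumes "sobolev_pair u g" "sobolev_pair v h"
  shows "sobolev_pair (\<lambda>x. u x + c * v x) (\<lambda>x. g x + c *\<^sub>R h x)"
proof -
  obtain \<phi> where \<phi>: "\<And>n. test_function \<Omega> (\<phi> n)" "(\<lambda>n. pnorm M p (\<lambda>x. \<phi> n x - u x)) \<longlonglongrightarrow> 0" "(\<lambda>n. pnorm M p (\<lambda>x. Xgrad X (\<phi> n) x - g x)) \<longlonglongrightarrow> 0"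
    using assms(1) by (auto simp: sobolev_pair_def)
  obtain \<psi> where \<psi>: "\<And>n. test_function \<Omega> (\<psi> n)" "(\<lambda>n. pnorm M p (\<lambda>x. \<psi> n x - v x)) \<longlonglongrightarrow> 0" "(\<lambda>n. pnorm M p (\<lambda>x. Xgrad X (\<psi> n) x - h x)) \<longlonglongrightarrow> 0"
    using assms(2) by (auto simp: sobolev_pair_def)
  note lp = sobolev_pairD[OF assms(1)] sobolev_pairD[OF assms(2)]
  have "(\<lambda>n. pnorm M p (\<lambda>x. (\<phi> n x - u x) + c *\<^sub>R (\<psi> n x - v x))) \<longlonglongrightarrow> 0"
    by (intro pnorm_add_scaled_tendsto in_Lp_diff p test_in_Lp \<phi> \<psi> lp)
  moreover have "(\<lambda>n. pnorm M p (\<lambda>x. (Xgrad X (\<phi> n) x - g x) + c *\<^sub>R (Xgrad X (\<psi> n) x - h x))) \<longlonglongrightarrow> 0"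
    by (intro pnorm_add_scaled_tendsto in_Lp_diff p Xgrad_in_Lp \<phi> \<psi> lp)
  moreover have "test_function \<Omega> (\<lambda>x. \<phi> n x + c * \<psi> n x)" for n
    by (intro test_function_add test_function_cmult \<phi> \<psi>)
  moreover have "in_Lp M p (\<lambda>x. u x + c * v x)" using in_Lp_add[OF p lp(1) in_Lp_scale[OF p lp(3), of c]] by simp
  moreover have "in_Lp M p (\<lambda>x. g x + c *\<^sub>R h x)" by (intro in_Lp_add in_Lp_scale p lp)
  ultimately show ?thesis
    unfolding sobolev_pair_def
    by (intro conjI exI[of _ "\<lambda>n x. \<phi> n x + c * \<psi> n x"]) (auto simp: Xgrad_add_scaled[OF \<phi>(1) \<psi>(1)] algebra_simps)
qed

lemma sobolev_iff: "u \<in> sobolev p \<Omega> X \<longleftrightarrow> in_Lp M p u \<and> (\<exists>g. weak_grad u g \<and> in_Lp M p g)"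
proof
  assume u: "u \<in> sobolev p \<Omega> X"
  then obtain h where h: "\<And>i. has_weak_derivative \<Omega> (X i) u (h i)" "\<And>i. in_Lp M p (h i)"
    unfolding sobolev_def Lp_iff_in_Lp by (auto simp: choice_iff)
  have "weak_grad u (\<lambda>x. \<chi> i. h i x)" "in_Lp M p (\<lambda>x. \<chi> i. h i x)"
    using h by (auto simp: weak_grad_def intro!: in_Lp_vec[OF p])
  then show "in_Lp M p u \<and> (\<exists>g. weak_grad u g \<and> in_Lp M p g)" using u by (auto simp: sobolev_def Lp_iff_in_Lp)
next
  assume "in_Lp M p u \<and> (\<exists>g. weak_grad u g \<and> in_Lp M p g)"
  then show "u \<in> sobolev p \<Omega> X"
    unfolding sobolev_def Lp_iff_in_Lp weak_grad_def using in_Lp_component(1)[OF p] by blast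
qed

lemma sobolev_norm_eq:
  assumes "in_Lp M p u" "weak_grad u g" "in_Lp M p g"
  shows "sobolev_norm p \<Omega> X u = (pnorm M p u + pnorm M p g) powr (1 / p)"
proof -
  have w: "in_Lp M p (weak_gradient \<Omega> X u)" "pnorm M p (weak_gradient \<Omega> X u) = pnorm M p g"
    using in_Lp_cong_AE[OF assms(3) weak_gradient_AE(2)[OF assms(2)]] weak_gradient_AE(1)[OF assms(2)] by (auto simp: eq_commute)
  then show ?thesis
    unfolding sobolev_norm_def using in_LpD(2)[OF assms(1)] in_LpD(2)[OF w(1)] by (simp add: pnorm_def)
qed

lemma sobolev_norm_diff_test:
  assumes g: "in_Lp M p u" "weak_grad u g" "in_Lp M p g" and \<phi>: "test_function \<Omega> \<phi>"
  shows "sobolev_norm p \<Omega> X (\<lambda>x. u x - \<phi> x) = (pnorm M p (\<lambda>x. \<phi> x - u x) + pnorm M p (\<lambda>x. Xgrad X \<phi> x - g x)) powr (1 / p)"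
  using sobolev_norm_eq[of "\<lambda>x. u x - \<phi> x" "\<lambda>x. g x - Xgrad X \<phi> x"] weak_grad_add_scaled[OF g(2) weak_grad_test[OF \<phi>], of "-1"]
    in_Lp_diff[OF p g(1) test_in_Lp[OF \<phi>]] in_Lp_diff[OF p g(3) Xgrad_in_Lp[OF \<phi>]]
    pnorm_minus_commute[OF p, of M u \<phi>] pnorm_minus_commute[OF p, of M g "Xgrad X \<phi>"] by simp

text \<open>The norm of u - \<phi> splits into the errors of the function and of the gradient. This
  removes the chosen weak derivatives, and everything later is argued with pairs and approximating
  sequences.\<close>

lemma sobolev0_iff: "u \<in> sobolev0 p \<Omega> X \<longleftrightarrow> (\<exists>g. sobolev_pair u g)"
proof
  assume u: "u \<in> sobolev0 p \<Omega> X"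
  then obtain g where g: "in_Lp M p u" "weak_grad u g" "in_Lp M p g" by (auto simp: sobolev0_def sobolev_iff)
  note nrm = sobolev_norm_diff_test[OF g]
  have "\<forall>n. \<exists>\<phi>. test_function \<Omega> \<phi> \<and> sobolev_norm p \<Omega> X (\<lambda>x. u x - \<phi> x) < 1 / real (Suc n)"
    using u by (simp add: sobolev0_def)
  then obtain \<phi> where \<phi>: "\<And>n. test_function \<Omega> (\<phi> n)" "\<And>n. sobolev_norm p \<Omega> X (\<lambda>x. u x - \<phi> n x) < 1 / real (Suc n)" by metis
  define s where "s n = pnorm M p (\<lambda>x. \<phi> n x - u x) + pnorm M p (\<lambda>x. Xgrad X (\<phi> n) x - g x)" for n
  have s0: "0 \<le> s n" for n by (simp add: s_def pnorm_nonneg)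
  have "(\<lambda>n. s n powr (1 / p)) \<longlonglongrightarrow> 0"
  proof (rule tendsto_sandwich[OF _ _ tendsto_const])
    show "\<forall>\<^sub>F n in sequentially. s n powr (1 / p) \<le> 1 / real (Suc n)"
      using \<phi>(2) nrm[OF \<phi>(1)] by (intro always_eventually allI) (simp add: s_def less_imp_le)
    show "(\<lambda>n. 1 / real (Suc n)) \<longlonglongrightarrow> 0" using LIMSEQ_Suc[OF lim_1_over_n] by simp
  qed simp
  then have "(\<lambda>n. (s n powr (1 / p)) powr p) \<longlonglongrightarrow> 0 powr p"
    using p by (intro tendsto_powr' tendsto_const) auto
  then have sl: "s \<longlonglongrightarrow> 0" using p s0 by (simp add: powr_powr)
  have "(\<lambda>n. pnorm M p (\<lambda>x. \<phi> n x - u x)) \<longlonglongrightarrow> 0" "(\<lambda>n. pnorm M p (\<lambda>x. Xgrad X (\<phi> n) x - g x)) \<longlonglongrightarrow> 0"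
    by (rule tendsto_sandwich[OF _ _ tendsto_const sl]; simp add: s_def pnorm_nonneg)+
  then show "\<exists>g. sobolev_pair u g" using g \<phi>(1) by (auto simp: sobolev_pair_def)
next
  assume "\<exists>g. sobolev_pair u g"
  then obtain g where S: "sobolev_pair u g" by blast
  note g = sobolev_pairD(1)[OF S] sobolev_pair_weak_grad[OF S] sobolev_pairD(2)[OF S]
  note nrm = sobolev_norm_diff_test[OF g]
  obtain \<phi> where \<phi>: "\<And>n. test_function \<Omega> (\<phi> n)" "(\<lambda>n. pnorm M p (\<lambda>x. \<phi> n x - u x)) \<longlonglongrightarrow> 0" "(\<lambda>n. pnorm M p (\<lambda>x. Xgrad X (\<phi> n) x - g x)) \<longlonglongrightarrow> 0"
    using S by (auto simp: sobolev_pair_def)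
  have "(\<lambda>n. (pnorm M p (\<lambda>x. \<phi> n x - u x) + pnorm M p (\<lambda>x. Xgrad X (\<phi> n) x - g x)) powr (1 / p)) \<longlonglongrightarrow> (0 + 0) powr (1 / p)"
    using p by (intro tendsto_powr' tendsto_add \<phi> tendsto_const) (auto simp: pnorm_nonneg)
  then have lim: "(\<lambda>n. sobolev_norm p \<Omega> X (\<lambda>x. u x - \<phi> n x)) \<longlonglongrightarrow> 0" using p by (simp add: nrm[OF \<phi>(1)])
  show "u \<in> sobolev0 p \<Omega> X"
    unfolding sobolev0_def
  proof (intro CollectI conjI allI impI)
    show "u \<in> sobolev p \<Omega> X" using g by (auto simp: sobolev_iff)
    fix \<epsilon> :: real assume "\<epsilon> > 0"
    then have "\<forall>\<^sub>F n in sequentially. sobolev_norm p \<Omega> X (\<lambda>x. u x - \<phi> n x) < \<epsilon>" by (rule order_tendstoD(2)[OF lim])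
    then obtain n where "sobolev_norm p \<Omega> X (\<lambda>x. u x - \<phi> n x) < \<epsilon>" by (auto simp: eventually_sequentially)
    then show "\<exists>\<phi>. test_function \<Omega> \<phi> \<and> sobolev_norm p \<Omega> X (\<lambda>x. u x - \<phi> x) < \<epsilon>" using \<phi>(1) by blast
  qed
qed

lemma rayleigh_eq:
  assumes "sobolev_pair u g"
  shows "rayleigh_quotient p \<Omega> X u = pnorm M p g / pnorm M p u"
proof -
  have "pnorm M p (weak_gradient \<Omega> X u) = pnorm M p g"
    using in_Lp_cong_AE(2)[OF sobolev_pairD(2)[OF assms] weak_gradient_AE(2)[OF sobolev_pair_weak_grad[OF assms]]] weak_gradient_AE(1)[OF sobolev_pair_weak_grad[OF assms]] by (auto simp: eq_commute)
  then show ?thesis by (simp add: rayleigh_quotient_def pnorm_def)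
qed

lemma sobolev0_nonzero_iff: "u \<in> sobolev0_nonzero p \<Omega> X \<longleftrightarrow> (\<exists>g. sobolev_pair u g \<and> 0 < pnorm M p u)"
  unfolding sobolev0_nonzero_def
  using pnorm_eq_0_iff[OF p sobolev_pairD(1)] pnorm_nonneg[of M p u] by (auto simp: sobolev0_iff less_le)

text \<open>Weak gradients enter only through integrals, so any representatives of the gradients of
  u and of the test element may replace them.\<close>

lemma eigen_equation_iff:
  assumes "sobolev_pair u g"
  shows "eigen_equation p \<Omega> X \<mu> u \<longleftrightarrow> (\<forall>\<phi> h. sobolev_pair \<phi> h \<longrightarrow>
    (LINT x|M. norm (g x) powr (p - 2) * (g x \<bullet> h x)) = \<mu> * (LINT x|M. \<bar>u x\<bar> powr (p - 2) * u x * \<phi> x))"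
proof -
  have eq: "(LINT x|M. norm (weak_gradient \<Omega> X u x) powr (p - 2) * (weak_gradient \<Omega> X u x \<bullet> weak_gradient \<Omega> X \<phi> x))
     = (LINT x|M. norm (g x) powr (p - 2) * (g x \<bullet> h x))" if h: "sobolev_pair \<phi> h" for \<phi> h
  proof -
    note w = sobolev_pair_weak_grad[OF assms] sobolev_pair_weak_grad[OF h]
    have [measurable]: "g \<in> borel_measurable M" "h \<in> borel_measurable M" using sobolev_pairD(2)[OF assms] sobolev_pairD(2)[OF h] by (auto simp: in_Lp_def)
    note [measurable] = weak_gradient_AE(2)[OF w(1)] weak_gradient_AE(2)[OF w(2)]
    show ?thesis
      using weak_gradient_AE(1)[OF w(1)] weak_gradient_AE(1)[OF w(2)]
      by (intro integral_cong_AE) (measurable, auto)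
  qed
  show ?thesis
  proof (intro iffI allI impI)
    fix \<phi> h assume e: "eigen_equation p \<Omega> X \<mu> u" and h: "sobolev_pair \<phi> h"
    then have "\<phi> \<in> sobolev0 p \<Omega> X" by (auto simp: sobolev0_iff)
    with e show "(LINT x|M. norm (g x) powr (p - 2) * (g x \<bullet> h x)) = \<mu> * (LINT x|M. \<bar>u x\<bar> powr (p - 2) * u x * \<phi> x)"
      unfolding eigen_equation_def eq[OF h, symmetric] by blast
  next
    assume e: "\<forall>\<phi> h. sobolev_pair \<phi> h \<longrightarrow>
      (LINT x|M. norm (g x) powr (p - 2) * (g x \<bullet> h x)) = \<mu> * (LINT x|M. \<bar>u x\<bar> powr (p - 2) * u x * \<phi> x)"
    show "eigen_equation p \<Omega> X \<mu> u"
      unfolding eigen_equation_def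
    proof
      fix \<phi> assume "\<phi> \<in> sobolev0 p \<Omega> X"
      then obtain h where h: "sobolev_pair \<phi> h" by (auto simp: sobolev0_iff)
      then show "(LINT x|M. norm (weak_gradient \<Omega> X u x) powr (p - 2) * (weak_gradient \<Omega> X u x \<bullet> weak_gradient \<Omega> X \<phi> x))
        = \<mu> * (LINT x|M. \<bar>u x\<bar> powr (p - 2) * u x * \<phi> x)"
        using e unfolding eq[OF h] by blast
    qed
  qed
qed

end

section \<open>The first eigenvalue\<close>

lemma tube_radius:
  fixes K U :: "'a::euclidean_space set"
  assumes "compact K" "K \<noteq> {}" "open U" "K \<subseteq> U"
  shows "\<exists>r>0. {x. infdist x K \<le> 4 * r} \<subseteq> U"
proof -
  have "closed (- U)" "K \<inter> - U = {}" using assms by (auto simp: closed_Compl)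
  from separate_compact_closed[OF assms(1) this]
  obtain d where d: "d > 0" "\<And>x y. x \<in> K \<Longrightarrow> y \<in> - U \<Longrightarrow> d \<le> dist x y" by blast
  have "x \<in> U" if x: "infdist x K \<le> 4 * (d / 8)" for x
  proof (rule ccontr)
    assume "x \<notin> U"
    obtain k where k: "k \<in> K" "infdist x K = dist x k"
      using infdist_attains_inf[of K x] assms compact_imp_closed by metis
    have "d \<le> dist k x" using d(2)[OF k(1)] \<open>x \<notin> U\<close> by simp
    then show False using x k(2) d(1) by (simp add: dist_commute)
  qed
  then show ?thesis using d(1) by (intro exI[of _ "d / 8"]) auto
qed

lemma norm_powr_inner_self:
  fixes a :: "'a::real_inner"
  shows "norm a powr (p - 2) * (a \<bullet> a) = norm a powr p"
proof (cases "a = 0")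
  case False
  then have "a \<bullet> a = norm a powr 2" by (simp add: power2_norm_eq_inner[symmetric])
  then show ?thesis by (simp only: powr_add[symmetric]) simp
qed simp

section \<open>Compact embedding by way of signed powers\<close>

context sobolev_setting
begin

lemma test_powr:
  assumes \<phi>: "test_function \<Omega> \<phi>"
  defines "v \<equiv> \<lambda>x. \<bar>\<phi> x\<bar> powr (p - 1) * \<phi> x"
  shows "v differentiable (at x)" "grad v x = (p * \<bar>\<phi> x\<bar> powr (p - 1)) *\<^sub>R grad \<phi> x"
proof -
  have "(v has_derivative (\<lambda>w. (p * \<bar>\<phi> x\<bar> powr (p - 1)) * (grad \<phi> x \<bullet> w))) (at x)"
    unfolding v_def
    using has_derivative_compose[OF has_derivative_grad[OF smooth_test[OF \<phi>]] DERIV_abs_powr[OF p, unfolded has_field_derivative_def]] .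
  then have d: "(v has_derivative (\<lambda>w. ((p * \<bar>\<phi> x\<bar> powr (p - 1)) *\<^sub>R grad \<phi> x) \<bullet> w)) (at x)" by simp
  show "v differentiable (at x)" using d by (auto simp: differentiable_def)
  show "grad v x = (p * \<bar>\<phi> x\<bar> powr (p - 1)) *\<^sub>R grad \<phi> x" by (rule grad_unique[OF d])
qed

lemma test_grad_0:
  assumes "test_function \<Omega> \<phi>" "x \<notin> \<Omega>"
  shows "grad \<phi> x = 0"
  using test_function_0[OF test_function_partial[OF assms(1)] assms(2)] by (simp add: grad_def vec_eq_iff)

lemma nn_integral_lborel_eq_M:
  assumes "f \<in> borel_measurable borel" "\<And>x. x \<notin> \<Omega> \<Longrightarrow> f x = 0"
  shows "(\<integral>\<^sup>+x. f x \<partial>lborel) = (\<integral>\<^sup>+x. f x \<partial>M)"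
proof -
  have "(\<integral>\<^sup>+x. f x \<partial>M) = (\<integral>\<^sup>+x. f x * indicator \<Omega> x \<partial>lebesgue)"
    using open_\<Omega> by (intro nn_integral_restrict_space) auto
  also have "(\<lambda>x. f x * indicator \<Omega> x) = f" using assms(2) by (auto simp: indicator_def fun_eq_iff)
  finally show ?thesis by (simp add: nn_integral_completion)
qed

lemma nn_integral_pnorm:
  assumes f: "f \<in> borel_measurable borel" "\<And>x. x \<notin> \<Omega> \<Longrightarrow> f x = 0" "in_Lp M p f"
  shows "(\<integral>\<^sup>+x. ennreal (norm (f x) powr p) \<partial>lborel) = ennreal (pnorm M p f)"
proof -
  have [measurable]: "f \<in> borel_measurable borel" by fact
  have "(\<integral>\<^sup>+x. ennreal (norm (f x) powr p) \<partial>lborel) = (\<integral>\<^sup>+x. ennreal (norm (f x) powr p) \<partial>M)"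
    using f(2) p by (intro nn_integral_lborel_eq_M) auto
  also have "\<dots> = ennreal (pnorm M p f)"
    unfolding pnorm_def using in_LpD(2)[OF f(3)] by (intro nn_integral_eq_integral) auto
  finally show ?thesis .
qed

lemma Xgrad_borel:
  assumes "test_function \<Omega> \<phi>"
  shows "Xgrad X \<phi> \<in> borel_measurable borel"
proof -
  have "(\<lambda>x. Xgrad X \<phi> x \<bullet> b) \<in> borel_measurable borel" if "b \<in> Basis" for b
    using that test_function_measurable[OF test_Xgrad[OF assms]] by (auto simp: Basis_vec_def inner_axis)
  then show ?thesis by (subst borel_measurable_euclidean_space) auto
qed

end

locale hormander_setting = sobolev_setting +
  fixes s :: nat
  assumes span: "commutators_span U X s" and closure_\<Omega>: "closure \<Omega> \<subseteq> U" and \<Omega>_ne: "\<Omega> \<noteq> {}"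
begin

lemma compact_embedding:
  fixes \<phi> :: "nat \<Rightarrow> real^'a \<Rightarrow> real"
  assumes \<phi>: "\<And>n. test_function \<Omega> (\<phi> n)" and A: "\<And>n. pnorm M p (\<phi> n) \<le> A" "\<And>n. pnorm M p (Xgrad X (\<phi> n)) \<le> A"
  shows "\<exists>r. strict_mono (r::nat\<Rightarrow>nat) \<and> (\<forall>e>0. \<exists>N. \<forall>i\<ge>N. \<forall>j\<ge>N. pnorm M p (\<lambda>x. \<phi> (r i) x - \<phi> (r j) x) < e)"
proof -
  have A0: "A \<ge> 0" using A(1)[of 0] pnorm_nonneg order_trans by blast
  have K: "compact (closure \<Omega>)" "closure \<Omega> \<noteq> {}" using bounded_\<Omega> \<Omega>_ne by auto
  obtain r where r: "r > 0" "{x. infdist x (closure \<Omega>) \<le> 4 * r} \<subseteq> U"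
    using tube_radius[OF K open_U closure_\<Omega>] by blast
  interpret T: tube_fields U "closure \<Omega>" r X
    by unfold_locales (use open_U K r smooth_X in auto)
  define v where "v n x = \<bar>\<phi> n x\<bar> powr (p - 1) * \<phi> n x" for n x
  have grad_v: "grad (v n) x = (p * \<bar>\<phi> n x\<bar> powr (p - 1)) *\<^sub>R grad (\<phi> n) x" for n x
    using test_powr(2)[OF \<phi>[of n]] by (simp add: v_def[abs_def])
  have adm: "T.adm (v n)" for n
    unfolding T.adm_def
  proof (intro conjI allI impI)
    show "v n differentiable (at x)" for x using test_powr(1)[OF \<phi>[of n]] by (simp add: v_def[abs_def])
    have "continuous_on UNIV (\<lambda>x. (p * \<bar>\<phi> n x\<bar> powr (p - 1)) *\<^sub>R grad (\<phi> n) x)"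
      using p \<phi>[of n] test_function_continuous[OF \<phi>[of n]]
      by (intro continuous_intros continuous_on_powr' continuous_on_grad) (auto simp: test_function_def)
    then show "continuous_on UNIV (grad (v n))" by (simp add: grad_v[abs_def])
    show "v n x = 0" if "x \<notin> closure \<Omega>" for x
      using test_function_0[OF \<phi>[of n], of x] that closure_subset[of \<Omega>] by (auto simp: v_def)
  qed
  have absv: "\<bar>v n x\<bar> = norm (\<phi> n x) powr p" for n x
    by (simp add: v_def abs_mult powr_pred_mult)
  have L1: "(\<integral>\<^sup>+x. ennreal \<bar>v n x\<bar> \<partial>lborel) \<le> ennreal A" for n
    using nn_integral_pnorm[OF test_function_measurable[OF \<phi>[of n]] test_function_0[OF \<phi>[of n]] test_in_Lp[OF \<phi>[of n]]]
      ennreal_leI[OF A(1)[of n]] by (simp add: absv)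
  \<comment> \<open>A crude form of Young's inequality: the larger of a and b is substituted for the
    other.\<close>
  have young: "a powr (p - 1) * b \<le> a powr p + b powr p" if "0 \<le> a" "0 \<le> b" for a b :: real
  proof (cases "b \<le> a")
    case True
    then have "a powr (p - 1) * b \<le> a powr (p - 1) * a" by (intro mult_left_mono) auto
    then show ?thesis using that by (simp add: powr_pred_mult add_increasing2)
  next
    case False
    then have "a powr (p - 1) * b \<le> b powr (p - 1) * b" using that p by (intro mult_right_mono powr_mono2) auto
    then show ?thesis using that by (simp add: powr_pred_mult add_increasing)
  qed
  have en: "T.energy (X i) (v n) \<le> ennreal (p * (2 * A))" for i n
  proof -
    have [measurable]: "\<phi> n \<in> borel_measurable borel" "Xgrad X (\<phi> n) \<in> borel_measurable borel"
      using test_function_measurable[OF \<phi>] Xgrad_borel[OF \<phi>] by auto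
    have X0: "Xgrad X (\<phi> n) x = 0" if "x \<notin> \<Omega>" for x
      unfolding Xgrad_def test_grad_0[OF \<phi>[of n] that] inner_zero_left by (simp add: vec_eq_iff)
    have "T.energy (X i) (v n) \<le> (\<integral>\<^sup>+x. ennreal p * (ennreal (norm (\<phi> n x) powr p) + ennreal (norm (Xgrad X (\<phi> n) x) powr p)) \<partial>lborel)"
      unfolding T.energy_def
    proof (intro nn_integral_mono)
      fix x
      have "\<bar>grad (v n) x \<bullet> X i x\<bar> = p * (\<bar>\<phi> n x\<bar> powr (p - 1) * \<bar>Xgrad X (\<phi> n) x $ i\<bar>)"
        using p by (simp add: grad_v Xgrad_def abs_mult)
      also have "\<dots> \<le> p * (\<bar>\<phi> n x\<bar> powr (p - 1) * norm (Xgrad X (\<phi> n) x))"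
        using p component_le_norm_cart[of "Xgrad X (\<phi> n) x" i] by (intro mult_left_mono) auto
      also have "\<dots> \<le> p * (\<bar>\<phi> n x\<bar> powr p + norm (Xgrad X (\<phi> n) x) powr p)"
        using p by (intro mult_left_mono young) auto
      finally have "ennreal \<bar>grad (v n) x \<bullet> X i x\<bar> \<le> ennreal p * (ennreal (norm (\<phi> n x) powr p) + ennreal (norm (Xgrad X (\<phi> n) x) powr p))"
        using p by (simp add: ennreal_leI flip: ennreal_mult ennreal_plus)
      then show "ennreal \<bar>grad (v n) x \<bullet> X i x\<bar> * indicator (closure \<Omega>) x \<le> ennreal p * (ennreal (norm (\<phi> n x) powr p) + ennreal (norm (Xgrad X (\<phi> n) x) powr p))"
        by (auto simp: indicator_def)
    qed
    also have "\<dots> = ennreal p * ((\<integral>\<^sup>+x. ennreal (norm (\<phi> n x) powr p) \<partial>lborel) + (\<integral>\<^sup>+x. ennreal (norm (Xgrad X (\<phi> n) x) powr p) \<partial>lborel))"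
      by (subst nn_integral_cmult, measurable, subst nn_integral_add) auto
    also have "\<dots> = ennreal p * (ennreal (pnorm M p (\<phi> n)) + ennreal (pnorm M p (Xgrad X (\<phi> n))))"
      using nn_integral_pnorm[OF test_function_measurable[OF \<phi>[of n]] test_function_0[OF \<phi>[of n]] test_in_Lp[OF \<phi>[of n]]]
          nn_integral_pnorm[OF Xgrad_borel[OF \<phi>[of n]] X0 Xgrad_in_Lp[OF \<phi>[of n]]] by simp
    also have "\<dots> \<le> ennreal p * (ennreal A + ennreal A)" using A by (intro mult_left_mono add_mono ennreal_leI) auto
    also have "\<dots> = ennreal (p * (2 * A))" using p A0 by (simp flip: ennreal_mult ennreal_plus)
    finally show ?thesis .
  qed
  \<comment> \<open>A single bound is needed for the L^1 norm and for the total energy; the latter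
    has one summand for each field.\<close>
  define B where "B = A + real CARD('b) * (p * (2 * A))"
  have B: "B \<ge> 0" "A \<le> B" using A0 p by (auto simp: B_def)
  have total_energy: "T.total_energy (v n) \<le> ennreal B" for n
  proof -
    have "T.total_energy (v n) \<le> of_nat CARD('b) * ennreal (p * (2 * A))"
      unfolding T.total_energy_def by (rule sum_bounded_above) (rule en)
    also have "\<dots> = ennreal (real CARD('b) * (p * (2 * A)))"
      using p A0 by (simp add: ennreal_of_nat_eq_real_of_nat ennreal_mult)
    also have "\<dots> \<le> ennreal B" using A0 by (intro ennreal_leI) (simp add: B_def)
    finally show ?thesis .
  qed
  obtain q where q: "strict_mono (q::nat\<Rightarrow>nat)" "\<And>\<eta>. \<eta> > 0 \<Longrightarrow> \<exists>N. \<forall>i\<ge>N. \<forall>j\<ge>N. L1dist (v (q i)) (v (q j)) \<le> ennreal \<eta>"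
  proof -
    have "(\<integral>\<^sup>+x. ennreal \<bar>v n x\<bar> \<partial>lborel) \<le> ennreal B" for n using order_trans[OF L1 ennreal_leI[OF B(2)]] .
    from T.adm_compact[where v=v and M=B, OF span adm this B(1) total_energy] show ?thesis using that by blast
  qed
  have "\<exists>N. \<forall>i\<ge>N. \<forall>j\<ge>N. pnorm M p (\<lambda>x. \<phi> (q i) x - \<phi> (q j) x) < e" if e: "e > 0" for e
  proof -
    define \<eta> where "\<eta> = e / (2 * 2 powr p)"
    have \<eta>: "\<eta> > 0" "2 powr p * \<eta> < e" using e by (auto simp: \<eta>_def)
    obtain N where N: "\<And>i j. i \<ge> N \<Longrightarrow> j \<ge> N \<Longrightarrow> L1dist (v (q i)) (v (q j)) \<le> ennreal \<eta>" using q(2)[OF \<eta>(1)] by blast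
    have "pnorm M p (\<lambda>x. \<phi> m x - \<phi> n x) < e" if mn: "L1dist (v m) (v n) \<le> ennreal \<eta>" for m n
    proof -
      have d: "test_function \<Omega> (\<lambda>x. \<phi> m x - \<phi> n x)"
        using test_function_add[OF \<phi>[of m] test_function_cmult[OF \<phi>[of n], of "-1"]] by simp
      have [measurable]: "v k \<in> borel_measurable borel" for k by (rule T.adm_measurable[OF adm])
      have "ennreal (pnorm M p (\<lambda>x. \<phi> m x - \<phi> n x)) = (\<integral>\<^sup>+x. ennreal (norm (\<phi> m x - \<phi> n x) powr p) \<partial>lborel)"
        by (rule nn_integral_pnorm[OF test_function_measurable[OF d] test_function_0[OF d] test_in_Lp[OF d], symmetric])
      also have "\<dots> \<le> (\<integral>\<^sup>+x. ennreal (2 powr p) * ennreal \<bar>v m x - v n x\<bar> \<partial>lborel)"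
        using abs_powr_root_diff[OF p] by (intro nn_integral_mono) (simp add: v_def ennreal_leI flip: ennreal_mult)
      also have "\<dots> = ennreal (2 powr p) * L1dist (v m) (v n)"
        unfolding L1dist_def by (rule nn_integral_cmult) measurable
      also have "\<dots> \<le> ennreal (2 powr p) * ennreal \<eta>" by (intro mult_left_mono mn) auto
      also have "\<dots> = ennreal (2 powr p * \<eta>)" using \<eta> by (simp add: ennreal_mult)
      finally have "pnorm M p (\<lambda>x. \<phi> m x - \<phi> n x) \<le> 2 powr p * \<eta>" using \<eta> by (simp add: ennreal_le_iff)
      then show ?thesis using \<eta>(2) by linarith
    qed
    then show ?thesis using N by blast
  qed
  then show ?thesis using q(1) by blast
qed

section \<open>The minimizer and its eigenvalue equation\<close>

abbreviation lam where "lam \<equiv> lambda1 p \<Omega> X"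

text \<open>The infimum over an empty set of reals would carry no information. A bump on a box
  inside \<Omega> is positive on a set of positive measure.\<close>

lemma sobolev0_nonzero_ne: "sobolev0_nonzero p \<Omega> X \<noteq> {}"
proof -
  obtain x where x: "x \<in> \<Omega>" using \<Omega>_ne by blast
  obtain a b where ab: "cbox a b \<subseteq> \<Omega>" "x \<in> box a b" using open_contains_cbox[OF open_\<Omega> x] by metis
  let ?\<phi> = "box_bump a b"
  have \<phi>: "test_function \<Omega> ?\<phi>" by (rule test_function_box_bump[OF ab(1)])
  have "pnorm M p ?\<phi> \<noteq> 0"
  proof
    assume "pnorm M p ?\<phi> = 0"
    then have "AE y in M. ?\<phi> y = 0" using pnorm_eq_0_iff[OF p test_in_Lp[OF \<phi>]] by simp
    then have "AE y in lebesgue. y \<in> \<Omega> \<longrightarrow> ?\<phi> y = 0"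
      using open_\<Omega> by (subst (asm) AE_restrict_space_iff) auto
    then have "AE y in lebesgue. y \<notin> box a b"
    proof eventually_elim
      case (elim y)
      then show ?case using box_bump(3)[of y a b] ab(1) box_subset_cbox[of a b] by force
    qed
    then have "negligible (box a b)"
      by (subst (asm) AE_iff_null_sets[symmetric, of "box a b"]) (auto simp: negligible_iff_null_sets)
    then show False using open_not_negligible[of "box a b"] ab(2) by auto
  qed
  then have "0 < pnorm M p ?\<phi>" using pnorm_nonneg[of M p ?\<phi>] by simp
  then show ?thesis using sobolev_pair_test[OF \<phi>] sobolev0_nonzero_iff by blast
qed

lemma rayleigh_bdd: "bdd_below (rayleigh_quotient p \<Omega> X ` sobolev0_nonzero p \<Omega> X)"
proof (rule bdd_belowI2[where m=0])
  fix u assume "u \<in> sobolev0_nonzero p \<Omega> X"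
  then obtain g where "sobolev_pair u g" by (auto simp: sobolev0_nonzero_iff)
  then show "0 \<le> rayleigh_quotient p \<Omega> X u" by (simp add: rayleigh_eq pnorm_nonneg)
qed

text \<open>The Rayleigh bound multiplied out, so that it also covers u = 0 and can be applied to
  midpoints and variations without checking that they are nonzero.\<close>

lemma lam_le:
  assumes "sobolev_pair u g"
  shows "lam * pnorm M p u \<le> pnorm M p g"
proof (cases "pnorm M p u = 0")
  case True
  then show ?thesis by (simp add: pnorm_nonneg)
next
  case False
  then have u: "pnorm M p u > 0" using pnorm_nonneg[of M p u] by simp
  then have "u \<in> sobolev0_nonzero p \<Omega> X" using assms sobolev0_nonzero_iff by blast
  then have "lam \<le> rayleigh_quotient p \<Omega> X u" unfolding lambda1_def by (rule cINF_lower[OF rayleigh_bdd])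
  then show ?thesis using u by (simp add: rayleigh_eq[OF assms] pos_le_divide_eq)
qed

lemma lam_nonneg: "0 \<le> lam"
  unfolding lambda1_def
proof (rule cINF_greatest[OF sobolev0_nonzero_ne])
  fix u assume "u \<in> sobolev0_nonzero p \<Omega> X"
  then obtain g where "sobolev_pair u g" by (auto simp: sobolev0_nonzero_iff)
  then show "0 \<le> rayleigh_quotient p \<Omega> X u" by (simp add: rayleigh_eq pnorm_nonneg)
qed

text \<open>An almost optimal element is approximated by test functions and rescaled by homogeneity.
  Test functions are wanted because \<open>compact_embedding\<close> is formulated for them.\<close>

lemma almost_minimizer:
  assumes e: "e > 0"
  shows "\<exists>\<phi>. test_function \<Omega> \<phi> \<and> pnorm M p \<phi> = 1 \<and> pnorm M p (Xgrad X \<phi>) < lam + e"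
proof -
  obtain u where u: "u \<in> sobolev0_nonzero p \<Omega> X" "rayleigh_quotient p \<Omega> X u < lam + e"
    using cINF_less_iff[OF sobolev0_nonzero_ne rayleigh_bdd, of "lam + e"] e unfolding lambda1_def by auto
  obtain g where g: "sobolev_pair u g" "pnorm M p u > 0" using u(1) by (auto simp: sobolev0_nonzero_iff)
  obtain \<phi> where \<phi>: "\<And>n. test_function \<Omega> (\<phi> n)" "(\<lambda>n. pnorm M p (\<lambda>x. \<phi> n x - u x)) \<longlonglongrightarrow> 0" "(\<lambda>n. pnorm M p (\<lambda>x. Xgrad X (\<phi> n) x - g x)) \<longlonglongrightarrow> 0"
    using g(1) by (auto simp: sobolev_pair_def)
  have lim: "(\<lambda>n. pnorm M p (\<phi> n)) \<longlonglongrightarrow> pnorm M p u" "(\<lambda>n. pnorm M p (Xgrad X (\<phi> n))) \<longlonglongrightarrow> pnorm M p g"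
    by (intro pnorm_tendsto[OF p] test_in_Lp Xgrad_in_Lp \<phi> sobolev_pairD[OF g(1)])+
  then have "(\<lambda>n. pnorm M p (Xgrad X (\<phi> n)) / pnorm M p (\<phi> n)) \<longlonglongrightarrow> pnorm M p g / pnorm M p u"
    using g(2) by (intro tendsto_divide) auto
  then have "\<forall>\<^sub>F n in sequentially. pnorm M p (Xgrad X (\<phi> n)) / pnorm M p (\<phi> n) < lam + e"
    using u(2) unfolding rayleigh_eq[OF g(1)] by (rule order_tendstoD(2))
  moreover have "\<forall>\<^sub>F n in sequentially. 0 < pnorm M p (\<phi> n)" using lim(1) g(2) by (rule order_tendstoD(1))
  ultimately have "\<forall>\<^sub>F n in sequentially. pnorm M p (Xgrad X (\<phi> n)) / pnorm M p (\<phi> n) < lam + e \<and> 0 < pnorm M p (\<phi> n)"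
    by eventually_elim simp
  then obtain n where n: "pnorm M p (Xgrad X (\<phi> n)) / pnorm M p (\<phi> n) < lam + e" "0 < pnorm M p (\<phi> n)"
    by (auto simp: eventually_sequentially)
  define c where "c = (1 / pnorm M p (\<phi> n)) powr (1 / p)"
  have c: "\<bar>c\<bar> powr p = 1 / pnorm M p (\<phi> n)" using n(2) p by (simp add: c_def powr_powr)
  have X: "Xgrad X (\<lambda>x. c * \<phi> n x) = (\<lambda>x. c *\<^sub>R Xgrad X (\<phi> n) x)"
  proof
    fix x
    have "((\<lambda>x. c * \<phi> n x) has_derivative (\<lambda>v. c * (grad (\<phi> n) x \<bullet> v))) (at x)"
      by (intro has_derivative_mult_right has_derivative_grad smooth_test \<phi>)
    from grad_eq[OF this] show "Xgrad X (\<lambda>x. c * \<phi> n x) x = c *\<^sub>R Xgrad X (\<phi> n) x" by (simp add: Xgrad_def vec_eq_iff)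
  qed
  have "pnorm M p (\<lambda>x. c * \<phi> n x) = 1" using pnorm_scale[OF p, of M c "\<phi> n"] c n(2) by simp
  moreover have "pnorm M p (Xgrad X (\<lambda>x. c * \<phi> n x)) < lam + e"
    unfolding X pnorm_scale[OF p] c using n(1) by simp
  ultimately show ?thesis using test_function_cmult[OF \<phi>(1)[of n], of c] by blast
qed

theorem minimizer_exists: "\<exists>u g. sobolev_pair u g \<and> pnorm M p u = 1 \<and> pnorm M p g = lam"
proof -
  have "\<forall>n. \<exists>\<phi>. test_function \<Omega> \<phi> \<and> pnorm M p \<phi> = 1 \<and> pnorm M p (Xgrad X \<phi>) < lam + 1 / real (Suc n)"
    by (intro allI almost_minimizer) simp
  then obtain \<phi>' where \<phi>': "\<And>n. test_function \<Omega> (\<phi>' n)" "\<And>n. pnorm M p (\<phi>' n) = 1" "\<And>n. pnorm M p (Xgrad X (\<phi>' n)) < lam + 1 / real (Suc n)"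
    by metis
  have "pnorm M p (Xgrad X (\<phi>' n)) \<le> lam + 1" for n
  proof -
    have "1 / real (Suc n) \<le> 1" by simp
    then show ?thesis using \<phi>'(3)[of n] by linarith
  qed
  note bound = this
  have "pnorm M p (\<phi>' n) \<le> lam + 1" for n using \<phi>'(2)[of n] lam_nonneg by simp
  from compact_embedding[where \<phi>=\<phi>' and A="lam + 1", OF \<phi>'(1) this bound]
  obtain r where r: "strict_mono (r::nat\<Rightarrow>nat)" 
      and C': "\<And>e. e > 0 \<Longrightarrow> \<exists>N. \<forall>i\<ge>N. \<forall>j\<ge>N. pnorm M p (\<lambda>x. \<phi>' (r i) x - \<phi>' (r j) x) < e"
    by blast
  define \<phi> where "\<phi> n = \<phi>' (r n)" for n
  have \<phi>: "test_function \<Omega> (\<phi> n)" "pnorm M p (\<phi> n) = 1" for n using \<phi>' by (auto simp: \<phi>_def)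
  have C: "\<And>e. e > 0 \<Longrightarrow> \<exists>N. \<forall>i\<ge>N. \<forall>j\<ge>N. pnorm M p (\<lambda>x. \<phi> i x - \<phi> j x) < e" using C' by (simp add: \<phi>_def)
  have lim: "(\<lambda>n. pnorm M p (Xgrad X (\<phi> n))) \<longlonglongrightarrow> lam"
  proof (rule tendsto_sandwich[OF _ _ tendsto_const])
    show "\<forall>\<^sub>F n in sequentially. lam \<le> pnorm M p (Xgrad X (\<phi> n))"
      using lam_le[OF sobolev_pair_test[OF \<phi>(1)]] \<phi>(2) by (intro always_eventually allI) simp
    show "\<forall>\<^sub>F n in sequentially. pnorm M p (Xgrad X (\<phi> n)) \<le> lam + 1 / real (Suc (r n))"
      using \<phi>'(3) by (intro always_eventually allI) (simp add: \<phi>_def less_imp_le)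
    have "(\<lambda>n. 1 / real (Suc n)) \<longlonglongrightarrow> 0" using LIMSEQ_Suc[OF lim_1_over_n] by simp
    from LIMSEQ_subseq_LIMSEQ[OF this r] have "(\<lambda>n. 1 / real (Suc (r n))) \<longlonglongrightarrow> 0" by (simp add: o_def)
    from tendsto_add[OF tendsto_const this] show "(\<lambda>n. lam + 1 / real (Suc (r n))) \<longlonglongrightarrow> lam" by simp
  qed
  \<comment> \<open>The midpoint of two nearby functions of norm 1 has norm at least 1 - \<delta>,
    hence p-th power at least 1 - p\<delta> by the tangent inequality. As a competitor it has
    gradient energy at least \<open>lam\<close> times that.\<close>
  have mid: "\<exists>N. \<forall>m\<ge>N. \<forall>n\<ge>N. lam - e \<le> pnorm M p (\<lambda>x. (Xgrad X (\<phi> m) x + Xgrad X (\<phi> n) x) /\<^sub>R 2)" if e: "e > 0" for e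
  proof -
    \<comment> \<open>Chosen so that \<open>lam * (p * \<delta>) \<le> e\<close>;
      \<open>lam + 1\<close> avoids a division by zero when \<open>lam\<close> is 0.\<close>
    define \<delta> where "\<delta> = e / ((lam + 1) * p)"
    have \<delta>: "\<delta> > 0" "lam * (p * \<delta>) \<le> e"
    proof -
      show "\<delta> > 0" using e p lam_nonneg by (simp add: \<delta>_def)
      have "lam * (p * \<delta>) = e * (lam / (lam + 1))" using p by (simp add: \<delta>_def)
      also have "\<dots> \<le> e * 1" using e lam_nonneg by (intro mult_left_mono) auto
      finally show "lam * (p * \<delta>) \<le> e" by simp
    qed
    obtain N where N: "\<And>i j. i \<ge> N \<Longrightarrow> j \<ge> N \<Longrightarrow> pnorm M p (\<lambda>x. \<phi> i x - \<phi> j x) < \<delta> powr p" using C[of "\<delta> powr p"] \<delta> by auto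
    show ?thesis
    proof (intro exI[of _ N] allI impI)
      fix m n assume mn: "N \<le> m" "N \<le> n"
      let ?w = "\<lambda>x. (\<phi> m x + \<phi> n x) /\<^sub>R 2" and ?d = "\<lambda>x. (\<phi> m x - \<phi> n x) /\<^sub>R 2"
      have "sobolev_pair (\<lambda>x. \<phi> m x + (-1/2) * \<phi> m x + (1/2) * \<phi> n x) (\<lambda>x. Xgrad X (\<phi> m) x + (-1/2) *\<^sub>R Xgrad X (\<phi> m) x + (1/2) *\<^sub>R Xgrad X (\<phi> n) x)"
        by (intro sobolev_pair_add_scaled sobolev_pair_test \<phi>)
      moreover have "(\<lambda>x. \<phi> m x + (-1/2) * \<phi> m x + (1/2) * \<phi> n x) = ?w" by (auto simp: fun_eq_iff field_simps)
      moreover have "(\<lambda>x. Xgrad X (\<phi> m) x + (-1/2) *\<^sub>R Xgrad X (\<phi> m) x + (1/2) *\<^sub>R Xgrad X (\<phi> n) x) = (\<lambda>x. (Xgrad X (\<phi> m) x + Xgrad X (\<phi> n) x) /\<^sub>R 2)"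
        by (auto simp: fun_eq_iff vec_eq_iff field_simps)
      ultimately have S': "sobolev_pair ?w (\<lambda>x. (Xgrad X (\<phi> m) x + Xgrad X (\<phi> n) x) /\<^sub>R 2)" by simp
      have lw: "in_Lp M p ?w" using sobolev_pairD(1)[OF S'] .
      have ld: "in_Lp M p ?d" using in_Lp_scale[OF p in_Lp_diff[OF p test_in_Lp[OF \<phi>(1)] test_in_Lp[OF \<phi>(1)]], of "inverse 2"] by simp
      have "Lnorm M p (\<lambda>x. ?w x + ?d x) \<le> Lnorm M p ?w + Lnorm M p ?d" by (rule Lnorm_triangle[OF p lw ld])
      moreover have "(\<lambda>x. ?w x + ?d x) = \<phi> m" by (auto simp: field_simps)
      moreover have "Lnorm M p (\<phi> m) = 1" using \<phi>(2) by (simp add: Lnorm_def[OF p])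
      moreover have "Lnorm M p ?d \<le> \<delta>"
      proof -
        have "pnorm M p ?d = (1/2) powr p * pnorm M p (\<lambda>x. \<phi> m x - \<phi> n x)" using pnorm_scale[OF p, of M "inverse 2" "\<lambda>x. \<phi> m x - \<phi> n x"] by simp
        also have "\<dots> \<le> 1 * \<delta> powr p" using N[OF mn] p by (intro mult_mono powr_le1) (auto simp: pnorm_nonneg less_imp_le)
        finally have "pnorm M p ?d powr (1/p) \<le> (\<delta> powr p) powr (1/p)" using p by (intro powr_mono2) (auto simp: pnorm_nonneg)
        then show ?thesis using p \<delta> by (simp add: Lnorm_def[OF p] powr_powr)
      qed
      ultimately have Lw: "1 - \<delta> \<le> Lnorm M p ?w" by simp
      have "1 - p * \<delta> \<le> 1 powr p + p * 1 powr (p - 1) * (Lnorm M p ?w - 1)" using Lw p mult_left_mono[OF Lw, of p] by (simp add: algebra_simps)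
      also have "\<dots> \<le> Lnorm M p ?w powr p" by (rule powr_tangent[OF p]) (auto simp: Lnorm_nonneg[OF p])
      also have "\<dots> = pnorm M p ?w" by (rule Lnorm_powr[OF p])
      finally have "lam * (1 - p * \<delta>) \<le> lam * pnorm M p ?w" using lam_nonneg by (intro mult_left_mono)
      also have "\<dots> \<le> pnorm M p (\<lambda>x. (Xgrad X (\<phi> m) x + Xgrad X (\<phi> n) x) /\<^sub>R 2)" by (rule lam_le[OF S'])
      finally show "lam - e \<le> pnorm M p (\<lambda>x. (Xgrad X (\<phi> m) x + Xgrad X (\<phi> n) x) /\<^sub>R 2)" using \<delta>(2) by (simp add: algebra_simps)
    qed
  qed
  have CX: "\<exists>N. \<forall>m\<ge>N. \<forall>n\<ge>N. pnorm M p (\<lambda>x. Xgrad X (\<phi> m) x - Xgrad X (\<phi> n) x) < e" if "e > 0" for e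
    by (rule Lp_uniformly_convex_Cauchy[OF p Xgrad_in_Lp[OF \<phi>(1)] lim mid that])
  obtain u where u: "in_Lp M p u" "(\<lambda>n. pnorm M p (\<lambda>x. \<phi> n x - u x)) \<longlonglongrightarrow> 0" using Lp_complete[OF p test_in_Lp[OF \<phi>(1)] C] by blast
  obtain g where g: "in_Lp M p g" "(\<lambda>n. pnorm M p (\<lambda>x. Xgrad X (\<phi> n) x - g x)) \<longlonglongrightarrow> 0" using Lp_complete[OF p Xgrad_in_Lp[OF \<phi>(1)] CX] by blast
  have "sobolev_pair u g" unfolding sobolev_pair_def using u g \<phi>(1) by blast
  moreover have "pnorm M p u = 1"
    using LIMSEQ_unique[OF pnorm_tendsto[OF p test_in_Lp[OF \<phi>(1)] u]] \<phi>(2) by simp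
  moreover have "pnorm M p g = lam"
    by (rule LIMSEQ_unique[OF pnorm_tendsto[OF p Xgrad_in_Lp[OF \<phi>(1)] g] lim])
  ultimately show ?thesis by blast
qed

text \<open>The function t \<mapsto> |g + t h|_p^p - \<open>lam\<close> |u + t \<phi>|_p^p is
  nonnegative and vanishes at t = 0, so its right derivative is nonnegative. Since -\<phi> is
  admissible too, this gives equality. No quotient has to be differentiated.\<close>

lemma minimizer_eigen_equation:
  assumes S: "sobolev_pair u g" and min: "pnorm M p g = lam * pnorm M p u"
  shows "eigen_equation p \<Omega> X lam u"
  unfolding eigen_equation_iff[OF S]
proof (intro allI impI)
  have ineq: "lam * (LINT x|M. norm (u x) powr (p - 2) * (u x \<bullet> \<phi> x)) \<le> (LINT x|M. norm (g x) powr (p - 2) * (g x \<bullet> h x))" if h: "sobolev_pair \<phi> h" for \<phi> h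
  proof -
    let ?t = "\<lambda>n. 1 / real (Suc n)"
    have "(\<lambda>n. (pnorm M p (\<lambda>x. g x + ?t n *\<^sub>R h x) - pnorm M p g) / ?t n - lam * ((pnorm M p (\<lambda>x. u x + ?t n *\<^sub>R \<phi> x) - pnorm M p u) / ?t n))
       \<longlonglongrightarrow> p * (LINT x|M. norm (g x) powr (p - 2) * (g x \<bullet> h x)) - lam * (p * (LINT x|M. norm (u x) powr (p - 2) * (u x \<bullet> \<phi> x)))"
      by (intro tendsto_diff tendsto_mult_left pnorm_directional_derivative(2)[OF p] sobolev_pairD[OF S] sobolev_pairD[OF h])
    moreover have "0 \<le> (pnorm M p (\<lambda>x. g x + ?t n *\<^sub>R h x) - pnorm M p g) / ?t n - lam * ((pnorm M p (\<lambda>x. u x + ?t n *\<^sub>R \<phi> x) - pnorm M p u) / ?t n)" for n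
    proof -
      have "lam * pnorm M p (\<lambda>x. u x + ?t n *\<^sub>R \<phi> x) \<le> pnorm M p (\<lambda>x. g x + ?t n *\<^sub>R h x)"
        using lam_le[OF sobolev_pair_add_scaled[OF S h, of "?t n"]] by simp
      then have "0 \<le> ((pnorm M p (\<lambda>x. g x + ?t n *\<^sub>R h x) - pnorm M p g) - lam * (pnorm M p (\<lambda>x. u x + ?t n *\<^sub>R \<phi> x) - pnorm M p u)) / ?t n"
        unfolding min by (intro divide_nonneg_nonneg) (simp_all add: algebra_simps)
      moreover have "(a - lam * b) / t = a / t - lam * (b / t)" for a b t by (simp add: diff_divide_distrib)
      ultimately show ?thesis by (simp only:)
    qed
    ultimately have "0 \<le> p * (LINT x|M. norm (g x) powr (p - 2) * (g x \<bullet> h x)) - lam * (p * (LINT x|M. norm (u x) powr (p - 2) * (u x \<bullet> \<phi> x)))"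
      by (intro LIMSEQ_le_const) auto
    then have "p * (lam * (LINT x|M. norm (u x) powr (p - 2) * (u x \<bullet> \<phi> x))) \<le> p * (LINT x|M. norm (g x) powr (p - 2) * (g x \<bullet> h x))"
      by (simp add: mult_ac)
    then show ?thesis using p by simp
  qed
  fix \<phi> h assume h: "sobolev_pair \<phi> h"
  \<comment> \<open>The negative of the pair is produced from closure under u + c v, with c =
    -2.\<close>
  have "sobolev_pair (\<lambda>x. \<phi> x + (-2) * \<phi> x) (\<lambda>x. h x + (-2) *\<^sub>R h x)" by (rule sobolev_pair_add_scaled[OF h h])
  moreover have "(\<lambda>x. \<phi> x + (-2) * \<phi> x) = (\<lambda>x. - \<phi> x)" by (auto simp: fun_eq_iff)
  moreover have "(\<lambda>x. h x + (-2) *\<^sub>R h x) = (\<lambda>x. - h x)" by (auto simp: fun_eq_iff scaleR_2)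
  ultimately have m: "sobolev_pair (\<lambda>x. - \<phi> x) (\<lambda>x. - h x)" by simp
  have "(LINT x|M. norm (g x) powr (p - 2) * (g x \<bullet> h x)) = lam * (LINT x|M. norm (u x) powr (p - 2) * (u x \<bullet> \<phi> x))"
    using ineq[OF h] ineq[OF m] by simp
  then show "(LINT x|M. norm (g x) powr (p - 2) * (g x \<bullet> h x)) = lam * (LINT x|M. \<bar>u x\<bar> powr (p - 2) * u x * \<phi> x)"
    by (simp add: mult.assoc)
qed

lemma eigenvalue_ge_lam:
  assumes "eigenvalue p \<Omega> X \<mu>"
  shows "lam \<le> \<mu>"
proof -
  obtain u g where u: "sobolev_pair u g" "0 < pnorm M p u" "eigen_equation p \<Omega> X \<mu> u"
    using assms unfolding eigenvalue_def by (auto simp: sobolev0_nonzero_iff)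
  have "(LINT x|M. norm (g x) powr (p - 2) * (g x \<bullet> g x)) = \<mu> * (LINT x|M. \<bar>u x\<bar> powr (p - 2) * u x * u x)"
    using u(3) eigen_equation_iff[OF u(1)] u(1) by blast
  moreover have "\<bar>u x\<bar> powr (p - 2) * u x * u x = norm (u x) powr p" for x
    using norm_powr_inner_self[of "u x" p] by (simp add: mult.assoc)
  ultimately have "pnorm M p g = \<mu> * pnorm M p u" by (simp add: norm_powr_inner_self pnorm_def)
  then have "lam * pnorm M p u \<le> \<mu> * pnorm M p u" using lam_le[OF u(1)] by simp
  then show ?thesis using u(2) by simp
qed

theorem first_eigenpair:
  "\<exists>u\<in>sobolev0_nonzero p \<Omega> X. rayleigh_quotient p \<Omega> X u = lam \<and> eigen_equation p \<Omega> X lam u"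
proof -
  obtain u g where u: "sobolev_pair u g" "pnorm M p u = 1" "pnorm M p g = lam" using minimizer_exists by blast
  have "u \<in> sobolev0_nonzero p \<Omega> X" using u(1,2) by (auto simp: sobolev0_nonzero_iff)
  moreover have "rayleigh_quotient p \<Omega> X u = lam" using u by (simp add: rayleigh_eq)
  moreover have "eigen_equation p \<Omega> X lam u" using u by (intro minimizer_eigen_equation) auto
  ultimately show ?thesis by blast
qed

end

theorem theorem3p7:
  fixes U \<Omega> :: "(real^'n) set"
    and X :: "'m::finite \<Rightarrow> real^'n \<Rightarrow> real^'n"
    and p :: real and s :: nat
  assumes "1 < p"
    and "CARD('n) \<ge> 2" and "CARD('m) \<le> CARD('n)"
    and "open U" and "connected U" and "U \<noteq> {}" and "bounded U"
    and "\<And>i. smooth_vector_field U (X i)"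
    and "hormander_step U X s"
    and "open \<Omega>" and "connected \<Omega>" and "\<Omega> \<noteq> {}"
    and "compact (closure \<Omega>)" and "closure \<Omega> \<subseteq> U"
  shows "(\<exists>u1\<in>sobolev0_nonzero p \<Omega> X.
            rayleigh_quotient p \<Omega> X u1 = lambda1 p \<Omega> X \<and>
            eigen_equation p \<Omega> X (lambda1 p \<Omega> X) u1) \<and>
         eigenvalue p \<Omega> X (lambda1 p \<Omega> X) \<and>
         (\<forall>\<mu>. eigenvalue p \<Omega> X \<mu> \<longrightarrow> lambda1 p \<Omega> X \<le> \<mu>)"
proof -
  interpret hormander_setting U \<Omega> X p s
  proof
    show "\<Omega> \<subseteq> U" by (rule order_trans[OF closure_subset assms(14)])
    show "bounded \<Omega>" by (rule bounded_subset[OF compact_imp_bounded[OF assms(13)] closure_subset])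
    show "commutators_span U X s" using assms(9) by (simp add: hormander_step_def)
  qed (use assms in auto)
  show ?thesis
    using first_eigenpair eigenvalue_ge_lam unfolding eigenvalue_def by blast
qed

end
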